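(* Let $G$ be a finite group acting on an abelian category $\mathcal{A}$, and let $\mathcal{N}\subseteq\mathcal{A}$ be a Serre subcategory which is invariant under the action, i.e. $F_g(\mathcal{N})\subseteq\mathcal{N}$ for all $g\in G$. Let $q\colon\mathcal{A}\to\mathcal{A}/\mathcal{N}$ be the quotient functor. Then the functor $$\bar\Psi\colon\mathcal{A}^G/\mathcal{N}^G\longrightarrow(\mathcal{A}/\mathcal{N})^G$$ induced by the exact functor $\Psi\colon\mathcal{A}^G\to(\mathcal{A}/\mathcal{N})^G$, $(X,\alpha)\mapsto(X,q(\alpha))$ with $q(\alpha)_g=q(\alpha_g)$, $\theta\mapsto q(\theta)$, is an equivalence of categories.
   Context: An action of a group $G$ on a category $\mathcal{C}$ consists of data $\{F_g,\varepsilon_{g,h}\mid g,h\in G\}$ with each $F_g\colon\mathcal{C}\to\mathcal{C}$ an auto-equivalence and each $\varepsilon_{g,h}\colon F_gF_h\to F_{gh}$ a natural isomorphism such that $\varepsilon_{gh,k}\circ\varepsilon_{g,h}F_k=\varepsilon_{g,hk}\circ F_g\varepsilon_{h,k}$ for all $g,h,k\in G$. A $G$-equivariant object is a pair $(X,\alpha)$ where $X\in\mathcal{C}$ and $\alpha$ assigns to each $g\in G$ an isomorphism $\alpha_g\colon X\to F_g(X)$ with $\alpha_{gg'}=(\varepsilon_{g,g'})_X\circ F_g(\alpha_{g'})\circ\alpha_g$. A morphism $(X,\alpha)\to(Y,\beta)$ is a morphism $\theta\colon X\to Y$ with $\beta_g\circ\theta=F_g(\theta)\circ\alpha_g$ for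 all $g$. These form the category $\mathcal{C}^G$. For $\mathcal{C}=\mathcal{A}$ abelian and $G$ finite, $\mathcal{A}^G$ is abelian, with exactness detected on underlying objects. A Serre subcategory is a full subcategory closed under subobjects, quotient objects and extensions; $\mathcal{A}/\mathcal{N}$ is the (Gabriel) quotient abelian category, with the same objects as $\mathcal{A}$. When $\mathcal{N}$ is invariant, $\mathcal{A}/\mathcal{N}$ inherits the $G$-action $\{\bar F_g,\bar\varepsilon_{g,h}\}$ induced by $\{F_g,\varepsilon_{g,h}\}$. $\mathcal{N}^G$ is the full (Serre) subcategory of $\mathcal{A}^G$ of objects $(X,\alpha)$ with $X\in\mathcal{N}$; it is the essential kernel of $\Psi$. *)

theory Defs
  imports "HOL-Algebra.Group"
begin

section \<open>Categories, functors and natural isomorphisms\<close>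

record ('o, 'm) cat =
  Obj :: "'o set"
  Arr :: "'m set"
  Dom :: "'m \<Rightarrow> 'o"
  Cod :: "'m \<Rightarrow> 'o"
  Cmp :: "'m \<Rightarrow> 'm \<Rightarrow> 'm"  (infixl "\<bullet>\<index>" 70)
  Idn :: "'o \<Rightarrow> 'm"

text \<open>Composition is written in applicative order: \<open>g \<bullet>\<^bsub>C\<^esub> f\<close> is ``first \<open>f\<close>, then \<open>g\<close>''.
  Its value is unspecified unless \<open>Cod C f = Dom C g\<close>.\<close>

definition Hom :: "('o, 'm) cat \<Rightarrow> 'o \<Rightarrow> 'o \<Rightarrow> 'm set" where
  "Hom C X Y = {f \<in> Arr C. Dom C f = X \<and> Cod C f = Y}"

locale category =
  fixes C :: "('o, 'm) cat" (structure)
  assumes Dom_closed: "f \<in> Arr C \<Longrightarrow> Dom C f \<in> Obj C"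
    and Cod_closed: "f \<in> Arr C \<Longrightarrow> Cod C f \<in> Obj C"
    and Idn_Hom: "X \<in> Obj C \<Longrightarrow> Idn C X \<in> Hom C X X"
    and Cmp_Hom: "\<lbrakk>f \<in> Hom C X Y; g \<in> Hom C Y Z\<rbrakk> \<Longrightarrow> g \<bullet> f \<in> Hom C X Z"
    and Cmp_Idn_right: "f \<in> Hom C X Y \<Longrightarrow> f \<bullet> Idn C X = f"
    and Cmp_Idn_left: "f \<in> Hom C X Y \<Longrightarrow> Idn C Y \<bullet> f = f"
    and Cmp_assoc: "\<lbrakk>f \<in> Hom C W X; g \<in> Hom C X Y; h \<in> Hom C Y Z\<rbrakk>
      \<Longrightarrow> (h \<bullet> g) \<bullet> f = h \<bullet> (g \<bullet> f)"

definition is_iso :: "('o, 'm) cat \<Rightarrow> 'm \<Rightarrow> bool" where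
  "is_iso C f \<longleftrightarrow> f \<in> Arr C \<and> (\<exists>g \<in> Hom C (Cod C f) (Dom C f).
     g \<bullet>\<^bsub>C\<^esub> f = Idn C (Dom C f) \<and> f \<bullet>\<^bsub>C\<^esub> g = Idn C (Cod C f))"

record ('o, 'm, 'p, 'n) cfunctor =
  FObj :: "'o \<Rightarrow> 'p"
  FArr :: "'m \<Rightarrow> 'n"

locale is_functor = src: category C + tgt: category D
  for C :: "('o, 'm) cat" and D :: "('p, 'n) cat" and F :: "('o, 'm, 'p, 'n) cfunctor" +
  assumes FObj_closed: "X \<in> Obj C \<Longrightarrow> FObj F X \<in> Obj D"
    and FArr_Hom: "f \<in> Hom C X Y \<Longrightarrow> FArr F f \<in> Hom D (FObj F X) (FObj F Y)"
    and FArr_Idn: "X \<in> Obj C \<Longrightarrow> FArr F (Idn C X) = Idn D (FObj F X)"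
    and FArr_Cmp: "\<lbrakk>f \<in> Hom C X Y; g \<in> Hom C Y Z\<rbrakk>
      \<Longrightarrow> FArr F (g \<bullet>\<^bsub>C\<^esub> f) = FArr F g \<bullet>\<^bsub>D\<^esub> FArr F f"

definition id_functor :: "('o, 'm, 'o, 'm) cfunctor" where
  "id_functor = \<lparr>FObj = id, FArr = id\<rparr>"

definition comp_functor ::
  "('p, 'n, 'q, 'k) cfunctor \<Rightarrow> ('o, 'm, 'p, 'n) cfunctor \<Rightarrow> ('o, 'm, 'q, 'k) cfunctor" where
  "comp_functor H F = \<lparr>FObj = FObj H \<circ> FObj F, FArr = FArr H \<circ> FArr F\<rparr>"

text \<open>Functors are HOL functions on whole types; only their values on the objects and arrows of
  the source category are meaningful.\<close>

definition functor_eq_on ::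
  "('o, 'm) cat \<Rightarrow> ('o, 'm, 'p, 'n) cfunctor \<Rightarrow> ('o, 'm, 'p, 'n) cfunctor \<Rightarrow> bool" where
  "functor_eq_on C F H \<longleftrightarrow>
     (\<forall>X \<in> Obj C. FObj F X = FObj H X) \<and> (\<forall>f \<in> Arr C. FArr F f = FArr H f)"

locale natural_iso = F: is_functor C D F + H: is_functor C D H
  for C :: "('o, 'm) cat" and D :: "('p, 'n) cat" and F H :: "('o, 'm, 'p, 'n) cfunctor"
    and \<tau> :: "'o \<Rightarrow> 'n" +
  assumes component_Hom: "X \<in> Obj C \<Longrightarrow> \<tau> X \<in> Hom D (FObj F X) (FObj H X)"
    and component_iso: "X \<in> Obj C \<Longrightarrow> is_iso D (\<tau> X)"
    and naturality: "f \<in> Hom C X Y \<Longrightarrow> \<tau> Y \<bullet>\<^bsub>D\<^esub> FArr F f = FArr H f \<bullet>\<^bsub>D\<^esub> \<tau> X"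

definition is_equivalence ::
  "('o, 'm) cat \<Rightarrow> ('p, 'n) cat \<Rightarrow> ('o, 'm, 'p, 'n) cfunctor \<Rightarrow> bool" where
  "is_equivalence C D F \<longleftrightarrow> is_functor C D F \<and>
     (\<exists>H. is_functor D C H \<and>
       (\<exists>\<eta>. natural_iso C C id_functor (comp_functor H F) \<eta>) \<and>
       (\<exists>\<epsilon>. natural_iso D D (comp_functor F H) id_functor \<epsilon>))"


section \<open>Abelian categories and Serre subcategories\<close>

definition mono_arr :: "('o, 'm) cat \<Rightarrow> 'm \<Rightarrow> bool" where
  "mono_arr C m \<longleftrightarrow> m \<in> Arr C \<and> (\<forall>W. \<forall>u \<in> Hom C W (Dom C m). \<forall>v \<in> Hom C W (Dom C m).
     m \<bullet>\<^bsub>C\<^esub> u = m \<bullet>\<^bsub>C\<^esub> v \<longrightarrow> u = v)"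

definition epi_arr :: "('o, 'm) cat \<Rightarrow> 'm \<Rightarrow> bool" where
  "epi_arr C e \<longleftrightarrow> e \<in> Arr C \<and> (\<forall>W. \<forall>u \<in> Hom C (Cod C e) W. \<forall>v \<in> Hom C (Cod C e) W.
     u \<bullet>\<^bsub>C\<^esub> e = v \<bullet>\<^bsub>C\<^esub> e \<longrightarrow> u = v)"

definition zero_obj :: "('o, 'm) cat \<Rightarrow> 'o \<Rightarrow> bool" where
  "zero_obj C Z \<longleftrightarrow> Z \<in> Obj C \<and>
     (\<forall>X \<in> Obj C. (\<exists>!f. f \<in> Hom C X Z) \<and> (\<exists>!f. f \<in> Hom C Z X))"

definition zero_arr :: "('o, 'm) cat \<Rightarrow> 'm \<Rightarrow> bool" where
  "zero_arr C f \<longleftrightarrow> f \<in> Arr C \<and> (\<exists>Z. zero_obj C Z \<and>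
     (\<exists>u \<in> Hom C (Dom C f) Z. \<exists>v \<in> Hom C Z (Cod C f). f = v \<bullet>\<^bsub>C\<^esub> u))"

definition is_kernel :: "('o, 'm) cat \<Rightarrow> 'm \<Rightarrow> 'm \<Rightarrow> bool" where
  "is_kernel C k f \<longleftrightarrow> k \<in> Arr C \<and> f \<in> Arr C \<and> Cod C k = Dom C f \<and> zero_arr C (f \<bullet>\<^bsub>C\<^esub> k) \<and>
     (\<forall>h \<in> Arr C. Cod C h = Dom C f \<and> zero_arr C (f \<bullet>\<^bsub>C\<^esub> h) \<longrightarrow>
       (\<exists>!u. u \<in> Hom C (Dom C h) (Dom C k) \<and> k \<bullet>\<^bsub>C\<^esub> u = h))"

definition is_cokernel :: "('o, 'm) cat \<Rightarrow> 'm \<Rightarrow> 'm \<Rightarrow> bool" where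
  "is_cokernel C c f \<longleftrightarrow> c \<in> Arr C \<and> f \<in> Arr C \<and> Dom C c = Cod C f \<and> zero_arr C (c \<bullet>\<^bsub>C\<^esub> f) \<and>
     (\<forall>h \<in> Arr C. Dom C h = Cod C f \<and> zero_arr C (h \<bullet>\<^bsub>C\<^esub> f) \<longrightarrow>
       (\<exists>!u. u \<in> Hom C (Cod C c) (Cod C h) \<and> u \<bullet>\<^bsub>C\<^esub> c = h))"

text \<open>The addition may be one function for all hom-sets, because distinct hom-sets are disjoint.\<close>

locale additive_category = category C for C :: "('o, 'm) cat" (structure) +
  fixes add :: "'m \<Rightarrow> 'm \<Rightarrow> 'm"
  assumes Hom_comm_group: "\<lbrakk>X \<in> Obj C; Y \<in> Obj C\<rbrakk>
      \<Longrightarrow> \<exists>z. comm_group \<lparr>carrier = Hom C X Y, monoid.mult = add, one = z\<rparr>"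
    and Cmp_add_left: "\<lbrakk>f \<in> Hom C X Y; g \<in> Hom C Y Z; g' \<in> Hom C Y Z\<rbrakk>
      \<Longrightarrow> add g g' \<bullet> f = add (g \<bullet> f) (g' \<bullet> f)"
    and Cmp_add_right: "\<lbrakk>f \<in> Hom C X Y; f' \<in> Hom C X Y; g \<in> Hom C Y Z\<rbrakk>
      \<Longrightarrow> g \<bullet> add f f' = add (g \<bullet> f) (g \<bullet> f')"
    and zero_obj_exists: "\<exists>Z. zero_obj C Z"
    and biproduct_exists: "\<lbrakk>X \<in> Obj C; Y \<in> Obj C\<rbrakk> \<Longrightarrow> \<exists>S.
      \<exists>i \<in> Hom C X S. \<exists>j \<in> Hom C Y S. \<exists>p \<in> Hom C S X. \<exists>r \<in> Hom C S Y.
        p \<bullet> i = Idn C X \<and> r \<bullet> j = Idn C Y \<and> zero_arr C (r \<bullet> i) \<and> zero_arr C (p \<bullet> j) \<and>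
        add (i \<bullet> p) (j \<bullet> r) = Idn C S"

locale abelian_category = category C for C :: "('o, 'm) cat" (structure) +
  assumes additive: "\<exists>add. additive_category C add"
    and kernel_exists: "f \<in> Arr C \<Longrightarrow> \<exists>k. is_kernel C k f"
    and cokernel_exists: "f \<in> Arr C \<Longrightarrow> \<exists>c. is_cokernel C c f"
    and mono_is_kernel: "mono_arr C m \<Longrightarrow> \<exists>f. is_kernel C m f"
    and epi_is_cokernel: "epi_arr C e \<Longrightarrow> \<exists>f. is_cokernel C e f"

definition short_exact :: "('o, 'm) cat \<Rightarrow> 'm \<Rightarrow> 'm \<Rightarrow> bool" where
  "short_exact C k e \<longleftrightarrow> is_kernel C k e \<and> is_cokernel C e k"

text \<open>A full subcategory is represented by its set of objects. As usual, Serre subcategories are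
  required to be nonempty.\<close>

locale serre_subcategory = abelian_category C
  for C :: "('o, 'm) cat" (structure) and N :: "'o set" +
  assumes serre_subset: "N \<subseteq> Obj C"
    and serre_nonempty: "N \<noteq> {}"
    and serre_sub: "\<lbrakk>mono_arr C m; Cod C m \<in> N\<rbrakk> \<Longrightarrow> Dom C m \<in> N"
    and serre_quot: "\<lbrakk>epi_arr C e; Dom C e \<in> N\<rbrakk> \<Longrightarrow> Cod C e \<in> N"
    and serre_ext: "\<lbrakk>short_exact C k e; Dom C k \<in> N; Cod C e \<in> N\<rbrakk> \<Longrightarrow> Dom C e \<in> N"


section \<open>The Gabriel quotient\<close>

text \<open>Gabriel's definition: the morphisms \<open>X \<rightarrow> Y\<close> of the quotient are the elements of the filtered
  colimit of the \<open>Hom C X' (Y/Y')\<close> over all subobjects \<open>X' \<subseteq> X\<close> and \<open>Y' \<subseteq> Y\<close> with \<open>X/X'\<close> and \<open>Y'\<close> in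
  \<open>N\<close>. An element is represented by a triple \<open>(i, f, p)\<close> consisting of the inclusion \<open>i : X' \<rightarrow> X\<close>,
  the projection \<open>p : Y \<rightarrow> Y/Y'\<close> and a morphism \<open>f : X' \<rightarrow> Y/Y'\<close>.\<close>

type_synonym 'm rep = "'m \<times> 'm \<times> 'm"

definition reps :: "('o, 'm) cat \<Rightarrow> 'o set \<Rightarrow> 'o \<Rightarrow> 'o \<Rightarrow> 'm rep set" where
  "reps C N X Y = {(i, f, p).
     mono_arr C i \<and> Cod C i = X \<and> (\<exists>c. is_cokernel C c i \<and> Cod C c \<in> N) \<and>
     epi_arr C p \<and> Dom C p = Y \<and> (\<exists>k. is_kernel C k p \<and> Dom C k \<in> N) \<and>
     f \<in> Hom C (Dom C i) (Cod C p)}"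

text \<open>\<open>refines C t s\<close>: the transition map to smaller \<open>X'\<close> and larger \<open>Y'\<close> sends \<open>s\<close> to \<open>t\<close>.\<close>

fun refines :: "('o, 'm) cat \<Rightarrow> 'm rep \<Rightarrow> 'm rep \<Rightarrow> bool" where
  "refines C (i', f', p') (i, f, p) \<longleftrightarrow>
     (\<exists>a \<in> Hom C (Dom C i') (Dom C i). \<exists>b \<in> Hom C (Cod C p) (Cod C p').
        i' = i \<bullet>\<^bsub>C\<^esub> a \<and> p' = b \<bullet>\<^bsub>C\<^esub> p \<and> f' = b \<bullet>\<^bsub>C\<^esub> f \<bullet>\<^bsub>C\<^esub> a)"

definition rep_rel ::
  "('o, 'm) cat \<Rightarrow> 'o set \<Rightarrow> 'o \<Rightarrow> 'o \<Rightarrow> ('m rep \<times> 'm rep) set" where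
  "rep_rel C N X Y = {(s, s'). s \<in> reps C N X Y \<and> s' \<in> reps C N X Y \<and>
     (\<exists>t \<in> reps C N X Y. refines C t s \<and> refines C t s')}"

text \<open>Composites. Let \<open>f : X' \<rightarrow> Y/Y'\<close> and \<open>g : Y'' \<rightarrow> Z/Z'\<close>, let \<open>p : Y \<rightarrow> Y/Y'\<close> and \<open>j : Y'' \<rightarrow> Y\<close> be the
  structure maps, and let \<open>p \<bullet> j = n \<bullet> e\<close> be the factorisation over the image
  \<open>I = (Y' + Y'')/Y' = Y''/(Y' \<inter> Y'')\<close>. After refinement (shrinking \<open>X'\<close> to the preimage of \<open>I\<close> and
  enlarging \<open>Z'\<close> by the image of \<open>Y' \<inter> Y''\<close>) one has \<open>f = n \<bullet> f'\<close> and \<open>g = g' \<bullet> e\<close>; the composite is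
  represented by \<open>g' \<bullet> f' : X' \<rightarrow> Z/Z'\<close>.\<close>

definition comp_reps ::
  "('o, 'm) cat \<Rightarrow> 'm rep set \<Rightarrow> 'm rep set \<Rightarrow> 'm rep set" where
  "comp_reps C d c = {(i, g' \<bullet>\<^bsub>C\<^esub> f', r) | i f' p n j g' r e.
     mono_arr C n \<and> epi_arr C e \<and> Cod C e = Dom C n \<and> p \<bullet>\<^bsub>C\<^esub> j = n \<bullet>\<^bsub>C\<^esub> e \<and>
     f' \<in> Hom C (Dom C i) (Dom C n) \<and> (i, n \<bullet>\<^bsub>C\<^esub> f', p) \<in> c \<and>
     g' \<in> Hom C (Cod C e) (Cod C r) \<and> (j, g' \<bullet>\<^bsub>C\<^esub> e, r) \<in> d}"

text \<open>Arrows of the quotient are triples \<open>(X, c, Y)\<close>: a class of representatives tagged with its source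
  and target.\<close>

type_synonym ('o, 'm) qarr = "'o \<times> 'm rep set \<times> 'o"

definition rep_class ::
  "('o, 'm) cat \<Rightarrow> 'o set \<Rightarrow> 'm \<Rightarrow> ('o, 'm) qarr" where
  "rep_class C N f = (Dom C f,
     rep_rel C N (Dom C f) (Cod C f) `` {(Idn C (Dom C f), f, Idn C (Cod C f))}, Cod C f)"

definition quotient_cat ::
  "('o, 'm) cat \<Rightarrow> 'o set \<Rightarrow> ('o, ('o, 'm) qarr) cat" where
  "quotient_cat C N = \<lparr>
     Obj = Obj C,
     Arr = {(X, c, Y). X \<in> Obj C \<and> Y \<in> Obj C \<and> c \<in> reps C N X Y // rep_rel C N X Y},
     Dom = (\<lambda>(X, c, Y). X),
     Cod = (\<lambda>(X, c, Y). Y),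
     Cmp = (\<lambda>(Y', d, Z) (X, c, Y). (X, rep_rel C N X Z `` comp_reps C d c, Z)),
     Idn = (\<lambda>X. rep_class C N (Idn C X))\<rparr>"

definition quotient_functor ::
  "('o, 'm) cat \<Rightarrow> 'o set \<Rightarrow> ('o, 'm, 'o, ('o, 'm) qarr) cfunctor" where
  "quotient_functor C N = \<lparr>FObj = (\<lambda>X. X), FArr = rep_class C N\<rparr>"


section \<open>Group actions and equivariant objects\<close>

locale cat_action = grp: group G + cat: category C
  for G :: "('g, 'x) monoid_scheme" and C :: "('o, 'm) cat"
    and F :: "'g \<Rightarrow> ('o, 'm, 'o, 'm) cfunctor" and \<epsilon> :: "'g \<Rightarrow> 'g \<Rightarrow> 'o \<Rightarrow> 'm" +
  assumes action_equivalence: "g \<in> carrier G \<Longrightarrow> is_equivalence C C (F g)"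
    and action_iso: "\<lbrakk>g \<in> carrier G; h \<in> carrier G\<rbrakk>
      \<Longrightarrow> natural_iso C C (comp_functor (F g) (F h)) (F (g \<otimes>\<^bsub>G\<^esub> h)) (\<epsilon> g h)"
    and action_cocycle: "\<lbrakk>g \<in> carrier G; h \<in> carrier G; k \<in> carrier G; X \<in> Obj C\<rbrakk>
      \<Longrightarrow> \<epsilon> (g \<otimes>\<^bsub>G\<^esub> h) k X \<bullet>\<^bsub>C\<^esub> \<epsilon> g h (FObj (F k) X)
        = \<epsilon> g (h \<otimes>\<^bsub>G\<^esub> k) X \<bullet>\<^bsub>C\<^esub> FArr (F g) (\<epsilon> h k X)"

text \<open>The families \<open>\<alpha>\<close> are extensional, so that an equivariant object is determined by its values on
  \<open>carrier G\<close>.\<close>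

type_synonym ('g, 'o, 'm) eobj = "'o \<times> ('g \<Rightarrow> 'm)"

definition equivariant_objs ::
  "('g, 'x) monoid_scheme \<Rightarrow> ('o, 'm) cat \<Rightarrow> ('g \<Rightarrow> ('o, 'm, 'o, 'm) cfunctor) \<Rightarrow>
   ('g \<Rightarrow> 'g \<Rightarrow> 'o \<Rightarrow> 'm) \<Rightarrow> ('g, 'o, 'm) eobj set" where
  "equivariant_objs G C F \<epsilon> = {(X, \<alpha>). X \<in> Obj C \<and>
     \<alpha> \<in> (\<Pi>\<^sub>E g \<in> carrier G. {a \<in> Hom C X (FObj (F g) X). is_iso C a}) \<and>
     (\<forall>g \<in> carrier G. \<forall>g' \<in> carrier G.
        \<alpha> (g \<otimes>\<^bsub>G\<^esub> g') = \<epsilon> g g' X \<bullet>\<^bsub>C\<^esub> FArr (F g) (\<alpha> g') \<bullet>\<^bsub>C\<^esub> \<alpha> g)}"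

text \<open>Arrows are triples \<open>((X, \<alpha>), \<theta>, (Y, \<beta>))\<close>: an arrow \<open>\<theta> : X \<rightarrow> Y\<close> tagged with its source and target.\<close>

type_synonym ('g, 'o, 'm) earr = "('g, 'o, 'm) eobj \<times> 'm \<times> ('g, 'o, 'm) eobj"

definition equivariant_cat ::
  "('g, 'x) monoid_scheme \<Rightarrow> ('o, 'm) cat \<Rightarrow> ('g \<Rightarrow> ('o, 'm, 'o, 'm) cfunctor) \<Rightarrow>
   ('g \<Rightarrow> 'g \<Rightarrow> 'o \<Rightarrow> 'm) \<Rightarrow>
   (('g, 'o, 'm) eobj, ('g, 'o, 'm) earr) cat" where
  "equivariant_cat G C F \<epsilon> = \<lparr>
     Obj = equivariant_objs G C F \<epsilon>,
     Arr = {((X, \<alpha>), \<theta>, (Y, \<beta>)).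
       (X, \<alpha>) \<in> equivariant_objs G C F \<epsilon> \<and> (Y, \<beta>) \<in> equivariant_objs G C F \<epsilon> \<and> \<theta> \<in> Hom C X Y \<and>
       (\<forall>g \<in> carrier G. \<beta> g \<bullet>\<^bsub>C\<^esub> \<theta> = FArr (F g) \<theta> \<bullet>\<^bsub>C\<^esub> \<alpha> g)},
     Dom = (\<lambda>(P, \<theta>, Q). P),
     Cod = (\<lambda>(P, \<theta>, Q). Q),
     Cmp = (\<lambda>(Q', \<phi>, R) (P, \<theta>, Q). (P, \<phi> \<bullet>\<^bsub>C\<^esub> \<theta>, R)),
     Idn = (\<lambda>(X, \<alpha>). ((X, \<alpha>), Idn C X, (X, \<alpha>)))\<rparr>"

definition equivariant_sub ::
  "('g, 'x) monoid_scheme \<Rightarrow> ('o, 'm) cat \<Rightarrow> ('g \<Rightarrow> ('o, 'm, 'o, 'm) cfunctor) \<Rightarrow>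
   ('g \<Rightarrow> 'g \<Rightarrow> 'o \<Rightarrow> 'm) \<Rightarrow> 'o set \<Rightarrow> ('g, 'o, 'm) eobj set" where
  "equivariant_sub G C F \<epsilon> N = {(X, \<alpha>) \<in> equivariant_objs G C F \<epsilon>. X \<in> N}"

text \<open>The induced action on the quotient: the functor induced by \<open>F\<^sub>g\<close> sends the class of \<open>(i, f, p)\<close>
  to the class of \<open>(F\<^sub>g i, F\<^sub>g f, F\<^sub>g p)\<close>.\<close>

definition induced_functor ::
  "('o, 'm) cat \<Rightarrow> 'o set \<Rightarrow> ('o, 'm, 'o, 'm) cfunctor \<Rightarrow>
   ('o, ('o, 'm) qarr, 'o, ('o, 'm) qarr) cfunctor" where
  "induced_functor C N F = \<lparr>
     FObj = FObj F,
     FArr = (\<lambda>(X, c, Y). (FObj F X,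
       rep_rel C N (FObj F X) (FObj F Y) `` ((\<lambda>(i, f, p). (FArr F i, FArr F f, FArr F p)) ` c),
       FObj F Y))\<rparr>"

definition induced_iso ::
  "('o, 'm) cat \<Rightarrow> 'o set \<Rightarrow> ('g \<Rightarrow> 'g \<Rightarrow> 'o \<Rightarrow> 'm) \<Rightarrow>
   'g \<Rightarrow> 'g \<Rightarrow> 'o \<Rightarrow> ('o, 'm) qarr" where
  "induced_iso C N \<epsilon> g h X = FArr (quotient_functor C N) (\<epsilon> g h X)"

definition equivariant_quotient ::
  "('g, 'x) monoid_scheme \<Rightarrow> ('o, 'm) cat \<Rightarrow> ('g \<Rightarrow> ('o, 'm, 'o, 'm) cfunctor) \<Rightarrow>
   ('g \<Rightarrow> 'g \<Rightarrow> 'o \<Rightarrow> 'm) \<Rightarrow> 'o set \<Rightarrow>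
   (('g, 'o, ('o, 'm) qarr) eobj,
    ('g, 'o, ('o, 'm) qarr) earr) cat" where
  "equivariant_quotient G C F \<epsilon> N =
     equivariant_cat G (quotient_cat C N) (\<lambda>g. induced_functor C N (F g)) (induced_iso C N \<epsilon>)"

text \<open>The functor \<open>\<Psi> : C\<^sup>G \<rightarrow> (C/N)\<^sup>G\<close>.\<close>

definition Psi_obj ::
  "('g, 'x) monoid_scheme \<Rightarrow> ('o, 'm) cat \<Rightarrow> 'o set \<Rightarrow> ('g, 'o, 'm) eobj \<Rightarrow>
   ('g, 'o, ('o, 'm) qarr) eobj" where
  "Psi_obj G C N = (\<lambda>(X, \<alpha>). (FObj (quotient_functor C N) X,
     \<lambda>g \<in> carrier G. FArr (quotient_functor C N) (\<alpha> g)))"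

definition Psi ::
  "('g, 'x) monoid_scheme \<Rightarrow> ('o, 'm) cat \<Rightarrow> 'o set \<Rightarrow>
   (('g, 'o, 'm) eobj, ('g, 'o, 'm) earr,
    ('g, 'o, ('o, 'm) qarr) eobj,
    ('g, 'o, ('o, 'm) qarr) earr) cfunctor" where
  "Psi G C N = \<lparr>
     FObj = Psi_obj G C N,
     FArr = (\<lambda>(P, \<theta>, Q). (Psi_obj G C N P, FArr (quotient_functor C N) \<theta>, Psi_obj G C N Q))\<rparr>"

text \<open>\<open>K : C/N \<rightarrow> D\<close> is the functor induced by \<open>H : C \<rightarrow> D\<close>: the unique functor with \<open>K \<circ> q = H\<close>.\<close>

definition is_induced_by ::
  "('o, 'm) cat \<Rightarrow> 'o set \<Rightarrow> ('p, 'n) cat \<Rightarrow> ('o, 'm, 'p, 'n) cfunctor \<Rightarrow>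
   ('o, ('o, 'm) qarr, 'p, 'n) cfunctor \<Rightarrow> bool" where
  "is_induced_by C N D H K \<longleftrightarrow>
     is_functor (quotient_cat C N) D K \<and>
     functor_eq_on C (comp_functor K (quotient_functor C N)) H \<and>
     (\<forall>K'. is_functor (quotient_cat C N) D K' \<and>
        functor_eq_on C (comp_functor K' (quotient_functor C N)) H \<longrightarrow>
        functor_eq_on (quotient_cat C N) K' K)"

end

theory Submission
  imports Defs
begin

text \<open>An arrow \<open>\<phi>\<close> of the quotient is determined by the pairs \<open>(u, v)\<close> with \<open>\<phi> \<circ> q(u) = q(v)\<close>, which gives
  the usual calculus of fractions by the arrows with kernel and cokernel in \<open>N\<close>; a functor inverting these
  factors over the quotient. It remains to see that the induced functor is fully faithful and dense.

  It is faithful because the equalizer of two equivariant arrows is equivariant. For the rest, the main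
  point is that a subobject \<open>\<phi> : V \<rightarrow> W\<close> in \<open>A/N\<close> of an equivariant object \<open>(W, \<beta>)\<close> which is invariant in
  \<open>A/N\<close> comes from an equivariant subobject: represent \<open>\<phi>\<close> by \<open>f : U \<rightarrow> W\<close>, let \<open>z : W \<rightarrow> Z\<close> be the cokernel
  of \<open>f\<close>, and take the kernel of the equivariant arrow \<open>W \<rightarrow> \<Prod>\<^sub>h F\<^sub>h Z\<close> with components \<open>F\<^sub>h z \<circ> \<beta>\<^sub>h\<close>; as \<open>G\<close> is
  finite, it agrees with the image of \<open>f\<close> up to objects of \<open>N\<close>. Applied to the graph of an arrow between
  equivariant objects this gives fullness, and applied to \<open>(a\<^sub>h)\<^sub>h : X \<rightarrow> \<Prod>\<^sub>h F\<^sub>h X\<close> for an object \<open>(X, a)\<close> of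
  \<open>(A/N)\<^sup>G\<close> it gives density.\<close>

section \<open>Categories\<close>

lemma in_Hom: "f \<in> Hom C X Y \<longleftrightarrow> f \<in> Arr C \<and> Dom C f = X \<and> Cod C f = Y"
  by (simp add: Hom_def)

context category
begin

lemma Obj_Dom [simp]: "f \<in> Arr C \<Longrightarrow> Dom C f \<in> Obj C"
  and Obj_Cod [simp]: "f \<in> Arr C \<Longrightarrow> Cod C f \<in> Obj C"
  using Dom_closed Cod_closed by auto

lemma Hom_Obj:
  assumes "f \<in> Hom C X Y"
  shows "X \<in> Obj C" "Y \<in> Obj C"
  using assms by (auto simp: in_Hom)

lemma Cmp_Arr [simp]: "\<lbrakk>f \<in> Arr C; g \<in> Arr C; Cod C f = Dom C g\<rbrakk> \<Longrightarrow> g \<bullet> f \<in> Arr C"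
  and Dom_Cmp [simp]: "\<lbrakk>f \<in> Arr C; g \<in> Arr C; Cod C f = Dom C g\<rbrakk> \<Longrightarrow> Dom C (g \<bullet> f) = Dom C f"
  and Cod_Cmp [simp]: "\<lbrakk>f \<in> Arr C; g \<in> Arr C; Cod C f = Dom C g\<rbrakk> \<Longrightarrow> Cod C (g \<bullet> f) = Cod C g"
  using Cmp_Hom[of f "Dom C f" "Cod C f" g "Cod C g"] by (auto simp: in_Hom)

lemma Idn_Arr [simp]: "X \<in> Obj C \<Longrightarrow> Idn C X \<in> Arr C"
  and Dom_Idn [simp]: "X \<in> Obj C \<Longrightarrow> Dom C (Idn C X) = X"
  and Cod_Idn [simp]: "X \<in> Obj C \<Longrightarrow> Cod C (Idn C X) = X"
  using Idn_Hom[of X] by (auto simp: in_Hom)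

lemma Cmp_Idn_l [simp]: "\<lbrakk>f \<in> Arr C; Cod C f = Y\<rbrakk> \<Longrightarrow> Idn C Y \<bullet> f = f"
  and Cmp_Idn_r [simp]: "\<lbrakk>f \<in> Arr C; Dom C f = X\<rbrakk> \<Longrightarrow> f \<bullet> Idn C X = f"
  using Cmp_Idn_left[of f X Y] Cmp_Idn_left[of f "Dom C f" Y] Cmp_Idn_right[of f X "Cod C f"]
  by (auto simp: in_Hom)

lemma assoc [simp]:
  "\<lbrakk>f \<in> Arr C; g \<in> Arr C; h \<in> Arr C; Cod C f = Dom C g; Cod C g = Dom C h\<rbrakk>
    \<Longrightarrow> (h \<bullet> g) \<bullet> f = h \<bullet> (g \<bullet> f)"
  using Cmp_assoc[of f "Dom C f" "Cod C f" g "Cod C g" h "Cod C h"] by (auto simp: in_Hom)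

text \<open>Lets the simplifier apply an equation between composites inside right-nested composites.\<close>

lemma pre:
  "\<lbrakk>b \<bullet> a = c; a \<in> Arr C; b \<in> Arr C; Cod C a = Dom C b; x \<in> Arr C; Cod C x = Dom C a\<rbrakk>
    \<Longrightarrow> b \<bullet> (a \<bullet> x) = c \<bullet> x"
  by (auto simp flip: assoc)

lemma monoD:
  "\<lbrakk>mono_arr C m; m \<bullet> u = m \<bullet> v; u \<in> Hom C W (Dom C m); v \<in> Hom C W (Dom C m)\<rbrakk> \<Longrightarrow> u = v"
  unfolding mono_arr_def by blast

lemma epiD:
  "\<lbrakk>epi_arr C e; u \<bullet> e = v \<bullet> e; u \<in> Hom C (Cod C e) W; v \<in> Hom C (Cod C e) W\<rbrakk> \<Longrightarrow> u = v"
  unfolding epi_arr_def by blast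

lemma monoI:
  "\<lbrakk>m \<in> Arr C; \<And>W u v. \<lbrakk>u \<in> Hom C W (Dom C m); v \<in> Hom C W (Dom C m); m \<bullet> u = m \<bullet> v\<rbrakk> \<Longrightarrow> u = v\<rbrakk>
    \<Longrightarrow> mono_arr C m"
  unfolding mono_arr_def by blast

lemma epiI:
  "\<lbrakk>m \<in> Arr C; \<And>W u v. \<lbrakk>u \<in> Hom C (Cod C m) W; v \<in> Hom C (Cod C m) W; u \<bullet> m = v \<bullet> m\<rbrakk> \<Longrightarrow> u = v\<rbrakk>
    \<Longrightarrow> epi_arr C m"
  unfolding epi_arr_def by blast

lemma mono_Arr: "mono_arr C m \<Longrightarrow> m \<in> Arr C"
  and epi_Arr: "epi_arr C m \<Longrightarrow> m \<in> Arr C"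
  by (auto simp: mono_arr_def epi_arr_def)

lemma mono_comp:
  assumes "mono_arr C m" "mono_arr C n" "Cod C m = Dom C n"
  shows "mono_arr C (n \<bullet> m)"
proof (rule monoI)
  note [simp] = assms(1,2)[THEN mono_Arr] assms(3)
  show "n \<bullet> m \<in> Arr C" by simp
  fix W u v assume "u \<in> Hom C W (Dom C (n \<bullet> m))" "v \<in> Hom C W (Dom C (n \<bullet> m))"
    and eq: "(n \<bullet> m) \<bullet> u = (n \<bullet> m) \<bullet> v"
  then have u: "u \<in> Hom C W (Dom C m)" and v: "v \<in> Hom C W (Dom C m)" by simp_all
  have "n \<bullet> (m \<bullet> u) = n \<bullet> (m \<bullet> v)" using eq u v by (simp add: in_Hom)
  then have "m \<bullet> u = m \<bullet> v"
    by (rule monoD[OF assms(2), where W=W]) (use u v in \<open>simp_all add: in_Hom\<close>)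
  then show "u = v" using monoD[OF assms(1)] u v by blast
qed

lemma mono_cancel:
  assumes "mono_arr C (n \<bullet> m)" "n \<in> Arr C" "m \<in> Arr C" "Cod C m = Dom C n"
  shows "mono_arr C m"
proof (rule monoI[OF assms(3)])
  fix W u v assume u: "u \<in> Hom C W (Dom C m)" and v: "v \<in> Hom C W (Dom C m)"
    and eq: "m \<bullet> u = m \<bullet> v"
  show "u = v"
    by (rule monoD[OF assms(1), where W=W]) (use u v eq assms in \<open>simp_all add: in_Hom\<close>)
qed

lemma mono_Idn: "X \<in> Obj C \<Longrightarrow> mono_arr C (Idn C X)"
  by (rule monoI) (auto simp: in_Hom)

lemma epi_Idn: "X \<in> Obj C \<Longrightarrow> epi_arr C (Idn C X)"
  by (rule epiI) (auto simp: in_Hom)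

lemma iso_Arr: "is_iso C f \<Longrightarrow> f \<in> Arr C"
  by (simp add: is_iso_def)

lemma isoI:
  "\<lbrakk>f \<in> Hom C X Y; g \<in> Hom C Y X; g \<bullet> f = Idn C X; f \<bullet> g = Idn C Y\<rbrakk> \<Longrightarrow> is_iso C f"
  unfolding is_iso_def by (auto simp: in_Hom)

lemma isoE:
  assumes "is_iso C f" "f \<in> Hom C X Y"
  obtains g where "g \<in> Hom C Y X" "g \<bullet> f = Idn C X" "f \<bullet> g = Idn C Y" "is_iso C g"
proof -
  obtain g where g: "g \<in> Hom C Y X" "g \<bullet> f = Idn C X" "f \<bullet> g = Idn C Y"
    using assms unfolding is_iso_def by (auto simp: in_Hom)
  with isoI[OF g(1) assms(2)] show ?thesis using that by blast
qed

lemma iso_Idn: "X \<in> Obj C \<Longrightarrow> is_iso C (Idn C X)"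
  by (rule isoI[of _ X X "Idn C X"]) (auto simp: in_Hom)

lemma iso_comp:
  assumes "is_iso C f" "is_iso C g" "Cod C f = Dom C g"
  shows "is_iso C (g \<bullet> f)"
proof -
  note [simp] = assms(1,2)[THEN iso_Arr] assms(3)
  obtain f' where f': "f' \<in> Hom C (Cod C f) (Dom C f)" "f' \<bullet> f = Idn C (Dom C f)"
    "f \<bullet> f' = Idn C (Cod C f)"
    using isoE[OF assms(1)] by (auto simp: in_Hom)
  obtain g' where g': "g' \<in> Hom C (Cod C g) (Dom C g)" "g' \<bullet> g = Idn C (Dom C g)"
    "g \<bullet> g' = Idn C (Cod C g)"
    using isoE[OF assms(2)] by (auto simp: in_Hom)
  show ?thesis
    by (rule isoI[of _ "Dom C f" "Cod C g" "f' \<bullet> g'"])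
      (use f' g' in \<open>simp_all add: in_Hom pre[OF f'(2)] pre[OF f'(3)] pre[OF g'(2)] pre[OF g'(3)]\<close>)
qed

lemma iso_mono:
  assumes "is_iso C f"
  shows "mono_arr C f"
proof -
  note [simp] = iso_Arr[OF assms]
  obtain g where g: "g \<in> Hom C (Cod C f) (Dom C f)" "g \<bullet> f = Idn C (Dom C f)"
    using isoE[OF assms] by (auto simp: in_Hom)
  have "mono_arr C (g \<bullet> f)" using mono_Idn by (simp add: g)
  then show ?thesis by (rule mono_cancel) (use g in \<open>auto simp: in_Hom\<close>)
qed

lemma iso_epi:
  assumes "is_iso C f"
  shows "epi_arr C f"
proof (rule epiI)
  show f: "f \<in> Arr C" using iso_Arr[OF assms] .
  obtain g where g: "g \<in> Hom C (Cod C f) (Dom C f)" "f \<bullet> g = Idn C (Cod C f)"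
    using isoE[OF assms] f by (auto simp: in_Hom)
  fix W u v assume uv: "u \<in> Hom C (Cod C f) W" "v \<in> Hom C (Cod C f) W" and "u \<bullet> f = v \<bullet> f"
  then have "(u \<bullet> f) \<bullet> g = (v \<bullet> f) \<bullet> g" by simp
  then show "u = v" using uv g f by (simp add: in_Hom)
qed

lemma split_mono:
  assumes "g \<bullet> f = Idn C (Dom C f)" "f \<in> Arr C" "g \<in> Arr C" "Cod C f = Dom C g"
  shows "mono_arr C f"
  by (rule mono_cancel[of g]) (use assms mono_Idn in auto)

lemma zero_unique_to:
  "\<lbrakk>zero_obj C Z; u \<in> Hom C X Z; v \<in> Hom C X Z\<rbrakk> \<Longrightarrow> u = v"
  unfolding zero_obj_def using Hom_Obj by blast

lemma zero_unique_from:
  "\<lbrakk>zero_obj C Z; u \<in> Hom C Z X; v \<in> Hom C Z X\<rbrakk> \<Longrightarrow> u = v"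
  unfolding zero_obj_def using Hom_Obj by blast

lemma zero_obj_Obj: "zero_obj C Z \<Longrightarrow> Z \<in> Obj C"
  by (simp add: zero_obj_def)

lemma zero_Arr: "zero_arr C f \<Longrightarrow> f \<in> Arr C"
  by (simp add: zero_arr_def)

lemma zero_arrI:
  assumes "zero_obj C Z" "u \<in> Hom C X Z" "v \<in> Hom C Z Y"
  shows "zero_arr C (v \<bullet> u)"
proof -
  have "v \<bullet> u \<in> Arr C" "Dom C (v \<bullet> u) = X" "Cod C (v \<bullet> u) = Y" using assms by (auto simp: in_Hom)
  then show ?thesis unfolding zero_arr_def using assms by blast
qed

lemma zero_arrE:
  assumes "zero_arr C f" "f \<in> Hom C X Y"
  obtains Z u v where "zero_obj C Z" "u \<in> Hom C X Z" "v \<in> Hom C Z Y" "f = v \<bullet> u"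
proof -
  have "Dom C f = X" "Cod C f = Y" using assms(2) by (auto simp: in_Hom)
  then show ?thesis using assms(1) that unfolding zero_arr_def by blast
qed

lemma zero_comp_left:
  assumes "zero_arr C f" "g \<in> Arr C" "Cod C f = Dom C g"
  shows "zero_arr C (g \<bullet> f)"
proof -
  have "f \<in> Hom C (Dom C f) (Dom C g)" using assms zero_Arr by (simp add: in_Hom)
  then obtain Z u v where *: "zero_obj C Z" "u \<in> Hom C (Dom C f) Z" "v \<in> Hom C Z (Dom C g)"
    and f: "f = v \<bullet> u"
    using zero_arrE[OF assms(1)] by blast
  have "g \<bullet> (v \<bullet> u) = (g \<bullet> v) \<bullet> u" using *(2,3) assms(2) by (simp add: in_Hom)
  moreover have "g \<bullet> v \<in> Hom C Z (Cod C g)" using *(3) assms(2) by (simp add: in_Hom)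
  ultimately show ?thesis using zero_arrI[OF *(1,2)] f by simp
qed

lemma zero_comp_right:
  assumes "zero_arr C f" "g \<in> Arr C" "Cod C g = Dom C f"
  shows "zero_arr C (f \<bullet> g)"
proof -
  have "f \<in> Hom C (Cod C g) (Cod C f)" using assms zero_Arr by (simp add: in_Hom)
  then obtain Z u v where *: "zero_obj C Z" "u \<in> Hom C (Cod C g) Z" "v \<in> Hom C Z (Cod C f)"
    and f: "f = v \<bullet> u"
    using zero_arrE[OF assms(1)] by blast
  have "(v \<bullet> u) \<bullet> g = v \<bullet> (u \<bullet> g)" using *(2,3) assms(2) by (simp add: in_Hom)
  moreover have "u \<bullet> g \<in> Hom C (Dom C g) Z" using *(2) assms(2) by (simp add: in_Hom)
  ultimately show ?thesis using zero_arrI[OF *(1) _ *(3)] f by simp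
qed

lemma zero_obj_to: "\<lbrakk>zero_obj C Z; X \<in> Obj C\<rbrakk> \<Longrightarrow> \<exists>f. f \<in> Hom C X Z"
  and zero_obj_from: "\<lbrakk>zero_obj C Z; X \<in> Obj C\<rbrakk> \<Longrightarrow> \<exists>f. f \<in> Hom C Z X"
  unfolding zero_obj_def by metis+

lemma zero_unique:
  assumes "zero_arr C f" "zero_arr C g" "Dom C f = Dom C g" "Cod C f = Cod C g"
  shows "f = g"
proof -
  define X Y where "X = Dom C f" and "Y = Cod C f"
  have fg: "f \<in> Hom C X Y" "g \<in> Hom C X Y" using assms zero_Arr by (auto simp: in_Hom X_def Y_def)
  obtain Z u v where 1: "zero_obj C Z" "u \<in> Hom C X Z" "v \<in> Hom C Z Y" "f = v \<bullet> u"
    using zero_arrE[OF assms(1) fg(1)] by blast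
  obtain Z' u' v' where 2: "zero_obj C Z'" "u' \<in> Hom C X Z'" "v' \<in> Hom C Z' Y" "g = v' \<bullet> u'"
    using zero_arrE[OF assms(2) fg(2)] by blast
  obtain w where w: "w \<in> Hom C Z Z'"
    using zero_obj_to[OF 2(1) zero_obj_Obj[OF 1(1)]] by blast
  have "w \<bullet> u = u'" by (rule zero_unique_to[OF 2(1)]) (use w 1 2 in \<open>auto simp: in_Hom\<close>)
  moreover have "v' \<bullet> w = v" by (rule zero_unique_from[OF 1(1)]) (use w 1 2 in \<open>auto simp: in_Hom\<close>)
  moreover have "(v' \<bullet> w) \<bullet> u = v' \<bullet> (w \<bullet> u)" using 1(2) 2(3) w by (simp add: in_Hom)
  ultimately show ?thesis using 1(4) 2(4) by simp
qed

lemma zero_arr_exists: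
  assumes "zero_obj C Z" "X \<in> Obj C" "Y \<in> Obj C"
  shows "\<exists>f \<in> Hom C X Y. zero_arr C f"
proof -
  obtain u v where u: "u \<in> Hom C X Z" and v: "v \<in> Hom C Z Y"
    using zero_obj_to zero_obj_from assms by blast
  then have "v \<bullet> u \<in> Hom C X Y" by (auto simp: in_Hom)
  moreover have "zero_arr C (v \<bullet> u)" using zero_arrI assms(1) u v by blast
  ultimately show ?thesis by blast
qed

lemma zero_via_zero_obj:
  assumes "zero_obj C Z" "f \<in> Arr C" "Dom C f = Z \<or> Cod C f = Z"
  shows "zero_arr C f"
  using assms(3)
proof
  assume "Dom C f = Z"
  then show ?thesis using zero_arrI[OF assms(1), of "Idn C Z" Z f] assms(2) zero_obj_Obj[OF assms(1)]
    by (simp add: in_Hom)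
next
  assume "Cod C f = Z"
  then show ?thesis using zero_arrI[OF assms(1), of f _ "Idn C Z"] assms(2) zero_obj_Obj[OF assms(1)]
    by (simp add: in_Hom)
qed

lemma zero_obj_iff_Idn:
  assumes "X \<in> Obj C"
  shows "zero_obj C X \<longleftrightarrow> zero_arr C (Idn C X)"
proof
  assume "zero_arr C (Idn C X)"
  then obtain Z u v where *: "zero_obj C Z" "u \<in> Hom C X Z" "v \<in> Hom C Z X" "Idn C X = v \<bullet> u"
    using zero_arrE Idn_Hom[OF assms] by blast
  have "\<exists>!f. f \<in> Hom C Y X" if Y: "Y \<in> Obj C" for Y
  proof -
    obtain a where a: "a \<in> Hom C Y Z" using zero_obj_to *(1) Y by blast
    show ?thesis
    proof (rule ex1I[of _ "v \<bullet> a"])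
      show "v \<bullet> a \<in> Hom C Y X" using a *(3) by (auto simp: in_Hom)
      fix f assume f: "f \<in> Hom C Y X"
      have "u \<bullet> f = a" by (rule zero_unique_to[OF *(1)]) (use a f *(2) in \<open>auto simp: in_Hom\<close>)
      moreover have "f = (v \<bullet> u) \<bullet> f" using f *(4)[symmetric] by (simp add: in_Hom)
      ultimately show "f = v \<bullet> a" using f *(2,3) by (auto simp: in_Hom)
    qed
  qed
  moreover have "\<exists>!f. f \<in> Hom C X Y" if Y: "Y \<in> Obj C" for Y
  proof -
    obtain b where b: "b \<in> Hom C Z Y" using zero_obj_from *(1) Y by blast
    show ?thesis
    proof (rule ex1I[of _ "b \<bullet> u"])
      show "b \<bullet> u \<in> Hom C X Y" using b *(2) by (auto simp: in_Hom)
      fix f assume f: "f \<in> Hom C X Y"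
      have "f \<bullet> v = b" by (rule zero_unique_from[OF *(1)]) (use b f *(3) in \<open>auto simp: in_Hom\<close>)
      moreover have "f = f \<bullet> (v \<bullet> u)" using f *(4)[symmetric] by (simp add: in_Hom)
      ultimately show "f = b \<bullet> u" using f *(2,3) by (auto simp: in_Hom simp flip: assoc)
    qed
  qed
  ultimately show "zero_obj C X" unfolding zero_obj_def using assms by blast
qed (use assms zero_via_zero_obj in auto)

lemma mono_zero_Dom:
  assumes "mono_arr C m" "zero_arr C m"
  shows "zero_obj C (Dom C m)"
proof -
  have m: "m \<in> Arr C" using assms(1) by (rule mono_Arr)
  obtain Z where Z: "zero_obj C Z" using assms(2) by (auto simp: zero_arr_def)
  obtain z where z: "z \<in> Hom C (Dom C m) (Dom C m)" "zero_arr C z"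
    using zero_arr_exists[OF Z, of "Dom C m" "Dom C m"] m by auto
  have "m \<bullet> z = m \<bullet> Idn C (Dom C m)"
    by (rule zero_unique) (use z m assms zero_comp_left in \<open>auto simp: in_Hom\<close>)
  then have "z = Idn C (Dom C m)" by (rule monoD[OF assms(1)]) (use z m in \<open>auto simp: in_Hom\<close>)
  then show ?thesis using z m zero_obj_iff_Idn by auto
qed

lemma kernelD:
  assumes "is_kernel C k f"
  shows "k \<in> Arr C" "f \<in> Arr C" "Cod C k = Dom C f" "zero_arr C (f \<bullet> k)"
  using assms by (auto simp: is_kernel_def)

lemma kernel_factor:
  assumes "is_kernel C k f" "zero_arr C (f \<bullet> h)" "h \<in> Hom C W (Dom C f)"
  obtains u where "u \<in> Hom C W (Dom C k)" "k \<bullet> u = h"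
proof -
  have "h \<in> Arr C" "Cod C h = Dom C f" "Dom C h = W" using assms(3) by (auto simp: in_Hom)
  then show ?thesis using assms(1,2) that unfolding is_kernel_def by metis
qed

lemma cokernelD:
  assumes "is_cokernel C k f"
  shows "k \<in> Arr C" "f \<in> Arr C" "Dom C k = Cod C f" "zero_arr C (k \<bullet> f)"
  using assms by (auto simp: is_cokernel_def)

lemma cokernel_factor:
  assumes "is_cokernel C k f" "zero_arr C (h \<bullet> f)" "h \<in> Hom C (Cod C f) W"
  obtains u where "u \<in> Hom C (Cod C k) W" "u \<bullet> k = h"
proof -
  have "h \<in> Arr C" "Dom C h = Cod C f" "Cod C h = W" using assms(3) by (auto simp: in_Hom)
  then show ?thesis using assms(1,2) that unfolding is_cokernel_def by metis
qed

lemma kernel_mono: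
  assumes "is_kernel C k f"
  shows "mono_arr C k"
proof (rule monoI)
  note [simp] = kernelD(1-3)[OF assms]
  show "k \<in> Arr C" by simp
  fix W u v assume u: "u \<in> Hom C W (Dom C k)" and v: "v \<in> Hom C W (Dom C k)"
    and eq: "k \<bullet> u = k \<bullet> v"
  have "k \<bullet> u \<in> Arr C \<and> Dom C (k \<bullet> u) = W \<and> Cod C (k \<bullet> u) = Dom C f \<and> zero_arr C (f \<bullet> (k \<bullet> u))"
    using zero_comp_right[OF kernelD(4)[OF assms], of u] u by (simp add: in_Hom)
  then have "\<exists>!w. w \<in> Hom C W (Dom C k) \<and> k \<bullet> w = k \<bullet> u"
    using assms unfolding is_kernel_def by metis
  then show "u = v" using u v eq by metis
qed

lemma kernelI:
  assumes "mono_arr C k" "f \<in> Arr C" "Cod C k = Dom C f" "zero_arr C (f \<bullet> k)"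
    and "\<And>W h. \<lbrakk>h \<in> Hom C W (Dom C f); zero_arr C (f \<bullet> h)\<rbrakk>
      \<Longrightarrow> \<exists>u \<in> Hom C W (Dom C k). k \<bullet> u = h"
  shows "is_kernel C k f"
  unfolding is_kernel_def
proof (intro conjI ballI impI)
  show "k \<in> Arr C" "f \<in> Arr C" "Cod C k = Dom C f" "zero_arr C (f \<bullet> k)"
    using assms mono_Arr by auto
  fix h assume h: "h \<in> Arr C" "Cod C h = Dom C f \<and> zero_arr C (f \<bullet> h)"
  then obtain u where u: "u \<in> Hom C (Dom C h) (Dom C k)" "k \<bullet> u = h"
    using assms(5)[of h "Dom C h"] by (auto simp: in_Hom)
  show "\<exists>!u. u \<in> Hom C (Dom C h) (Dom C k) \<and> k \<bullet> u = h"
  proof (rule ex1I[of _ u])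
    show "v = u" if "v \<in> Hom C (Dom C h) (Dom C k) \<and> k \<bullet> v = h" for v
      by (rule monoD[OF assms(1) _ _ u(1)]) (use that u(2) in auto)
  qed (use u in simp)
qed

end

section \<open>The opposite category\<close>

definition opc :: "('o, 'm) cat \<Rightarrow> ('o, 'm) cat" where
  "opc C = \<lparr>Obj = Obj C, Arr = Arr C, Dom = Cod C, Cod = Dom C,
     Cmp = (\<lambda>g f. f \<bullet>\<^bsub>C\<^esub> g), Idn = Idn C\<rparr>"

lemma opc_sel:
  "Obj (opc C) = Obj C" "Arr (opc C) = Arr C" "Dom (opc C) = Cod C" "Cod (opc C) = Dom C"
  "g \<bullet>\<^bsub>opc C\<^esub> f = f \<bullet>\<^bsub>C\<^esub> g" "Idn (opc C) = Idn C"
  by (simp_all add: opc_def)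

lemma opc_Hom: "Hom (opc C) X Y = Hom C Y X"
  by (auto simp: Hom_def opc_sel)

lemma opc_mono: "mono_arr (opc C) m \<longleftrightarrow> epi_arr C m"
  and opc_epi: "epi_arr (opc C) m \<longleftrightarrow> mono_arr C m"
  by (simp_all add: mono_arr_def epi_arr_def opc_sel opc_Hom)

lemma opc_zero_obj: "zero_obj (opc C) Z \<longleftrightarrow> zero_obj C Z"
  by (auto simp: zero_obj_def opc_sel opc_Hom)

lemma opc_zero_arr: "zero_arr (opc C) f \<longleftrightarrow> zero_arr C f"
  by (auto simp: zero_arr_def opc_sel opc_Hom opc_zero_obj)

lemma opc_kernel: "is_kernel (opc C) k f \<longleftrightarrow> is_cokernel C k f"
  and opc_cokernel: "is_cokernel (opc C) k f \<longleftrightarrow> is_kernel C k f"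
  by (simp_all add: is_kernel_def is_cokernel_def opc_sel opc_zero_arr opc_Hom)

lemmas opc_simps = opc_sel opc_Hom opc_mono opc_epi opc_zero_obj opc_zero_arr opc_kernel opc_cokernel

context category
begin

lemma op_category: "category (opc C)"
  by unfold_locales (auto simp: opc_simps in_Hom)

lemmas epi_comp = category.mono_comp[OF op_category, simplified opc_simps]
lemmas epi_cancel = category.mono_cancel[OF op_category, simplified opc_simps]
lemmas cokernel_epi = category.kernel_mono[OF op_category, simplified opc_simps]
lemmas cokernelI = category.kernelI[OF op_category, simplified opc_simps]

end

section \<open>Additive categories\<close>

context additive_category
begin

lemma Hom_group:
  assumes "X \<in> Obj C" "Y \<in> Obj C"
  obtains z where "comm_group \<lparr>carrier = Hom C X Y, monoid.mult = add, one = z\<rparr>"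
    "z \<in> Hom C X Y" "zero_arr C z"
proof -
  obtain z where g: "comm_group \<lparr>carrier = Hom C X Y, monoid.mult = add, one = z\<rparr>"
    using Hom_comm_group[OF assms] by blast
  interpret g: comm_group "\<lparr>carrier = Hom C X Y, monoid.mult = add, one = z\<rparr>" by (fact g)
  have z: "z \<in> Hom C X Y" using g.one_closed by simp
  obtain Z where Z: "zero_obj C Z" using zero_obj_exists by blast
  obtain u v where u: "u \<in> Hom C X Z" and v: "v \<in> Hom C Z Y"
    using zero_obj_to zero_obj_from Z assms by blast
  have vu: "v \<bullet> u \<in> Hom C X Y" "zero_arr C (v \<bullet> u)"
    using u v zero_arrI[OF Z] by (auto simp: in_Hom)
  obtain z' where "comm_group \<lparr>carrier = Hom C X Z, monoid.mult = add, one = z'\<rparr>"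
    using Hom_comm_group[of X Z] assms Z zero_obj_Obj by blast
  then interpret g': comm_group "\<lparr>carrier = Hom C X Z, monoid.mult = add, one = z'\<rparr>" .
  have "add u u \<in> Hom C X Z" using g'.m_closed[of u u] u by simp
  then have "add u u = u" using zero_unique_to[OF Z] u by blast
  then have "add (v \<bullet> u) (v \<bullet> u) = v \<bullet> u" using Cmp_add_right[OF u u v] by simp
  then have "v \<bullet> u = z" using g.l_cancel_one[of "v \<bullet> u" "v \<bullet> u"] vu(1) by simp
  with g z vu(2) that show ?thesis by blast
qed

lemma add_Hom: "\<lbrakk>f \<in> Hom C X Y; g \<in> Hom C X Y\<rbrakk> \<Longrightarrow> add f g \<in> Hom C X Y"
proof -
  assume a: "f \<in> Hom C X Y" "g \<in> Hom C X Y"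
  obtain z where "comm_group \<lparr>carrier = Hom C X Y, monoid.mult = add, one = z\<rparr>"
    using Hom_group Hom_Obj[OF a(1)] by blast
  then interpret g: comm_group "\<lparr>carrier = Hom C X Y, monoid.mult = add, one = z\<rparr>" .
  show ?thesis using g.m_closed a by simp
qed

lemma add_zero:
  assumes "f \<in> Hom C X Y" "g \<in> Hom C X Y" "zero_arr C g"
  shows "add f g = f" "add g f = f"
proof -
  obtain z where "comm_group \<lparr>carrier = Hom C X Y, monoid.mult = add, one = z\<rparr>"
    and z: "z \<in> Hom C X Y" "zero_arr C z"
    using Hom_group Hom_Obj[OF assms(1)] by blast
  then interpret g: comm_group "\<lparr>carrier = Hom C X Y, monoid.mult = add, one = z\<rparr>" by simp
  have "g = z" using zero_unique assms z by (auto simp: in_Hom)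
  then show "add f g = f" "add g f = f" using g.r_one g.l_one assms by auto
qed

lemma negative_exists:
  assumes g: "g \<in> Hom C X Y"
  shows "\<exists>n \<in> Hom C X Y. zero_arr C (add g n)"
proof -
  obtain z where "comm_group \<lparr>carrier = Hom C X Y, monoid.mult = add, one = z\<rparr>"
    and z: "z \<in> Hom C X Y" "zero_arr C z" using Hom_group Hom_Obj[OF g] by blast
  then interpret g: comm_group "\<lparr>carrier = Hom C X Y, monoid.mult = add, one = z\<rparr>" by simp
  show ?thesis
    using g.inv_closed[of g] g.r_inv[of g] g z(2)
    by (intro bexI[of _ "inv\<^bsub>\<lparr>carrier = Hom C X Y, monoid.mult = add, one = z\<rparr>\<^esub> g"]) auto
qed

lemma difference_add:
  assumes f: "f \<in> Hom C X Y" and g: "g \<in> Hom C X Y" and n: "n \<in> Hom C X Y" "zero_arr C (add g n)"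
    and u: "u \<in> Hom C W X" and v: "v \<in> Hom C Y Z"
  shows "zero_arr C (v \<bullet> (add f n \<bullet> u)) \<longleftrightarrow> v \<bullet> (f \<bullet> u) = v \<bullet> (g \<bullet> u)"
proof -
  let ?a = "v \<bullet> (f \<bullet> u)" and ?b = "v \<bullet> (g \<bullet> u)" and ?n = "v \<bullet> (n \<bullet> u)"
  have H: "?a \<in> Hom C W Z" "?b \<in> Hom C W Z" "?n \<in> Hom C W Z"
    using f g n u v by (auto simp: in_Hom)
  have split: "v \<bullet> (add a n \<bullet> u) = add (v \<bullet> (a \<bullet> u)) ?n" if "a \<in> Hom C X Y" for a
    using Cmp_add_left[OF u that n(1)] Cmp_add_right[of "a \<bullet> u" W Y "n \<bullet> u" v Z] that n u v
    by (auto simp: in_Hom)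
  obtain y where "comm_group \<lparr>carrier = Hom C W Z, monoid.mult = add, one = y\<rparr>"
    and y: "y \<in> Hom C W Z" "zero_arr C y" using Hom_group Hom_Obj[OF H(1)] by blast
  then interpret h: comm_group "\<lparr>carrier = Hom C W Z, monoid.mult = add, one = y\<rparr>" by simp
  have "zero_arr C (v \<bullet> (add g n \<bullet> u))"
    using add_Hom[OF g n(1)] n(2) u v zero_comp_left zero_comp_right by (auto simp: in_Hom)
  then have b: "add ?b ?n = y"
    using split[OF g] y add_Hom[OF H(2,3)] zero_unique[of "add ?b ?n" y] by (simp add: in_Hom)
  have "zero_arr C (v \<bullet> (add f n \<bullet> u)) \<longleftrightarrow> add ?a ?n = y"
    using split[OF f] y add_Hom[OF H(1,3)] zero_unique[of "add ?a ?n" y] by (auto simp: in_Hom)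
  also have "\<dots> \<longleftrightarrow> ?a = ?b"
    using h.right_cancel[of ?n ?a ?b] H b by auto
  finally show ?thesis .
qed

lemma op_additive: "additive_category (opc C) add"
proof -
  interpret op: category "opc C" by (rule op_category)
  show ?thesis
  proof
    fix X Y assume "X \<in> Obj (opc C)" "Y \<in> Obj (opc C)"
    then obtain S i j p r where "i \<in> Hom C X S" "j \<in> Hom C Y S" "p \<in> Hom C S X" "r \<in> Hom C S Y"
      "p \<bullet> i = Idn C X \<and> r \<bullet> j = Idn C Y \<and> zero_arr C (r \<bullet> i) \<and> zero_arr C (p \<bullet> j) \<and>
        add (i \<bullet> p) (j \<bullet> r) = Idn C S"
      using biproduct_exists[of X Y] by (auto simp: opc_simps)
    then show "\<exists>S. \<exists>i\<in>Hom (opc C) X S. \<exists>j\<in>Hom (opc C) Y S. \<exists>p\<in>Hom (opc C) S X. \<exists>r\<in>Hom (opc C) S Y.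
             p \<bullet>\<^bsub>opc C\<^esub> i = Idn (opc C) X \<and>
             r \<bullet>\<^bsub>opc C\<^esub> j = Idn (opc C) Y \<and>
             zero_arr (opc C) (r \<bullet>\<^bsub>opc C\<^esub> i) \<and>
             zero_arr (opc C) (p \<bullet>\<^bsub>opc C\<^esub> j) \<and>
             add (i \<bullet>\<^bsub>opc C\<^esub> p) (j \<bullet>\<^bsub>opc C\<^esub> r) = Idn (opc C) S"
      unfolding opc_simps by blast
  next
    fix X Y assume "X \<in> Obj (opc C)" "Y \<in> Obj (opc C)"
    then show "\<exists>z. comm_group \<lparr>carrier = Hom (opc C) X Y, monoid.mult = add, one = z\<rparr>"
      using Hom_comm_group unfolding opc_simps by blast
  qed (use zero_obj_exists in \<open>auto simp: opc_simps Cmp_add_left Cmp_add_right\<close>)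
qed

lemma biproduct_product:
  assumes i: "i \<in> Hom C X S" and j: "j \<in> Hom C Y S" and p: "p \<in> Hom C S X" and r: "r \<in> Hom C S Y"
    and eqs: "p \<bullet> i = Idn C X" "r \<bullet> j = Idn C Y" "zero_arr C (r \<bullet> i)" "zero_arr C (p \<bullet> j)"
      "add (i \<bullet> p) (j \<bullet> r) = Idn C S"
    and u: "u \<in> Hom C W X" and v: "v \<in> Hom C W Y"
  shows "\<exists>!h. h \<in> Hom C W S \<and> p \<bullet> h = u \<and> r \<bullet> h = v"
proof (rule ex1I[of _ "add (i \<bullet> u) (j \<bullet> v)"])
  have iu: "i \<bullet> u \<in> Hom C W S" "j \<bullet> v \<in> Hom C W S" using i j u v by (auto simp: in_Hom)
  have "p \<bullet> (i \<bullet> u) = u" "r \<bullet> (j \<bullet> v) = v"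
    using i j p r u v by (auto simp: in_Hom pre[OF eqs(1)] pre[OF eqs(2)])
  moreover have "zero_arr C (p \<bullet> (j \<bullet> v))" "zero_arr C (r \<bullet> (i \<bullet> u))"
    using zero_comp_right[OF eqs(4), of v] zero_comp_right[OF eqs(3), of u] i j p r u v
    by (auto simp: in_Hom)
  moreover have "p \<bullet> (j \<bullet> v) \<in> Hom C W X" "r \<bullet> (i \<bullet> u) \<in> Hom C W Y" using i j p r u v by (auto simp: in_Hom)
  ultimately show "add (i \<bullet> u) (j \<bullet> v) \<in> Hom C W S \<and>
      p \<bullet> add (i \<bullet> u) (j \<bullet> v) = u \<and> r \<bullet> add (i \<bullet> u) (j \<bullet> v) = v"
    using Cmp_add_right[OF iu p] Cmp_add_right[OF iu r] add_Hom iu add_zero u v by auto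
  fix h assume h: "h \<in> Hom C W S \<and> p \<bullet> h = u \<and> r \<bullet> h = v"
  have "add (i \<bullet> p) (j \<bullet> r) \<bullet> h = add (i \<bullet> (p \<bullet> h)) (j \<bullet> (r \<bullet> h))"
    using Cmp_add_left[of h W S "i \<bullet> p" S "j \<bullet> r"] h i j p r by (auto simp: in_Hom)
  then show "h = add (i \<bullet> u) (j \<bullet> v)" using eqs(5) h by (auto simp: in_Hom)
qed

end

section \<open>Abelian categories\<close>

definition is_pullback :: "('o, 'm) cat \<Rightarrow> 'm \<Rightarrow> 'm \<Rightarrow> 'm \<Rightarrow> 'm \<Rightarrow> bool" where
  "is_pullback C f g p q \<longleftrightarrow> f \<in> Arr C \<and> g \<in> Arr C \<and> p \<in> Arr C \<and> q \<in> Arr C \<and>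
     Cod C f = Cod C g \<and> Dom C p = Dom C q \<and> Cod C p = Dom C f \<and> Cod C q = Dom C g \<and>
     f \<bullet>\<^bsub>C\<^esub> p = g \<bullet>\<^bsub>C\<^esub> q \<and>
     (\<forall>W. \<forall>u \<in> Hom C W (Dom C f). \<forall>v \<in> Hom C W (Dom C g). f \<bullet>\<^bsub>C\<^esub> u = g \<bullet>\<^bsub>C\<^esub> v \<longrightarrow>
       (\<exists>!w. w \<in> Hom C W (Dom C p) \<and> p \<bullet>\<^bsub>C\<^esub> w = u \<and> q \<bullet>\<^bsub>C\<^esub> w = v))"

context category
begin

lemma pullbackD:
  assumes "is_pullback C f g p q"
  shows "f \<in> Arr C" "g \<in> Arr C" "p \<in> Arr C" "q \<in> Arr C" "Cod C f = Cod C g" "Dom C p = Dom C q"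
    "Cod C p = Dom C f" "Cod C q = Dom C g" "f \<bullet> p = g \<bullet> q"
  using assms by (simp_all add: is_pullback_def)

lemma pullback_factor:
  assumes "is_pullback C f g p q" "u \<in> Hom C W (Dom C f)" "v \<in> Hom C W (Dom C g)" "f \<bullet> u = g \<bullet> v"
  obtains w where "w \<in> Hom C W (Dom C p)" "p \<bullet> w = u" "q \<bullet> w = v"
  using assms unfolding is_pullback_def by metis

lemma pullback_eq:
  assumes pb: "is_pullback C f g p q" and w: "w \<in> Hom C W (Dom C p)" "w' \<in> Hom C W (Dom C p)"
    and eq: "p \<bullet> w = p \<bullet> w'" "q \<bullet> w = q \<bullet> w'"
  shows "w = w'"
proof -
  note D = pullbackD[OF pb]
  have "p \<bullet> w \<in> Hom C W (Dom C f)" "q \<bullet> w \<in> Hom C W (Dom C g)" using w(1) D by (auto simp: in_Hom)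
  moreover have "f \<bullet> (p \<bullet> w) = g \<bullet> (q \<bullet> w)" using w(1) D by (simp add: in_Hom pre[OF D(9)])
  ultimately have "\<exists>!x. x \<in> Hom C W (Dom C p) \<and> p \<bullet> x = p \<bullet> w \<and> q \<bullet> x = q \<bullet> w"
    using pb unfolding is_pullback_def by blast
  then show ?thesis using w eq by metis
qed

lemma pullback_mono:
  assumes pb: "is_pullback C f g p q" and m: "mono_arr C g"
  shows "mono_arr C p"
proof (rule monoI)
  note [simp] = pullbackD(1-8)[OF pb]
  note eq = pullbackD(9)[OF pb]
  show "p \<in> Arr C" by simp
  fix W u v assume u: "u \<in> Hom C W (Dom C p)" and v: "v \<in> Hom C W (Dom C p)" and e: "p \<bullet> u = p \<bullet> v"
  have "g \<bullet> (q \<bullet> u) = f \<bullet> (p \<bullet> u)" using u by (simp add: in_Hom pre[OF eq])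
  also have "\<dots> = g \<bullet> (q \<bullet> v)" unfolding e using v by (simp add: in_Hom pre[OF eq])
  finally have "q \<bullet> u = q \<bullet> v" by (rule monoD[OF m, where W=W]) (use u v in \<open>simp_all add: in_Hom\<close>)
  then show "u = v" using pullback_eq[OF pb u v e] by blast
qed

end

context abelian_category
begin

lemma op_abelian: "abelian_category (opc C)"
proof -
  interpret op: category "opc C" by (rule op_category)
  show ?thesis
  proof
    show "\<exists>add. additive_category (opc C) add"
      using additive additive_category.op_additive by blast
  qed (simp_all add: opc_simps kernel_exists cokernel_exists mono_is_kernel epi_is_cokernel)
qed

lemma zero_object: obtains Z where "zero_obj C Z"
  using additive additive_category.zero_obj_exists by blast

lemma zero_Hom: "\<lbrakk>X \<in> Obj C; Y \<in> Obj C\<rbrakk> \<Longrightarrow> \<exists>f \<in> Hom C X Y. zero_arr C f"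
  using zero_arr_exists zero_object by metis

lemma mono_zeroD:
  assumes "mono_arr C m" "zero_arr C (m \<bullet> u)" "u \<in> Arr C" "Cod C u = Dom C m"
  shows "zero_arr C u"
proof -
  have m: "m \<in> Arr C" using mono_Arr assms by blast
  obtain z where z: "z \<in> Hom C (Dom C u) (Dom C m)" "zero_arr C z"
    using zero_Hom[of "Dom C u" "Dom C m"] m assms(3) by auto
  have "m \<bullet> u = m \<bullet> z"
    by (rule zero_unique) (use z m assms zero_comp_left in \<open>auto simp: in_Hom\<close>)
  then have "u = z" by (rule monoD[OF assms(1) _ _ z(1)]) (use assms in \<open>auto simp: in_Hom\<close>)
  then show ?thesis using z by simp
qed

lemma difference:
  assumes f: "f \<in> Hom C X Y" and g: "g \<in> Hom C X Y"
  shows "\<exists>d \<in> Hom C X Y.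
    (\<forall>W Z. \<forall>u \<in> Hom C W X. \<forall>v \<in> Hom C Y Z. zero_arr C (v \<bullet> (d \<bullet> u)) \<longleftrightarrow> v \<bullet> (f \<bullet> u) = v \<bullet> (g \<bullet> u)) \<and>
    (\<forall>W. \<forall>u \<in> Hom C W X. zero_arr C (d \<bullet> u) \<longleftrightarrow> f \<bullet> u = g \<bullet> u) \<and>
    (\<forall>Z. \<forall>v \<in> Hom C Y Z. zero_arr C (v \<bullet> d) \<longleftrightarrow> v \<bullet> f = v \<bullet> g) \<and>
    (zero_arr C d \<longleftrightarrow> f = g)"
proof -
  obtain add where "additive_category C add" using additive by blast
  then interpret a: additive_category C add .
  obtain n where n: "n \<in> Hom C X Y" "zero_arr C (add g n)" using a.negative_exists[OF g] by blast
  define d where "d = add f n"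
  have d: "d \<in> Hom C X Y" using a.add_Hom[OF f n(1)] by (simp add: d_def)
  have *: "\<forall>W Z. \<forall>u \<in> Hom C W X. \<forall>v \<in> Hom C Y Z.
      zero_arr C (v \<bullet> (d \<bullet> u)) \<longleftrightarrow> v \<bullet> (f \<bullet> u) = v \<bullet> (g \<bullet> u)"
    unfolding d_def using a.difference_add[OF f g n] by blast
  note XY = Hom_Obj[OF f]
  note idn = Idn_Hom[OF XY(1)] Idn_Hom[OF XY(2)]
  have "zero_arr C (d \<bullet> u) \<longleftrightarrow> f \<bullet> u = g \<bullet> u" if "u \<in> Hom C W X" for W u
    using *[rule_format, OF that idn(2)] that d f g by (simp add: in_Hom)
  moreover have "zero_arr C (v \<bullet> d) \<longleftrightarrow> v \<bullet> f = v \<bullet> g" if "v \<in> Hom C Y Z" for Z v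
    using *[rule_format, OF idn(1) that] that d f g by (simp add: in_Hom)
  moreover have "zero_arr C d \<longleftrightarrow> f = g"
    using *[rule_format, OF idn] d f g by (simp add: in_Hom)
  ultimately show ?thesis using d * by blast
qed

lemma mono_by_zero:
  assumes "m \<in> Arr C" "\<And>W u. \<lbrakk>u \<in> Hom C W (Dom C m); zero_arr C (m \<bullet> u)\<rbrakk> \<Longrightarrow> zero_arr C u"
  shows "mono_arr C m"
proof (rule monoI[OF assms(1)])
  fix W u v assume uv: "u \<in> Hom C W (Dom C m)" "v \<in> Hom C W (Dom C m)" "m \<bullet> u = m \<bullet> v"
  obtain d where d: "d \<in> Hom C W (Dom C m)"
    "\<forall>Z. \<forall>x \<in> Hom C (Dom C m) Z. zero_arr C (x \<bullet> d) \<longleftrightarrow> x \<bullet> u = x \<bullet> v"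
    "zero_arr C d \<longleftrightarrow> u = v"
    using difference[OF uv(1,2)] by blast
  have "m \<in> Hom C (Dom C m) (Cod C m)" using assms(1) by (simp add: in_Hom)
  then show "u = v" using assms(2)[OF d(1)] d uv(3) by blast
qed

lemmas epi_zeroD = abelian_category.mono_zeroD[OF op_abelian, simplified opc_simps]
lemmas epi_by_zero = abelian_category.mono_by_zero[OF op_abelian, simplified opc_simps]

lemma mono_kernel_of_cokernel:
  assumes m: "mono_arr C m" and c: "is_cokernel C c m"
  shows "is_kernel C m c"
proof (rule kernelI[OF m])
  note [simp] = cokernelD(1-3)[OF c]
  show "c \<in> Arr C" "Cod C m = Dom C c" "zero_arr C (c \<bullet> m)" using cokernelD[OF c] by auto
  fix W h assume h: "h \<in> Hom C W (Dom C c)" "zero_arr C (c \<bullet> h)"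
  obtain f where f: "is_kernel C m f" using mono_is_kernel[OF m] by blast
  note fD = kernelD[OF f]
  obtain x where x: "x \<in> Hom C (Cod C c) (Cod C f)" "x \<bullet> c = f"
    using cokernel_factor[OF c fD(4)] fD by (auto simp: in_Hom)
  have "zero_arr C (x \<bullet> (c \<bullet> h))" using zero_comp_left[OF h(2), of x] x h by (simp add: in_Hom)
  then have "zero_arr C (f \<bullet> h)" using x h by (simp add: in_Hom pre[OF x(2)])
  then show "\<exists>u\<in>Hom C W (Dom C m). m \<bullet> u = h"
    using kernel_factor[OF f, of h W] h fD by (metis cokernelD(3)[OF c])
qed

lemmas epi_cokernel_of_kernel =
  abelian_category.mono_kernel_of_cokernel[OF op_abelian, simplified opc_simps]

lemma mono_epi_iso:
  assumes m: "mono_arr C f" and e: "epi_arr C f"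
  shows "is_iso C f"
proof -
  have [simp]: "f \<in> Arr C" using mono_Arr m .
  obtain g where g: "is_kernel C f g" using mono_is_kernel[OF m] by blast
  note gD = kernelD[OF g]
  have "zero_arr C g" using epi_zeroD[OF e gD(4)] gD by simp
  then have "zero_arr C (g \<bullet> Idn C (Cod C f))" using gD by simp
  moreover have "Idn C (Cod C f) \<in> Hom C (Cod C f) (Dom C g)" using Idn_Hom gD(2,3) by auto
  ultimately obtain u where u: "u \<in> Hom C (Cod C f) (Dom C f)" "f \<bullet> u = Idn C (Cod C f)"
    by (rule kernel_factor[OF g])
  have "f \<bullet> (u \<bullet> f) = f \<bullet> Idn C (Dom C f)" using u by (simp add: in_Hom pre[OF u(2)])
  then have "u \<bullet> f = Idn C (Dom C f)"
    by (rule monoD[OF m, where W="Dom C f"]) (use u in \<open>simp_all add: in_Hom\<close>)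
  then show ?thesis using isoI[of f "Dom C f" "Cod C f" u] u by (simp add: in_Hom)
qed

lemma kernel_mono_comp:
  assumes m: "mono_arr C m" and e: "e \<in> Arr C" "Cod C e = Dom C m"
  shows "is_kernel C k (m \<bullet> e) \<longleftrightarrow> is_kernel C k e"
proof -
  have [simp]: "m \<in> Arr C" using mono_Arr m .
  have "zero_arr C (m \<bullet> (e \<bullet> h)) \<longleftrightarrow> zero_arr C (e \<bullet> h)" if "h \<in> Arr C" "Cod C h = Dom C e" for h
    using that e mono_zeroD[OF m, of "e \<bullet> h"] zero_comp_left[of "e \<bullet> h" m] by auto
  then show ?thesis unfolding is_kernel_def using e by (auto cong: conj_cong)
qed

lemmas cokernel_epi_comp = abelian_category.kernel_mono_comp[OF op_abelian, simplified opc_simps]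

lemma factorization:
  assumes f: "f \<in> Hom C X Y"
  obtains I m e where "mono_arr C m" "epi_arr C e" "e \<in> Hom C X I" "m \<in> Hom C I Y" "f = m \<bullet> e"
proof -
  have [simp]: "f \<in> Arr C" using f by (simp add: in_Hom)
  obtain c where c: "is_cokernel C c f" using cokernel_exists[of f] by auto
  note [simp] = cokernelD(1,3)[OF c]
  obtain m where m: "is_kernel C m c" using kernel_exists[of c] by auto
  note mm = kernel_mono[OF m] and [simp] = kernelD(1,3)[OF m]
  obtain e where e: "e \<in> Hom C X (Dom C m)" "m \<bullet> e = f"
    using kernel_factor[OF m, of f X] cokernelD[OF c] f by (auto simp: in_Hom)
  have [simp]: "e \<in> Arr C" "Cod C e = Dom C m" using e by (auto simp: in_Hom)
  have "epi_arr C e"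
  proof (rule epi_by_zero)
    show "e \<in> Arr C" by simp
    fix W d assume d: "d \<in> Hom C (Cod C e) W" and z: "zero_arr C (d \<bullet> e)"
    have [simp]: "d \<in> Arr C" "Dom C d = Dom C m" using d e by (auto simp: in_Hom)
    obtain k where k: "is_kernel C k d" using kernel_exists[of d] by auto
    note [simp] = kernelD(1,3)[OF k]
    obtain e' where e': "e' \<in> Hom C (Dom C e) (Dom C k)" "k \<bullet> e' = e"
      using kernel_factor[OF k z] by (auto simp: in_Hom)
    have mk: "mono_arr C (m \<bullet> k)" using mono_comp[OF kernel_mono[OF k] mm] by simp
    obtain c' where c': "is_cokernel C c' (m \<bullet> k)" using cokernel_exists[of "m \<bullet> k"] by auto
    note [simp] = cokernelD(1,3)[OF c']
    have km: "is_kernel C (m \<bullet> k) c'" by (rule mono_kernel_of_cokernel[OF mk c'])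
    have "zero_arr C ((c' \<bullet> (m \<bullet> k)) \<bullet> e')"
      by (rule zero_comp_right[OF cokernelD(4)[OF c']]) (use e' in \<open>auto simp: in_Hom\<close>)
    then have "zero_arr C (c' \<bullet> f)" using e' e by (simp add: in_Hom)
    then obtain x where x: "x \<in> Hom C (Cod C c) (Cod C c')" "x \<bullet> c = c'"
      using cokernel_factor[OF c, of c'] f e by (auto simp: in_Hom)
    have "zero_arr C (x \<bullet> (c \<bullet> m))"
      using zero_comp_left[OF kernelD(4)[OF m], of x] x by (simp add: in_Hom)
    then have "zero_arr C (c' \<bullet> m)" using x by (simp add: in_Hom pre[OF x(2)])
    then obtain y where y: "y \<in> Hom C (Dom C m) (Dom C k)" "(m \<bullet> k) \<bullet> y = m"
      using kernel_factor[OF km, of m "Dom C m"] f e by (auto simp: in_Hom)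
    have "m \<bullet> (k \<bullet> y) = m \<bullet> Idn C (Dom C m)" using y by (simp add: in_Hom)
    then have ky: "k \<bullet> y = Idn C (Dom C m)"
      by (rule monoD[OF mm, where W="Dom C m"]) (use y in \<open>simp_all add: in_Hom\<close>)
    have "zero_arr C ((d \<bullet> k) \<bullet> y)"
      by (rule zero_comp_right[OF kernelD(4)[OF k]]) (use y in \<open>auto simp: in_Hom\<close>)
    then show "zero_arr C d" using ky y by (simp add: in_Hom)
  qed
  moreover have "m \<in> Hom C (Dom C m) Y" using f e by (auto simp: in_Hom)
  ultimately show ?thesis using that[OF mm _ e(1)] e(2) by simp
qed

lemma product:
  assumes "X \<in> Obj C" "Y \<in> Obj C"
  shows "\<exists>S. \<exists>p \<in> Hom C S X. \<exists>r \<in> Hom C S Y. \<forall>W. \<forall>u \<in> Hom C W X. \<forall>v \<in> Hom C W Y.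
    \<exists>!h. h \<in> Hom C W S \<and> p \<bullet> h = u \<and> r \<bullet> h = v"
proof -
  obtain add where "additive_category C add" using additive by blast
  then interpret a: additive_category C add .
  obtain S i j p r where S: "i \<in> Hom C X S" "j \<in> Hom C Y S" and pr: "p \<in> Hom C S X" "r \<in> Hom C S Y"
    and eqs: "p \<bullet> i = Idn C X" "r \<bullet> j = Idn C Y" "zero_arr C (r \<bullet> i)" "zero_arr C (p \<bullet> j)"
      "add (i \<bullet> p) (j \<bullet> r) = Idn C S"
    using a.biproduct_exists[OF assms] by blast
  then show ?thesis using a.biproduct_product[OF S pr eqs] by blast
qed

lemma pullback_exists:
  assumes f: "f \<in> Hom C X Z" and g: "g \<in> Hom C Y Z"
  obtains p q where "is_pullback C f g p q" "epi_arr C g \<longrightarrow> epi_arr C p"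
proof -
  note XYZ = Hom_Obj[OF f] Hom_Obj[OF g]
  have [simp]: "f \<in> Arr C" "g \<in> Arr C" "Dom C f = X" "Cod C f = Z" "Dom C g = Y" "Cod C g = Z"
    using f g by (auto simp: in_Hom)
  obtain S p r where S: "p \<in> Hom C S X" "r \<in> Hom C S Y"
    and univ0: "\<forall>W. \<forall>u \<in> Hom C W X. \<forall>v \<in> Hom C W Y.
      \<exists>!h. h \<in> Hom C W S \<and> p \<bullet> h = u \<and> r \<bullet> h = v"
    using product[OF XYZ(1,3)] by blast
  note univ = univ0[rule_format]
  have [simp]: "p \<in> Arr C" "r \<in> Arr C" "Dom C p = S" "Cod C p = X" "Dom C r = S" "Cod C r = Y"
    using S by (auto simp: in_Hom)
  have "f \<bullet> p \<in> Hom C S Z" "g \<bullet> r \<in> Hom C S Z" by (auto simp: in_Hom)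
  then obtain d where d: "d \<in> Hom C S Z"
    "\<forall>W U. \<forall>u \<in> Hom C W S. \<forall>v \<in> Hom C Z U.
      zero_arr C (v \<bullet> (d \<bullet> u)) \<longleftrightarrow> v \<bullet> ((f \<bullet> p) \<bullet> u) = v \<bullet> ((g \<bullet> r) \<bullet> u)"
    "\<forall>W. \<forall>u \<in> Hom C W S. zero_arr C (d \<bullet> u) \<longleftrightarrow> (f \<bullet> p) \<bullet> u = (g \<bullet> r) \<bullet> u"
    using difference[of "f \<bullet> p" S Z "g \<bullet> r"] by blast
  have [simp]: "d \<in> Arr C" "Dom C d = S" "Cod C d = Z" using d(1) by (auto simp: in_Hom)
  obtain k where k: "is_kernel C k d" using kernel_exists[of d] by auto
  note [simp] = kernelD(1,3)[OF k, simplified]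
  have pb: "is_pullback C f g (p \<bullet> k) (r \<bullet> k)"
    unfolding is_pullback_def
  proof (intro conjI allI ballI impI)
    show "f \<bullet> (p \<bullet> k) = g \<bullet> (r \<bullet> k)"
      using d(3)[rule_format, of k "Dom C k"] kernelD(4)[OF k] by (simp add: in_Hom)
    fix W u v assume "u \<in> Hom C W (Dom C f)" "v \<in> Hom C W (Dom C g)" and eq: "f \<bullet> u = g \<bullet> v"
    then have u: "u \<in> Hom C W X" and v: "v \<in> Hom C W Y" by auto
    obtain h where h: "h \<in> Hom C W S" "p \<bullet> h = u" "r \<bullet> h = v" using univ[OF u v] by blast
    have hh: "h \<in> Arr C" "Dom C h = W" "Cod C h = S" using h(1) by (auto simp: in_Hom)
    have "zero_arr C (d \<bullet> h)" using d(3)[rule_format, OF h(1)] hh h(2,3) eq by simp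
    then obtain w where w: "w \<in> Hom C W (Dom C k)" "k \<bullet> w = h"
      using kernel_factor[OF k, of h W] h(1) by auto
    show "\<exists>!w. w \<in> Hom C W (Dom C (p \<bullet> k)) \<and> (p \<bullet> k) \<bullet> w = u \<and> (r \<bullet> k) \<bullet> w = v"
    proof (rule ex1I[of _ w])
      show "w \<in> Hom C W (Dom C (p \<bullet> k)) \<and> (p \<bullet> k) \<bullet> w = u \<and> (r \<bullet> k) \<bullet> w = v"
        using w h(2,3) by (auto simp: in_Hom)
      fix w' assume w': "w' \<in> Hom C W (Dom C (p \<bullet> k)) \<and> (p \<bullet> k) \<bullet> w' = u \<and> (r \<bullet> k) \<bullet> w' = v"
      then have a: "w' \<in> Hom C W (Dom C k)" and b: "k \<bullet> w' \<in> Hom C W S" by (auto simp: in_Hom)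
      have "p \<bullet> (k \<bullet> w') = u" "r \<bullet> (k \<bullet> w') = v" using w' a by (auto simp: in_Hom)
      then have "k \<bullet> w' = k \<bullet> w" using univ[OF u v] b h w(2) by metis
      then show "w' = w" by (rule monoD[OF kernel_mono[OF k] _ a w(1)])
    qed
  qed auto
  have "epi_arr C (p \<bullet> k)" if e: "epi_arr C g"
  proof (rule epi_by_zero)
    obtain z where z: "z \<in> Hom C Y X" "zero_arr C z" using zero_Hom XYZ by blast
    obtain j where j: "j \<in> Hom C Y S" "p \<bullet> j = z" "r \<bullet> j = Idn C Y"
      using univ[OF z(1) Idn_Hom[OF XYZ(3)]] by blast
    obtain z' where z': "z' \<in> Hom C X Y" using zero_Hom XYZ by blast
    obtain i where i: "i \<in> Hom C X S" "p \<bullet> i = Idn C X"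
      using univ[OF Idn_Hom[OF XYZ(1)] z'] by blast
    have pe: "epi_arr C p"
      by (rule epi_cancel[of p i]) (use i epi_Idn XYZ in \<open>auto simp: in_Hom\<close>)
    have zj: "zero_arr C (v \<bullet> (d \<bullet> j)) \<longleftrightarrow> zero_arr C (v \<bullet> g)" if v: "v \<in> Hom C Z U" for v U
    proof -
      have [simp]: "v \<in> Arr C" "Dom C v = Z" "j \<in> Arr C" "Dom C j = Y" "Cod C j = S"
        using v j by (auto simp: in_Hom)
      have 0: "zero_arr C ((v \<bullet> f) \<bullet> z)" by (rule zero_comp_left) (use z in \<open>auto simp: in_Hom\<close>)
      have "zero_arr C (v \<bullet> (d \<bullet> j)) \<longleftrightarrow> v \<bullet> (f \<bullet> z) = v \<bullet> g"
        using d(2)[rule_format, OF j(1) v] j by simp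
      also have "\<dots> \<longleftrightarrow> zero_arr C (v \<bullet> g)"
      proof
        assume "v \<bullet> (f \<bullet> z) = v \<bullet> g" then show "zero_arr C (v \<bullet> g)" using 0 z by (simp add: in_Hom)
      next
        assume "zero_arr C (v \<bullet> g)"
        then have "(v \<bullet> f) \<bullet> z = v \<bullet> g" by (rule zero_unique[OF 0]) (use z in \<open>auto simp: in_Hom\<close>)
        then show "v \<bullet> (f \<bullet> z) = v \<bullet> g" using z by (simp add: in_Hom)
      qed
      finally show ?thesis .
    qed
    have de: "epi_arr C d"
    proof (rule epi_by_zero)
      fix W v assume v: "v \<in> Hom C (Cod C d) W" "zero_arr C (v \<bullet> d)"
      have "zero_arr C ((v \<bullet> d) \<bullet> j)" by (rule zero_comp_right) (use v j in \<open>auto simp: in_Hom\<close>)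
      then have "zero_arr C (v \<bullet> g)" using zj[of v W] v j by (auto simp: in_Hom)
      then show "zero_arr C v" by (rule epi_zeroD[OF e]) (use v in \<open>auto simp: in_Hom\<close>)
    qed simp
    show "p \<bullet> k \<in> Arr C" by simp
    fix W v assume v0: "v \<in> Hom C (Cod C (p \<bullet> k)) W" "zero_arr C (v \<bullet> (p \<bullet> k))"
    then have v: "v \<in> Hom C X W" "zero_arr C ((v \<bullet> p) \<bullet> k)" by (auto simp: in_Hom)
    then have "v \<bullet> p \<in> Hom C (Cod C k) W" by (auto simp: in_Hom)
    then obtain w where w: "w \<in> Hom C (Cod C d) W" "w \<bullet> d = v \<bullet> p"
      using cokernel_factor[OF epi_cokernel_of_kernel[OF de k] v(2)] by blast
    have "zero_arr C (v \<bullet> z)" by (rule zero_comp_left) (use z v in \<open>auto simp: in_Hom\<close>)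
    then have "zero_arr C (w \<bullet> (d \<bullet> j))"
      using w v j z by (simp add: in_Hom pre[OF w(2)])
    then have "zero_arr C (w \<bullet> g)" using zj[of w W] w by simp
    then have "zero_arr C w" by (rule epi_zeroD[OF e]) (use w in \<open>auto simp: in_Hom\<close>)
    then have "zero_arr C (w \<bullet> d)" by (rule zero_comp_right) (use w in \<open>auto simp: in_Hom\<close>)
    then have "zero_arr C (v \<bullet> p)" using w(2) by simp
    then show "zero_arr C v" by (rule epi_zeroD[OF pe]) (use v in \<open>auto simp: in_Hom\<close>)
  qed
  then show ?thesis using that[OF pb] by blast
qed

lemma pullback_epi:
  assumes pb: "is_pullback C f g p q" and e: "epi_arr C g"
  shows "epi_arr C p"
proof -
  note D = pullbackD[OF pb]
  obtain p' q' where pb': "is_pullback C f g p' q'" and e': "epi_arr C p'"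
    using pullback_exists[of f "Dom C f" "Cod C f" g "Dom C g"] D e by (auto simp: in_Hom)
  note D' = pullbackD[OF pb']
  obtain w where w: "w \<in> Hom C (Dom C p') (Dom C p)" "p \<bullet> w = p'"
    using pullback_factor[OF pb, of p' "Dom C p'" q'] D' by (auto simp: in_Hom)
  show ?thesis by (rule epi_cancel[of _ w]) (use w e' D in \<open>auto simp: in_Hom\<close>)
qed

end

section \<open>Isomorphisms modulo a Serre subcategory\<close>

definition Nker :: "('o, 'm) cat \<Rightarrow> 'o set \<Rightarrow> 'm \<Rightarrow> bool" where
  "Nker C N f \<longleftrightarrow> (\<exists>k. is_kernel C k f \<and> Dom C k \<in> N)"

definition Ncok :: "('o, 'm) cat \<Rightarrow> 'o set \<Rightarrow> 'm \<Rightarrow> bool" where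
  "Ncok C N f \<longleftrightarrow> (\<exists>c. is_cokernel C c f \<and> Cod C c \<in> N)"

definition Niso :: "('o, 'm) cat \<Rightarrow> 'o set \<Rightarrow> 'm \<Rightarrow> bool" where
  "Niso C N f \<longleftrightarrow> Nker C N f \<and> Ncok C N f"

lemma opc_Nker: "Nker (opc C) N f \<longleftrightarrow> Ncok C N f"
  and opc_Ncok: "Ncok (opc C) N f \<longleftrightarrow> Nker C N f"
  and opc_Niso: "Niso (opc C) N f \<longleftrightarrow> Niso C N f"
  by (auto simp: Nker_def Ncok_def Niso_def opc_simps)

lemmas opN_simps = opc_simps opc_Nker opc_Ncok opc_Niso

context serre_subcategory
begin

lemma op_serre: "serre_subcategory (opc C) N"
proof -
  interpret op: abelian_category "opc C" by (rule op_abelian)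
  show ?thesis
  proof
    fix k e assume a: "short_exact (opc C) k e" "Dom (opc C) k \<in> N" "Cod (opc C) e \<in> N"
    have ke: "is_cokernel C k e" "is_kernel C e k" "Cod C k \<in> N" "Dom C e \<in> N"
      using a by (simp_all only: short_exact_def opc_simps)
    then have "Dom C k \<in> N" using serre_ext[of e k] by (simp add: short_exact_def)
    then show "Dom (opc C) e \<in> N" using cokernelD(3)[OF ke(1)] by (simp only: opc_simps)
  next
    show "N \<subseteq> Obj (opc C)" "N \<noteq> {}" using serre_subset serre_nonempty by (simp_all add: opc_simps)
  qed (simp_all only: opc_simps serre_quot serre_sub)
qed

lemma N_Obj: "X \<in> N \<Longrightarrow> X \<in> Obj C"
  using serre_subset by blast

lemma N_zero:
  assumes "zero_obj C Z"
  shows "Z \<in> N"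
proof -
  obtain X where X: "X \<in> N" using serre_nonempty by blast
  obtain f where f: "f \<in> Hom C Z X" using zero_obj_from[OF assms N_Obj[OF X]] by blast
  have "mono_arr C f"
    by (rule monoI) (use f zero_unique_to[OF assms] in \<open>auto simp: in_Hom\<close>)
  then show ?thesis using serre_sub[of f] f X by (auto simp: in_Hom)
qed

lemma Nker_Arr: "Nker C N f \<Longrightarrow> f \<in> Arr C"
  and Ncok_Arr: "Ncok C N f \<Longrightarrow> f \<in> Arr C"
  and Niso_Arr: "Niso C N f \<Longrightarrow> f \<in> Arr C"
  by (auto simp: Nker_def Ncok_def Niso_def kernelD cokernelD)

lemma Nker_kernel:
  assumes "Nker C N f" "is_kernel C k f"
  shows "Dom C k \<in> N"
proof -
  obtain k' where k': "is_kernel C k' f" "Dom C k' \<in> N" using assms by (auto simp: Nker_def)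
  note D = kernelD[OF assms(2)] and D' = kernelD[OF k'(1)]
  obtain u where u: "u \<in> Hom C (Dom C k) (Dom C k')" "k' \<bullet> u = k"
    using kernel_factor[OF k'(1) D(4)] D by (auto simp: in_Hom)
  have "mono_arr C u"
    by (rule mono_cancel[of k']) (use u kernel_mono[OF assms(2)] D' in \<open>auto simp: in_Hom\<close>)
  then show ?thesis using serre_sub[of u] u k'(2) by (auto simp: in_Hom)
qed

lemma mono_Nker:
  assumes "mono_arr C m"
  shows "Nker C N m"
proof -
  obtain k where k: "is_kernel C k m" using kernel_exists mono_Arr assms by blast
  note D = kernelD[OF k]
  have "zero_arr C k" using mono_zeroD[OF assms D(4)] D by simp
  then have "zero_obj C (Dom C k)" using mono_zero_Dom kernel_mono[OF k] by blast
  then show ?thesis using N_zero k by (auto simp: Nker_def)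
qed

lemma Nker_mono_comp:
  "\<lbrakk>mono_arr C m; e \<in> Arr C; Cod C e = Dom C m\<rbrakk> \<Longrightarrow> Nker C N (m \<bullet> e) \<longleftrightarrow> Nker C N e"
  by (simp add: Nker_def kernel_mono_comp)

text \<open>The cokernel of \<open>g \<bullet> f\<close> is an extension of a quotient of \<open>Coker g\<close> by a quotient of \<open>Coker f\<close>.\<close>

lemma Ncok_comp:
  assumes f: "Ncok C N f" and g: "Ncok C N g" and fg: "Cod C f = Dom C g"
  shows "Ncok C N (g \<bullet> f)"
proof -
  note [simp] = Ncok_Arr[OF f] Ncok_Arr[OF g] fg
  obtain c1 where c1: "is_cokernel C c1 f" "Cod C c1 \<in> N" using f by (auto simp: Ncok_def)
  obtain c2 where c2: "is_cokernel C c2 g" "Cod C c2 \<in> N" using g by (auto simp: Ncok_def)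
  obtain c where c: "is_cokernel C c (g \<bullet> f)" using cokernel_exists[of "g \<bullet> f"] by auto
  note [simp] = cokernelD(1,3)[OF c1(1), simplified] cokernelD(1,3)[OF c2(1), simplified]
    cokernelD(1,3)[OF c, simplified]
  obtain x where x: "x \<in> Hom C (Cod C c1) (Cod C c)" "x \<bullet> c1 = c \<bullet> g"
    using cokernel_factor[OF c1(1), of "c \<bullet> g" "Cod C c"] cokernelD(4)[OF c] by (auto simp: in_Hom)
  obtain I m e where me: "mono_arr C m" "epi_arr C e" "e \<in> Hom C (Cod C c1) I" "m \<in> Hom C I (Cod C c)"
    "x = m \<bullet> e"
    using factorization[OF x(1)] by metis
  have [simp]: "m \<in> Arr C" "e \<in> Arr C" "Dom C m = I" "Cod C m = Cod C c" "Dom C e = Cod C c1" "Cod C e = I"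
    using me by (auto simp: in_Hom)
  have I: "I \<in> N" using serre_quot[OF me(2)] c1(2) by simp
  obtain y where y: "is_cokernel C y m" using cokernel_exists[of m] by auto
  note [simp] = cokernelD(1,3)[OF y, simplified]
  have "zero_arr C ((y \<bullet> m) \<bullet> (e \<bullet> c1))"
    by (rule zero_comp_right[OF cokernelD(4)[OF y]]) auto
  moreover have "(y \<bullet> m) \<bullet> (e \<bullet> c1) = y \<bullet> (x \<bullet> c1)" using me(5) by simp
  ultimately have "zero_arr C ((y \<bullet> c) \<bullet> g)" using x(2) by simp
  then obtain w where w: "w \<in> Hom C (Cod C c2) (Cod C y)" "w \<bullet> c2 = y \<bullet> c"
    using cokernel_factor[OF c2(1), of "y \<bullet> c"] by (auto simp: in_Hom)
  have "epi_arr C (y \<bullet> c)" using epi_comp[OF cokernel_epi[OF y] cokernel_epi[OF c]] by simp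
  then have "epi_arr C w" by (intro epi_cancel[of w c2]) (use w in \<open>auto simp: in_Hom\<close>)
  then have "Cod C y \<in> N" using serre_quot[of w] w c2 by (auto simp: in_Hom)
  moreover have "short_exact C m y"
    using mono_kernel_of_cokernel[OF me(1) y] y by (simp add: short_exact_def)
  ultimately have "Cod C c \<in> N" using serre_ext[of m y] I by simp
  then show ?thesis using c by (auto simp: Ncok_def)
qed

lemma Ncok_cancel:
  assumes "Ncok C N (g \<bullet> f)" "f \<in> Arr C" "g \<in> Arr C" "Cod C f = Dom C g"
  shows "Ncok C N g"
proof -
  note [simp] = assms(2-4)
  obtain c where c: "is_cokernel C c (g \<bullet> f)" "Cod C c \<in> N" using assms by (auto simp: Ncok_def)
  obtain c' where c': "is_cokernel C c' g" using cokernel_exists[of g] by auto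
  note [simp] = cokernelD(1,3)[OF c(1), simplified] cokernelD(1,3)[OF c', simplified]
  have "zero_arr C ((c' \<bullet> g) \<bullet> f)" by (rule zero_comp_right[OF cokernelD(4)[OF c']]) auto
  then obtain x where x: "x \<in> Hom C (Cod C c) (Cod C c')" "x \<bullet> c = c'"
    using cokernel_factor[OF c(1), of c' "Cod C c'"] by (auto simp: in_Hom)
  have "epi_arr C x" by (rule epi_cancel[of _ c]) (use x cokernel_epi[OF c'] in \<open>auto simp: in_Hom\<close>)
  then have "Cod C c' \<in> N" using serre_quot[of x] x c by (auto simp: in_Hom)
  then show ?thesis using c' by (auto simp: Ncok_def)
qed

lemmas epi_Ncok = serre_subcategory.mono_Nker[OF op_serre, simplified opN_simps]
lemmas Ncok_epi_comp = serre_subcategory.Nker_mono_comp[OF op_serre, simplified opN_simps]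
lemmas Nker_comp = serre_subcategory.Ncok_comp[OF op_serre, simplified opN_simps]
lemmas Nker_cancel = serre_subcategory.Ncok_cancel[OF op_serre, simplified opN_simps]
lemmas Ncok_cokernel = serre_subcategory.Nker_kernel[OF op_serre, simplified opN_simps]

lemma Niso_comp: "\<lbrakk>Niso C N f; Niso C N g; Cod C f = Dom C g\<rbrakk> \<Longrightarrow> Niso C N (g \<bullet> f)"
  unfolding Niso_def using Ncok_comp Nker_comp by metis

lemma iso_Niso: "is_iso C f \<Longrightarrow> Niso C N f"
  unfolding Niso_def using mono_Nker epi_Ncok iso_mono iso_epi by blast

lemma Niso_Idn [simp]: "X \<in> Obj C \<Longrightarrow> Niso C N (Idn C X)"
  by (rule iso_Niso[OF iso_Idn])

lemma Niso_factorization: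
  assumes "Niso C N (m \<bullet> e)" "mono_arr C m" "epi_arr C e" "Cod C e = Dom C m"
  shows "Niso C N m" "Niso C N e"
  using assms mono_Nker epi_Ncok Nker_mono_comp[of m e] Ncok_epi_comp[of e m] mono_Arr epi_Arr
  unfolding Niso_def by auto

lemma pullback_Nker:
  assumes pb: "is_pullback C f g p q" and g: "Nker C N g"
  shows "Nker C N p"
proof -
  note [simp] = pullbackD(1-8)[OF pb] and eq = pullbackD(9)[OF pb]
  obtain k where k: "is_kernel C k p" using kernel_exists[of p] by auto
  obtain l where l: "is_kernel C l g" "Dom C l \<in> N" using g by (auto simp: Nker_def)
  note [simp] = kernelD(1,3)[OF k, simplified] kernelD(1,3)[OF l(1), simplified]
  have z: "zero_arr C (f \<bullet> (p \<bullet> k))" by (rule zero_comp_left[OF kernelD(4)[OF k]]) auto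
  then have "zero_arr C (g \<bullet> (q \<bullet> k))" by (simp add: pre[OF eq])
  then obtain x where x: "x \<in> Hom C (Dom C k) (Dom C l)" "l \<bullet> x = q \<bullet> k"
    using kernel_factor[OF l(1), of "q \<bullet> k" "Dom C k"] by (auto simp: in_Hom)
  have "mono_arr C x"
  proof (rule monoI)
    show "x \<in> Arr C" using x by (simp add: in_Hom)
    fix W u v assume uv0: "u \<in> Hom C W (Dom C x)" "v \<in> Hom C W (Dom C x)" and e: "x \<bullet> u = x \<bullet> v"
    then have uv: "u \<in> Hom C W (Dom C k)" "v \<in> Hom C W (Dom C k)" using x by (auto simp: in_Hom)
    have "(l \<bullet> x) \<bullet> u = (l \<bullet> x) \<bullet> v" using x(1) uv e by (simp add: in_Hom)
    then have 1: "q \<bullet> (k \<bullet> u) = q \<bullet> (k \<bullet> v)" using x(2) uv by (simp add: in_Hom)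
    have "(p \<bullet> k) \<bullet> u = (p \<bullet> k) \<bullet> v"
      by (rule zero_unique; (rule zero_comp_right[OF kernelD(4)[OF k]])?)
        (use uv in \<open>auto simp: in_Hom\<close>)
    then have "p \<bullet> (k \<bullet> u) = p \<bullet> (k \<bullet> v)" using uv by (simp add: in_Hom)
    then have "k \<bullet> u = k \<bullet> v" using 1 uv pullback_eq[OF pb, of "k \<bullet> u" W "k \<bullet> v"]
      by (simp add: in_Hom)
    then show "u = v" by (rule monoD[OF kernel_mono[OF k] _ uv])
  qed
  then have "Dom C k \<in> N" using serre_sub[of x] x l by (auto simp: in_Hom)
  then show ?thesis using k by (auto simp: Nker_def)
qed

lemma pullback_Ncok:
  assumes pb: "is_pullback C f g p q" and g: "Ncok C N g"
  shows "Ncok C N p"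
proof -
  note [simp] = pullbackD(1-8)[OF pb] and eq = pullbackD(9)[OF pb]
  obtain c where c: "is_cokernel C c g" "Cod C c \<in> N" using g by (auto simp: Ncok_def)
  note [simp] = cokernelD(1,3)[OF c(1), simplified]
  obtain I m e where me: "mono_arr C m" "epi_arr C e" "e \<in> Hom C (Dom C f) I" "m \<in> Hom C I (Cod C c)"
    "c \<bullet> f = m \<bullet> e"
    using factorization[of "c \<bullet> f" "Dom C f" "Cod C c"] by (auto simp: in_Hom)
  have [simp]: "e \<in> Arr C" "m \<in> Arr C" "Dom C e = Dom C f" "Cod C e = I" "Dom C m = I" "Cod C m = Cod C c"
    using me by (auto simp: in_Hom)
  have I: "I \<in> N" using serre_sub[OF me(1)] c(2) by simp
  obtain k where k: "is_kernel C k e" using kernel_exists[of e] by auto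
  note [simp] = kernelD(1,3)[OF k, simplified]
  have kN: "Ncok C N k" using epi_cokernel_of_kernel[OF me(2) k] I by (auto simp: Ncok_def)
  have ze: "zero_arr C (e \<bullet> h)" if h: "h \<in> Arr C" "Cod C h = Dom C f" and z: "zero_arr C (c \<bullet> (f \<bullet> h))" for h
  proof -
    have "c \<bullet> (f \<bullet> h) = m \<bullet> (e \<bullet> h)" using h by (simp add: pre[OF me(5)])
    then show ?thesis using mono_zeroD[OF me(1), of "e \<bullet> h"] z h by simp
  qed
  have "zero_arr C ((c \<bullet> g) \<bullet> q)" by (rule zero_comp_right[OF cokernelD(4)[OF c(1)]]) auto
  then have "zero_arr C (e \<bullet> p)" using ze[of p] by (simp add: eq)
  then obtain p' where p': "p' \<in> Hom C (Dom C p) (Dom C k)" "k \<bullet> p' = p"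
    using kernel_factor[OF k, of p "Dom C p"] by (auto simp: in_Hom)
  obtain J m' e' where me': "mono_arr C m'" "epi_arr C e'" "e' \<in> Hom C (Dom C g) J"
    "m' \<in> Hom C J (Cod C g)" "g = m' \<bullet> e'"
    using factorization[of g "Dom C g" "Cod C g"] by (auto simp: in_Hom)
  have [simp]: "e' \<in> Arr C" "m' \<in> Arr C" "Dom C e' = Dom C g" "Cod C e' = J" "Dom C m' = J"
    "Cod C m' = Cod C g" using me'(3,4) by (auto simp: in_Hom)
  have "is_cokernel C c m'" using c(1) cokernel_epi_comp[OF me'(2), of m' c] me'(5) by simp
  then have ck: "is_kernel C m' c" by (rule mono_kernel_of_cokernel[OF me'(1)])
  have "zero_arr C ((m \<bullet> e) \<bullet> k)"
    using zero_comp_left[OF kernelD(4)[OF k], of m] by simp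
  then have "zero_arr C (c \<bullet> (f \<bullet> k))" using me(5)[symmetric] by simp
  then obtain l where l: "l \<in> Hom C (Dom C k) J" "m' \<bullet> l = f \<bullet> k"
    using kernel_factor[OF ck, of "f \<bullet> k" "Dom C k"] by (auto simp: in_Hom)
  have [simp]: "l \<in> Arr C" "Dom C l = Dom C k" "Cod C l = J" "p' \<in> Arr C" "Dom C p' = Dom C q" "Cod C p' = Dom C k"
    using l p' by (auto simp: in_Hom)
  have pb': "is_pullback C l e' p' q"
    unfolding is_pullback_def
  proof (intro conjI allI ballI impI)
    have "m' \<bullet> (l \<bullet> p') = f \<bullet> p" using p'(2) by (simp add: pre[OF l(2)])
    also have "\<dots> = m' \<bullet> (e' \<bullet> q)" by (simp add: eq pre[OF me'(5)[symmetric]])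
    finally show "l \<bullet> p' = e' \<bullet> q"
      by (rule monoD[OF me'(1), where W="Dom C q"]) (auto simp: in_Hom)
    fix W u v assume u: "u \<in> Hom C W (Dom C l)" and v: "v \<in> Hom C W (Dom C e')"
      and uv: "l \<bullet> u = e' \<bullet> v"
    have [simp]: "u \<in> Arr C" "Dom C u = W" "Cod C u = Dom C k" "v \<in> Arr C" "Dom C v = W" "Cod C v = Dom C g"
      using u v by (auto simp: in_Hom)
    have "f \<bullet> (k \<bullet> u) = m' \<bullet> (l \<bullet> u)" by (simp add: pre[OF l(2)])
    also have "\<dots> = g \<bullet> v" by (simp add: uv pre[OF me'(5)[symmetric]])
    finally obtain w where w: "w \<in> Hom C W (Dom C p)" "p \<bullet> w = k \<bullet> u" "q \<bullet> w = v"
      using pullback_factor[OF pb, of "k \<bullet> u" W v] by (auto simp: in_Hom)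
    show "\<exists>!w. w \<in> Hom C W (Dom C p') \<and> p' \<bullet> w = u \<and> q \<bullet> w = v"
    proof (rule ex1I[of _ w])
      have "k \<bullet> (p' \<bullet> w) = k \<bullet> u" using w p'(2) by (simp add: in_Hom pre[OF p'(2)])
      then have "p' \<bullet> w = u" by (rule monoD[OF kernel_mono[OF k], where W=W]) (use w in \<open>auto simp: in_Hom\<close>)
      then show "w \<in> Hom C W (Dom C p') \<and> p' \<bullet> w = u \<and> q \<bullet> w = v" using w by simp
      fix w' assume w': "w' \<in> Hom C W (Dom C p') \<and> p' \<bullet> w' = u \<and> q \<bullet> w' = v"
      then have "p \<bullet> w' = k \<bullet> u" using p'(2)[symmetric] by (auto simp: in_Hom)
      then show "w' = w" using pullback_eq[OF pb, of w' W w] w' w by auto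
    qed
  qed auto
  have "epi_arr C p'" by (rule pullback_epi[OF pb' me'(2)])
  then have "Ncok C N (k \<bullet> p')" using Ncok_comp[OF epi_Ncok kN] by simp
  then show ?thesis using p' by simp
qed

lemma pullback_Niso: "\<lbrakk>is_pullback C f g p q; Niso C N g\<rbrakk> \<Longrightarrow> Niso C N p"
  unfolding Niso_def using pullback_Nker pullback_Ncok by blast

lemma Niso_mono_cancel:
  assumes "mono_arr C i" "Niso C N (i \<bullet> a)" "a \<in> Arr C" "Cod C a = Dom C i"
  shows "Niso C N a"
proof -
  note [simp] = mono_Arr[OF assms(1)] assms(3,4)
  have "is_pullback C i (i \<bullet> a) a (Idn C (Dom C a))"
    unfolding is_pullback_def
  proof (intro conjI allI ballI impI)
    fix W u v assume u: "u \<in> Hom C W (Dom C i)" and v0: "v \<in> Hom C W (Dom C (i \<bullet> a))"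
      and "i \<bullet> u = (i \<bullet> a) \<bullet> v"
    then have "i \<bullet> u = i \<bullet> (a \<bullet> v)" by (auto simp: in_Hom)
    then have uv: "a \<bullet> v = u"
      by (intro monoD[OF assms(1) _ _ u]) (use u v0 in \<open>auto simp: in_Hom\<close>)
    have v: "v \<in> Hom C W (Dom C a)" using v0 by simp
    have idv: "Idn C (Dom C a) \<bullet> w = w" if "w \<in> Hom C W (Dom C a)" for w
      using that by (simp add: in_Hom)
    show "\<exists>!w. w \<in> Hom C W (Dom C a) \<and> a \<bullet> w = u \<and> Idn C (Dom C a) \<bullet> w = v"
    proof (rule ex1I[of _ v])
      show "v \<in> Hom C W (Dom C a) \<and> a \<bullet> v = u \<and> Idn C (Dom C a) \<bullet> v = v"
        using v uv idv by blast
    qed (use idv in metis)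
  qed auto
  then show ?thesis using pullback_Niso assms(2) by blast
qed

lemma Ore:
  assumes f: "f \<in> Hom C X Z" and s: "s \<in> Hom C Y Z" "Niso C N s"
  obtains W t w where "t \<in> Hom C W X" "Niso C N t" "w \<in> Hom C W Y" "s \<bullet> w = f \<bullet> t"
proof -
  obtain p q where pb: "is_pullback C f s p q" using pullback_exists[OF f s(1)] by metis
  have "p \<in> Hom C (Dom C p) X" "q \<in> Hom C (Dom C p) Y" "s \<bullet> q = f \<bullet> p"
    using pullbackD[OF pb] f s by (auto simp: in_Hom)
  with that pullback_Niso[OF pb s(2)] show ?thesis by blast
qed

lemma Nker_equalize:
  assumes f: "f \<in> Hom C X Y" and g: "g \<in> Hom C X Y" and s: "Nker C N s" "Dom C s = Y"
    and eq: "s \<bullet> f = s \<bullet> g"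
  obtains W t where "t \<in> Hom C W X" "mono_arr C t" "Niso C N t" "f \<bullet> t = g \<bullet> t"
proof -
  note [simp] = Nker_Arr[OF s(1)] s(2)
  obtain d where d: "d \<in> Hom C X Y"
    "\<forall>W. \<forall>u \<in> Hom C W X. zero_arr C (d \<bullet> u) \<longleftrightarrow> f \<bullet> u = g \<bullet> u"
    "\<forall>Z. \<forall>v \<in> Hom C Y Z. zero_arr C (v \<bullet> d) \<longleftrightarrow> v \<bullet> f = v \<bullet> g"
    using difference[OF f g] by blast
  have "zero_arr C (s \<bullet> d)" using d(3)[rule_format, of s "Cod C s"] eq by (simp add: in_Hom)
  obtain k where k: "is_kernel C k s" "Dom C k \<in> N" using s by (auto simp: Nker_def)
  note [simp] = kernelD(1,3)[OF k(1), simplified]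
  obtain x where x: "x \<in> Hom C X (Dom C k)" "k \<bullet> x = d"
    using kernel_factor[OF k(1) \<open>zero_arr C (s \<bullet> d)\<close>] d(1) by auto
  obtain I m e where me: "mono_arr C m" "epi_arr C e" "e \<in> Hom C X I" "m \<in> Hom C I (Dom C k)" "x = m \<bullet> e"
    using factorization[OF x(1)] by metis
  have I: "I \<in> N" using serre_sub[OF me(1)] me(4) k(2) by (auto simp: in_Hom)
  obtain t where t: "is_kernel C t e" using kernel_exists[of e] me(3) by (auto simp: in_Hom)
  note tD = kernelD[OF t]
  have tH: "t \<in> Hom C (Dom C t) X" using tD me(3) by (auto simp: in_Hom)
  have "Ncok C N t" using epi_cokernel_of_kernel[OF me(2) t] I me(3) by (auto simp: Ncok_def in_Hom)
  then have "Niso C N t" using mono_Nker[OF kernel_mono[OF t]] by (simp add: Niso_def)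
  have km: "k \<bullet> m \<in> Arr C" "Dom C (k \<bullet> m) = I" using me(4) by (auto simp: in_Hom)
  then have "zero_arr C ((k \<bullet> m) \<bullet> (e \<bullet> t))"
    using zero_comp_left[OF tD(4), of "k \<bullet> m"] me(3) tD by (auto simp: in_Hom)
  moreover have "d \<bullet> t = (k \<bullet> m) \<bullet> (e \<bullet> t)" using x(2) me(3-5) tH by (auto simp: in_Hom)
  ultimately have "f \<bullet> t = g \<bullet> t" using d(2)[rule_format, OF tH] by simp
  then show ?thesis using that tH kernel_mono[OF t] \<open>Niso C N t\<close> by blast
qed

lemma Niso_equalize:
  assumes "f \<in> Hom C X Y" "g \<in> Hom C X Y" "Niso C N s" "Dom C s = Y" "s \<bullet> f = s \<bullet> g"
  obtains W t where "t \<in> Hom C W X" "Niso C N t" "f \<bullet> t = g \<bullet> t"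
  using Nker_equalize[of f X Y g s] assms by (metis Niso_def)

end

section \<open>The quotient category\<close>

text \<open>The graph of the arrow \<open>\<phi>\<close> of the quotient represented by \<open>(i, f, p)\<close> consists of the pairs
  \<open>(u, v)\<close> of arrows with common domain such that \<open>\<phi> \<circ> q(u) = q(v)\<close>. Since graphs compose like relations, up to
  restriction along isomorphisms modulo \<open>N\<close>, associativity comes for free.\<close>

fun rep_graph :: "('o, 'm) cat \<Rightarrow> 'o set \<Rightarrow> 'm rep \<Rightarrow> ('m \<times> 'm) set" where
  "rep_graph C N (i, f, p) = {(u, v). u \<in> Arr C \<and> v \<in> Arr C \<and> Dom C u = Dom C v \<and>
     Cod C u = Cod C i \<and> Cod C v = Dom C p \<and>
     (\<exists>t w. Niso C N t \<and> Cod C t = Dom C u \<and> w \<in> Hom C (Dom C t) (Dom C i) \<and>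
       i \<bullet>\<^bsub>C\<^esub> w = u \<bullet>\<^bsub>C\<^esub> t \<and> f \<bullet>\<^bsub>C\<^esub> w = p \<bullet>\<^bsub>C\<^esub> (v \<bullet>\<^bsub>C\<^esub> t))}"

definition is_graph :: "('o, 'm) cat \<Rightarrow> 'o set \<Rightarrow> 'o \<Rightarrow> 'o \<Rightarrow> ('m \<times> 'm) set \<Rightarrow> bool" where
  "is_graph C N X Y T \<longleftrightarrow>
     (\<forall>u v. (u, v) \<in> T \<longrightarrow> u \<in> Arr C \<and> v \<in> Arr C \<and> Dom C u = Dom C v \<and> Cod C u = X \<and> Cod C v = Y) \<and>
     (\<forall>u v a. (u, v) \<in> T \<longrightarrow> a \<in> Arr C \<longrightarrow> Cod C a = Dom C u \<longrightarrow> (u \<bullet>\<^bsub>C\<^esub> a, v \<bullet>\<^bsub>C\<^esub> a) \<in> T) \<and>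
     (\<forall>W u v t. u \<in> Hom C W X \<longrightarrow> v \<in> Hom C W Y \<longrightarrow> Niso C N t \<longrightarrow> Cod C t = W \<longrightarrow>
       (u \<bullet>\<^bsub>C\<^esub> t, v \<bullet>\<^bsub>C\<^esub> t) \<in> T \<longrightarrow> (u, v) \<in> T) \<and>
     (\<forall>u. u \<in> Arr C \<longrightarrow> Cod C u = X \<longrightarrow> (\<exists>t v. Niso C N t \<and> Cod C t = Dom C u \<and> (u \<bullet>\<^bsub>C\<^esub> t, v) \<in> T)) \<and>
     (\<forall>u v v'. (u, v) \<in> T \<longrightarrow> (u, v') \<in> T \<longrightarrow>
       (\<exists>t. Niso C N t \<and> Cod C t = Dom C u \<and> v \<bullet>\<^bsub>C\<^esub> t = v' \<bullet>\<^bsub>C\<^esub> t))"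

lemma graph_typing:
  assumes "is_graph C N X Y T" "(u, v) \<in> T"
  shows "u \<in> Arr C" "v \<in> Arr C" "Dom C u = Dom C v" "Cod C u = X" "Cod C v = Y"
  using assms unfolding is_graph_def by metis+

lemma graph_restrict:
  "\<lbrakk>is_graph C N X Y T; (u, v) \<in> T; a \<in> Arr C; Cod C a = Dom C u\<rbrakk>
    \<Longrightarrow> (u \<bullet>\<^bsub>C\<^esub> a, v \<bullet>\<^bsub>C\<^esub> a) \<in> T"
  unfolding is_graph_def by metis

lemma graph_local:
  "\<lbrakk>is_graph C N X Y T; (u \<bullet>\<^bsub>C\<^esub> t, v \<bullet>\<^bsub>C\<^esub> t) \<in> T; u \<in> Hom C W X; v \<in> Hom C W Y;
    Niso C N t; Cod C t = W\<rbrakk> \<Longrightarrow> (u, v) \<in> T"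
  unfolding is_graph_def by metis

lemma graph_total:
  assumes "is_graph C N X Y T" "u \<in> Arr C" "Cod C u = X"
  obtains t v where "Niso C N t" "Cod C t = Dom C u" "(u \<bullet>\<^bsub>C\<^esub> t, v) \<in> T"
  using assms unfolding is_graph_def by metis

lemma graph_functional:
  assumes "is_graph C N X Y T" "(u, v) \<in> T" "(u, v') \<in> T"
  obtains t where "Niso C N t" "Cod C t = Dom C u" "v \<bullet>\<^bsub>C\<^esub> t = v' \<bullet>\<^bsub>C\<^esub> t"
  using assms unfolding is_graph_def by metis

context serre_subcategory
begin

lemma mem_reps:
  "(i, f, p) \<in> reps C N X Y \<longleftrightarrow> mono_arr C i \<and> Cod C i = X \<and> Ncok C N i \<and>
     epi_arr C p \<and> Dom C p = Y \<and> Nker C N p \<and> f \<in> Hom C (Dom C i) (Cod C p)"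
  by (simp add: reps_def Ncok_def Nker_def)

lemma repsD:
  assumes "(i, f, p) \<in> reps C N X Y"
  shows "mono_arr C i" "Niso C N i" "epi_arr C p" "Niso C N p" "i \<in> Hom C (Dom C i) X"
    "p \<in> Hom C Y (Cod C p)" "f \<in> Hom C (Dom C i) (Cod C p)"
  using assms mono_Arr epi_Arr mono_Nker epi_Ncok by (auto simp: mem_reps Niso_def in_Hom)

lemma rep_graphI:
  assumes "Niso C N t" "t \<in> Hom C V W" "w \<in> Hom C V (Dom C i)"
    "u \<in> Hom C W (Cod C i)" "v \<in> Hom C W (Dom C p)" "i \<bullet> w = u \<bullet> t" "f \<bullet> w = p \<bullet> (v \<bullet> t)"
  shows "(u, v) \<in> rep_graph C N (i, f, p)"
  using assms by (auto simp: in_Hom)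

lemma refinesI:
  assumes "a \<in> Hom C (Dom C i') (Dom C i)" "b \<in> Hom C (Cod C p) (Cod C p')"
    "i' = i \<bullet> a" "p' = b \<bullet> p" "f' = (b \<bullet> f) \<bullet> a"
  shows "refines C (i', f', p') (i, f, p)"
  using assms by auto

lemma comp_repsI:
  assumes "mono_arr C n" "epi_arr C e" "Cod C e = Dom C n" "p \<bullet> j = n \<bullet> e"
    "f' \<in> Hom C (Dom C i) (Dom C n)" "(i, n \<bullet> f', p) \<in> c"
    "g' \<in> Hom C (Cod C e) (Cod C r)" "(j, g' \<bullet> e, r) \<in> d"
  shows "(i, g' \<bullet> f', r) \<in> comp_reps C d c"
  unfolding comp_reps_def mem_Collect_eq using assms by (intro exI conjI) (rule refl)

lemma comp_repsE:
  assumes "x \<in> comp_reps C d c"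
  obtains i f' p n j g' r e where "x = (i, g' \<bullet> f', r)" "mono_arr C n" "epi_arr C e"
    "Cod C e = Dom C n" "p \<bullet> j = n \<bullet> e" "f' \<in> Hom C (Dom C i) (Dom C n)" "(i, n \<bullet> f', p) \<in> c"
    "g' \<in> Hom C (Cod C e) (Cod C r)" "(j, g' \<bullet> e, r) \<in> d"
  using assms unfolding comp_reps_def mem_Collect_eq by (elim exE conjE) (rule that)

lemma Ore_common:
  assumes "s \<in> Hom C X Z" "Niso C N s" "t \<in> Hom C Y Z" "Niso C N t"
  obtains W a b where "a \<in> Hom C W X" "b \<in> Hom C W Y" "s \<bullet> a = t \<bullet> b" "Niso C N (s \<bullet> a)"
    "Niso C N a"
proof -
  obtain W a b where *: "a \<in> Hom C W X" "Niso C N a" "b \<in> Hom C W Y" "t \<bullet> b = s \<bullet> a"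
    using Ore[OF assms(1,3,4)] by metis
  moreover have "Niso C N (s \<bullet> a)" using Niso_comp[OF *(2) assms(2)] *(1) assms(1) by (auto simp: in_Hom)
  ultimately show ?thesis using that[of a W b] by simp
qed

lemma rep_graph_is_graph:
  assumes r: "(i, f, p) \<in> reps C N X Y"
  shows "is_graph C N X Y (rep_graph C N (i, f, p))"
  unfolding is_graph_def
proof (intro conjI allI impI)
  note D = repsD[OF r]
  have [simp]: "i \<in> Arr C" "Cod C i = X" "p \<in> Arr C" "Dom C p = Y" "f \<in> Arr C" "Dom C f = Dom C i"
    "Cod C f = Cod C p" "X \<in> Obj C" "Y \<in> Obj C"
    using D(5-7) by (auto simp: in_Hom)
  fix u v assume uv: "(u, v) \<in> rep_graph C N (i, f, p)"
  then show "u \<in> Arr C" "v \<in> Arr C" "Dom C u = Dom C v" "Cod C u = X" "Cod C v = Y" by auto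
  note [simp] = this
  obtain t w where tw: "Niso C N t" "Cod C t = Dom C v" "w \<in> Hom C (Dom C t) (Dom C i)"
    "i \<bullet> w = u \<bullet> t" "f \<bullet> w = p \<bullet> (v \<bullet> t)"
    using uv by auto
  have [simp]: "t \<in> Arr C" "Cod C t = Dom C v" "w \<in> Arr C" "Dom C w = Dom C t" "Cod C w = Dom C i"
    using tw(1,2,3) Niso_Arr by (auto simp: in_Hom)
  { fix a assume a: "a \<in> Arr C" "Cod C a = Dom C u"
    have [simp]: "a \<in> Arr C" "Cod C a = Dom C v" using a by auto
    obtain W t' w' where t': "t' \<in> Hom C W (Dom C a)" "Niso C N t'" "w' \<in> Hom C W (Dom C t)"
      "t \<bullet> w' = a \<bullet> t'"
      using Ore[of a "Dom C a" "Dom C v" t "Dom C t"] tw(1) by (auto simp: in_Hom)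
    have [simp]: "t' \<in> Arr C" "Cod C t' = Dom C a" "Dom C t' = W" "w' \<in> Arr C" "Dom C w' = W"
      "Cod C w' = Dom C t" using t'(1,3) by (auto simp: in_Hom)
    have "i \<bullet> (w \<bullet> w') = (u \<bullet> a) \<bullet> t'" by (simp add: pre[OF tw(4)] t'(4))
    moreover have "f \<bullet> (w \<bullet> w') = p \<bullet> ((v \<bullet> a) \<bullet> t')" by (simp add: pre[OF tw(5)] t'(4))
    moreover have "w \<bullet> w' \<in> Hom C (Dom C t') (Dom C i)" by (simp add: in_Hom)
    ultimately show "(u \<bullet> a, v \<bullet> a) \<in> rep_graph C N (i, f, p)"
      by (intro rep_graphI[OF t'(2,1)]) (auto simp: in_Hom) }
  fix v' assume uv': "(u, v') \<in> rep_graph C N (i, f, p)"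
  then have [simp]: "v' \<in> Arr C" "Dom C v' = Dom C v" "Cod C v' = Y" by auto
  obtain t' w' where tw': "Niso C N t'" "Cod C t' = Dom C v" "w' \<in> Hom C (Dom C t') (Dom C i)"
    "i \<bullet> w' = u \<bullet> t'" "f \<bullet> w' = p \<bullet> (v' \<bullet> t')"
    using uv' by auto
  have [simp]: "t' \<in> Arr C" "Cod C t' = Dom C v" "w' \<in> Arr C" "Dom C w' = Dom C t'" "Cod C w' = Dom C i"
    using tw'(1,2,3) Niso_Arr by (auto simp: in_Hom)
  have tH: "t \<in> Hom C (Dom C t) (Dom C v)" "t' \<in> Hom C (Dom C t') (Dom C v)" by (auto simp: in_Hom)
  obtain W a b where ab: "a \<in> Hom C W (Dom C t)" "b \<in> Hom C W (Dom C t')" "t \<bullet> a = t' \<bullet> b"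
    "Niso C N (t \<bullet> a)"
    using Ore_common[OF tH(1) tw(1) tH(2) tw'(1)] by metis
  have [simp]: "a \<in> Arr C" "Dom C a = W" "Cod C a = Dom C t" "b \<in> Arr C" "Dom C b = W" "Cod C b = Dom C t'"
    using ab(1,2) by (auto simp: in_Hom)
  have "i \<bullet> (w \<bullet> a) = i \<bullet> (w' \<bullet> b)" by (simp add: pre[OF tw(4)] pre[OF tw'(4)] ab(3))
  then have wa: "w \<bullet> a = w' \<bullet> b" by (rule monoD[OF D(1), where W=W]) (auto simp: in_Hom)
  have "p \<bullet> (v \<bullet> (t \<bullet> a)) = f \<bullet> (w \<bullet> a)" by (simp add: pre[OF tw(5)])
  also have "\<dots> = p \<bullet> (v' \<bullet> (t \<bullet> a))" unfolding wa by (simp add: pre[OF tw'(5)] ab(3))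
  finally obtain V x where x: "x \<in> Hom C V W" "Niso C N x" "(v \<bullet> (t \<bullet> a)) \<bullet> x = (v' \<bullet> (t \<bullet> a)) \<bullet> x"
    using Niso_equalize[of "v \<bullet> (t \<bullet> a)" W Y "v' \<bullet> (t \<bullet> a)" p] D(4) by (auto simp: in_Hom)
  have "Niso C N ((t \<bullet> a) \<bullet> x)" using Niso_comp[OF x(2) ab(4)] x(1) by (simp add: in_Hom)
  moreover have "v \<bullet> ((t \<bullet> a) \<bullet> x) = v' \<bullet> ((t \<bullet> a) \<bullet> x)" using x by (simp add: in_Hom)
  moreover have "Cod C ((t \<bullet> a) \<bullet> x) = Dom C u" using x by (simp add: in_Hom)
  ultimately show "\<exists>t. Niso C N t \<and> Cod C t = Dom C u \<and> v \<bullet> t = v' \<bullet> t" by blast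
next
  note D = repsD[OF r]
  have [simp]: "i \<in> Arr C" "Cod C i = X" "p \<in> Arr C" "Dom C p = Y" "f \<in> Arr C" "Dom C f = Dom C i"
    "Cod C f = Cod C p" "X \<in> Obj C" "Y \<in> Obj C"
    using D(5-7) by (auto simp: in_Hom)
  fix W u v t assume uv: "u \<in> Hom C W X" "v \<in> Hom C W Y" and t: "Niso C N t" "Cod C t = W"
    and g: "(u \<bullet> t, v \<bullet> t) \<in> rep_graph C N (i, f, p)"
  have [simp]: "u \<in> Arr C" "Dom C u = W" "Cod C u = X" "v \<in> Arr C" "Dom C v = W" "Cod C v = Y"
    "t \<in> Arr C" "Cod C t = W" using uv t Niso_Arr by (auto simp: in_Hom)
  obtain t' w where tw: "Niso C N t'" "Cod C t' = Dom C t" "w \<in> Hom C (Dom C t') (Dom C i)"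
    "i \<bullet> w = (u \<bullet> t) \<bullet> t'" "f \<bullet> w = p \<bullet> ((v \<bullet> t) \<bullet> t')"
    using g by (auto simp del: assoc)
  have [simp]: "t' \<in> Arr C" using tw Niso_Arr by auto
  have "Niso C N (t \<bullet> t')" using Niso_comp[OF tw(1) t(1)] tw(2) by simp
  moreover have "i \<bullet> w = u \<bullet> (t \<bullet> t')" "f \<bullet> w = p \<bullet> (v \<bullet> (t \<bullet> t'))" using tw by auto
  moreover have "Cod C (t \<bullet> t') = Dom C u" "w \<in> Hom C (Dom C (t \<bullet> t')) (Dom C i)" using tw by auto
  ultimately show "(u, v) \<in> rep_graph C N (i, f, p)" by auto
next
  note D = repsD[OF r]
  have [simp]: "i \<in> Arr C" "Cod C i = X" "p \<in> Arr C" "Dom C p = Y" "f \<in> Arr C" "Dom C f = Dom C i"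
    "Cod C f = Cod C p" "X \<in> Obj C" "Y \<in> Obj C"
    using D(5-7) by (auto simp: in_Hom)
  fix u assume [simp]: "u \<in> Arr C" "Cod C u = X"
  obtain W t w where tw: "t \<in> Hom C W (Dom C u)" "Niso C N t" "w \<in> Hom C W (Dom C i)"
    "i \<bullet> w = u \<bullet> t"
    using Ore[of u "Dom C u" X i "Dom C i"] D(2) by (auto simp: in_Hom)
  have [simp]: "t \<in> Arr C" "Dom C t = W" "Cod C t = Dom C u" "w \<in> Arr C" "Dom C w = W" "Cod C w = Dom C i"
    using tw(1,3) by (auto simp: in_Hom)
  obtain V t' v where tv: "t' \<in> Hom C V W" "Niso C N t'" "v \<in> Hom C V Y" "p \<bullet> v = (f \<bullet> w) \<bullet> t'"
    using Ore[of "f \<bullet> w" W "Cod C p" p Y] D(4) by (auto simp: in_Hom)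
  have [simp]: "t' \<in> Arr C" "Dom C t' = V" "Cod C t' = W" "v \<in> Arr C" "Dom C v = V" "Cod C v = Y"
    using tv(1,3) by (auto simp: in_Hom)
  have V: "V \<in> Obj C" using Obj_Dom[of v] by simp
  have "Niso C N (t \<bullet> t')" using Niso_comp[OF tv(2) tw(2)] by simp
  moreover have "(u \<bullet> (t \<bullet> t'), v) \<in> rep_graph C N (i, f, p)"
  proof -
    have "i \<bullet> (w \<bullet> t') = (u \<bullet> (t \<bullet> t')) \<bullet> Idn C V" "f \<bullet> (w \<bullet> t') = p \<bullet> (v \<bullet> Idn C V)"
      using V by (auto simp: pre[OF tw(4)] tv(4))
    moreover have "w \<bullet> t' \<in> Hom C (Dom C (Idn C V)) (Dom C i)" "Cod C (Idn C V) = V" using V by (auto simp: in_Hom)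
    ultimately show ?thesis using Niso_Idn[OF V] by (auto simp del: Cmp_Idn_r Dom_Idn Cod_Idn assoc)
  qed
  ultimately show "\<exists>t v. Niso C N t \<and> Cod C t = Dom C u \<and> (u \<bullet> t, v) \<in> rep_graph C N (i, f, p)"
    by (intro exI[of _ "t \<bullet> t'"] exI[of _ v]) simp
qed

lemma graph_roof:
  assumes "is_graph C N X Y T" "X \<in> Obj C"
  obtains V s f where "s \<in> Hom C V X" "f \<in> Hom C V Y" "Niso C N s" "(s, f) \<in> T"
proof -
  obtain t v where tv: "Niso C N t" "Cod C t = X" "(Idn C X \<bullet> t, v) \<in> T"
    using graph_total[OF assms(1), of "Idn C X"] assms(2) by auto
  have "(t, v) \<in> T" using tv Niso_Arr by simp
  then show ?thesis using that[of t "Dom C t" v] tv(1,2) graph_typing[OF assms(1)]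
    by (auto simp: in_Hom)
qed

lemma graph_subset_by_roof:
  assumes T: "is_graph C N X Y T" and T': "is_graph C N X Y T'"
    and sf: "(s, f) \<in> T" "(s, f) \<in> T'" and s: "Niso C N s"
  shows "T \<subseteq> T'"
proof (rule subrelI)
  fix u v assume uv: "(u, v) \<in> T"
  note [simp] = graph_typing[OF T uv] and [simp] = graph_typing[OF T sf(1)]
  obtain W t w where tw: "t \<in> Hom C W (Dom C v)" "Niso C N t" "w \<in> Hom C W (Dom C f)" "s \<bullet> w = u \<bullet> t"
    using Ore[of u "Dom C v" X s "Dom C f"] s by (auto simp: in_Hom)
  have [simp]: "t \<in> Arr C" "Dom C t = W" "Cod C t = Dom C v" "w \<in> Arr C" "Dom C w = W" "Cod C w = Dom C f"
    using tw(1,3) by (auto simp: in_Hom)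
  have "(u \<bullet> t, f \<bullet> w) \<in> T" "(u \<bullet> t, v \<bullet> t) \<in> T"
    using graph_restrict[OF T sf(1), of w] graph_restrict[OF T uv, of t] tw(4) by auto
  from graph_functional[OF T this]
  obtain x where x: "Niso C N x" "Cod C x = W" "(f \<bullet> w) \<bullet> x = (v \<bullet> t) \<bullet> x" by auto
  have [simp]: "x \<in> Arr C" "Cod C x = W" using x Niso_Arr by auto
  have eq: "s \<bullet> (w \<bullet> x) = u \<bullet> (t \<bullet> x)" "f \<bullet> (w \<bullet> x) = v \<bullet> (t \<bullet> x)"
    using x(3) by (simp_all add: pre[OF tw(4)])
  have "(s \<bullet> (w \<bullet> x), f \<bullet> (w \<bullet> x)) \<in> T'" by (rule graph_restrict[OF T' sf(2)]) auto
  then have "(u \<bullet> (t \<bullet> x), v \<bullet> (t \<bullet> x)) \<in> T'" unfolding eq .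
  then show "(u, v) \<in> T'"
    by (rule graph_local[OF T', where W="Dom C v"])
      (use Niso_comp[OF x(1) tw(2)] in \<open>auto simp: in_Hom\<close>)
qed

lemma graph_eq_by_roof:
  assumes "is_graph C N X Y T" "is_graph C N X Y T'" "(s, f) \<in> T" "(s, f) \<in> T'" "Niso C N s"
  shows "T = T'"
  using graph_subset_by_roof[OF assms] graph_subset_by_roof[OF assms(2,1,4,3,5)] by blast

lemmas Niso_epi_cancel = serre_subcategory.Niso_mono_cancel[OF op_serre, simplified opN_simps]

lemma refines_graph:
  assumes r: "(i, f, p) \<in> reps C N X Y" and r': "(i', f', p') \<in> reps C N X Y"
    and ref: "refines C (i', f', p') (i, f, p)"
  shows "rep_graph C N (i', f', p') = rep_graph C N (i, f, p)"
proof -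
  note D = repsD[OF r] and D' = repsD[OF r']
  note T = rep_graph_is_graph[OF r] and T' = rep_graph_is_graph[OF r']
  obtain a b where a: "a \<in> Hom C (Dom C i') (Dom C i)" and b: "b \<in> Hom C (Cod C p) (Cod C p')"
    and eqs: "i' = i \<bullet> a" "p' = b \<bullet> p" "f' = (b \<bullet> f) \<bullet> a"
    using ref by auto
  have [simp]: "i \<in> Arr C" "p \<in> Arr C" "f \<in> Arr C" "Cod C i = X" "Dom C p = Y" "Dom C f = Dom C i"
    "Cod C f = Cod C p" "a \<in> Arr C" "Cod C a = Dom C i" "b \<in> Arr C" "Dom C b = Cod C p"
    using D a b by (auto simp: in_Hom)
  obtain V s g where sg: "s \<in> Hom C V X" "g \<in> Hom C V Y" "Niso C N s" "(s, g) \<in> rep_graph C N (i', f', p')"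
    using graph_roof[OF T'] Hom_Obj[OF D(5)] by metis
  have [simp]: "s \<in> Arr C" "Cod C s = X" "Dom C s = V" "g \<in> Arr C" "Cod C g = Y" "Dom C g = V"
    using sg(1,2) by (auto simp: in_Hom)
  obtain t w where tw: "Niso C N t" "Cod C t = V" "w \<in> Hom C (Dom C t) (Dom C i')" "i' \<bullet> w = s \<bullet> t"
    "f' \<bullet> w = p' \<bullet> (g \<bullet> t)"
    using sg(4) by auto
  have [simp]: "t \<in> Arr C" "Cod C t = V" "w \<in> Arr C" "Dom C w = Dom C t" "Cod C w = Dom C a"
    using tw(1-3) Niso_Arr a by (auto simp: in_Hom)
  have "Niso C N b" using Niso_epi_cancel[of p b] D(3) D'(4) eqs(2) by simp
  moreover have "b \<bullet> (f \<bullet> (a \<bullet> w)) = b \<bullet> (p \<bullet> (g \<bullet> t))" using tw(5) eqs(2,3) by simp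
  ultimately obtain U x where x: "x \<in> Hom C U (Dom C t)" "Niso C N x"
    "(f \<bullet> (a \<bullet> w)) \<bullet> x = (p \<bullet> (g \<bullet> t)) \<bullet> x"
    using Niso_equalize[of "f \<bullet> (a \<bullet> w)" "Dom C t" "Cod C p" "p \<bullet> (g \<bullet> t)" b] by (auto simp: in_Hom)
  have [simp]: "x \<in> Arr C" "Cod C x = Dom C t" "Dom C x = U" using x(1) by (auto simp: in_Hom)
  have "i \<bullet> (a \<bullet> w) = s \<bullet> t" using tw(4) eqs(1) by simp
  then have "i \<bullet> ((a \<bullet> w) \<bullet> x) = s \<bullet> (t \<bullet> x)" by (simp flip: assoc)
  moreover have "f \<bullet> ((a \<bullet> w) \<bullet> x) = p \<bullet> (g \<bullet> (t \<bullet> x))" using x(3) by simp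
  moreover have "Niso C N (t \<bullet> x)" using Niso_comp[OF x(2) tw(1)] by simp
  moreover have "(a \<bullet> w) \<bullet> x \<in> Hom C (Dom C (t \<bullet> x)) (Dom C i)" "Cod C (t \<bullet> x) = Dom C s"
    by (auto simp: in_Hom)
  ultimately have "(s, g) \<in> rep_graph C N (i, f, p)" by (auto simp del: assoc Dom_Cmp Cod_Cmp)
  with graph_eq_by_roof[OF T' T sg(4)] sg(3) show ?thesis by blast
qed

lemma mono_Ncok_pullback:
  assumes "f \<in> Hom C Y V" "e \<in> Hom C I V" "mono_arr C e" "Ncok C N e"
  shows "\<exists>P. \<exists>p \<in> Hom C P Y. \<exists>g \<in> Hom C P I. mono_arr C p \<and> Ncok C N p \<and> e \<bullet> g = f \<bullet> p \<and>
    is_pullback C f e p g"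
proof -
  obtain p q where pb: "is_pullback C f e p q" using pullback_exists[OF assms(1,2)] by metis
  have "p \<in> Hom C (Dom C p) Y" "q \<in> Hom C (Dom C p) I" "e \<bullet> q = f \<bullet> p"
    using pullbackD[OF pb] assms by (auto simp: in_Hom)
  with pullback_mono[OF pb] pullback_Ncok[OF pb] assms pb show ?thesis by blast
qed

lemma epi_Nker_pushout:
  assumes "f \<in> Hom C V Y" "e \<in> Hom C V I" "epi_arr C e" "Nker C N e"
  shows "\<exists>P. \<exists>p \<in> Hom C Y P. \<exists>g \<in> Hom C I P. epi_arr C p \<and> Nker C N p \<and> g \<bullet> e = p \<bullet> f"
  using serre_subcategory.mono_Ncok_pullback[OF op_serre, of f Y V e I] assms
  unfolding opN_simps by blast

lemma rep_rel_iff: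
  "(r, r') \<in> rep_rel C N X Y \<longleftrightarrow> r \<in> reps C N X Y \<and> r' \<in> reps C N X Y \<and>
    rep_graph C N r = rep_graph C N r'"
proof (intro iffI conjI)
  assume rr: "(r, r') \<in> rep_rel C N X Y"
  then show "r \<in> reps C N X Y" "r' \<in> reps C N X Y" by (auto simp: rep_rel_def)
  from rr obtain t where t: "t \<in> reps C N X Y" "refines C t r" "refines C t r'"
    and rr: "r \<in> reps C N X Y" "r' \<in> reps C N X Y"
    by (auto simp: rep_rel_def)
  show "rep_graph C N r = rep_graph C N r'"
    using refines_graph t rr by (metis prod_cases3)
next
  assume a: "r \<in> reps C N X Y \<and> r' \<in> reps C N X Y \<and> rep_graph C N r = rep_graph C N r'"
  obtain i f p i' f' p' where [simp]: "r = (i, f, p)" "r' = (i', f', p')" by (metis prod_cases3)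
  have r: "(i, f, p) \<in> reps C N X Y" and r': "(i', f', p') \<in> reps C N X Y"
    and geq: "rep_graph C N (i, f, p) = rep_graph C N (i', f', p')" using a by auto
  note D = repsD[OF r] and D' = repsD[OF r'] and T = rep_graph_is_graph[OF r]
  have [simp]: "i \<in> Arr C" "p \<in> Arr C" "f \<in> Arr C" "Cod C i = X" "Dom C p = Y" "Dom C f = Dom C i"
    "Cod C f = Cod C p" "i' \<in> Arr C" "p' \<in> Arr C" "f' \<in> Arr C" "Cod C i' = X" "Dom C p' = Y"
    "Dom C f' = Dom C i'" "Cod C f' = Cod C p'"
    using D D' by (auto simp: in_Hom)
  have N: "Ncok C N i" "Ncok C N i'" "Nker C N p" "Nker C N p'" using r r' by (auto simp: mem_reps)
  obtain I a a' where aH: "a \<in> Hom C I (Dom C i)" "a' \<in> Hom C I (Dom C i')" "mono_arr C a" "Ncok C N a"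
    "i' \<bullet> a' = i \<bullet> a" "is_pullback C i i' a a'"
    using mono_Ncok_pullback[OF D(5) D'(5,1) N(2)] by blast
  have [simp]: "a \<in> Arr C" "Dom C a = I" "Cod C a = Dom C i" "a' \<in> Arr C" "Dom C a' = I" "Cod C a' = Dom C i'"
    using aH(1,2) by (auto simp: in_Hom)
  obtain P b b' where bH: "b \<in> Hom C (Cod C p) P" "b' \<in> Hom C (Cod C p') P" "epi_arr C b" "Nker C N b"
    "b' \<bullet> p' = b \<bullet> p"
    using epi_Nker_pushout[of p Y "Cod C p" p' "Cod C p'"] D'(3) N by (auto simp: in_Hom)
  have [simp]: "b \<in> Arr C" "Dom C b = Cod C p" "Cod C b = P" "b' \<in> Arr C" "Dom C b' = Cod C p'" "Cod C b' = P"
    using bH(1,2) by (auto simp: in_Hom)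
  obtain V s g where sg: "s \<in> Hom C V X" "g \<in> Hom C V Y" "Niso C N s" "(s, g) \<in> rep_graph C N (i, f, p)"
    using graph_roof[OF T] Hom_Obj[OF D(5)] by metis
  have [simp]: "s \<in> Arr C" "Cod C s = X" "Dom C s = V" "g \<in> Arr C" "Cod C g = Y" "Dom C g = V"
    using sg(1,2) by (auto simp: in_Hom)
  obtain t w where tw: "Niso C N t" "Cod C t = V" "w \<in> Hom C (Dom C t) (Dom C i)" "i \<bullet> w = s \<bullet> t"
    "f \<bullet> w = p \<bullet> (g \<bullet> t)"
    using sg(4) by auto
  have "(s, g) \<in> rep_graph C N (i', f', p')" using sg(4) geq by blast
  then obtain t' w' where tw': "Niso C N t'" "Cod C t' = V" "w' \<in> Hom C (Dom C t') (Dom C i')" "i' \<bullet> w' = s \<bullet> t'"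
    "f' \<bullet> w' = p' \<bullet> (g \<bullet> t')"
    by auto
  have [simp]: "t \<in> Arr C" "Cod C t = V" "w \<in> Arr C" "Dom C w = Dom C t" "Cod C w = Dom C i"
    "t' \<in> Arr C" "Cod C t' = V" "w' \<in> Arr C" "Dom C w' = Dom C t'" "Cod C w' = Dom C i'"
    using tw(1-3) tw'(1-3) Niso_Arr by (auto simp: in_Hom)
  have tH: "t \<in> Hom C (Dom C t) V" "t' \<in> Hom C (Dom C t') V" by (auto simp: in_Hom)
  obtain U c d where cd: "c \<in> Hom C U (Dom C t)" "d \<in> Hom C U (Dom C t')" "t \<bullet> c = t' \<bullet> d"
    "Niso C N (t \<bullet> c)"
    using Ore_common[OF tH(1) tw(1) tH(2) tw'(1)] by metis
  have [simp]: "c \<in> Arr C" "Dom C c = U" "Cod C c = Dom C t" "d \<in> Arr C" "Dom C d = U" "Cod C d = Dom C t'"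
    using cd(1,2) by (auto simp: in_Hom)
  have "i \<bullet> (w \<bullet> c) = i' \<bullet> (w' \<bullet> d)" by (simp add: pre[OF tw(4)] pre[OF tw'(4)] cd(3))
  then obtain x where x: "x \<in> Hom C U I" "a \<bullet> x = w \<bullet> c" "a' \<bullet> x = w' \<bullet> d"
    using pullback_factor[OF aH(6), of "w \<bullet> c" U "w' \<bullet> d"] by (auto simp: in_Hom)
  have [simp]: "x \<in> Arr C" "Dom C x = U" "Cod C x = I" using x(1) by (auto simp: in_Hom)
  have ia: "mono_arr C (i \<bullet> a)" using mono_comp[OF aH(3) D(1)] by simp
  have "(i \<bullet> a) \<bullet> x = s \<bullet> (t \<bullet> c)" by (simp add: x(2) pre[OF tw(4)])
  moreover have "Niso C N (s \<bullet> (t \<bullet> c))" using Niso_comp[OF cd(4) sg(3)] by simp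
  ultimately have "Niso C N ((i \<bullet> a) \<bullet> x)" by metis
  then have xN: "Niso C N x" using Niso_mono_cancel[OF ia, of x] by simp
  obtain J m e where me: "mono_arr C m" "epi_arr C e" "e \<in> Hom C U J" "m \<in> Hom C J I" "x = m \<bullet> e"
    using factorization[OF x(1)] by metis
  have [simp]: "m \<in> Arr C" "Dom C m = J" "Cod C m = I" "e \<in> Arr C" "Cod C e = J" "Dom C e = U"
    using me(3,4) by (auto simp: in_Hom)
  have mN: "Ncok C N m" using Niso_factorization[of m e] me xN by (auto simp: Niso_def)
  have "b \<bullet> (f \<bullet> (a \<bullet> x)) = (b \<bullet> p) \<bullet> (g \<bullet> (t \<bullet> c))" by (simp add: x(2) pre[OF tw(5)])
  also have "\<dots> = b' \<bullet> (f' \<bullet> (a' \<bullet> x))" unfolding bH(5)[symmetric] cd(3) by (simp add: x(3) pre[OF tw'(5)])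
  finally have "(b \<bullet> (f \<bullet> (a \<bullet> m))) \<bullet> e = (b' \<bullet> (f' \<bullet> (a' \<bullet> m))) \<bullet> e" using me(5) by simp
  then have eq: "b \<bullet> (f \<bullet> (a \<bullet> m)) = b' \<bullet> (f' \<bullet> (a' \<bullet> m))"
    by (rule epiD[OF me(2), where W=P]) (auto simp: in_Hom)
  let ?t = "(i \<bullet> (a \<bullet> m), b \<bullet> (f \<bullet> (a \<bullet> m)), b \<bullet> p)"
  have "?t \<in> reps C N X Y"
  proof -
    have "mono_arr C (i \<bullet> (a \<bullet> m))" using mono_comp[OF mono_comp[OF me(1) aH(3)] D(1)] by simp
    moreover have "Ncok C N (i \<bullet> (a \<bullet> m))" using Ncok_comp[OF Ncok_comp[OF mN aH(4)] N(1)] by simp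
    moreover have "epi_arr C (b \<bullet> p)" using epi_comp[OF bH(3) D(3)] by simp
    moreover have "Nker C N (b \<bullet> p)" using Nker_comp[OF bH(4) N(3)] by simp
    ultimately show ?thesis by (auto simp: mem_reps in_Hom)
  qed
  moreover have "refines C ?t (i, f, p)"
    by (rule refinesI[of "a \<bullet> m" _ _ b]) (auto simp: in_Hom)
  moreover have "refines C ?t (i', f', p')"
    by (rule refinesI[of "a' \<bullet> m" _ _ b']) (auto simp: in_Hom eq bH(5) pre[OF aH(5)])
  ultimately have "\<exists>t \<in> reps C N X Y. refines C t (i, f, p) \<and> refines C t (i', f', p')" by blast
  then show "(r, r') \<in> rep_rel C N X Y" using r r' unfolding rep_rel_def by (simp del: refines.simps)
qed

abbreviation "Q \<equiv> quotient_cat C N"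
abbreviation "q \<equiv> rep_class C N"

lemma quot_sel:
  "Obj Q = Obj C" "Dom Q = (\<lambda>(X, c, Y). X)" "Cod Q = (\<lambda>(X, c, Y). Y)" "Idn Q = (\<lambda>X. q (Idn C X))"
  by (simp_all add: quotient_cat_def)

lemma quot_Hom_iff:
  "\<phi> \<in> Hom Q X Y \<longleftrightarrow> X \<in> Obj C \<and> Y \<in> Obj C \<and>
     (\<exists>r \<in> reps C N X Y. \<phi> = (X, rep_rel C N X Y `` {r}, Y))"
  by (auto simp: Hom_def quotient_cat_def quotient_def)

definition qgraph :: "('o, 'm) qarr \<Rightarrow> ('m \<times> 'm) set" where
  "qgraph \<phi> = (\<Union>r \<in> fst (snd \<phi>). rep_graph C N r)"

lemma qgraph_class:
  assumes "r \<in> reps C N X Y"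
  shows "qgraph (X, rep_rel C N X Y `` {r}, Y) = rep_graph C N r"
  using assms unfolding qgraph_def by (auto simp: rep_rel_iff simp del: rep_graph.simps)

lemma qgraph_is_graph:
  assumes "\<phi> \<in> Hom Q X Y"
  shows "is_graph C N X Y (qgraph \<phi>)"
proof -
  obtain i f p where r: "(i, f, p) \<in> reps C N X Y" "\<phi> = (X, rep_rel C N X Y `` {(i, f, p)}, Y)"
    using assms unfolding quot_Hom_iff by (metis prod_cases3)
  then show ?thesis using rep_graph_is_graph[OF r(1)] qgraph_class[OF r(1)] by simp
qed

lemma qgraph_inject:
  assumes "\<phi> \<in> Hom Q X Y" "\<psi> \<in> Hom Q X Y" "qgraph \<phi> = qgraph \<psi>"
  shows "\<phi> = \<psi>"
proof -
  obtain r r' where r: "r \<in> reps C N X Y" "\<phi> = (X, rep_rel C N X Y `` {r}, Y)"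
    and r': "r' \<in> reps C N X Y" "\<psi> = (X, rep_rel C N X Y `` {r'}, Y)"
    using assms unfolding quot_Hom_iff by blast
  then have "rep_graph C N r = rep_graph C N r'" using assms(3) qgraph_class by simp
  then show ?thesis using r r' by (auto simp: rep_rel_iff simp del: rep_graph.simps)
qed

lemma qarr_eq_by_roof:
  assumes "\<phi> \<in> Hom Q X Y" "\<psi> \<in> Hom Q X Y" "(s, f) \<in> qgraph \<phi>" "(s, f) \<in> qgraph \<psi>" "Niso C N s"
  shows "\<phi> = \<psi>"
  using qgraph_inject[OF assms(1,2)] graph_eq_by_roof[OF assms(1,2)[THEN qgraph_is_graph] assms(3-5)]
  by blast

lemma qgraph_surj:
  assumes T: "is_graph C N X Y T" and XY: "X \<in> Obj C" "Y \<in> Obj C"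
  shows "\<exists>\<phi> \<in> Hom Q X Y. qgraph \<phi> = T"
proof -
  obtain V s f where sf: "s \<in> Hom C V X" "f \<in> Hom C V Y" "Niso C N s" "(s, f) \<in> T"
    using graph_roof[OF T XY(1)] by metis
  obtain I m e where me: "mono_arr C m" "epi_arr C e" "e \<in> Hom C V I" "m \<in> Hom C I X" "s = m \<bullet> e"
    using factorization[OF sf(1)] by metis
  have [simp]: "m \<in> Arr C" "Dom C m = I" "Cod C m = X" "e \<in> Arr C" "Cod C e = I" "Dom C e = V"
    "f \<in> Arr C" "Dom C f = V" "Cod C f = Y"
    using me(3,4) sf(2) by (auto simp: in_Hom)
  have N: "Ncok C N m" "Nker C N e" using Niso_factorization[of m e] me sf(3) by (auto simp: Niso_def)
  obtain P p g where pg: "p \<in> Hom C Y P" "g \<in> Hom C I P" "epi_arr C p" "Nker C N p" "g \<bullet> e = p \<bullet> f"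
    using epi_Nker_pushout[OF sf(2) me(3,2) N(2)] by blast
  have [simp]: "p \<in> Arr C" "Dom C p = Y" "Cod C p = P" using pg(1) by (auto simp: in_Hom)
  have r: "(m, g, p) \<in> reps C N X Y" using me(1) N pg by (auto simp: mem_reps)
  have V: "V \<in> Obj C" using Obj_Dom[of f] by simp
  have "(s, f) \<in> rep_graph C N (m, g, p)"
    by (rule rep_graphI[of "Idn C V" V V e]) (use V sf(1) me(3,5) pg(5) in \<open>auto simp: in_Hom\<close>)
  then have "rep_graph C N (m, g, p) = T"
    using graph_eq_by_roof[OF rep_graph_is_graph[OF r] T _ sf(4,3)] by blast
  then have "qgraph (X, rep_rel C N X Y `` {(m, g, p)}, Y) = T" using qgraph_class[OF r] by simp
  moreover have "(X, rep_rel C N X Y `` {(m, g, p)}, Y) \<in> Hom Q X Y"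
    using r XY unfolding quot_Hom_iff by blast
  ultimately show ?thesis by (rule bexI)
qed

lemma comp_reps_graph:
  assumes r: "(i, n \<bullet> f', p) \<in> reps C N X Y" and r': "(j, g' \<bullet> e, r) \<in> reps C N Y Z"
    and n: "mono_arr C n" "epi_arr C e" "Cod C e = Dom C n" "p \<bullet> j = n \<bullet> e"
    and f': "f' \<in> Hom C (Dom C i) (Dom C n)" and g': "g' \<in> Hom C (Cod C e) (Cod C r)"
  shows "(i, g' \<bullet> f', r) \<in> reps C N X Z"
    and "\<lbrakk>(u, v) \<in> rep_graph C N (i, n \<bullet> f', p); (v, z) \<in> rep_graph C N (j, g' \<bullet> e, r)\<rbrakk>
      \<Longrightarrow> (u, z) \<in> rep_graph C N (i, g' \<bullet> f', r)"
proof -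
  note D = repsD[OF r] and D' = repsD[OF r']
  have [simp]: "i \<in> Arr C" "Cod C i = X" "p \<in> Arr C" "Dom C p = Y" "j \<in> Arr C" "Cod C j = Y"
    "r \<in> Arr C" "Dom C r = Z" "n \<in> Arr C" "e \<in> Arr C" "Cod C e = Dom C n" "f' \<in> Arr C"
    "Dom C f' = Dom C i" "Cod C f' = Dom C n" "g' \<in> Arr C" "Dom C g' = Dom C n" "Cod C g' = Cod C r"
    using D D' n(3) mono_Arr[OF n(1)] epi_Arr[OF n(2)] f' g' by (auto simp: in_Hom)
  have [simp]: "Dom C e = Dom C j" "Cod C n = Cod C p"
    using arg_cong[OF n(4), of "Dom C"] arg_cong[OF n(4), of "Cod C"] by auto
  show "(i, g' \<bullet> f', r) \<in> reps C N X Z" using r r' by (auto simp: mem_reps in_Hom)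
  assume uv: "(u, v) \<in> rep_graph C N (i, n \<bullet> f', p)" and vz: "(v, z) \<in> rep_graph C N (j, g' \<bullet> e, r)"
  have [simp]: "u \<in> Arr C" "v \<in> Arr C" "z \<in> Arr C" "Dom C u = Dom C z" "Dom C v = Dom C z" "Cod C u = X"
    "Cod C v = Y" "Cod C z = Z" using uv vz by auto
  obtain t w where tw: "Niso C N t" "Cod C t = Dom C z" "w \<in> Hom C (Dom C t) (Dom C i)"
    "i \<bullet> w = u \<bullet> t" "(n \<bullet> f') \<bullet> w = p \<bullet> (v \<bullet> t)"
    using uv by (auto simp del: assoc)
  obtain t' w' where tw': "Niso C N t'" "Cod C t' = Dom C z" "w' \<in> Hom C (Dom C t') (Dom C j)"
    "j \<bullet> w' = v \<bullet> t'" "(g' \<bullet> e) \<bullet> w' = r \<bullet> (z \<bullet> t')"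
    using vz by (auto simp del: assoc)
  have [simp]: "t \<in> Arr C" "Cod C t = Dom C z" "w \<in> Arr C" "Dom C w = Dom C t" "Cod C w = Dom C i"
    "t' \<in> Arr C" "Cod C t' = Dom C z" "w' \<in> Arr C" "Dom C w' = Dom C t'" "Cod C w' = Dom C j"
    using tw(1-3) tw'(1-3) Niso_Arr by (auto simp: in_Hom)
  have tH: "t \<in> Hom C (Dom C t) (Dom C z)" "t' \<in> Hom C (Dom C t') (Dom C z)" by (auto simp: in_Hom)
  obtain W a b where ab: "a \<in> Hom C W (Dom C t)" "b \<in> Hom C W (Dom C t')" "t \<bullet> a = t' \<bullet> b" "Niso C N (t \<bullet> a)"
    using Ore_common[OF tH(1) tw(1) tH(2) tw'(1)] by metis
  have [simp]: "a \<in> Arr C" "Dom C a = W" "Cod C a = Dom C t" "b \<in> Arr C" "Dom C b = W" "Cod C b = Dom C t'"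
    using ab(1,2) by (auto simp: in_Hom)
  have "n \<bullet> (f' \<bullet> (w \<bullet> a)) = ((n \<bullet> f') \<bullet> w) \<bullet> a" by simp
  also have "\<dots> = p \<bullet> (v \<bullet> (t \<bullet> a))" unfolding tw(5) by simp
  also have "\<dots> = n \<bullet> (e \<bullet> (w' \<bullet> b))"
    unfolding ab(3) by (simp add: pre[OF tw'(4)[symmetric]] pre[OF n(4)])
  finally have fw: "f' \<bullet> (w \<bullet> a) = e \<bullet> (w' \<bullet> b)"
    by (rule monoD[OF n(1), where W=W]) (auto simp: in_Hom)
  have "(g' \<bullet> f') \<bullet> (w \<bullet> a) = ((g' \<bullet> e) \<bullet> w') \<bullet> b" using fw by simp
  also have "\<dots> = r \<bullet> (z \<bullet> (t \<bullet> a))" unfolding tw'(5) ab(3) by simp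
  finally have "(g' \<bullet> f') \<bullet> (w \<bullet> a) = r \<bullet> (z \<bullet> (t \<bullet> a))" .
  moreover have "i \<bullet> (w \<bullet> a) = u \<bullet> (t \<bullet> a)" by (simp add: pre[OF tw(4)])
  moreover have "w \<bullet> a \<in> Hom C (Dom C (t \<bullet> a)) (Dom C i)" "Cod C (t \<bullet> a) = Dom C u" by (auto simp: in_Hom)
  ultimately show "(u, z) \<in> rep_graph C N (i, g' \<bullet> f', r)"
    using ab(4) by (auto simp del: assoc Dom_Cmp Cod_Cmp)
qed

lemma comp_reps_nonempty:
  assumes r: "r1 \<in> reps C N X Y" and r': "r2 \<in> reps C N Y Z"
  shows "comp_reps C (rep_rel C N Y Z `` {r2}) (rep_rel C N X Y `` {r1}) \<noteq> {}"
proof -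
  obtain i f p j g r where [simp]: "r1 = (i, f, p)" "r2 = (j, g, r)" by (metis prod_cases3)
  note R = r[simplified] and R' = r'[simplified]
  note D = repsD[OF R] and D' = repsD[OF R']
  have N: "Ncok C N i" "Nker C N p" "Ncok C N j" "Nker C N r" using R R' by (auto simp: mem_reps)
  have [simp]: "i \<in> Arr C" "Cod C i = X" "p \<in> Arr C" "Dom C p = Y" "j \<in> Arr C" "Cod C j = Y"
    "r \<in> Arr C" "Dom C r = Z" "f \<in> Arr C" "Dom C f = Dom C i" "Cod C f = Cod C p"
    "g \<in> Arr C" "Dom C g = Dom C j" "Cod C g = Cod C r"
    using D D' by (auto simp: in_Hom)
  obtain I n e where ne: "mono_arr C n" "epi_arr C e" "e \<in> Hom C (Dom C j) I" "n \<in> Hom C I (Cod C p)"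
    "p \<bullet> j = n \<bullet> e"
    using factorization[of "p \<bullet> j" "Dom C j" "Cod C p"] by (auto simp: in_Hom)
  have [simp]: "n \<in> Arr C" "Dom C n = I" "Cod C n = Cod C p" "e \<in> Arr C" "Dom C e = Dom C j" "Cod C e = I"
    using ne(3,4) by (auto simp: in_Hom)
  have "Ncok C N (p \<bullet> j)" "Nker C N (p \<bullet> j)"
    using Ncok_comp[OF N(3) epi_Ncok[OF D(3)]] Nker_comp[OF N(2) mono_Nker[OF D'(1)]] by auto
  then have nN: "Ncok C N n" "Nker C N e" using Ncok_cancel[of n e] Nker_cancel[of n e] ne(5) by auto
  obtain P i1 f' where i1: "i1 \<in> Hom C P (Dom C i)" "f' \<in> Hom C P I" "mono_arr C i1" "Ncok C N i1"
    "n \<bullet> f' = f \<bullet> i1"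
    using mono_Ncok_pullback[OF D(7) ne(4,1) nN(1)] by blast
  obtain R r1 g' where r1: "r1 \<in> Hom C (Cod C r) R" "g' \<in> Hom C I R" "epi_arr C r1" "Nker C N r1"
    "g' \<bullet> e = r1 \<bullet> g"
    using epi_Nker_pushout[OF D'(7) ne(3,2) nN(2)] by blast
  have [simp]: "i1 \<in> Arr C" "Dom C i1 = P" "Cod C i1 = Dom C i" "f' \<in> Arr C" "Dom C f' = P" "Cod C f' = I"
    "r1 \<in> Arr C" "Dom C r1 = Cod C r" "Cod C r1 = R" "g' \<in> Arr C" "Dom C g' = I" "Cod C g' = R"
    using i1(1,2) r1(1,2) by (auto simp: in_Hom)
  have a: "(i \<bullet> i1, n \<bullet> f', p) \<in> reps C N X Y"
    using R mono_comp[OF i1(3) D(1)] Ncok_comp[OF i1(4) N(1)] by (auto simp: mem_reps in_Hom)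
  have b: "(j, g' \<bullet> e, r1 \<bullet> r) \<in> reps C N Y Z"
    using R' epi_comp[OF r1(3) D'(3)] Nker_comp[OF r1(4) N(4)] by (auto simp: mem_reps in_Hom)
  have "refines C (i \<bullet> i1, n \<bullet> f', p) (i, f, p)"
    by (rule refinesI[of i1 _ _ "Idn C (Cod C p)"]) (auto simp: in_Hom i1(5))
  then have a': "(i \<bullet> i1, n \<bullet> f', p) \<in> rep_rel C N X Y `` {r1}" if "r1 = (i, f, p)" for r1
    using refines_graph[OF R a] R a that by (auto simp: rep_rel_iff)
  have "refines C (j, g' \<bullet> e, r1 \<bullet> r) (j, g, r)"
    by (rule refinesI[of "Idn C (Dom C j)" _ _ r1]) (auto simp: in_Hom r1(5))
  then have b': "(j, g' \<bullet> e, r1 \<bullet> r) \<in> rep_rel C N Y Z `` {r2}"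
    using refines_graph[OF R' b] R' b by (auto simp: rep_rel_iff)
  have "(i \<bullet> i1, g' \<bullet> f', r1 \<bullet> r) \<in> comp_reps C (rep_rel C N Y Z `` {r2}) (rep_rel C N X Y `` {(i, f, p)})"
    by (rule comp_repsI[OF ne(1,2) _ ne(5) _ a'[OF refl] _ b']) (auto simp: in_Hom)
  then show ?thesis by auto
qed

lemma quot_Cmp:
  assumes \<phi>: "\<phi> \<in> Hom Q X Y" and \<psi>: "\<psi> \<in> Hom Q Y Z"
  shows "\<psi> \<bullet>\<^bsub>Q\<^esub> \<phi> \<in> Hom Q X Z"
    and "\<lbrakk>(u, v) \<in> qgraph \<phi>; (v, z) \<in> qgraph \<psi>\<rbrakk> \<Longrightarrow> (u, z) \<in> qgraph (\<psi> \<bullet>\<^bsub>Q\<^esub> \<phi>)"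
proof -
  obtain r where r: "r \<in> reps C N X Y" "\<phi> = (X, rep_rel C N X Y `` {r}, Y)" and XY: "X \<in> Obj C" "Y \<in> Obj C"
    using \<phi> unfolding quot_Hom_iff by blast
  obtain r' where r': "r' \<in> reps C N Y Z" "\<psi> = (Y, rep_rel C N Y Z `` {r'}, Z)" and Z: "Z \<in> Obj C"
    using \<psi> unfolding quot_Hom_iff by blast
  let ?S = "comp_reps C (rep_rel C N Y Z `` {r'}) (rep_rel C N X Y `` {r})"
  have S: "x \<in> reps C N X Z \<and> (\<forall>u v z. (u, v) \<in> qgraph \<phi> \<longrightarrow> (v, z) \<in> qgraph \<psi> \<longrightarrow> (u, z) \<in> rep_graph C N x)"
    if xS: "x \<in> ?S" for x
  proof -
    obtain i f' p n j g' k e where x: "x = (i, g' \<bullet> f', k)" and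
      *: "mono_arr C n" "epi_arr C e" "Cod C e = Dom C n" "p \<bullet> j = n \<bullet> e"
       "f' \<in> Hom C (Dom C i) (Dom C n)" "g' \<in> Hom C (Cod C e) (Cod C k)"
      and m: "(i, n \<bullet> f', p) \<in> rep_rel C N X Y `` {r}" "(j, g' \<bullet> e, k) \<in> rep_rel C N Y Z `` {r'}"
      by (rule comp_repsE[OF xS]) (rule that)
    have 1: "(i, n \<bullet> f', p) \<in> reps C N X Y" and "(j, g' \<bullet> e, k) \<in> reps C N Y Z"
      and "qgraph \<phi> = rep_graph C N (i, n \<bullet> f', p)" "qgraph \<psi> = rep_graph C N (j, g' \<bullet> e, k)"
      using m qgraph_class[OF r(1)] qgraph_class[OF r'(1)] r(2) r'(2) by (auto simp: rep_rel_iff simp del: rep_graph.simps)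
    then show ?thesis using comp_reps_graph[OF 1 _ *] x by metis
  qed
  obtain x where x: "x \<in> ?S" using comp_reps_nonempty[OF r(1) r'(1)] by blast
  obtain V s f where sf: "s \<in> Hom C V X" "f \<in> Hom C V Y" "Niso C N s" "(s, f) \<in> qgraph \<phi>"
    using graph_roof[OF qgraph_is_graph[OF \<phi>] XY(1)] by metis
  obtain t g where tg: "Niso C N t" "Cod C t = V" "(f \<bullet> t, g) \<in> qgraph \<psi>"
    using graph_total[OF qgraph_is_graph[OF \<psi>], of f] sf(2) by (auto simp: in_Hom)
  have st: "(s \<bullet> t, f \<bullet> t) \<in> qgraph \<phi>" "Niso C N (s \<bullet> t)"
    using graph_restrict[OF qgraph_is_graph[OF \<phi>] sf(4), of t] Niso_comp[OF tg(1) sf(3)] tg(1,2) Niso_Arr sf(1)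
    by (auto simp: in_Hom)
  have rg: "is_graph C N X Z (rep_graph C N y)" if "y \<in> reps C N X Z" for y
    using rep_graph_is_graph that by (metis prod_cases3)
  have same: "rep_rel C N X Z `` {y} = rep_rel C N X Z `` {x}" if y: "y \<in> ?S" for y
  proof -
    have "(s \<bullet> t, g) \<in> rep_graph C N y" "(s \<bullet> t, g) \<in> rep_graph C N x"
      using S[OF x] S[OF y] st(1) tg(3) by blast+
    then have "rep_graph C N y = rep_graph C N x"
      using graph_eq_by_roof[OF rg rg _ _ st(2)] S[OF x] S[OF y] by blast
    moreover have "x \<in> reps C N X Z" "y \<in> reps C N X Z" using S[OF x] S[OF y] by blast+
    ultimately show ?thesis unfolding Image_def rep_rel_iff by simp
  qed
  have "rep_rel C N X Z `` ?S = (\<Union>y \<in> ?S. rep_rel C N X Z `` {y})" by (rule Image_eq_UN)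
  also have "\<dots> = rep_rel C N X Z `` {x}" using same by (intro UN_constant_eq[OF x] ballI)
  finally have eq: "\<psi> \<bullet>\<^bsub>Q\<^esub> \<phi> = (X, rep_rel C N X Z `` {x}, Z)"
    unfolding r(2) r'(2) quotient_cat_def by simp
  show "\<psi> \<bullet>\<^bsub>Q\<^esub> \<phi> \<in> Hom Q X Z" unfolding eq quot_Hom_iff using XY Z S[OF x] by blast
  show "(u, z) \<in> qgraph (\<psi> \<bullet>\<^bsub>Q\<^esub> \<phi>)" if "(u, v) \<in> qgraph \<phi>" "(v, z) \<in> qgraph \<psi>"
    unfolding eq using that qgraph_class S[OF x] by blast
qed

lemma q_rep: "f \<in> Hom C X Y \<Longrightarrow> (Idn C X, f, Idn C Y) \<in> reps C N X Y"
  using Hom_Obj[of f X Y] Niso_Idn mono_Idn epi_Idn by (auto simp: mem_reps Niso_def in_Hom)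

lemma q_Hom [intro]: "f \<in> Hom C X Y \<Longrightarrow> q f \<in> Hom Q X Y"
  using q_rep[of f X Y] Hom_Obj[of f X Y] unfolding quot_Hom_iff rep_class_def by (auto simp: in_Hom)

lemma q_graph:
  assumes "f \<in> Hom C X Y" "u \<in> Hom C W X"
  shows "(u, f \<bullet> u) \<in> qgraph (q f)"
proof -
  have W: "W \<in> Obj C" "X \<in> Obj C" "Y \<in> Obj C" using Hom_Obj assms by blast+
  then have "(u, f \<bullet> u) \<in> rep_graph C N (Idn C X, f, Idn C Y)"
    by (intro rep_graphI[of "Idn C W" W W u]) (use assms in \<open>auto simp: in_Hom\<close>)
  then show ?thesis using qgraph_class[OF q_rep[OF assms(1)]] assms(1)
    by (auto simp: rep_class_def in_Hom)
qed

lemma quot_category: "category Q"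
proof
  show "Dom Q f \<in> Obj Q" "Cod Q f \<in> Obj Q" if "f \<in> Arr Q" for f
    using that by (auto simp: quotient_cat_def)
  show idn: "Idn Q X \<in> Hom Q X X" if "X \<in> Obj Q" for X
    using that Idn_Hom[of X] by (auto simp: quot_sel)
  show "g \<bullet>\<^bsub>Q\<^esub> f \<in> Hom Q X Z" if "f \<in> Hom Q X Y" "g \<in> Hom Q Y Z" for f g X Y Z
    using quot_Cmp that by blast
  fix \<phi> X Y assume \<phi>: "\<phi> \<in> Hom Q X Y"
  then have XY: "X \<in> Obj C" "Y \<in> Obj C" by (auto simp: quot_Hom_iff)
  obtain V s f where sf: "s \<in> Hom C V X" "f \<in> Hom C V Y" "Niso C N s" "(s, f) \<in> qgraph \<phi>"
    using graph_roof[OF qgraph_is_graph[OF \<phi>] XY(1)] by metis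
  have X: "Idn Q X \<in> Hom Q X X" and Y: "Idn Q Y \<in> Hom Q Y Y" using idn XY by (auto simp: quot_sel)
  have "(s, s) \<in> qgraph (Idn Q X)" "(f, f) \<in> qgraph (Idn Q Y)"
    using q_graph[OF Idn_Hom[OF XY(1)] sf(1)] q_graph[OF Idn_Hom[OF XY(2)] sf(2)] sf(1,2) XY
    by (auto simp: quot_sel in_Hom)
  then have "(s, f) \<in> qgraph (\<phi> \<bullet>\<^bsub>Q\<^esub> Idn Q X)" "(s, f) \<in> qgraph (Idn Q Y \<bullet>\<^bsub>Q\<^esub> \<phi>)"
    using quot_Cmp(2)[OF X \<phi>] quot_Cmp(2)[OF \<phi> Y] sf(4) by blast+
  then show "\<phi> \<bullet>\<^bsub>Q\<^esub> Idn Q X = \<phi>" "Idn Q Y \<bullet>\<^bsub>Q\<^esub> \<phi> = \<phi>"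
    using qarr_eq_by_roof[OF quot_Cmp(1)[OF X \<phi>] \<phi> _ sf(4,3)]
      qarr_eq_by_roof[OF quot_Cmp(1)[OF \<phi> Y] \<phi> _ sf(4,3)] by blast+
  fix \<psi> \<chi> Z U assume \<psi>: "\<psi> \<in> Hom Q Y Z" and \<chi>: "\<chi> \<in> Hom Q Z U"
  obtain t g where tg: "Niso C N t" "Cod C t = V" "(f \<bullet> t, g) \<in> qgraph \<psi>"
    using graph_total[OF qgraph_is_graph[OF \<psi>], of f] sf(2) by (auto simp: in_Hom)
  note g = graph_typing[OF qgraph_is_graph[OF \<psi>] tg(3)]
  obtain t' h where th: "Niso C N t'" "Cod C t' = Dom C g" "(g \<bullet> t', h) \<in> qgraph \<chi>"
    using graph_total[OF qgraph_is_graph[OF \<chi>], of g] g by auto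
  have [simp]: "s \<in> Arr C" "Dom C s = V" "f \<in> Arr C" "Dom C f = V" "t \<in> Arr C" "Cod C t = V" "t' \<in> Arr C"
    "Cod C t' = Dom C t" using sf(1,2) tg(1,2) th(1,2) g Niso_Arr by (auto simp: in_Hom)
  let ?s = "s \<bullet> (t \<bullet> t')"
  have s: "Niso C N ?s" using Niso_comp[OF Niso_comp[OF th(1) tg(1)] sf(3)] by simp
  have 1: "(?s, f \<bullet> (t \<bullet> t')) \<in> qgraph \<phi>" using graph_restrict[OF qgraph_is_graph[OF \<phi>] sf(4), of "t \<bullet> t'"] by simp
  have 2: "(f \<bullet> (t \<bullet> t'), g \<bullet> t') \<in> qgraph \<psi>"
    using graph_restrict[OF qgraph_is_graph[OF \<psi>] tg(3), of t'] by simp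
  note c = quot_Cmp(1)[OF \<phi> \<psi>] quot_Cmp(1)[OF \<psi> \<chi>]
  have "(?s, h) \<in> qgraph (\<chi> \<bullet>\<^bsub>Q\<^esub> (\<psi> \<bullet>\<^bsub>Q\<^esub> \<phi>))"
    using quot_Cmp(2)[OF c(1) \<chi> quot_Cmp(2)[OF \<phi> \<psi> 1 2] th(3)] .
  moreover have "(?s, h) \<in> qgraph ((\<chi> \<bullet>\<^bsub>Q\<^esub> \<psi>) \<bullet>\<^bsub>Q\<^esub> \<phi>)"
    using quot_Cmp(2)[OF \<phi> c(2) 1 quot_Cmp(2)[OF \<psi> \<chi> 2 th(3)]] .
  ultimately show "(\<chi> \<bullet>\<^bsub>Q\<^esub> \<psi>) \<bullet>\<^bsub>Q\<^esub> \<phi> = \<chi> \<bullet>\<^bsub>Q\<^esub> (\<psi> \<bullet>\<^bsub>Q\<^esub> \<phi>)"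
    using qarr_eq_by_roof[OF quot_Cmp(1)[OF \<phi> c(2)] quot_Cmp(1)[OF c(1) \<chi>]] s by blast
qed

sublocale Q: category Q
  by (rule quot_category)

end

context is_functor
begin

lemma FObj_Obj [simp]: "X \<in> Obj C \<Longrightarrow> FObj F X \<in> Obj D"
  by (rule FObj_closed)

lemma FArr_Arr [simp]: "f \<in> Arr C \<Longrightarrow> FArr F f \<in> Arr D"
  and Dom_FArr [simp]: "f \<in> Arr C \<Longrightarrow> Dom D (FArr F f) = FObj F (Dom C f)"
  and Cod_FArr [simp]: "f \<in> Arr C \<Longrightarrow> Cod D (FArr F f) = FObj F (Cod C f)"
  using FArr_Hom[of f "Dom C f" "Cod C f"] by (auto simp: in_Hom)

lemma FArr_comp [simp]: "\<lbrakk>f \<in> Arr C; g \<in> Arr C; Cod C f = Dom C g\<rbrakk>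
    \<Longrightarrow> FArr F (g \<bullet>\<^bsub>C\<^esub> f) = FArr F g \<bullet>\<^bsub>D\<^esub> FArr F f"
  using FArr_Cmp[of f "Dom C f" "Cod C f" g "Cod C g"] by (auto simp: in_Hom)

lemma FArr_id [simp]: "X \<in> Obj C \<Longrightarrow> FArr F (Idn C X) = Idn D (FObj F X)"
  by (rule FArr_Idn)

lemma FArr_iso:
  assumes "is_iso C f"
  shows "is_iso D (FArr F f)"
proof -
  have f: "f \<in> Hom C (Dom C f) (Cod C f)" using src.iso_Arr[OF assms] by (simp add: in_Hom)
  obtain g where g: "g \<in> Hom C (Cod C f) (Dom C f)" "g \<bullet>\<^bsub>C\<^esub> f = Idn C (Dom C f)"
    "f \<bullet>\<^bsub>C\<^esub> g = Idn C (Cod C f)"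
    using src.isoE[OF assms f] by metis
  show ?thesis
    by (rule tgt.isoI[OF FArr_Hom[OF f] FArr_Hom[OF g(1)]])
      (simp_all add: FArr_Cmp[OF f g(1), symmetric] FArr_Cmp[OF g(1) f, symmetric] g(2,3)
        src.Hom_Obj[OF f] del: FArr_comp)
qed

end

context serre_subcategory
begin

lemma Obj_Q [simp]: "Obj Q = Obj C"
  by (simp add: quot_sel)

lemma q_Arr [simp]: "f \<in> Arr C \<Longrightarrow> q f \<in> Arr Q"
  and Dom_q [simp]: "f \<in> Arr C \<Longrightarrow> Dom Q (q f) = Dom C f"
  and Cod_q [simp]: "f \<in> Arr C \<Longrightarrow> Cod Q (q f) = Cod C f"
  using q_Hom[of f "Dom C f" "Cod C f"] by (auto simp: in_Hom)

lemma q_Idn [simp]: "q (Idn C X) = Idn Q X"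
  by (simp add: quot_sel)

lemma q_Cmp:
  assumes f: "f \<in> Hom C X Y" and g: "g \<in> Hom C Y Z"
  shows "q (g \<bullet> f) = q g \<bullet>\<^bsub>Q\<^esub> q f"
proof (rule qarr_eq_by_roof)
  have X: "X \<in> Obj C" using Hom_Obj f by blast
  note X1 = Idn_Hom[OF X]
  have gf: "g \<bullet> f \<in> Hom C X Z" using f g by (rule Cmp_Hom)
  show "q (g \<bullet> f) \<in> Hom Q X Z" using gf by (rule q_Hom)
  show "q g \<bullet>\<^bsub>Q\<^esub> q f \<in> Hom Q X Z" using quot_Cmp(1) q_Hom f g by blast
  show "(Idn C X, g \<bullet> f) \<in> qgraph (q (g \<bullet> f))" using q_graph[OF gf X1] gf by (simp add: in_Hom)
  have "(Idn C X, f) \<in> qgraph (q f)" "(f, g \<bullet> f) \<in> qgraph (q g)"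
    using q_graph[OF f X1] q_graph[OF g f] f by (simp_all add: in_Hom)
  then show "(Idn C X, g \<bullet> f) \<in> qgraph (q g \<bullet>\<^bsub>Q\<^esub> q f)"
    by (rule quot_Cmp(2)[OF q_Hom[OF f] q_Hom[OF g]])
  show "Niso C N (Idn C X)" using X by simp
qed

lemma q_comp [simp]:
  "\<lbrakk>f \<in> Arr C; g \<in> Arr C; Cod C f = Dom C g\<rbrakk> \<Longrightarrow> q (g \<bullet> f) = q g \<bullet>\<^bsub>Q\<^esub> q f"
  using q_Cmp[of f "Dom C f" "Cod C f" g "Cod C g"] by (auto simp: in_Hom)

lemma qgraph_iff:
  assumes \<phi>: "\<phi> \<in> Hom Q X Y" and u: "u \<in> Hom C W X" and v: "v \<in> Hom C W Y"
  shows "(u, v) \<in> qgraph \<phi> \<longleftrightarrow> \<phi> \<bullet>\<^bsub>Q\<^esub> q u = q v"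
proof
  have W: "W \<in> Obj C" using Hom_Obj u by blast
  have [simp]: "u \<in> Arr C" "Dom C u = W" "v \<in> Arr C" "Dom C v = W" "Cod C u = X" "Cod C v = Y"
    using u v by (auto simp: in_Hom)
  note W1 = Idn_Hom[OF W] and c = quot_Cmp[OF q_Hom[OF u] \<phi>]
  note T = qgraph_is_graph[OF \<phi>] and Tv = qgraph_is_graph[OF q_Hom[OF v]]
  { assume "(u, v) \<in> qgraph \<phi>"
    then have "(Idn C W, v) \<in> qgraph (\<phi> \<bullet>\<^bsub>Q\<^esub> q u)"
      using q_graph[OF u W1] c(2)[of "Idn C W" u v] by simp
    moreover have "(Idn C W, v) \<in> qgraph (q v)" using q_graph[OF v W1] by simp
    ultimately show "\<phi> \<bullet>\<^bsub>Q\<^esub> q u = q v"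
      using qarr_eq_by_roof[OF c(1) q_Hom[OF v]] Niso_Idn[OF W] by blast }
  assume eq: "\<phi> \<bullet>\<^bsub>Q\<^esub> q u = q v"
  obtain t v' where tv: "Niso C N t" "Cod C t = W" "(u \<bullet> t, v') \<in> qgraph \<phi>"
    using graph_total[OF T, of u] by auto
  have tH: "t \<in> Hom C (Dom C t) W" using tv Niso_Arr by (simp add: in_Hom)
  have [simp]: "t \<in> Arr C" "Cod C t = W" using tH by (auto simp: in_Hom)
  have v': "v' \<in> Arr C" "Dom C v' = Dom C t" "Cod C v' = Y" using graph_typing[OF T tv(3)] by auto
  have "(t, v') \<in> qgraph (q v)"
    using c(2)[OF q_graph[OF u tH] tv(3)] eq by simp
  from graph_functional[OF Tv this q_graph[OF v tH]]
  obtain t' where t': "Niso C N t'" "Cod C t' = Dom C t" "v' \<bullet> t' = (v \<bullet> t) \<bullet> t'" by metis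
  have [simp]: "t' \<in> Arr C" "Cod C t' = Dom C t" using t' Niso_Arr by auto
  have "((u \<bullet> t) \<bullet> t', v' \<bullet> t') \<in> qgraph \<phi>" using graph_restrict[OF T tv(3), of t'] by simp
  then have "(u \<bullet> (t \<bullet> t'), v \<bullet> (t \<bullet> t')) \<in> qgraph \<phi>" using t'(3) by simp
  then show "(u, v) \<in> qgraph \<phi>"
    by (rule graph_local[OF T _ u v]) (use Niso_comp[OF t'(1) tv(1)] in auto)
qed

lemma quot_roof:
  assumes \<phi>: "\<phi> \<in> Hom Q X Y"
  obtains V s f where "s \<in> Hom C V X" "f \<in> Hom C V Y" "Niso C N s" "\<phi> \<bullet>\<^bsub>Q\<^esub> q s = q f"
proof -
  have X: "X \<in> Obj C" using \<phi> by (simp add: quot_Hom_iff)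
  obtain V s f where *: "s \<in> Hom C V X" "f \<in> Hom C V Y" "Niso C N s" "(s, f) \<in> qgraph \<phi>"
    using graph_roof[OF qgraph_is_graph[OF \<phi>] X] by metis
  then show ?thesis using that qgraph_iff[OF \<phi>] by blast
qed

lemma q_eq_iff:
  assumes f: "f \<in> Hom C X Y" and g: "g \<in> Hom C X Y"
  shows "q f = q g \<longleftrightarrow> (\<exists>W. \<exists>t \<in> Hom C W X. Niso C N t \<and> f \<bullet> t = g \<bullet> t)"
proof
  have X: "X \<in> Obj C" using Hom_Obj f by blast
  assume "q f = q g"
  then have "(Idn C X, f) \<in> qgraph (q f)" "(Idn C X, g) \<in> qgraph (q f)"
    using q_graph[OF f Idn_Hom[OF X]] q_graph[OF g Idn_Hom[OF X]] f g by (simp_all add: in_Hom)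
  from graph_functional[OF qgraph_is_graph[OF q_Hom[OF f]] this]
  obtain t where t: "Niso C N t" "Cod C t = X" "f \<bullet> t = g \<bullet> t" using X by auto
  then have "t \<in> Hom C (Dom C t) X" using Niso_Arr by (simp add: in_Hom)
  then show "\<exists>W. \<exists>t \<in> Hom C W X. Niso C N t \<and> f \<bullet> t = g \<bullet> t" using t by blast
next
  assume "\<exists>W. \<exists>t \<in> Hom C W X. Niso C N t \<and> f \<bullet> t = g \<bullet> t"
  then obtain W t where t: "t \<in> Hom C W X" "Niso C N t" "f \<bullet> t = g \<bullet> t" by blast
  then show "q f = q g"
    using qarr_eq_by_roof[OF q_Hom[OF f] q_Hom[OF g] q_graph[OF f t(1)]] q_graph[OF g t(1)] by simp
qed

lemma q_iso:
  assumes s: "Niso C N s"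
  shows "is_iso Q (q s)"
proof -
  define X Y where XY: "X = Dom C s" "Y = Cod C s"
  have [simp]: "s \<in> Arr C" "Dom C s = X" "Cod C s = Y" using s Niso_Arr by (auto simp: XY)
  have sH: "s \<in> Hom C X Y" by (simp add: in_Hom)
  have Obj [simp]: "X \<in> Obj C" "Y \<in> Obj C" using Hom_Obj[OF sH] by auto
  define T where "T = {(u, v). u \<in> Arr C \<and> v \<in> Arr C \<and> Dom C u = Dom C v \<and> Cod C u = Y \<and> Cod C v = X \<and>
    (\<exists>t. Niso C N t \<and> Cod C t = Dom C u \<and> s \<bullet> (v \<bullet> t) = u \<bullet> t)}"
  have memT: "(u, v) \<in> T" if "u \<in> Hom C W Y" "v \<in> Hom C W X" "t \<in> Hom C V W" "Niso C N t"
    "s \<bullet> (v \<bullet> t) = u \<bullet> t" for u v t W V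
    using that unfolding T_def by (auto simp: in_Hom)
  have "is_graph C N Y X T"
    unfolding is_graph_def
  proof (intro conjI allI impI)
    fix u v assume uv: "(u, v) \<in> T"
    then show "u \<in> Arr C" "v \<in> Arr C" "Dom C u = Dom C v" "Cod C u = Y" "Cod C v = X"
      by (auto simp: T_def)
    note [simp] = this
    obtain t where t: "Niso C N t" "Cod C t = Dom C v" "s \<bullet> (v \<bullet> t) = u \<bullet> t"
      using uv by (auto simp: T_def)
    have [simp]: "t \<in> Arr C" "Cod C t = Dom C v" using t Niso_Arr by auto
    have tH: "t \<in> Hom C (Dom C t) (Dom C v)" by (simp add: in_Hom)
    have eqt: "s \<bullet> (v \<bullet> (t \<bullet> x)) = u \<bullet> (t \<bullet> x)" if "x \<in> Arr C" "Cod C x = Dom C t" for x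
      using arg_cong[OF t(3), of "\<lambda>z. z \<bullet> x"] that by simp
    { fix a assume a: "a \<in> Arr C" "Cod C a = Dom C u"
      then have [simp]: "a \<in> Arr C" "Cod C a = Dom C v" by auto
      have aH: "a \<in> Hom C (Dom C a) (Dom C v)" by (simp add: in_Hom)
      obtain W t' w where t': "t' \<in> Hom C W (Dom C a)" "Niso C N t'" "w \<in> Hom C W (Dom C t)"
        "t \<bullet> w = a \<bullet> t'"
        using Ore[OF aH tH t(1)] by metis
      show "(u \<bullet> a, v \<bullet> a) \<in> T"
        by (rule memT[OF _ _ t'(1,2)])
          (use t'(1,3) eqt[of w] in \<open>auto simp: in_Hom t'(4)[symmetric]\<close>) }
    fix v' assume uv': "(u, v') \<in> T"
    then have [simp]: "v' \<in> Arr C" "Dom C v' = Dom C v" "Cod C v' = X" by (auto simp: T_def)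
    obtain t' where t': "Niso C N t'" "Cod C t' = Dom C v" "s \<bullet> (v' \<bullet> t') = u \<bullet> t'"
      using uv' by (auto simp: T_def)
    have [simp]: "t' \<in> Arr C" "Cod C t' = Dom C v" using t' Niso_Arr by auto
    have tH': "t' \<in> Hom C (Dom C t') (Dom C v)" by (simp add: in_Hom)
    have eqt': "s \<bullet> (v' \<bullet> (t' \<bullet> x)) = u \<bullet> (t' \<bullet> x)" if "x \<in> Arr C" "Cod C x = Dom C t'" for x
      using arg_cong[OF t'(3), of "\<lambda>z. z \<bullet> x"] that by simp
    obtain W a b where ab: "a \<in> Hom C W (Dom C t)" "b \<in> Hom C W (Dom C t')" "t \<bullet> a = t' \<bullet> b"
      "Niso C N (t \<bullet> a)"
      using Ore_common[OF tH t(1) tH' t'(1)] by metis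
    have [simp]: "a \<in> Arr C" "Cod C a = Dom C t" "Dom C a = W" "b \<in> Arr C" "Cod C b = Dom C t'" "Dom C b = W"
      using ab(1,2) by (auto simp: in_Hom)
    have "s \<bullet> (v \<bullet> (t \<bullet> a)) = s \<bullet> (v' \<bullet> (t \<bullet> a))" using eqt[of a] eqt'[of b] ab(3) by simp
    moreover have "v \<bullet> (t \<bullet> a) \<in> Hom C W X" "v' \<bullet> (t \<bullet> a) \<in> Hom C W X" by (auto simp: in_Hom)
    ultimately obtain U x where x: "x \<in> Hom C U W" "Niso C N x"
      "(v \<bullet> (t \<bullet> a)) \<bullet> x = (v' \<bullet> (t \<bullet> a)) \<bullet> x"
      using Niso_equalize[of _ W X _ s] s by (metis \<open>Dom C s = X\<close>)
    have [simp]: "x \<in> Arr C" "Cod C x = W" using x by (auto simp: in_Hom)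
    have "Niso C N ((t \<bullet> a) \<bullet> x)" using Niso_comp[OF x(2) ab(4)] by simp
    then show "\<exists>t. Niso C N t \<and> Cod C t = Dom C u \<and> v \<bullet> t = v' \<bullet> t"
      using x(3) by (intro exI[of _ "(t \<bullet> a) \<bullet> x"]) simp
  next
    fix W u v t assume uv: "u \<in> Hom C W Y" "v \<in> Hom C W X" and t: "Niso C N t" "Cod C t = W"
      and T: "(u \<bullet> t, v \<bullet> t) \<in> T"
    have [simp]: "t \<in> Arr C" "Cod C t = W" "u \<in> Arr C" "Dom C u = W" "v \<in> Arr C" "Dom C v = W" "Cod C v = X"
      using t uv Niso_Arr by (auto simp: in_Hom)
    obtain t' where t': "Niso C N t'" "Cod C t' = Dom C t" "s \<bullet> ((v \<bullet> t) \<bullet> t') = (u \<bullet> t) \<bullet> t'"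
      using T by (auto simp: T_def simp del: assoc)
    have [simp]: "t' \<in> Arr C" using t' Niso_Arr by auto
    show "(u, v) \<in> T"
      by (rule memT[OF uv _ Niso_comp[OF t'(1) t(1) t'(2)]])
        (use t'(2,3) in \<open>auto simp: in_Hom\<close>)
  next
    fix u assume [simp]: "u \<in> Arr C" "Cod C u = Y"
    have "u \<in> Hom C (Dom C u) Y" by (simp add: in_Hom)
    then obtain W t w where t: "t \<in> Hom C W (Dom C u)" "Niso C N t" "w \<in> Hom C W X" "s \<bullet> w = u \<bullet> t"
      using Ore[OF _ sH s] by metis
    have "(u \<bullet> t, w) \<in> T"
      by (rule memT[of _ W _ "Idn C W" W]) (use t Hom_Obj[OF t(1)] in \<open>auto simp: in_Hom\<close>)
    then show "\<exists>t v. Niso C N t \<and> Cod C t = Dom C u \<and> (u \<bullet> t, v) \<in> T"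
      using t by (auto simp: in_Hom)
  qed
  then obtain \<psi> where \<psi>: "\<psi> \<in> Hom Q Y X" "qgraph \<psi> = T" using qgraph_surj Obj by blast
  have "(s, Idn C X) \<in> T"
    by (rule memT[of _ X _ "Idn C X" X]) (auto simp: in_Hom)
  then have 1: "\<psi> \<bullet>\<^bsub>Q\<^esub> q s = Idn Q X"
    using qgraph_iff[OF \<psi>(1) sH Idn_Hom[OF Obj(1)]] \<psi>(2) by simp
  have \<psi>s: "q s \<bullet>\<^bsub>Q\<^esub> \<psi> \<in> Hom Q Y Y" using quot_Cmp(1)[OF \<psi>(1) q_Hom[OF sH]] .
  have "(q s \<bullet>\<^bsub>Q\<^esub> \<psi>) \<bullet>\<^bsub>Q\<^esub> q s = q s" using \<psi>(1) 1 by (simp add: in_Hom)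
  then have "(s, s) \<in> qgraph (q s \<bullet>\<^bsub>Q\<^esub> \<psi>)" using qgraph_iff[OF \<psi>s sH sH] by simp
  moreover have Y1: "Idn Q Y \<in> Hom Q Y Y" using Q.Idn_Hom[of Y] by simp
  have "(s, s) \<in> qgraph (Idn Q Y)" using qgraph_iff[OF Y1 sH sH] by simp
  ultimately have 2: "q s \<bullet>\<^bsub>Q\<^esub> \<psi> = Idn Q Y" using qarr_eq_by_roof[OF \<psi>s Y1 _ _ s] by blast
  show ?thesis using Q.isoI[OF q_Hom[OF sH] \<psi>(1) 1 2] .
qed

lemma Ncok_zero_Cod:
  assumes "Ncok C N t" "zero_arr C t"
  shows "Cod C t \<in> N"
proof -
  have [simp]: "t \<in> Arr C" using Ncok_Arr[OF assms(1)] .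
  obtain c where c: "is_cokernel C c t" "Cod C c \<in> N" using assms by (auto simp: Ncok_def)
  note [simp] = cokernelD(1,3)[OF c(1)]
  obtain x where x: "x \<in> Hom C (Cod C c) (Cod C t)" "x \<bullet> c = Idn C (Cod C t)"
    using cokernel_factor[OF c(1), of "Idn C (Cod C t)" "Cod C t"] assms(2) by (auto simp: in_Hom)
  have "mono_arr C c" by (rule split_mono[of x]) (use x in \<open>auto simp: in_Hom\<close>)
  then show ?thesis using serre_sub[of c] c(2) by simp
qed

lemma q_zero:
  assumes "q f = q z" "zero_arr C z" "f \<in> Hom C X Y" "z \<in> Hom C X Y"
  obtains W t where "t \<in> Hom C W X" "Niso C N t" "zero_arr C (f \<bullet> t)"
proof -
  obtain W t where t: "t \<in> Hom C W X" "Niso C N t" "f \<bullet> t = z \<bullet> t"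
    using q_eq_iff[OF assms(3,4)] assms(1) by blast
  have "zero_arr C (z \<bullet> t)" by (rule zero_comp_right) (use t assms in \<open>auto simp: in_Hom\<close>)
  then show ?thesis using that t by simp
qed

lemma q_mono_Nker:
  assumes "mono_arr Q (q s)" "s \<in> Arr C"
  shows "Nker C N s"
proof -
  note [simp] = assms(2)
  obtain k where k: "is_kernel C k s" using kernel_exists[of s] by auto
  note [simp] = kernelD(1,3)[OF k]
  obtain z where z: "z \<in> Hom C (Dom C k) (Dom C s)" "zero_arr C z"
    using zero_Hom[of "Dom C k" "Dom C s"] by auto
  have [simp]: "z \<in> Arr C" "Dom C z = Dom C k" "Cod C z = Dom C s" using z by (auto simp: in_Hom)
  have "zero_arr C (s \<bullet> z)" by (rule zero_comp_left[OF z(2)]) auto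
  then have "s \<bullet> k = s \<bullet> z" using zero_unique kernelD(4)[OF k] by simp
  then have "q (s \<bullet> k) = q (s \<bullet> z)" by simp
  then have eqk: "q s \<bullet>\<^bsub>Q\<^esub> q k = q s \<bullet>\<^bsub>Q\<^esub> q z" by simp
  have kH: "k \<in> Hom C (Dom C k) (Dom C s)" by (simp add: in_Hom)
  from eqk have "q k = q z" by (rule Q.monoD[OF assms(1), where W="Dom C k"]) (auto simp: in_Hom)
  then obtain W t where t: "t \<in> Hom C W (Dom C k)" "Niso C N t" "zero_arr C (k \<bullet> t)"
    using q_zero[OF _ z(2) kH z(1)] by metis
  have "zero_arr C t" by (rule mono_zeroD[OF kernel_mono[OF k] t(3)]) (use t in \<open>auto simp: in_Hom\<close>)
  then have "Dom C k \<in> N" using Ncok_zero_Cod[of t] t by (auto simp: Niso_def in_Hom)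
  then show ?thesis using k by (auto simp: Nker_def)
qed

lemma q_epi_Ncok:
  assumes "epi_arr Q (q s)" "s \<in> Arr C"
  shows "Ncok C N s"
proof -
  note [simp] = assms(2)
  obtain k where k: "is_cokernel C k s" using cokernel_exists[of s] by auto
  note [simp] = cokernelD(1,3)[OF k]
  obtain z where z: "z \<in> Hom C (Cod C s) (Cod C k)" "zero_arr C z"
    using zero_Hom[of "Cod C s" "Cod C k"] by auto
  have [simp]: "z \<in> Arr C" "Dom C z = Cod C s" "Cod C z = Cod C k" using z by (auto simp: in_Hom)
  have "zero_arr C (z \<bullet> s)" by (rule zero_comp_right[OF z(2)]) auto
  then have "k \<bullet> s = z \<bullet> s" using zero_unique cokernelD(4)[OF k] by simp
  then have "q (k \<bullet> s) = q (z \<bullet> s)" by simp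
  then have eqk: "q k \<bullet>\<^bsub>Q\<^esub> q s = q z \<bullet>\<^bsub>Q\<^esub> q s" by simp
  have kH: "k \<in> Hom C (Cod C s) (Cod C k)" by (simp add: in_Hom)
  from eqk have "q k = q z" by (rule Q.epiD[OF assms(1), where W="Cod C k"]) (auto simp: in_Hom)
  then obtain W t where t: "t \<in> Hom C W (Cod C s)" "Niso C N t" "zero_arr C (k \<bullet> t)"
    using q_zero[OF _ z(2) kH z(1)] by metis
  obtain c where c: "is_cokernel C c t" "Cod C c \<in> N" using t by (auto simp: Niso_def Ncok_def)
  obtain x where x: "x \<in> Hom C (Cod C c) (Cod C k)" "x \<bullet> c = k"
    using cokernel_factor[OF c(1) t(3)] t(1) by (auto simp: in_Hom)
  have "epi_arr C x" by (rule epi_cancel[of _ c])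
    (use x cokernelD[OF c(1)] cokernel_epi[OF k] in \<open>auto simp: in_Hom\<close>)
  then have "Cod C k \<in> N" using serre_quot[of x] x c by (auto simp: in_Hom)
  then show ?thesis using k by (auto simp: Ncok_def)
qed

lemma q_iso_iff: "s \<in> Arr C \<Longrightarrow> is_iso Q (q s) \<longleftrightarrow> Niso C N s"
  using q_iso q_mono_Nker q_epi_Ncok Q.iso_mono Q.iso_epi unfolding Niso_def by blast

lemma quot_common_roof:
  assumes "finite S" "\<And>h. h \<in> S \<Longrightarrow> \<phi> h \<in> Hom Q X (Y h)" "X \<in> Obj C"
  shows "\<exists>V. \<exists>s \<in> Hom C V X. Niso C N s \<and> (\<forall>h \<in> S. \<exists>f \<in> Hom C V (Y h). \<phi> h \<bullet>\<^bsub>Q\<^esub> q s = q f)"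
  using assms(1,2)
proof (induction S)
  case empty
  show ?case using Idn_Hom Niso_Idn assms(3) by blast
next
  case (insert a S)
  then obtain V s where s: "s \<in> Hom C V X" "Niso C N s"
    "\<And>h. h \<in> S \<Longrightarrow> \<exists>f \<in> Hom C V (Y h). \<phi> h \<bullet>\<^bsub>Q\<^esub> q s = q f"
    by auto
  obtain V' s' f' where s': "s' \<in> Hom C V' X" "f' \<in> Hom C V' (Y a)" "Niso C N s'" "\<phi> a \<bullet>\<^bsub>Q\<^esub> q s' = q f'"
    using quot_roof[OF insert.prems[OF insertI1]] by metis
  obtain W b b' where b: "b \<in> Hom C W V" "b' \<in> Hom C W V'" "s \<bullet> b = s' \<bullet> b'" "Niso C N (s \<bullet> b)"
    using Ore_common[OF s(1,2) s'(1,3)] by metis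
  have [simp]: "s \<in> Arr C" "Dom C s = V" "Cod C s = X" "s' \<in> Arr C" "Dom C s' = V'" "Cod C s' = X"
    "b \<in> Arr C" "Dom C b = W" "Cod C b = V" "b' \<in> Arr C" "Dom C b' = W" "Cod C b' = V'"
    using s(1) s'(1) b(1,2) by (auto simp: in_Hom)
  have "\<exists>f \<in> Hom C W (Y h). \<phi> h \<bullet>\<^bsub>Q\<^esub> q (s \<bullet> b) = q f" if h: "h \<in> insert a S" for h
  proof -
    have \<phi>: "\<phi> h \<in> Arr Q" "Dom Q (\<phi> h) = X" "Cod Q (\<phi> h) = Y h"
      using insert.prems[OF h] by (auto simp: in_Hom)
    show ?thesis
    proof (cases "h \<in> S")
      case True
      obtain f where f: "f \<in> Hom C V (Y h)" "\<phi> h \<bullet>\<^bsub>Q\<^esub> q s = q f" using s(3)[OF True] by blast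
      show ?thesis using f(1) \<phi> by (intro bexI[of _ "f \<bullet> b"]) (auto simp: in_Hom Q.pre[OF f(2)])
    next
      case False
      then have [simp]: "h = a" using h by simp
      have "\<phi> h \<bullet>\<^bsub>Q\<^esub> q (s' \<bullet> b') = q (f' \<bullet> b')"
        using s'(2,4) \<phi> Q.pre[OF s'(4), of "q b'"] by (simp add: in_Hom)
      then show ?thesis using s'(2) unfolding b(3)
        by (intro bexI[of _ "f' \<bullet> b'"]) (auto simp: in_Hom)
    qed
  qed
  moreover have "s \<bullet> b \<in> Hom C W X" by (simp add: in_Hom)
  ultimately show ?case using b(4) by blast
qed

lemma quot_common_roof2:
  assumes "\<phi> \<in> Hom Q X Y" "\<psi> \<in> Hom Q X Z"
  obtains V s f g where "s \<in> Hom C V X" "f \<in> Hom C V Y" "g \<in> Hom C V Z" "Niso C N s"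
    "\<phi> \<bullet>\<^bsub>Q\<^esub> q s = q f" "\<psi> \<bullet>\<^bsub>Q\<^esub> q s = q g"
proof -
  have X: "X \<in> Obj C" using assms(1) by (simp add: quot_Hom_iff)
  have "(if h then \<phi> else \<psi>) \<in> Hom Q X (if h then Y else Z)" for h using assms by simp
  then obtain V s where s: "s \<in> Hom C V X" "Niso C N s" "\<forall>h \<in> UNIV.
    \<exists>f \<in> Hom C V (if h then Y else Z). (if h then \<phi> else \<psi>) \<bullet>\<^bsub>Q\<^esub> q s = q f"
    using quot_common_roof[of UNIV "\<lambda>h. if h then \<phi> else \<psi>" X "\<lambda>h. if h then Y else Z"] X by auto
  show ?thesis using that[OF s(1) _ _ s(2)] s(3)[THEN bspec, of True] s(3)[THEN bspec, of False] by auto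
qed

lemma induced_arrow:
  assumes H: "is_functor C D H" and inv: "\<And>s. Niso C N s \<Longrightarrow> is_iso D (FArr H s)"
    and \<phi>: "\<phi> \<in> Hom Q X Y"
  shows "\<exists>!\<kappa>. \<kappa> \<in> Hom D (FObj H X) (FObj H Y) \<and>
    (\<forall>W. \<forall>u \<in> Hom C W X. \<forall>v \<in> Hom C W Y. \<phi> \<bullet>\<^bsub>Q\<^esub> q u = q v \<longrightarrow> \<kappa> \<bullet>\<^bsub>D\<^esub> FArr H u = FArr H v)"
proof -
  interpret H: is_functor C D H by (rule H)
  obtain V s f where sf: "s \<in> Hom C V X" "f \<in> Hom C V Y" "Niso C N s" "\<phi> \<bullet>\<^bsub>Q\<^esub> q s = q f"
    using quot_roof[OF \<phi>] by metis
  have [simp]: "s \<in> Arr C" "Dom C s = V" "Cod C s = X" "f \<in> Arr C" "Dom C f = V" "Cod C f = Y"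
    using sf(1,2) by (auto simp: in_Hom)
  have [simp]: "\<phi> \<in> Arr Q" "Dom Q \<phi> = X" "Cod Q \<phi> = Y" using \<phi> by (auto simp: in_Hom)
  obtain k where k: "k \<in> Hom D (FObj H X) (FObj H V)" "k \<bullet>\<^bsub>D\<^esub> FArr H s = Idn D (FObj H V)"
    "FArr H s \<bullet>\<^bsub>D\<^esub> k = Idn D (FObj H X)"
    using H.tgt.isoE[OF inv[OF sf(3)], of "FObj H V" "FObj H X"] by (auto simp: in_Hom)
  have [simp]: "k \<in> Arr D" "Dom D k = FObj H X" "Cod D k = FObj H V" using k by (auto simp: in_Hom)
  have ObjV [simp]: "V \<in> Obj C" "X \<in> Obj C" using Hom_Obj[OF sf(1)] by auto
  show ?thesis
  proof (rule ex1I[of _ "FArr H f \<bullet>\<^bsub>D\<^esub> k"], intro conjI allI ballI impI)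
    show "FArr H f \<bullet>\<^bsub>D\<^esub> k \<in> Hom D (FObj H X) (FObj H Y)" by (auto simp: in_Hom)
    fix W u v assume u: "u \<in> Hom C W X" and v: "v \<in> Hom C W Y" and eq: "\<phi> \<bullet>\<^bsub>Q\<^esub> q u = q v"
    have [simp]: "u \<in> Arr C" "Dom C u = W" "Cod C u = X" "v \<in> Arr C" "Dom C v = W" "Cod C v = Y"
      using u v by (auto simp: in_Hom)
    obtain U t w where t: "t \<in> Hom C U W" "Niso C N t" "w \<in> Hom C U V" "s \<bullet> w = u \<bullet> t"
      using Ore[OF u sf(1,3)] by metis
    have [simp]: "t \<in> Arr C" "Dom C t = U" "Cod C t = W" "w \<in> Arr C" "Dom C w = U" "Cod C w = V"
      using t(1,3) by (auto simp: in_Hom)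
    have "q (f \<bullet> w) = \<phi> \<bullet>\<^bsub>Q\<^esub> q (s \<bullet> w)" by (simp add: Q.pre[OF sf(4)])
    also have "\<dots> = q (v \<bullet> t)" unfolding t(4) by (simp add: Q.pre[OF eq])
    finally obtain U' t' where t': "t' \<in> Hom C U' U" "Niso C N t'" "(f \<bullet> w) \<bullet> t' = (v \<bullet> t) \<bullet> t'"
      using q_eq_iff[of "f \<bullet> w" U Y "v \<bullet> t"] by (auto simp: in_Hom)
    have [simp]: "t' \<in> Arr C" "Dom C t' = U'" "Cod C t' = U" using t'(1) by (auto simp: in_Hom)
    have st: "FArr H s \<bullet>\<^bsub>D\<^esub> FArr H w = FArr H u \<bullet>\<^bsub>D\<^esub> FArr H t"
      using arg_cong[OF t(4), of "FArr H"] by simp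
    have tN: "is_iso D (FArr H (t \<bullet> t'))" using inv[OF Niso_comp[OF t'(2) t(2)]] by simp
    have "FArr H f \<bullet>\<^bsub>D\<^esub> (k \<bullet>\<^bsub>D\<^esub> (FArr H u \<bullet>\<^bsub>D\<^esub> FArr H (t \<bullet> t'))) = FArr H ((f \<bullet> w) \<bullet> t')"
      by (simp add: H.tgt.pre[OF st[symmetric]] H.tgt.pre[OF k(2)])
    also have "\<dots> = FArr H v \<bullet>\<^bsub>D\<^esub> FArr H (t \<bullet> t')" unfolding t'(3) by simp
    finally have "((FArr H f \<bullet>\<^bsub>D\<^esub> k) \<bullet>\<^bsub>D\<^esub> FArr H u) \<bullet>\<^bsub>D\<^esub> FArr H (t \<bullet> t') = FArr H v \<bullet>\<^bsub>D\<^esub> FArr H (t \<bullet> t')"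
      by simp
    then show "(FArr H f \<bullet>\<^bsub>D\<^esub> k) \<bullet>\<^bsub>D\<^esub> FArr H u = FArr H v"
      by (rule H.tgt.epiD[OF H.tgt.iso_epi[OF tN], where W="FObj H Y"]) (auto simp: in_Hom)
  next
    fix \<kappa> assume \<kappa>: "\<kappa> \<in> Hom D (FObj H X) (FObj H Y) \<and>
      (\<forall>W. \<forall>u \<in> Hom C W X. \<forall>v \<in> Hom C W Y. \<phi> \<bullet>\<^bsub>Q\<^esub> q u = q v \<longrightarrow> \<kappa> \<bullet>\<^bsub>D\<^esub> FArr H u = FArr H v)"
    then have [simp]: "\<kappa> \<in> Arr D" "Dom D \<kappa> = FObj H X" and eq: "\<kappa> \<bullet>\<^bsub>D\<^esub> FArr H s = FArr H f"
      using sf by (auto simp: in_Hom)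
    show "\<kappa> = FArr H f \<bullet>\<^bsub>D\<^esub> k" using k(3) by (simp flip: eq)
  qed
qed

lemma induced_exists:
  assumes H: "is_functor C D H" and inv: "\<And>s. Niso C N s \<Longrightarrow> is_iso D (FArr H s)"
  shows "\<exists>K. is_induced_by C N D H K"
proof -
  interpret H: is_functor C D H by (rule H)
  define P where "P X Y \<phi> \<kappa> \<longleftrightarrow> \<kappa> \<in> Hom D (FObj H X) (FObj H Y) \<and>
    (\<forall>W. \<forall>u \<in> Hom C W X. \<forall>v \<in> Hom C W Y. \<phi> \<bullet>\<^bsub>Q\<^esub> q u = q v \<longrightarrow> \<kappa> \<bullet>\<^bsub>D\<^esub> FArr H u = FArr H v)"
    for X Y \<phi> \<kappa>
  define K where
    "K = \<lparr>FObj = FObj H, FArr = \<lambda>\<phi>. THE \<kappa>. P (Dom Q \<phi>) (Cod Q \<phi>) \<phi> \<kappa>\<rparr>"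
  have ex1: "\<exists>!\<kappa>. P X Y \<phi> \<kappa>" if "\<phi> \<in> Hom Q X Y" for X Y \<phi>
    unfolding P_def using induced_arrow[OF H inv that] .
  have KP: "P X Y \<phi> (FArr K \<phi>)" if "\<phi> \<in> Hom Q X Y" for X Y \<phi>
    using theI'[OF ex1[OF that]] that by (auto simp: K_def in_Hom)
  have Kuniq: "FArr K \<phi> = \<kappa>" if "\<phi> \<in> Hom Q X Y" "P X Y \<phi> \<kappa>" for X Y \<phi> \<kappa>
    using ex1[OF that(1)] KP[OF that(1)] that(2) by blast
  have KH: "FArr K \<phi> \<in> Hom D (FObj H X) (FObj H Y)" if "\<phi> \<in> Hom Q X Y" for X Y \<phi>
    using KP[OF that] by (simp add: P_def)
  have Kuv: "FArr K \<phi> \<bullet>\<^bsub>D\<^esub> FArr H u = FArr H v"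
    if "\<phi> \<in> Hom Q X Y" "u \<in> Hom C W X" "v \<in> Hom C W Y" "\<phi> \<bullet>\<^bsub>Q\<^esub> q u = q v" for X Y \<phi> W u v
    using KP[OF that(1)] that(2-4) unfolding P_def by blast
  have Kq: "FArr K (q f) = FArr H f" if f: "f \<in> Hom C X Y" for f X Y
  proof -
    have X: "X \<in> Obj C" using Hom_Obj f by blast
    have "FArr K (q f) \<bullet>\<^bsub>D\<^esub> FArr H (Idn C X) = FArr H f"
      by (rule Kuv[OF q_Hom[OF f] Idn_Hom[OF X] f]) (use f in \<open>simp add: in_Hom\<close>)
    then show ?thesis using KH[OF q_Hom[OF f]] X by (simp add: in_Hom)
  qed
  have Kfun: "is_functor Q D K"
  proof
    show "FObj K X \<in> Obj D" if "X \<in> Obj Q" for X using that by (simp add: K_def)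
    show "FArr K \<phi> \<in> Hom D (FObj K X) (FObj K Y)" if "\<phi> \<in> Hom Q X Y" for \<phi> X Y
      using KH[OF that] by (simp add: K_def)
    show "FArr K (Idn Q X) = Idn D (FObj K X)" if "X \<in> Obj Q" for X
      using Kq[OF Idn_Hom[of X]] that by (simp add: K_def)
    fix \<phi> \<psi> X Y Z assume \<phi>: "\<phi> \<in> Hom Q X Y" and \<psi>: "\<psi> \<in> Hom Q Y Z"
    note c = quot_Cmp(1)[OF \<phi> \<psi>]
    obtain V s f where sf: "s \<in> Hom C V X" "f \<in> Hom C V Y" "Niso C N s" "\<phi> \<bullet>\<^bsub>Q\<^esub> q s = q f"
      using quot_roof[OF \<phi>] by metis
    obtain V' s' g where sg: "s' \<in> Hom C V' Y" "g \<in> Hom C V' Z" "Niso C N s'" "\<psi> \<bullet>\<^bsub>Q\<^esub> q s' = q g"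
      using quot_roof[OF \<psi>] by metis
    obtain W t w where t: "t \<in> Hom C W V" "Niso C N t" "w \<in> Hom C W V'" "s' \<bullet> w = f \<bullet> t"
      using Ore[OF sf(2) sg(1,3)] by metis
    have [simp]: "s \<in> Arr C" "Dom C s = V" "Cod C s = X" "f \<in> Arr C" "Dom C f = V" "Cod C f = Y"
      "s' \<in> Arr C" "Dom C s' = V'" "Cod C s' = Y" "g \<in> Arr C" "Dom C g = V'" "Cod C g = Z"
      "t \<in> Arr C" "Dom C t = W" "Cod C t = V" "w \<in> Arr C" "Dom C w = W" "Cod C w = V'"
      "\<phi> \<in> Arr Q" "Dom Q \<phi> = X" "Cod Q \<phi> = Y" "\<psi> \<in> Arr Q" "Dom Q \<psi> = Y" "Cod Q \<psi> = Z"
      using sf(1,2) sg(1,2) t(1,3) \<phi> \<psi> by (auto simp: in_Hom)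
    have st: "s \<bullet> t \<in> Hom C W X" "f \<bullet> t \<in> Hom C W Y" "g \<bullet> w \<in> Hom C W Z" by (auto simp: in_Hom)
    have e1: "\<phi> \<bullet>\<^bsub>Q\<^esub> q (s \<bullet> t) = q (f \<bullet> t)" by (simp add: Q.pre[OF sf(4)])
    have e2: "\<psi> \<bullet>\<^bsub>Q\<^esub> q (f \<bullet> t) = q (g \<bullet> w)" unfolding t(4)[symmetric] by (simp add: Q.pre[OF sg(4)])
    have e3: "(\<psi> \<bullet>\<^bsub>Q\<^esub> \<phi>) \<bullet>\<^bsub>Q\<^esub> q (s \<bullet> t) = q (g \<bullet> w)" using e1 e2 by simp
    note k1 = Kuv[OF \<phi> st(1,2) e1] and k2 = Kuv[OF \<psi> st(2,3) e2] and k3 = Kuv[OF c st(1,3) e3]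
    note KHs = KH[OF \<phi>] KH[OF \<psi>] KH[OF c]
    have "FArr K \<psi> \<bullet>\<^bsub>D\<^esub> (FArr K \<phi> \<bullet>\<^bsub>D\<^esub> FArr H (s \<bullet> t)) = FArr H (g \<bullet> w)" unfolding k1 k2 ..
    then have "FArr K (\<psi> \<bullet>\<^bsub>Q\<^esub> \<phi>) \<bullet>\<^bsub>D\<^esub> FArr H (s \<bullet> t) = (FArr K \<psi> \<bullet>\<^bsub>D\<^esub> FArr K \<phi>) \<bullet>\<^bsub>D\<^esub> FArr H (s \<bullet> t)"
      unfolding k3 using KHs by (simp add: in_Hom)
    moreover have "is_iso D (FArr H (s \<bullet> t))" using inv[OF Niso_comp[OF t(2) sf(3)]] by simp
    moreover have "FArr K (\<psi> \<bullet>\<^bsub>Q\<^esub> \<phi>) \<in> Hom D (Cod D (FArr H (s \<bullet> t))) (FObj H Z)"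
      "FArr K \<psi> \<bullet>\<^bsub>D\<^esub> FArr K \<phi> \<in> Hom D (Cod D (FArr H (s \<bullet> t))) (FObj H Z)"
      using KHs by (auto simp: in_Hom)
    ultimately show "FArr K (\<psi> \<bullet>\<^bsub>Q\<^esub> \<phi>) = FArr K \<psi> \<bullet>\<^bsub>D\<^esub> FArr K \<phi>"
      using H.tgt.epiD[OF H.tgt.iso_epi] by metis
  qed
  moreover have "functor_eq_on C (comp_functor K (quotient_functor C N)) H"
    unfolding functor_eq_on_def comp_functor_def quotient_functor_def
    using Kq by (auto simp: K_def in_Hom)
  moreover have "functor_eq_on Q K' K" if K': "is_functor Q D K'"
    and eq: "functor_eq_on C (comp_functor K' (quotient_functor C N)) H" for K'
    unfolding functor_eq_on_def
  proof (intro conjI ballI)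
    interpret K': is_functor Q D K' by (rule K')
    have o: "FObj K' X = FObj H X" if "X \<in> Obj C" for X
      using eq that by (auto simp: functor_eq_on_def comp_functor_def quotient_functor_def)
    have a: "FArr K' (q f) = FArr H f" if "f \<in> Arr C" for f
      using eq that by (auto simp: functor_eq_on_def comp_functor_def quotient_functor_def)
    show "FObj K' X = FObj K X" if "X \<in> Obj Q" for X using that o by (simp add: K_def)
    fix \<phi> assume "\<phi> \<in> Arr Q"
    define X Y where XY: "X = Dom Q \<phi>" "Y = Cod Q \<phi>"
    have \<phi>: "\<phi> \<in> Hom Q X Y" using \<open>\<phi> \<in> Arr Q\<close> by (simp add: in_Hom XY)
    then have Obj: "X \<in> Obj C" "Y \<in> Obj C" by (auto simp: quot_Hom_iff)
    have "P X Y \<phi> (FArr K' \<phi>)"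
      unfolding P_def
    proof (intro conjI allI ballI impI)
      show "FArr K' \<phi> \<in> Hom D (FObj H X) (FObj H Y)" using K'.FArr_Hom[OF \<phi>] o Obj by simp
      fix W u v assume u: "u \<in> Hom C W X" and v: "v \<in> Hom C W Y" and e: "\<phi> \<bullet>\<^bsub>Q\<^esub> q u = q v"
      have "FArr K' (\<phi> \<bullet>\<^bsub>Q\<^esub> q u) = FArr K' (q v)" using e by simp
      then show "FArr K' \<phi> \<bullet>\<^bsub>D\<^esub> FArr H u = FArr H v"
        using K'.FArr_Cmp[OF q_Hom[OF u] \<phi>] a u v by (simp add: in_Hom)
    qed
    then show "FArr K' \<phi> = FArr K \<phi>" using Kuniq[OF \<phi>] by simp
  qed
  ultimately show ?thesis unfolding is_induced_by_def by blast
qed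

end

locale serre_endofunctor = serre_subcategory C N + F: is_functor C C F
  for C :: "('o, 'm) cat" (structure) and N :: "'o set" and F :: "('o, 'm, 'o, 'm) cfunctor" +
  assumes pres_mono: "mono_arr C m \<Longrightarrow> mono_arr C (FArr F m)"
    and pres_epi: "epi_arr C m \<Longrightarrow> epi_arr C (FArr F m)"
    and pres_Nker: "Nker C N f \<Longrightarrow> Nker C N (FArr F f)"
    and pres_Ncok: "Ncok C N f \<Longrightarrow> Ncok C N (FArr F f)"
begin

abbreviation "Fbar \<equiv> induced_functor C N F"

lemma pres_Niso: "Niso C N f \<Longrightarrow> Niso C N (FArr F f)"
  unfolding Niso_def using pres_Nker pres_Ncok by blast

lemma Fbar_graph:
  assumes \<phi>: "\<phi> \<in> Hom Q X Y"
  shows "FArr Fbar \<phi> \<in> Hom Q (FObj F X) (FObj F Y)"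
    and "(u, v) \<in> qgraph \<phi> \<Longrightarrow> (FArr F u, FArr F v) \<in> qgraph (FArr Fbar \<phi>)"
proof -
  let ?F = "\<lambda>(i, f, p). (FArr F i, FArr F f, FArr F p)"
  let ?R = "rep_rel C N (FObj F X) (FObj F Y)"
  obtain r where r: "r \<in> reps C N X Y" "\<phi> = (X, rep_rel C N X Y `` {r}, Y)" and XY: "X \<in> Obj C" "Y \<in> Obj C"
    using \<phi> unfolding quot_Hom_iff by blast
  have Freps: "?F x \<in> reps C N (FObj F X) (FObj F Y)" if xr: "x \<in> reps C N X Y" for x
  proof -
    obtain i f p where x: "x = (i, f, p)" by (metis prod_cases3)
    have "i \<in> Arr C" "f \<in> Arr C" "p \<in> Arr C" using repsD[of i f p X Y] xr x by (auto simp: in_Hom)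
    then show ?thesis using xr x pres_mono pres_epi pres_Nker pres_Ncok
      by (auto simp: mem_reps in_Hom)
  qed
  have Fgr: "(FArr F u, FArr F v) \<in> rep_graph C N (?F x)"
    if xr: "x \<in> reps C N X Y" and uv: "(u, v) \<in> rep_graph C N x" for x u v
  proof -
    obtain i f p where x: "x = (i, f, p)" by (metis prod_cases3)
    have D: "i \<in> Arr C" "f \<in> Arr C" "p \<in> Arr C" "Dom C f = Dom C i" "Cod C f = Cod C p"
      using repsD[of i f p X Y] xr x by (auto simp: in_Hom)
    obtain t w where tw: "Niso C N t" "Cod C t = Dom C u" "w \<in> Hom C (Dom C t) (Dom C i)" "i \<bullet> w = u \<bullet> t"
      "f \<bullet> w = p \<bullet> (v \<bullet> t)" and uv': "u \<in> Arr C" "v \<in> Arr C" "Dom C u = Dom C v"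
      "Cod C u = Cod C i" "Cod C v = Dom C p"
      using uv unfolding x by auto
    have t: "t \<in> Arr C" using tw Niso_Arr by blast
    have "FArr F i \<bullet> FArr F w = FArr F u \<bullet> FArr F t"
      using arg_cong[OF tw(4), of "FArr F"] D tw(2,3) t uv' by (simp add: in_Hom)
    moreover have "FArr F f \<bullet> FArr F w = FArr F p \<bullet> (FArr F v \<bullet> FArr F t)"
      using arg_cong[OF tw(5), of "FArr F"] D tw(2,3) t uv' by (simp add: in_Hom)
    ultimately have "(FArr F u, FArr F v) \<in> rep_graph C N (FArr F i, FArr F f, FArr F p)"
      by (intro rep_graphI[OF pres_Niso[OF tw(1)], where V="FObj F (Dom C t)" and W="FObj F (Dom C v)"])
        (use D tw(2,3) t uv' in \<open>auto simp: in_Hom\<close>)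
    then show ?thesis by (simp add: x del: rep_graph.simps)
  qed
  have rg: "is_graph C N X' Y' (rep_graph C N y)" if "y \<in> reps C N X' Y'" for y X' Y'
    using rep_graph_is_graph that by (metis prod_cases3)
  let ?c = "rep_rel C N X Y `` {r}"
  have same: "?R `` {y} = ?R `` {?F r}" if yF: "y \<in> ?F ` ?c" for y
  proof -
    obtain x where x: "y = ?F x" "x \<in> ?c" using yF by blast
    have xr: "x \<in> reps C N X Y" "rep_graph C N x = rep_graph C N r" using x(2) by (auto simp: rep_rel_iff simp del: rep_graph.simps)
    obtain V s f where sf: "s \<in> Hom C V X" "f \<in> Hom C V Y" "Niso C N s" "(s, f) \<in> rep_graph C N r"
      using graph_roof[OF rg[OF r(1)] XY(1)] by metis
    have "rep_graph C N (?F x) = rep_graph C N (?F r)"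
      using graph_eq_by_roof[OF rg[OF Freps[OF xr(1)]] rg[OF Freps[OF r(1)]]
          Fgr[OF xr(1)] Fgr[OF r(1) sf(4)] pres_Niso[OF sf(3)]] sf(4) xr(2) by blast
    then show ?thesis
      using Freps[OF xr(1)] Freps[OF r(1)] unfolding x(1) Image_def rep_rel_iff by simp
  qed
  have rc: "?F r \<in> ?F ` ?c" using r(1) by (intro imageI) (simp add: rep_rel_iff)
  have "?R `` (?F ` ?c) = (\<Union>y \<in> ?F ` ?c. ?R `` {y})" by (rule Image_eq_UN)
  also have "\<dots> = ?R `` {?F r}" using same by (intro UN_constant_eq[OF rc] ballI)
  finally have eq: "FArr Fbar \<phi> = (FObj F X, ?R `` {?F r}, FObj F Y)"
    unfolding r(2) induced_functor_def by simp
  show "FArr Fbar \<phi> \<in> Hom Q (FObj F X) (FObj F Y)"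
    unfolding eq quot_Hom_iff using Freps[OF r(1)] XY F.FObj_closed by blast
  have a: "qgraph (FArr Fbar \<phi>) = rep_graph C N (?F r)"
    unfolding eq by (rule qgraph_class[OF Freps[OF r(1)]])
  have b: "qgraph \<phi> = rep_graph C N r" unfolding r(2) by (rule qgraph_class[OF r(1)])
  show "(FArr F u, FArr F v) \<in> qgraph (FArr Fbar \<phi>)" if "(u, v) \<in> qgraph \<phi>"
    unfolding a using Fgr[OF r(1)] that unfolding b .
qed

lemma Fbar_q:
  assumes f: "f \<in> Hom C X Y"
  shows "FArr Fbar (q f) = q (FArr F f)"
proof -
  have X: "X \<in> Obj C" using Hom_Obj f by blast
  have "(FArr F (Idn C X), FArr F f) \<in> qgraph (FArr Fbar (q f))"
    by (rule Fbar_graph(2)[OF q_Hom[OF f]]) (use q_graph[OF f Idn_Hom[OF X]] f in \<open>simp add: in_Hom\<close>)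
  moreover have "(Idn C (FObj F X), FArr F f) \<in> qgraph (q (FArr F f))"
    using q_graph[OF F.FArr_Hom[OF f] Idn_Hom[of "FObj F X"]] f X by (simp add: in_Hom)
  ultimately show ?thesis
    using qarr_eq_by_roof[OF Fbar_graph(1)[OF q_Hom[OF f]] q_Hom[OF F.FArr_Hom[OF f]]] X by simp
qed

lemma Fbar_functor: "is_functor Q Q Fbar"
proof
  have o [simp]: "FObj Fbar X = FObj F X" for X by (simp add: induced_functor_def)
  show "FObj Fbar X \<in> Obj Q" if "X \<in> Obj Q" for X using that by simp
  show "FArr Fbar \<phi> \<in> Hom Q (FObj Fbar X) (FObj Fbar Y)" if "\<phi> \<in> Hom Q X Y" for \<phi> X Y
    using Fbar_graph(1)[OF that] by simp
  show "FArr Fbar (Idn Q X) = Idn Q (FObj Fbar X)" if "X \<in> Obj Q" for X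
    using Fbar_q[OF Idn_Hom[of X]] that by simp
  fix \<phi> \<psi> X Y Z assume \<phi>: "\<phi> \<in> Hom Q X Y" and \<psi>: "\<psi> \<in> Hom Q Y Z"
  have X: "X \<in> Obj C" using \<phi> by (simp add: quot_Hom_iff)
  obtain V s f where sf: "s \<in> Hom C V X" "f \<in> Hom C V Y" "Niso C N s" "(s, f) \<in> qgraph \<phi>"
    using graph_roof[OF qgraph_is_graph[OF \<phi>] X] by metis
  obtain t g where tg: "Niso C N t" "Cod C t = V" "(f \<bullet> t, g) \<in> qgraph \<psi>"
    using graph_total[OF qgraph_is_graph[OF \<psi>], of f] sf(2) by (auto simp: in_Hom)
  have 1: "(s \<bullet> t, f \<bullet> t) \<in> qgraph \<phi>"
    by (rule graph_restrict[OF qgraph_is_graph[OF \<phi>] sf(4)]) (use tg sf(1) in \<open>auto simp: in_Hom Niso_Arr\<close>)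
  note F\<phi> = Fbar_graph[OF \<phi>] and F\<psi> = Fbar_graph[OF \<psi>]
  have "(FArr F (s \<bullet> t), FArr F g) \<in> qgraph (FArr Fbar (\<psi> \<bullet>\<^bsub>Q\<^esub> \<phi>))"
    using Fbar_graph(2)[OF quot_Cmp(1)[OF \<phi> \<psi>] quot_Cmp(2)[OF \<phi> \<psi> 1 tg(3)]] .
  moreover have "(FArr F (s \<bullet> t), FArr F g) \<in> qgraph (FArr Fbar \<psi> \<bullet>\<^bsub>Q\<^esub> FArr Fbar \<phi>)"
    using quot_Cmp(2)[OF F\<phi>(1) F\<psi>(1) F\<phi>(2)[OF 1] F\<psi>(2)[OF tg(3)]] .
  moreover have "Niso C N (FArr F (s \<bullet> t))"
    by (rule pres_Niso[OF Niso_comp[OF tg(1) sf(3)]]) (use tg sf(1) in \<open>simp add: in_Hom\<close>)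
  ultimately show "FArr Fbar (\<psi> \<bullet>\<^bsub>Q\<^esub> \<phi>) = FArr Fbar \<psi> \<bullet>\<^bsub>Q\<^esub> FArr Fbar \<phi>"
    using qarr_eq_by_roof[OF Fbar_graph(1)[OF quot_Cmp(1)[OF \<phi> \<psi>]] quot_Cmp(1)[OF F\<phi>(1) F\<psi>(1)]] by blast
qed

end

section \<open>Equivalences of categories\<close>

lemma opc_iso: "is_iso (opc C) f \<longleftrightarrow> is_iso C f"
  by (auto simp: is_iso_def opc_simps)

locale equivalence_functor = is_functor C D F
  for C :: "('o, 'm) cat" and D :: "('p, 'n) cat" and F :: "('o, 'm, 'p, 'n) cfunctor" +
  assumes faithful: "\<lbrakk>f \<in> Hom C X Y; f' \<in> Hom C X Y; FArr F f = FArr F f'\<rbrakk> \<Longrightarrow> f = f'"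
    and full: "\<lbrakk>X \<in> Obj C; Y \<in> Obj C; h \<in> Hom D (FObj F X) (FObj F Y)\<rbrakk> \<Longrightarrow> \<exists>f \<in> Hom C X Y. FArr F f = h"
    and dense: "W \<in> Obj D \<Longrightarrow> \<exists>V \<in> Obj C. \<exists>i \<in> Hom D (FObj F V) W. is_iso D i"

lemma id_functor_sel [simp]: "FObj id_functor X = X" "FArr id_functor f = f"
  by (simp_all add: id_functor_def)

lemma comp_functor_sel [simp]:
  "FObj (comp_functor H F) X = FObj H (FObj F X)" "FArr (comp_functor H F) f = FArr H (FArr F f)"
  by (simp_all add: comp_functor_def)

lemma natural_iso_faithful:
  assumes "natural_iso C C id_functor (comp_functor H F) \<eta>" "f \<in> Hom C X Y" "f' \<in> Hom C X Y"
    "FArr H (FArr F f) = FArr H (FArr F f')"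
  shows "f = f'"
proof -
  interpret n: natural_iso C C id_functor "comp_functor H F" \<eta> by fact
  have Y: "Y \<in> Obj C" using n.F.src.Hom_Obj assms(2) by blast
  note YH = n.component_Hom[OF Y]
  have "\<eta> Y \<bullet>\<^bsub>C\<^esub> f = \<eta> Y \<bullet>\<^bsub>C\<^esub> f'"
    using n.naturality[OF assms(2)] n.naturality[OF assms(3)] assms(4) by simp
  then show ?thesis
    by (rule n.F.src.monoD[OF n.F.src.iso_mono[OF n.component_iso[OF Y]], where W=X])
      (use assms(2,3) YH in \<open>auto simp: in_Hom\<close>)
qed

lemma natural_iso_faithful':
  assumes "natural_iso D D (comp_functor F H) id_functor \<epsilon>" "f \<in> Hom D X Y" "f' \<in> Hom D X Y"
    "FArr F (FArr H f) = FArr F (FArr H f')"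
  shows "f = f'"
proof -
  interpret n: natural_iso D D "comp_functor F H" id_functor \<epsilon> by fact
  have X: "X \<in> Obj D" using n.F.src.Hom_Obj assms(2) by blast
  note XH = n.component_Hom[OF X]
  have "f \<bullet>\<^bsub>D\<^esub> \<epsilon> X = f' \<bullet>\<^bsub>D\<^esub> \<epsilon> X"
    using n.naturality[OF assms(2)] n.naturality[OF assms(3)] assms(4) by simp
  then show ?thesis
    by (rule n.F.src.epiD[OF n.F.src.iso_epi[OF n.component_iso[OF X]], where W=Y])
      (use assms(2,3) XH in \<open>auto simp: in_Hom\<close>)
qed

lemma equivalence_functorI:
  assumes "is_equivalence C D F"
  shows "equivalence_functor C D F"
proof -
  obtain H \<eta> \<epsilon> where F: "is_functor C D F" and H: "is_functor D C H"
    and \<eta>: "natural_iso C C id_functor (comp_functor H F) \<eta>"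
    and \<epsilon>: "natural_iso D D (comp_functor F H) id_functor \<epsilon>"
    using assms unfolding is_equivalence_def by blast
  interpret F: is_functor C D F by (rule F)
  interpret H: is_functor D C H by (rule H)
  interpret n: natural_iso C C id_functor "comp_functor H F" \<eta> by (rule \<eta>)
  interpret e: natural_iso D D "comp_functor F H" id_functor \<epsilon> by (rule \<epsilon>)
  have cH: "\<eta> X \<in> Hom C X (FObj H (FObj F X))" if "X \<in> Obj C" for X
    using n.component_Hom[OF that] by simp
  show ?thesis
  proof
    show "f = f'" if "f \<in> Hom C X Y" "f' \<in> Hom C X Y" "FArr F f = FArr F f'" for f f' X Y
      by (rule natural_iso_faithful[OF \<eta> that(1,2)]) (simp add: that(3))
    show "\<exists>X \<in> Obj C. \<exists>i \<in> Hom D (FObj F X) Y. is_iso D i" if Y: "Y \<in> Obj D" for Y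
    proof (intro bexI)
      show "is_iso D (\<epsilon> Y)" by (rule e.component_iso[OF Y])
      show "\<epsilon> Y \<in> Hom D (FObj F (FObj H Y)) Y" using e.component_Hom[OF Y] by simp
      show "FObj H Y \<in> Obj C" using Y by simp
    qed
    fix X Y h assume X: "X \<in> Obj C" and Y: "Y \<in> Obj C" and h: "h \<in> Hom D (FObj F X) (FObj F Y)"
    obtain j where j: "j \<in> Hom C (FObj H (FObj F Y)) Y" "\<eta> Y \<bullet>\<^bsub>C\<^esub> j = Idn C (FObj H (FObj F Y))"
      using F.src.isoE[OF n.component_iso[OF Y] cH[OF Y]] by metis
    let ?f = "j \<bullet>\<^bsub>C\<^esub> (FArr H h \<bullet>\<^bsub>C\<^esub> \<eta> X)"
    have hH: "FArr H h \<in> Hom C (FObj H (FObj F X)) (FObj H (FObj F Y))" using H.FArr_Hom[OF h] .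
    have f: "?f \<in> Hom C X Y" using j hH cH[OF X] by (auto simp: in_Hom)
    have "\<eta> Y \<bullet>\<^bsub>C\<^esub> ?f = FArr H h \<bullet>\<^bsub>C\<^esub> \<eta> X"
      using j hH cH[OF X] cH[OF Y] by (simp add: in_Hom F.src.pre[OF j(2)])
    then have "FArr H (FArr F ?f) \<bullet>\<^bsub>C\<^esub> \<eta> X = FArr H h \<bullet>\<^bsub>C\<^esub> \<eta> X"
      using n.naturality[OF f] by (simp del: F.FArr_comp H.FArr_comp)
    then have "FArr H (FArr F ?f) = FArr H h"
      by (rule F.src.epiD[OF F.src.iso_epi[OF n.component_iso[OF X]], where W="FObj H (FObj F Y)"])
        (use H.FArr_Hom[OF F.FArr_Hom[OF f]] hH cH[OF X] in \<open>auto simp: in_Hom simp del: F.FArr_comp H.FArr_comp\<close>)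
    then have "FArr F ?f = h"
      by (intro natural_iso_faithful'[OF \<epsilon> F.FArr_Hom[OF f] h]) simp
    then show "\<exists>f \<in> Hom C X Y. FArr F f = h" using f by blast
  qed
qed

context equivalence_functor
begin

lemma iso_reflect:
  assumes "is_iso D (FArr F f)" "f \<in> Hom C X Y"
  shows "is_iso C f"
proof -
  note XY = src.Hom_Obj[OF assms(2)]
  obtain g where g: "g \<in> Hom D (FObj F Y) (FObj F X)" "g \<bullet>\<^bsub>D\<^esub> FArr F f = Idn D (FObj F X)"
    "FArr F f \<bullet>\<^bsub>D\<^esub> g = Idn D (FObj F Y)"
    using tgt.isoE[OF assms(1) FArr_Hom[OF assms(2)]] by metis
  obtain g' where g': "g' \<in> Hom C Y X" "FArr F g' = g" using full[OF XY(2,1) g(1)] by blast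
  have "g' \<bullet>\<^bsub>C\<^esub> f = Idn C X"
    by (rule faithful[of _ X X]) (use g g' assms(2) XY in \<open>auto simp: in_Hom\<close>)
  moreover have "f \<bullet>\<^bsub>C\<^esub> g' = Idn C Y"
    by (rule faithful[of _ Y Y]) (use g g' assms(2) XY in \<open>auto simp: in_Hom\<close>)
  ultimately show ?thesis using src.isoI[OF assms(2) g'(1)] by blast
qed

lemma is_equivalence: "is_equivalence C D F"
proof -
  obtain X i where X: "\<And>Y. Y \<in> Obj D \<Longrightarrow> X Y \<in> Obj C"
    and i: "\<And>Y. Y \<in> Obj D \<Longrightarrow> i Y \<in> Hom D (FObj F (X Y)) Y"
    and ii: "\<And>Y. Y \<in> Obj D \<Longrightarrow> is_iso D (i Y)"
    using dense by metis
  note im = tgt.iso_mono[OF ii]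
  have i_simps [simp]: "i Y \<in> Arr D" "Dom D (i Y) = FObj F (X Y)" "Cod D (i Y) = Y" if "Y \<in> Obj D" for Y
    using i[OF that] by (auto simp: in_Hom)
  have ex: "\<exists>f \<in> Hom C (X Y) (X Y'). i Y' \<bullet>\<^bsub>D\<^esub> FArr F f = h \<bullet>\<^bsub>D\<^esub> i Y"
    if h: "h \<in> Hom D Y Y'" for h Y Y'
  proof -
    note O = tgt.Hom_Obj[OF h]
    obtain j where j: "j \<in> Hom D Y' (FObj F (X Y'))" "i Y' \<bullet>\<^bsub>D\<^esub> j = Idn D Y'"
      using tgt.isoE[OF ii[OF O(2)] i[OF O(2)]] by metis
    have "j \<bullet>\<^bsub>D\<^esub> (h \<bullet>\<^bsub>D\<^esub> i Y) \<in> Hom D (FObj F (X Y)) (FObj F (X Y'))"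
      using j h O by (auto simp: in_Hom)
    then obtain f where f: "f \<in> Hom C (X Y) (X Y')" "FArr F f = j \<bullet>\<^bsub>D\<^esub> (h \<bullet>\<^bsub>D\<^esub> i Y)"
      using full[OF X[OF O(1)] X[OF O(2)]] by blast
    have "i Y' \<bullet>\<^bsub>D\<^esub> FArr F f = h \<bullet>\<^bsub>D\<^esub> i Y"
      unfolding f(2) using j h O by (simp add: in_Hom tgt.pre[OF j(2)])
    then show ?thesis using f(1) by blast
  qed
  have uniq: "f = f'" if "f \<in> Hom C Z (X Y)" "f' \<in> Hom C Z (X Y)" "Y \<in> Obj D"
    "i Y \<bullet>\<^bsub>D\<^esub> FArr F f = i Y \<bullet>\<^bsub>D\<^esub> FArr F f'" for f f' Z Y
  proof -
    have "FArr F f = FArr F f'"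
      by (rule tgt.monoD[OF im[OF that(3)] that(4), where W="FObj F Z"])
        (use that(1-3) in \<open>auto simp: in_Hom\<close>)
    then show ?thesis using faithful that(1,2) by blast
  qed
  define H where "H = \<lparr>FObj = X, FArr = \<lambda>h. SOME f. f \<in> Hom C (X (Dom D h)) (X (Cod D h)) \<and>
    i (Cod D h) \<bullet>\<^bsub>D\<^esub> FArr F f = h \<bullet>\<^bsub>D\<^esub> i (Dom D h)\<rparr>"
  have HO [simp]: "FObj H Y = X Y" for Y by (simp add: H_def)
  have HA: "FArr H h \<in> Hom C (X Y) (X Y')" "i Y' \<bullet>\<^bsub>D\<^esub> FArr F (FArr H h) = h \<bullet>\<^bsub>D\<^esub> i Y"
    if "h \<in> Hom D Y Y'" for h Y Y'
  proof -
    have "\<exists>f. f \<in> Hom C (X (Dom D h)) (X (Cod D h)) \<and>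
      i (Cod D h) \<bullet>\<^bsub>D\<^esub> FArr F f = h \<bullet>\<^bsub>D\<^esub> i (Dom D h)"
      using ex[OF that] that by (auto simp: in_Hom)
    then have "FArr H h \<in> Hom C (X (Dom D h)) (X (Cod D h)) \<and>
      i (Cod D h) \<bullet>\<^bsub>D\<^esub> FArr F (FArr H h) = h \<bullet>\<^bsub>D\<^esub> i (Dom D h)"
      unfolding H_def cfunctor.simps by (rule someI_ex)
    then show "FArr H h \<in> Hom C (X Y) (X Y')" "i Y' \<bullet>\<^bsub>D\<^esub> FArr F (FArr H h) = h \<bullet>\<^bsub>D\<^esub> i Y"
      using that by (auto simp: in_Hom)
  qed
  interpret H: is_functor D C H
  proof
    show "FObj H Y \<in> Obj C" if "Y \<in> Obj D" for Y using X that by simp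
    show "FArr H h \<in> Hom C (FObj H Y) (FObj H Y')" if "h \<in> Hom D Y Y'" for h Y Y' using HA(1)[OF that] by simp
    show "FArr H (Idn D Y) = Idn C (FObj H Y)" if Y: "Y \<in> Obj D" for Y
      by (rule uniq[of _ "X Y" Y])
        (use HA[OF tgt.Idn_Hom[OF Y]] X[OF Y] Y src.Idn_Hom[OF X[OF Y]] in \<open>auto\<close>)
    fix f g Y Y' Y'' assume f: "f \<in> Hom D Y Y'" and g: "g \<in> Hom D Y' Y''"
    note O = tgt.Hom_Obj[OF f] tgt.Hom_Obj[OF g] and gf = tgt.Cmp_Hom[OF f g]
    have [simp]: "f \<in> Arr D" "Dom D f = Y" "Cod D f = Y'" "g \<in> Arr D" "Dom D g = Y'" "Cod D g = Y''"
      "FArr H f \<in> Arr C" "Dom C (FArr H f) = X Y" "Cod C (FArr H f) = X Y'"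
      "FArr H g \<in> Arr C" "Dom C (FArr H g) = X Y'" "Cod C (FArr H g) = X Y''"
      using f g HA(1)[OF f] HA(1)[OF g] by (auto simp: in_Hom)
    show "FArr H (g \<bullet>\<^bsub>D\<^esub> f) = FArr H g \<bullet>\<^bsub>C\<^esub> FArr H f"
    proof (rule uniq[OF HA(1)[OF gf] _ O(4)])
      show "FArr H g \<bullet>\<^bsub>C\<^esub> FArr H f \<in> Hom C (X Y) (X Y'')" by (simp add: in_Hom)
      show "i Y'' \<bullet>\<^bsub>D\<^esub> FArr F (FArr H (g \<bullet>\<^bsub>D\<^esub> f)) = i Y'' \<bullet>\<^bsub>D\<^esub> FArr F (FArr H g \<bullet>\<^bsub>C\<^esub> FArr H f)"
        unfolding HA(2)[OF gf] using O HA(2)[OF f]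
        by (simp add: tgt.pre[OF HA(2)[OF g]])
    qed
  qed
  have FH: "is_functor D D (comp_functor F H)"
    by unfold_locales (auto simp: in_Hom X)
  have HF: "is_functor C C (comp_functor H F)"
    by unfold_locales (auto simp: in_Hom X)
  have idC: "is_functor C C id_functor" and idD: "is_functor D D id_functor"
    by unfold_locales auto
  have "natural_iso D D (comp_functor F H) id_functor i"
  proof (intro natural_iso.intro natural_iso_axioms.intro FH idD)
    show "i Y \<bullet>\<^bsub>D\<^esub> FArr (comp_functor F H) f = FArr id_functor f \<bullet>\<^bsub>D\<^esub> i Z" if "f \<in> Hom D Z Y" for f Z Y
      using HA(2)[OF that] by simp
  qed (use i ii in auto)
  moreover have "\<exists>\<eta>. natural_iso C C id_functor (comp_functor H F) \<eta>"
  proof -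
    have "\<exists>e \<in> Hom C Z (X (FObj F Z)). i (FObj F Z) \<bullet>\<^bsub>D\<^esub> FArr F e = Idn D (FObj F Z) \<and> is_iso C e"
      if Z: "Z \<in> Obj C" for Z
    proof -
      have Z': "FObj F Z \<in> Obj D" using Z by simp
      obtain j where j: "j \<in> Hom D (FObj F Z) (FObj F (X (FObj F Z)))"
        "i (FObj F Z) \<bullet>\<^bsub>D\<^esub> j = Idn D (FObj F Z)" "is_iso D j"
        using tgt.isoE[OF ii[OF Z'] i[OF Z']] by metis
      obtain e where "e \<in> Hom C Z (X (FObj F Z))" "FArr F e = j" using full[OF Z X[OF Z'] j(1)] by blast
      then show ?thesis using j iso_reflect by blast
    qed
    then obtain e where e: "\<And>Z. Z \<in> Obj C \<Longrightarrow> e Z \<in> Hom C Z (X (FObj F Z))"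
      "\<And>Z. Z \<in> Obj C \<Longrightarrow> i (FObj F Z) \<bullet>\<^bsub>D\<^esub> FArr F (e Z) = Idn D (FObj F Z)"
      "\<And>Z. Z \<in> Obj C \<Longrightarrow> is_iso C (e Z)"
      by metis
    have "natural_iso C C id_functor (comp_functor H F) e"
    proof (intro natural_iso.intro natural_iso_axioms.intro HF idC)
      fix f Z Y assume f: "f \<in> Hom C Z Y"
      note O = src.Hom_Obj[OF f] and Ff = FArr_Hom[OF f]
      note D = HA[OF Ff]
      have [simp]: "f \<in> Arr C" "Dom C f = Z" "Cod C f = Y" "e Z \<in> Arr C" "Dom C (e Z) = Z" "Cod C (e Z) = X (FObj F Z)"
        "e Y \<in> Arr C" "Dom C (e Y) = Y" "Cod C (e Y) = X (FObj F Y)"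
        using f e(1)[OF O(1)] e(1)[OF O(2)] by (auto simp: in_Hom)
      have "e Y \<bullet>\<^bsub>C\<^esub> f = FArr H (FArr F f) \<bullet>\<^bsub>C\<^esub> e Z"
      proof (rule uniq[of _ Z "FObj F Y"])
        show "i (FObj F Y) \<bullet>\<^bsub>D\<^esub> FArr F (e Y \<bullet>\<^bsub>C\<^esub> f) = i (FObj F Y) \<bullet>\<^bsub>D\<^esub> FArr F (FArr H (FArr F f) \<bullet>\<^bsub>C\<^esub> e Z)"
          using O e(2)[OF O(1)]
          by (simp add: tgt.pre[OF e(2)[OF O(2)]] tgt.pre[OF D(2)])
      qed (use O D in \<open>auto simp: in_Hom\<close>)
      then show "e Y \<bullet>\<^bsub>C\<^esub> FArr id_functor f = FArr (comp_functor H F) f \<bullet>\<^bsub>C\<^esub> e Z" by simp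
    qed (use e in auto)
    then show ?thesis by blast
  qed
  ultimately show ?thesis
    unfolding is_equivalence_def using is_functor_axioms H.is_functor_axioms by blast
qed

lemma op_equivalence: "equivalence_functor (opc C) (opc D) F"
proof -
  interpret oC: category "opc C" by (rule src.op_category)
  interpret oD: category "opc D" by (rule tgt.op_category)
  show ?thesis
  proof
    fix Y assume "Y \<in> Obj (opc D)"
    then have "Y \<in> Obj D" by (simp add: opc_simps)
    then obtain X i where "X \<in> Obj C" "i \<in> Hom D (FObj F X) Y" "is_iso D i"
      using dense by blast
    then show "\<exists>X \<in> Obj (opc C). \<exists>i \<in> Hom (opc D) (FObj F X) Y. is_iso (opc D) i"
      unfolding opc_simps opc_iso using tgt.isoE by metis
  next
    fix f f' X Y assume "f \<in> Hom (opc C) X Y" "f' \<in> Hom (opc C) X Y" "FArr F f = FArr F f'"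
    then show "f = f'" using faithful unfolding opc_simps by blast
  next
    fix X Y h assume "X \<in> Obj (opc C)" "Y \<in> Obj (opc C)" "h \<in> Hom (opc D) (FObj F X) (FObj F Y)"
    then show "\<exists>f \<in> Hom (opc C) X Y. FArr F f = h" using full unfolding opc_simps by blast
  qed (auto simp: opc_simps FArr_Hom in_Hom)
qed

lemma test_object:
  assumes W: "W \<in> Obj D"
  obtains V i where "V \<in> Obj C" "i \<in> Hom D (FObj F V) W" "is_iso D i"
    "\<And>X u. \<lbrakk>X \<in> Obj C; u \<in> Hom D W (FObj F X)\<rbrakk> \<Longrightarrow> \<exists>u' \<in> Hom C V X. FArr F u' = u \<bullet>\<^bsub>D\<^esub> i"
proof -
  obtain V i where V: "V \<in> Obj C" "i \<in> Hom D (FObj F V) W" "is_iso D i" using dense[OF W] by blast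
  have "\<exists>u' \<in> Hom C V X. FArr F u' = u \<bullet>\<^bsub>D\<^esub> i" if "X \<in> Obj C" "u \<in> Hom D W (FObj F X)" for X u
    using full[OF V(1) that(1)] that(2) V(2) by (auto simp: in_Hom)
  then show ?thesis using that V by blast
qed

lemma jointly_monic:
  assumes S: "S \<in> Obj C" and \<pi>: "\<And>h. h \<in> I \<Longrightarrow> \<pi> h \<in> Arr C \<and> Dom C (\<pi> h) = S"
    and jm: "\<And>W u v. \<lbrakk>u \<in> Hom C W S; v \<in> Hom C W S; \<And>h. h \<in> I \<Longrightarrow> \<pi> h \<bullet>\<^bsub>C\<^esub> u = \<pi> h \<bullet>\<^bsub>C\<^esub> v\<rbrakk> \<Longrightarrow> u = v"
    and u: "u \<in> Hom D W (FObj F S)" and v: "v \<in> Hom D W (FObj F S)"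
    and eq: "\<And>h. h \<in> I \<Longrightarrow> FArr F (\<pi> h) \<bullet>\<^bsub>D\<^esub> u = FArr F (\<pi> h) \<bullet>\<^bsub>D\<^esub> v"
  shows "u = v"
proof -
  obtain V i where V: "V \<in> Obj C" and i: "i \<in> Hom D (FObj F V) W" "is_iso D i"
    and lift: "\<And>X u. \<lbrakk>X \<in> Obj C; u \<in> Hom D W (FObj F X)\<rbrakk> \<Longrightarrow> \<exists>u' \<in> Hom C V X. FArr F u' = u \<bullet>\<^bsub>D\<^esub> i"
    using test_object[OF tgt.Hom_Obj(1)[OF u]] by blast
  obtain u' v' where u': "u' \<in> Hom C V S" "FArr F u' = u \<bullet>\<^bsub>D\<^esub> i" and v': "v' \<in> Hom C V S" "FArr F v' = v \<bullet>\<^bsub>D\<^esub> i"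
    using lift[OF S u] lift[OF S v] by blast
  have "\<pi> h \<bullet>\<^bsub>C\<^esub> u' = \<pi> h \<bullet>\<^bsub>C\<^esub> v'" if h: "h \<in> I" for h
  proof (rule faithful[of _ V "Cod C (\<pi> h)"])
    have "FArr F (\<pi> h) \<bullet>\<^bsub>D\<^esub> (u \<bullet>\<^bsub>D\<^esub> i) = (FArr F (\<pi> h) \<bullet>\<^bsub>D\<^esub> u) \<bullet>\<^bsub>D\<^esub> i" using \<pi>[OF h] u i by (simp add: in_Hom)
    also have "\<dots> = FArr F (\<pi> h) \<bullet>\<^bsub>D\<^esub> (v \<bullet>\<^bsub>D\<^esub> i)" unfolding eq[OF h] using \<pi>[OF h] v i by (simp add: in_Hom)
    finally show "FArr F (\<pi> h \<bullet>\<^bsub>C\<^esub> u') = FArr F (\<pi> h \<bullet>\<^bsub>C\<^esub> v')"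
      using u' v' \<pi>[OF h] by (simp add: in_Hom)
  qed (use u' v' \<pi>[OF h] in \<open>auto simp: in_Hom\<close>)
  then have "u' = v'" using jm u'(1) v'(1) by blast
  then have "u \<bullet>\<^bsub>D\<^esub> i = v \<bullet>\<^bsub>D\<^esub> i" using u' v' by simp
  then show ?thesis
    by (rule tgt.epiD[OF tgt.iso_epi[OF i(2)], where W="FObj F S"]) (use u v i in \<open>auto simp: in_Hom\<close>)
qed

lemma pres_mono:
  assumes m: "mono_arr C m"
  shows "mono_arr D (FArr F m)"
proof -
  have [simp]: "m \<in> Arr C" using src.mono_Arr[OF m] .
  show ?thesis
  proof (rule tgt.monoI)
    fix W u v assume "u \<in> Hom D W (Dom D (FArr F m))" "v \<in> Hom D W (Dom D (FArr F m))"
      "FArr F m \<bullet>\<^bsub>D\<^esub> u = FArr F m \<bullet>\<^bsub>D\<^esub> v"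
    then show "u = v"
      using jointly_monic[of "Dom C m" "{()}" "\<lambda>_. m" u W v] src.monoD[OF m] by simp
  qed simp
qed

lemma pres_epi: "epi_arr C e \<Longrightarrow> epi_arr D (FArr F e)"
  using equivalence_functor.pres_mono[OF op_equivalence] by (simp add: opc_simps)

lemma pres_terminal:
  assumes Z: "Z \<in> Obj C" "\<forall>X \<in> Obj C. \<exists>!f. f \<in> Hom C X Z" and W: "W \<in> Obj D"
  shows "\<exists>!f. f \<in> Hom D W (FObj F Z)"
proof -
  obtain V i where V: "V \<in> Obj C" and i: "i \<in> Hom D (FObj F V) W" "is_iso D i"
    using dense[OF W] by blast
  obtain j where j: "j \<in> Hom D W (FObj F V)" using tgt.isoE[OF i(2,1)] by metis
  obtain z where "z \<in> Hom C V Z" using Z V by blast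
  then have "FArr F z \<bullet>\<^bsub>D\<^esub> j \<in> Hom D W (FObj F Z)" using tgt.Cmp_Hom[OF j FArr_Hom] by blast
  moreover have "f = g" if "f \<in> Hom D W (FObj F Z)" "g \<in> Hom D W (FObj F Z)" for f g
  proof (rule jointly_monic[OF Z(1) _ _ that, of "{}"])
    show "u = v" if "u \<in> Hom C W Z" "v \<in> Hom C W Z" for u v W
      using Z(2) src.Hom_Obj(1)[OF that(1)] that by blast
  qed auto
  ultimately show ?thesis by blast
qed

lemma pres_zero_obj:
  assumes "zero_obj C Z"
  shows "zero_obj D (FObj F Z)"
proof -
  have Z: "Z \<in> Obj C" "\<forall>X \<in> Obj C. \<exists>!f. f \<in> Hom C X Z" "\<forall>X \<in> Obj C. \<exists>!f. f \<in> Hom C Z X"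
    using assms by (auto simp: zero_obj_def)
  show ?thesis unfolding zero_obj_def
    using Z(1) pres_terminal[OF Z(1,2)]
      equivalence_functor.pres_terminal[OF op_equivalence, of Z, unfolded opc_simps, OF Z(1,3)] by simp
qed

lemma pres_zero:
  assumes "zero_arr C f"
  shows "zero_arr D (FArr F f)"
proof -
  have f: "f \<in> Hom C (Dom C f) (Cod C f)" using src.zero_Arr[OF assms] by (simp add: in_Hom)
  obtain Z u v where *: "zero_obj C Z" "u \<in> Hom C (Dom C f) Z" "v \<in> Hom C Z (Cod C f)" "f = v \<bullet>\<^bsub>C\<^esub> u"
    using src.zero_arrE[OF assms f] by metis
  have "zero_arr D (FArr F v \<bullet>\<^bsub>D\<^esub> FArr F u)"
    by (rule tgt.zero_arrI[OF pres_zero_obj[OF *(1)] FArr_Hom[OF *(2)] FArr_Hom[OF *(3)]])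
  then show ?thesis using FArr_Cmp[OF *(2,3)] *(4) by simp
qed

lemma reflect_zero:
  assumes z: "zero_obj C Z" and f: "f \<in> Arr C" "zero_arr D (FArr F f)"
  shows "zero_arr C f"
proof -
  obtain g where g: "g \<in> Hom C (Dom C f) (Cod C f)" "zero_arr C g"
    using src.zero_arr_exists[OF z, of "Dom C f" "Cod C f"] f by auto
  have "FArr F f = FArr F g"
    by (rule tgt.zero_unique[OF f(2) pres_zero[OF g(2)]]) (use f g in \<open>auto simp: in_Hom\<close>)
  then have "f = g" using faithful[of f _ _ g] f g by (auto simp: in_Hom)
  then show ?thesis using g by simp
qed

lemma pres_kernel:
  assumes z: "zero_obj C Z" and k: "is_kernel C k f"
  shows "is_kernel D (FArr F k) (FArr F f)"
proof -
  note [simp] = src.kernelD(1-3)[OF k]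
  show ?thesis
  proof (rule tgt.kernelI)
    show "mono_arr D (FArr F k)" by (rule pres_mono[OF src.kernel_mono[OF k]])
    show "zero_arr D (FArr F f \<bullet>\<^bsub>D\<^esub> FArr F k)" using pres_zero[OF src.kernelD(4)[OF k]] by simp
    fix W h assume "h \<in> Hom D W (Dom D (FArr F f))" and zh: "zero_arr D (FArr F f \<bullet>\<^bsub>D\<^esub> h)"
    then have h: "h \<in> Hom D W (FObj F (Dom C f))" by simp
    obtain V i where V: "V \<in> Obj C" and i: "i \<in> Hom D (FObj F V) W" "is_iso D i"
      and lift: "\<And>X u. \<lbrakk>X \<in> Obj C; u \<in> Hom D W (FObj F X)\<rbrakk> \<Longrightarrow> \<exists>u' \<in> Hom C V X. FArr F u' = u \<bullet>\<^bsub>D\<^esub> i"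
      using test_object[OF tgt.Hom_Obj(1)[OF h]] by blast
    obtain j where j: "j \<in> Hom D W (FObj F V)" "i \<bullet>\<^bsub>D\<^esub> j = Idn D W" using tgt.isoE[OF i(2,1)] by metis
    obtain h' where h': "h' \<in> Hom C V (Dom C f)" "FArr F h' = h \<bullet>\<^bsub>D\<^esub> i" using lift[OF _ h] by auto
    have hs: "h' \<in> Arr C" "Cod C h' = Dom C f" "h \<in> Arr D" "Cod D h = FObj F (Dom C f)" "i \<in> Arr D" "Cod D i = W" "Dom D h = W"
      "j \<in> Arr D" "Dom D j = W" "Cod D j = FObj F V" "Dom D i = FObj F V"
      using h h' i j by (auto simp: in_Hom)
    have "zero_arr D ((FArr F f \<bullet>\<^bsub>D\<^esub> h) \<bullet>\<^bsub>D\<^esub> i)"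
      by (rule tgt.zero_comp_right[OF zh]) (use hs in auto)
    then have "zero_arr C (f \<bullet>\<^bsub>C\<^esub> h')" using hs h'(2) by (intro reflect_zero[OF z]) auto
    then obtain u where u: "u \<in> Hom C V (Dom C k)" "k \<bullet>\<^bsub>C\<^esub> u = h'"
      using src.kernel_factor[OF k _ h'(1)] by metis
    have us: "u \<in> Arr C" "Dom C u = V" "Cod C u = Dom C k" using u by (auto simp: in_Hom)
    have "FArr F k \<bullet>\<^bsub>D\<^esub> FArr F u = h \<bullet>\<^bsub>D\<^esub> i" using arg_cong[OF u(2), of "FArr F"] us h'(2) by simp
    then have "FArr F k \<bullet>\<^bsub>D\<^esub> (FArr F u \<bullet>\<^bsub>D\<^esub> j) = h"
      using us hs j(2) by (simp add: tgt.pre[of "FArr F k" "FArr F u" "h \<bullet>\<^bsub>D\<^esub> i"])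
    moreover have "FArr F u \<bullet>\<^bsub>D\<^esub> j \<in> Hom D W (Dom D (FArr F k))" using us hs by (auto simp: in_Hom)
    ultimately show "\<exists>u \<in> Hom D W (Dom D (FArr F k)). FArr F k \<bullet>\<^bsub>D\<^esub> u = h" by blast
  qed auto
qed

lemma pres_cokernel:
  assumes "zero_obj C Z" "is_cokernel C k f"
  shows "is_cokernel D (FArr F k) (FArr F f)"
  using equivalence_functor.pres_kernel[OF op_equivalence, of Z k f] assms by (simp add: opc_simps)

end

definition is_product :: "('o, 'm) cat \<Rightarrow> 'i set \<Rightarrow> ('i \<Rightarrow> 'o) \<Rightarrow> 'o \<Rightarrow> ('i \<Rightarrow> 'm) \<Rightarrow> bool" where
  "is_product C I Z S \<pi> \<longleftrightarrow> S \<in> Obj C \<and> (\<forall>h \<in> I. \<pi> h \<in> Hom C S (Z h)) \<and>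
     (\<forall>W u. W \<in> Obj C \<longrightarrow> (\<forall>h \<in> I. u h \<in> Hom C W (Z h)) \<longrightarrow>
       (\<exists>!x. x \<in> Hom C W S \<and> (\<forall>h \<in> I. \<pi> h \<bullet>\<^bsub>C\<^esub> x = u h)))"

context category
begin

lemma productD:
  assumes "is_product C I Z S \<pi>"
  shows "S \<in> Obj C" "h \<in> I \<Longrightarrow> \<pi> h \<in> Hom C S (Z h)"
  using assms by (auto simp: is_product_def)

lemma product_map:
  assumes "is_product C I Z S \<pi>" "W \<in> Obj C" "\<And>h. h \<in> I \<Longrightarrow> u h \<in> Hom C W (Z h)"
  shows "\<exists>x \<in> Hom C W S. \<forall>h \<in> I. \<pi> h \<bullet> x = u h"
proof -
  have "\<exists>!x. x \<in> Hom C W S \<and> (\<forall>h \<in> I. \<pi> h \<bullet> x = u h)"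
    using assms unfolding is_product_def by simp
  then show ?thesis by blast
qed

lemma product_eq:
  assumes p: "is_product C I Z S \<pi>" and u: "u \<in> Hom C W S" and v: "v \<in> Hom C W S"
    and eq: "\<And>h. h \<in> I \<Longrightarrow> \<pi> h \<bullet> u = \<pi> h \<bullet> v"
  shows "u = v"
proof -
  have "\<forall>h \<in> I. \<pi> h \<bullet> v \<in> Hom C W (Z h)" using productD(2)[OF p] Cmp_Hom[OF v] by blast
  then have "\<exists>!x. x \<in> Hom C W S \<and> (\<forall>h \<in> I. \<pi> h \<bullet> x = \<pi> h \<bullet> v)"
    using p Hom_Obj(1)[OF u] unfolding is_product_def by simp
  then show ?thesis using u v eq by blast
qed

end

abbreviation "is_product2 C X Y S p r \<equiv>
  is_product C UNIV (\<lambda>b. if b then X else Y) S (\<lambda>b. if b then p else r)"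

context category
begin

lemma product2_map:
  assumes p: "is_product2 C X Y S p r" and u: "u \<in> Hom C W X" and v: "v \<in> Hom C W Y"
  shows "\<exists>x \<in> Hom C W S. p \<bullet> x = u \<and> r \<bullet> x = v"
proof -
  have "(if b then u else v) \<in> Hom C W (if b then X else Y)" for b using u v by simp
  then obtain x where x: "x \<in> Hom C W S"
    "\<forall>b \<in> UNIV. (if b then p else r) \<bullet> x = (if b then u else v)"
    using product_map[OF p Hom_Obj(1)[OF u], of "\<lambda>b. if b then u else v"] by blast
  from x(2)[THEN bspec, of True] x(2)[THEN bspec, of False] show ?thesis
    using x(1) by (intro bexI[of _ x]) simp_all
qed

lemma product2_eq:
  assumes "is_product2 C X Y S p r" "u \<in> Hom C W S" "v \<in> Hom C W S" "p \<bullet> u = p \<bullet> v" "r \<bullet> u = r \<bullet> v"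
  shows "u = v"
  by (rule product_eq[OF assms(1-3)]) (use assms(4,5) in simp)

end

lemma (in additive_category) biproduct_product2:
  assumes i: "i \<in> Hom C X S" and j: "j \<in> Hom C Y S" and p: "p \<in> Hom C S X" and r: "r \<in> Hom C S Y"
    and eqs: "p \<bullet> i = Idn C X" "r \<bullet> j = Idn C Y" "zero_arr C (r \<bullet> i)" "zero_arr C (p \<bullet> j)"
      "add (i \<bullet> p) (j \<bullet> r) = Idn C S"
  shows "is_product2 C X Y S p r"
  unfolding is_product_def
proof (intro conjI allI impI ballI)
  show "S \<in> Obj C" using Hom_Obj[OF i] by simp
  show "(if b then p else r) \<in> Hom C S (if b then X else Y)" for b using p r by simp
  fix W u assume "\<forall>b \<in> UNIV. u b \<in> Hom C W (if b then X else Y)"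
  from bspec[OF this, of True] bspec[OF this, of False]
  have u: "u True \<in> Hom C W X" "u False \<in> Hom C W Y" by auto
  have "(\<forall>b \<in> UNIV. (if b then p else r) \<bullet> x = u b) \<longleftrightarrow> p \<bullet> x = u True \<and> r \<bullet> x = u False" for x
    unfolding ball_UNIV all_bool_eq by auto
  then show "\<exists>!x. x \<in> Hom C W S \<and> (\<forall>b \<in> UNIV. (if b then p else r) \<bullet> x = u b)"
    using biproduct_product[OF i j p r eqs u] by presburger
qed

lemma (in abelian_category) finite_product_exists:
  assumes "finite I" "\<And>h. h \<in> I \<Longrightarrow> Z h \<in> Obj C"
  shows "\<exists>S \<pi>. is_product C I Z S \<pi>"
  using assms
proof (induction I)
  case empty
  obtain O' where "zero_obj C O'" using zero_object by blast
  then have "is_product C {} Z O' \<pi>" for \<pi> by (simp add: is_product_def zero_obj_def)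
  then show ?case by blast
next
  case (insert a I)
  then obtain S \<pi> where p: "is_product C I Z S \<pi>" by auto
  obtain P p1 p2 where P: "p1 \<in> Hom C P (Z a)" "p2 \<in> Hom C P S"
    and univ: "\<forall>W. \<forall>u \<in> Hom C W (Z a). \<forall>v \<in> Hom C W S. \<exists>!h. h \<in> Hom C W P \<and> p1 \<bullet> h = u \<and> p2 \<bullet> h = v"
    using product[of "Z a" S] insert.prems productD(1)[OF p] by blast
  define \<rho> where "\<rho> h = (if h = a then p1 else \<pi> h \<bullet> p2)" for h
  have "is_product C (insert a I) Z P \<rho>"
    unfolding is_product_def
  proof (intro conjI ballI allI impI)
    show "P \<in> Obj C" using Hom_Obj[OF P(1)] by simp
    show "\<rho> h \<in> Hom C P (Z h)" if "h \<in> insert a I" for h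
      using that P(1) Cmp_Hom[OF P(2) productD(2)[OF p]] by (auto simp: \<rho>_def)
    fix W u assume W: "W \<in> Obj C" and u: "\<forall>h \<in> insert a I. u h \<in> Hom C W (Z h)"
    obtain v where v: "v \<in> Hom C W S" "\<forall>h \<in> I. \<pi> h \<bullet> v = u h"
      using product_map[OF p W, of u] u by blast
    have assoc2: "\<rho> h \<bullet> y = \<pi> h \<bullet> (p2 \<bullet> y)" if "h \<in> I" "y \<in> Hom C W P" for h y
      using that insert.hyps(2) P(2) productD(2)[OF p that(1)] by (auto simp: \<rho>_def in_Hom)
    obtain x where x: "x \<in> Hom C W P" "p1 \<bullet> x = u a" "p2 \<bullet> x = v"
      using univ u v(1) by blast
    show "\<exists>!x. x \<in> Hom C W P \<and> (\<forall>h \<in> insert a I. \<rho> h \<bullet> x = u h)"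
    proof (rule ex1I[of _ x])
      show "x \<in> Hom C W P \<and> (\<forall>h \<in> insert a I. \<rho> h \<bullet> x = u h)"
        using x v(2) assoc2[OF _ x(1)] by (auto simp: \<rho>_def)
      fix y assume y: "y \<in> Hom C W P \<and> (\<forall>h \<in> insert a I. \<rho> h \<bullet> y = u h)"
      then have y1: "p1 \<bullet> y = u a" by (auto simp: \<rho>_def)
      have "p2 \<bullet> y = v"
      proof (rule product_eq[OF p _ v(1)])
        show "p2 \<bullet> y \<in> Hom C W S" using y P(2) Cmp_Hom by blast
        show "\<pi> h \<bullet> (p2 \<bullet> y) = \<pi> h \<bullet> v" if h: "h \<in> I" for h
        proof -
          have "\<rho> h \<bullet> y = \<pi> h \<bullet> (p2 \<bullet> y)" "\<rho> h \<bullet> y = u h" "\<pi> h \<bullet> v = u h"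
            using assoc2[OF h] y h v(2) by blast+
          then show ?thesis by simp
        qed
      qed
      then show "y = x" using univ u v(1) x y y1 by blast
    qed
  qed
  then show ?case by blast
qed

lemma (in equivalence_functor) pres_product:
  assumes p: "is_product C I Z S \<pi>"
  shows "is_product D I (\<lambda>h. FObj F (Z h)) (FObj F S) (\<lambda>h. FArr F (\<pi> h))"
  unfolding is_product_def
proof (intro conjI ballI allI impI)
  note P = src.productD[OF p]
  show "FObj F S \<in> Obj D" using P(1) by simp
  show "FArr F (\<pi> h) \<in> Hom D (FObj F S) (FObj F (Z h))" if "h \<in> I" for h
    using FArr_Hom[OF P(2)[OF that]] .
  fix W u assume W: "W \<in> Obj D" and u: "\<forall>h \<in> I. u h \<in> Hom D W (FObj F (Z h))"
  obtain V i where V: "V \<in> Obj C" and i: "i \<in> Hom D (FObj F V) W" "is_iso D i"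
    and lift: "\<And>X u. \<lbrakk>X \<in> Obj C; u \<in> Hom D W (FObj F X)\<rbrakk> \<Longrightarrow> \<exists>u' \<in> Hom C V X. FArr F u' = u \<bullet>\<^bsub>D\<^esub> i"
    using test_object[OF W] by blast
  obtain j where j: "j \<in> Hom D W (FObj F V)" "i \<bullet>\<^bsub>D\<^esub> j = Idn D W" using tgt.isoE[OF i(2,1)] by metis
  have "\<forall>h \<in> I. \<exists>u' \<in> Hom C V (Z h). FArr F u' = u h \<bullet>\<^bsub>D\<^esub> i"
    using lift src.Hom_Obj(2)[OF P(2)] u by blast
  then obtain u' where u': "\<And>h. h \<in> I \<Longrightarrow> u' h \<in> Hom C V (Z h)" "\<And>h. h \<in> I \<Longrightarrow> FArr F (u' h) = u h \<bullet>\<^bsub>D\<^esub> i"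
    by metis
  obtain x where x: "x \<in> Hom C V S" "\<forall>h \<in> I. \<pi> h \<bullet>\<^bsub>C\<^esub> x = u' h"
    using src.product_map[OF p V, of u'] u'(1) by blast
  have jm: "y = y'" if "y \<in> Hom D W (FObj F S)" "y' \<in> Hom D W (FObj F S)"
    "\<And>h. h \<in> I \<Longrightarrow> FArr F (\<pi> h) \<bullet>\<^bsub>D\<^esub> y = FArr F (\<pi> h) \<bullet>\<^bsub>D\<^esub> y'" for y y'
    by (rule jointly_monic[OF P(1) _ src.product_eq[OF p] that]) (use P(2) in \<open>auto simp: in_Hom\<close>)
  have xj: "FArr F x \<bullet>\<^bsub>D\<^esub> j \<in> Hom D W (FObj F S)" using tgt.Cmp_Hom[OF j(1) FArr_Hom[OF x(1)]] .
  have e: "FArr F (\<pi> h) \<bullet>\<^bsub>D\<^esub> (FArr F x \<bullet>\<^bsub>D\<^esub> j) = u h" if h: "h \<in> I" for h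
  proof -
    have "FArr F (\<pi> h) \<bullet>\<^bsub>D\<^esub> FArr F x = u h \<bullet>\<^bsub>D\<^esub> i"
      using FArr_Cmp[OF x(1) P(2)[OF h]] x(2) u'(2)[OF h] h by simp
    then show ?thesis using P(2)[OF h] x(1) j i(1) u h
      by (simp add: in_Hom tgt.pre[of "FArr F (\<pi> h)" "FArr F x" "u h \<bullet>\<^bsub>D\<^esub> i"])
  qed
  show "\<exists>!x. x \<in> Hom D W (FObj F S) \<and> (\<forall>h \<in> I. FArr F (\<pi> h) \<bullet>\<^bsub>D\<^esub> x = u h)"
    by (rule ex1I[of _ "FArr F x \<bullet>\<^bsub>D\<^esub> j"]) (use xj e jm in auto)
qed

lemma (in equivalence_functor) pres_product2:
  assumes "is_product2 C X Y S p r"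
  shows "is_product2 D (FObj F X) (FObj F Y) (FObj F S) (FArr F p) (FArr F r)"
  using pres_product[OF assms] by (simp only: if_distrib[of "FObj F"] if_distrib[of "FArr F"])

lemma (in additive_category) equivalence_additive:
  assumes F: "equivalence_functor C C F" and f: "f \<in> Hom C X Y" and g: "g \<in> Hom C X Y"
  shows "FArr F (add f g) = add (FArr F f) (FArr F g)"
proof -
  interpret F: equivalence_functor C C F by (rule F)
  note XY = Hom_Obj[OF f]
  obtain S i j p r where ij: "i \<in> Hom C Y S" "j \<in> Hom C Y S" and pr: "p \<in> Hom C S Y" "r \<in> Hom C S Y"
    and eqs: "p \<bullet> i = Idn C Y" "r \<bullet> j = Idn C Y" "zero_arr C (r \<bullet> i)" "zero_arr C (p \<bullet> j)"
      "add (i \<bullet> p) (j \<bullet> r) = Idn C S"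
    using biproduct_exists[OF XY(2,2)] by blast
  note univ = biproduct_product[OF ij pr eqs]
  have S: "S \<in> Obj C" using Hom_Obj[OF ij(1)] by blast
  let ?s = "add p r"
  have [simp]: "f \<in> Arr C" "Dom C f = X" "Cod C f = Y" "g \<in> Arr C" "Dom C g = X" "Cod C g = Y"
    "i \<in> Arr C" "Dom C i = Y" "Cod C i = S" "j \<in> Arr C" "Dom C j = Y" "Cod C j = S"
    "p \<in> Arr C" "Dom C p = S" "Cod C p = Y" "r \<in> Arr C" "Dom C r = S" "Cod C r = Y"
    using f g ij pr by (auto simp: in_Hom)
  obtain h where h: "h \<in> Hom C X S" "p \<bullet> h = f" "r \<bullet> h = g" using univ[OF f g] by blast
  have sH: "?s \<in> Hom C S Y" using add_Hom pr by blast
  have sh: "?s \<bullet> h = add f g" using Cmp_add_left[OF h(1) pr] h by simp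
  have "?s \<bullet> i = add (Idn C Y) (r \<bullet> i)" using Cmp_add_left[OF ij(1) pr] eqs by simp
  then have si: "?s \<bullet> i = Idn C Y" using add_zero(1)[OF Idn_Hom[OF XY(2)] _ eqs(3)] by (simp add: in_Hom)
  have "?s \<bullet> j = add (p \<bullet> j) (Idn C Y)" using Cmp_add_left[OF ij(2) pr] eqs by simp
  then have sj: "?s \<bullet> j = Idn C Y" using add_zero(2)[OF Idn_Hom[OF XY(2)] _ eqs(4)] by (simp add: in_Hom)
  have [simp]: "?s \<in> Arr C" "Dom C ?s = S" "Cod C ?s = Y" "h \<in> Arr C" "Dom C h = X" "Cod C h = S"
    using sH h(1) by (auto simp: in_Hom)
  note XS = XY S
  let ?F = "FArr F"
  note a = arg_cong[of _ _ "?F"]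
  note Fij = F.FArr_Hom[OF ij(1)] F.FArr_Hom[OF ij(2)] F.FArr_Hom[OF pr(1)] F.FArr_Hom[OF pr(2)]
  have E: "?F p \<bullet> ?F i = Idn C (FObj F Y)" "?F r \<bullet> ?F j = Idn C (FObj F Y)"
    "?F ?s \<bullet> ?F i = Idn C (FObj F Y)" "?F ?s \<bullet> ?F j = Idn C (FObj F Y)"
    "?F p \<bullet> ?F h = ?F f" "?F r \<bullet> ?F h = ?F g" "?F ?s \<bullet> ?F h = ?F (add f g)"
    using a[OF eqs(1)] a[OF eqs(2)] a[OF si] a[OF sj] a[OF h(2)] a[OF h(3)] a[OF sh] XS by simp_all
  have Z: "zero_arr C (?F r \<bullet> ?F i)" "zero_arr C (?F p \<bullet> ?F j)"
    using F.pres_zero[OF eqs(3)] F.pres_zero[OF eqs(4)] by simp_all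
  let ?t = "add (?F i \<bullet> ?F p) (?F j \<bullet> ?F r)"
  have tH1: "?F i \<bullet> ?F p \<in> Hom C (FObj F S) (FObj F S)" "?F j \<bullet> ?F r \<in> Hom C (FObj F S) (FObj F S)"
    using Cmp_Hom[OF Fij(3,1)] Cmp_Hom[OF Fij(4,2)] by auto
  have tH: "?t \<in> Hom C (FObj F S) (FObj F S)" using add_Hom[OF tH1] .
  have "?t = Idn C (FObj F S)"
  proof (rule F.jointly_monic[of S "{True, False}" "\<lambda>b. if b then p else r"])
    show "u = v" if "u \<in> Hom C W S" "v \<in> Hom C W S"
      "\<And>b. b \<in> {True, False} \<Longrightarrow> (if b then p else r) \<bullet> u = (if b then p else r) \<bullet> v" for W u v
    proof -
      have "p \<bullet> u \<in> Hom C W Y" "r \<bullet> u \<in> Hom C W Y" using that(1) by (auto simp: in_Hom)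
      moreover have "p \<bullet> u = p \<bullet> v" "r \<bullet> u = r \<bullet> v" using that(3)[of True] that(3)[of False] by auto
      ultimately show ?thesis using univ that(1,2) by metis
    qed
    have "?F p \<bullet> ?t = add (?F p \<bullet> (?F i \<bullet> ?F p)) (?F p \<bullet> (?F j \<bullet> ?F r))"
      by (rule Cmp_add_right[OF tH1 Fij(3)])
    also have "?F p \<bullet> (?F i \<bullet> ?F p) = ?F p" using XS by (simp add: pre[OF E(1)])
    also have "add (?F p) (?F p \<bullet> (?F j \<bullet> ?F r)) = ?F p"
      by (rule add_zero(1)[OF Fij(3)]) (use zero_comp_right[OF Z(2), of "?F r"] in \<open>auto simp: in_Hom\<close>)
    finally have 1: "?F p \<bullet> ?t = ?F p" .
    have "?F r \<bullet> ?t = add (?F r \<bullet> (?F i \<bullet> ?F p)) (?F r \<bullet> (?F j \<bullet> ?F r))"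
      by (rule Cmp_add_right[OF tH1 Fij(4)])
    also have "?F r \<bullet> (?F j \<bullet> ?F r) = ?F r" using XS by (simp add: pre[OF E(2)])
    also have "add (?F r \<bullet> (?F i \<bullet> ?F p)) (?F r) = ?F r"
      by (rule add_zero(2)[OF Fij(4)]) (use zero_comp_right[OF Z(1), of "?F p"] in \<open>auto simp: in_Hom\<close>)
    finally have 2: "?F r \<bullet> ?t = ?F r" .
    show "?F (if b then p else r) \<bullet> ?t = ?F (if b then p else r) \<bullet> Idn C (FObj F S)" for b
      using 1 2 XS by simp
    show "Idn C (FObj F S) \<in> Hom C (FObj F S) (FObj F S)" using XS Idn_Hom by simp
  qed (use tH S in auto)
  then have "?F h = ?t \<bullet> ?F h" using XS by simp
  also have "\<dots> = add (?F i \<bullet> ?F f) (?F j \<bullet> ?F g)"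
    using Cmp_add_left[OF F.FArr_Hom[OF h(1)] tH1] by (simp add: E(5,6))
  finally have Fh: "?F h = add (?F i \<bullet> ?F f) (?F j \<bullet> ?F g)" .
  have "?F (add f g) = ?F ?s \<bullet> add (?F i \<bullet> ?F f) (?F j \<bullet> ?F g)" unfolding E(7)[symmetric] Fh[symmetric] ..
  also have "\<dots> = add (?F ?s \<bullet> (?F i \<bullet> ?F f)) (?F ?s \<bullet> (?F j \<bullet> ?F g))"
    by (rule Cmp_add_right[of _ "FObj F X" "FObj F S" _ _ "FObj F Y"]) (auto simp: in_Hom)
  also have "\<dots> = add (?F f) (?F g)" using XS by (simp add: pre[OF E(3)] pre[OF E(4)])
  finally show ?thesis .
qed

section \<open>The category of equivariant objects\<close>

locale functor_family = category C
  for G :: "('g, 'x) monoid_scheme" and C :: "('o, 'm) cat" (structure)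
    and F :: "'g \<Rightarrow> ('o, 'm, 'o, 'm) cfunctor" and \<epsilon> :: "'g \<Rightarrow> 'g \<Rightarrow> 'o \<Rightarrow> 'm" +
  assumes F_functor: "g \<in> carrier G \<Longrightarrow> is_functor C C (F g)"
begin

abbreviation "E \<equiv> equivariant_cat G C F \<epsilon>"
abbreviation "Fo g \<equiv> FObj (F g)"
abbreviation "Fa g \<equiv> FArr (F g)"

lemma Fa_simps [simp]:
  assumes "g \<in> carrier G"
  shows "X \<in> Obj C \<Longrightarrow> Fo g X \<in> Obj C"
    and "f \<in> Arr C \<Longrightarrow> Fa g f \<in> Arr C"
    and "f \<in> Arr C \<Longrightarrow> Dom C (Fa g f) = Fo g (Dom C f)"
    and "f \<in> Arr C \<Longrightarrow> Cod C (Fa g f) = Fo g (Cod C f)"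
    and "\<lbrakk>f \<in> Arr C; f' \<in> Arr C; Cod C f = Dom C f'\<rbrakk> \<Longrightarrow> Fa g (f' \<bullet> f) = Fa g f' \<bullet> Fa g f"
    and "X \<in> Obj C \<Longrightarrow> Fa g (Idn C X) = Idn C (Fo g X)"
  using is_functor.FObj_Obj[OF F_functor[OF assms]] is_functor.FArr_Arr[OF F_functor[OF assms]]
    is_functor.Dom_FArr[OF F_functor[OF assms]] is_functor.Cod_FArr[OF F_functor[OF assms]]
    is_functor.FArr_comp[OF F_functor[OF assms]] is_functor.FArr_id[OF F_functor[OF assms]]
  by auto

lemma Fa_Hom: "\<lbrakk>g \<in> carrier G; f \<in> Hom C X Y\<rbrakk> \<Longrightarrow> Fa g f \<in> Hom C (Fo g X) (Fo g Y)"
  by (auto simp: in_Hom)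

definition equi :: "('g, 'o, 'm) eobj \<Rightarrow> 'm \<Rightarrow> ('g, 'o, 'm) eobj \<Rightarrow> bool" where
  "equi P \<theta> R \<longleftrightarrow> \<theta> \<in> Hom C (fst P) (fst R) \<and>
     (\<forall>g \<in> carrier G. snd R g \<bullet> \<theta> = Fa g \<theta> \<bullet> snd P g)"

lemma E_Obj: "P \<in> Obj E \<longleftrightarrow> fst P \<in> Obj C \<and> snd P \<in> extensional (carrier G) \<and>
   (\<forall>g \<in> carrier G. snd P g \<in> Hom C (fst P) (Fo g (fst P)) \<and> is_iso C (snd P g)) \<and>
   (\<forall>g \<in> carrier G. \<forall>h \<in> carrier G. snd P (g \<otimes>\<^bsub>G\<^esub> h) =
      (\<epsilon> g h (fst P) \<bullet> Fa g (snd P h)) \<bullet> snd P g)"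
  by (cases P) (auto simp: equivariant_cat_def equivariant_objs_def PiE_iff)

lemma E_sel:
  "Dom E (P, \<theta>, R) = P" "Cod E (P, \<theta>, R) = R" "(R, \<phi>, S) \<bullet>\<^bsub>E\<^esub> (P, \<theta>, Q) = (P, \<phi> \<bullet> \<theta>, S)"
  "Idn E P = (P, Idn C (fst P), P)"
  by (simp_all add: equivariant_cat_def case_prod_unfold)

lemma E_Hom_iff: "a \<in> Hom E P R \<longleftrightarrow> P \<in> Obj E \<and> R \<in> Obj E \<and> (\<exists>\<theta>. a = (P, \<theta>, R) \<and> equi P \<theta> R)"
  unfolding Hom_def by (cases a; cases P; cases R) (auto simp: equivariant_cat_def equi_def in_Hom)

lemma E_Arr_iff: "a \<in> Arr E \<longleftrightarrow> (\<exists>P \<theta> R. a = (P, \<theta>, R) \<and> P \<in> Obj E \<and> R \<in> Obj E \<and> equi P \<theta> R)"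
  using E_Hom_iff[of a "Dom E a" "Cod E a"] by (cases a) (auto simp: in_Hom E_sel)

lemma E_objD:
  assumes "P \<in> Obj E"
  shows "fst P \<in> Obj C"
    and "g \<in> carrier G \<Longrightarrow> snd P g \<in> Arr C"
    and "g \<in> carrier G \<Longrightarrow> Dom C (snd P g) = fst P"
    and "g \<in> carrier G \<Longrightarrow> Cod C (snd P g) = Fo g (fst P)"
    and "g \<in> carrier G \<Longrightarrow> is_iso C (snd P g)"
    and "\<lbrakk>g \<in> carrier G; h \<in> carrier G\<rbrakk>
      \<Longrightarrow> snd P (g \<otimes>\<^bsub>G\<^esub> h) = (\<epsilon> g h (fst P) \<bullet> Fa g (snd P h)) \<bullet> snd P g"
  using assms by (auto simp: E_Obj in_Hom)

lemma equiD:
  assumes "equi P \<theta> R"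
  shows "\<theta> \<in> Arr C" "Dom C \<theta> = fst P" "Cod C \<theta> = fst R"
    and "g \<in> carrier G \<Longrightarrow> snd R g \<bullet> \<theta> = Fa g \<theta> \<bullet> snd P g"
  using assms by (auto simp: equi_def in_Hom)

lemma equi_comp:
  assumes P: "P \<in> Obj E" and R: "R \<in> Obj E" and S: "S \<in> Obj E" and a: "equi P \<theta> R" and b: "equi R \<phi> S"
  shows "equi P (\<phi> \<bullet> \<theta>) S"
proof -
  note [simp] = equiD(1-3)[OF a] equiD(1-3)[OF b] E_objD(2-4)[OF P] E_objD(2-4)[OF R] E_objD(2-4)[OF S]
  have "snd S g \<bullet> (\<phi> \<bullet> \<theta>) = Fa g (\<phi> \<bullet> \<theta>) \<bullet> snd P g" if g: "g \<in> carrier G" for g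
    using g by (simp add: pre[OF equiD(4)[OF b g]] equiD(4)[OF a g])
  then show ?thesis by (simp add: equi_def in_Hom)
qed

lemma equi_Idn: "P \<in> Obj E \<Longrightarrow> equi P (Idn C (fst P)) P"
  by (auto simp: equi_def in_Hom E_objD)

lemma E_category: "category E"
proof
  show "Dom E a \<in> Obj E" "Cod E a \<in> Obj E" if "a \<in> Arr E" for a
    using that by (auto simp: E_Arr_iff E_sel)
  show "Idn E P \<in> Hom E P P" if "P \<in> Obj E" for P
    using that equi_Idn by (auto simp: E_Hom_iff E_sel)
  show "b \<bullet>\<^bsub>E\<^esub> a \<in> Hom E P S" if "a \<in> Hom E P R" "b \<in> Hom E R S" for a b P R S
  proof -
    obtain \<theta> \<phi> where *: "a = (P, \<theta>, R)" "equi P \<theta> R" "b = (R, \<phi>, S)" "equi R \<phi> S"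
      and Ob: "P \<in> Obj E" "R \<in> Obj E" "S \<in> Obj E"
      using \<open>a \<in> Hom E P R\<close> \<open>b \<in> Hom E R S\<close> unfolding E_Hom_iff by blast
    then show ?thesis using equi_comp[OF Ob *(2,4)] Ob by (simp add: E_Hom_iff E_sel)
  qed
  show "a \<bullet>\<^bsub>E\<^esub> Idn E P = a" "Idn E R \<bullet>\<^bsub>E\<^esub> a = a" if aH: "a \<in> Hom E P R" for a P R
  proof -
    obtain \<theta> where "a = (P, \<theta>, R)" "equi P \<theta> R" using aH[unfolded E_Hom_iff] by metis
    then show "a \<bullet>\<^bsub>E\<^esub> Idn E P = a" "Idn E R \<bullet>\<^bsub>E\<^esub> a = a" by (simp_all add: E_sel equi_def in_Hom)
  qed
  show "(c \<bullet>\<^bsub>E\<^esub> b) \<bullet>\<^bsub>E\<^esub> a = c \<bullet>\<^bsub>E\<^esub> (b \<bullet>\<^bsub>E\<^esub> a)"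
    if H: "a \<in> Hom E P R" "b \<in> Hom E R S" "c \<in> Hom E S T" for a b c P R S T
  proof -
    obtain \<theta> \<phi> \<psi> where *: "a = (P, \<theta>, R)" "equi P \<theta> R" "b = (R, \<phi>, S)" "equi R \<phi> S"
      "c = (S, \<psi>, T)" "equi S \<psi> T"
      using H[unfolded E_Hom_iff] by metis
    have "(\<psi> \<bullet> \<phi>) \<bullet> \<theta> = \<psi> \<bullet> (\<phi> \<bullet> \<theta>)"
      using equiD(1-3)[OF *(2)] equiD(1-3)[OF *(4)] equiD(1-3)[OF *(6)] by simp
    then show ?thesis using * by (simp only: E_sel)
  qed
qed

sublocale E: category E
  by (rule E_category)

lemma E_mono_lift:
  assumes a: "(S, k, P) \<in> Arr E" and m: "mono_arr C k"
  shows "mono_arr E (S, k, P)"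
proof (rule E.monoI[OF a])
  fix W u v assume u: "u \<in> Hom E W (Dom E (S, k, P))" and v: "v \<in> Hom E W (Dom E (S, k, P))"
    and eq: "(S, k, P) \<bullet>\<^bsub>E\<^esub> u = (S, k, P) \<bullet>\<^bsub>E\<^esub> v"
  obtain u' v' where *: "u = (W, u', S)" "equi W u' S" "v = (W, v', S)" "equi W v' S"
    using u v by (auto simp: E_Hom_iff E_sel)
  have "Dom C k = fst S" using a by (auto simp: E_Arr_iff equi_def in_Hom)
  then have "u' = v'" using monoD[OF m, of u' v' "fst W"] eq * by (simp add: E_sel equi_def)
  then show "u = v" using * by simp
qed

lemma E_epi_lift:
  assumes a: "(P, k, S) \<in> Arr E" and m: "epi_arr C k"
  shows "epi_arr E (P, k, S)"
proof (rule E.epiI[OF a])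
  fix W u v assume u: "u \<in> Hom E (Cod E (P, k, S)) W" and v: "v \<in> Hom E (Cod E (P, k, S)) W"
    and eq: "u \<bullet>\<^bsub>E\<^esub> (P, k, S) = v \<bullet>\<^bsub>E\<^esub> (P, k, S)"
  obtain u' v' where *: "u = (S, u', W)" "equi S u' W" "v = (S, v', W)" "equi S v' W"
    using u v by (auto simp: E_Hom_iff E_sel)
  have "Cod C k = fst S" using a by (auto simp: E_Arr_iff equi_def in_Hom)
  then have "u' = v'" using epiD[OF m, of u' v' "fst W"] eq * by (simp add: E_sel equi_def)
  then show "u = v" using * by simp
qed

lemma E_iso_lift:
  assumes a: "(P, k, S) \<in> Arr E" and i: "is_iso C k"
  shows "is_iso E (P, k, S)"
proof -
  have P: "P \<in> Obj E" and S: "S \<in> Obj E" and k: "equi P k S" using a by (auto simp: E_Arr_iff)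
  note [simp] = equiD(1-3)[OF k] E_objD(1-4)[OF P] E_objD(1-4)[OF S]
  have "k \<in> Hom C (fst P) (fst S)" using k by (simp add: equi_def)
  then obtain j where j: "j \<in> Hom C (fst S) (fst P)" "j \<bullet> k = Idn C (fst P)" "k \<bullet> j = Idn C (fst S)"
    using isoE[OF i] by metis
  have [simp]: "j \<in> Arr C" "Dom C j = fst S" "Cod C j = fst P" using j(1) by (auto simp: in_Hom)
  have "equi S j P"
    unfolding equi_def
  proof (intro conjI ballI)
    show "j \<in> Hom C (fst S) (fst P)" by fact
    fix g assume g: "g \<in> carrier G"
    have "(Fa g j \<bullet> Fa g k) \<bullet> (snd P g \<bullet> j) = Fa g (j \<bullet> k) \<bullet> (snd P g \<bullet> j)" using g by simp
    then have "snd P g \<bullet> j = Fa g j \<bullet> ((Fa g k \<bullet> snd P g) \<bullet> j)" using g j by simp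
    also have "\<dots> = Fa g j \<bullet> snd S g" unfolding equiD(4)[OF k g, symmetric] using g j by simp
    finally show "snd P g \<bullet> j = Fa g j \<bullet> snd S g" .
  qed
  then have "(P, k, S) \<in> Hom E P S" "(S, j, P) \<in> Hom E S P" using P S k by (auto simp: E_Hom_iff)
  then show ?thesis by (rule E.isoI) (use j in \<open>simp_all add: E_sel\<close>)
qed

end

locale invariant_serre = serre_subcategory C N + act: cat_action G C F \<epsilon>
  for G :: "('g, 'x) monoid_scheme" and C :: "('o, 'm) cat" (structure)
    and F :: "'g \<Rightarrow> ('o, 'm, 'o, 'm) cfunctor" and \<epsilon> :: "'g \<Rightarrow> 'g \<Rightarrow> 'o \<Rightarrow> 'm"
    and N :: "'o set" +
  assumes finite_G: "finite (carrier G)"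
    and invariant: "\<lbrakk>g \<in> carrier G; X \<in> N\<rbrakk> \<Longrightarrow> FObj (F g) X \<in> N"
begin

lemma F_equivalence: "g \<in> carrier G \<Longrightarrow> equivalence_functor C C (F g)"
  by (rule equivalence_functorI[OF act.action_equivalence])

sublocale functor_family G C F \<epsilon>
  by (intro functor_family.intro functor_family_axioms.intro category_axioms
      equivalence_functor.axioms(1)[OF F_equivalence])

lemma eps_simps [simp]:
  assumes "g \<in> carrier G" "h \<in> carrier G" "X \<in> Obj C"
  shows "\<epsilon> g h X \<in> Arr C" "Dom C (\<epsilon> g h X) = Fo g (Fo h X)" "Cod C (\<epsilon> g h X) = Fo (g \<otimes>\<^bsub>G\<^esub> h) X"
    "is_iso C (\<epsilon> g h X)"
  using natural_iso.component_Hom[OF act.action_iso[OF assms(1,2)] assms(3)]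
    natural_iso.component_iso[OF act.action_iso[OF assms(1,2)] assms(3)] by (auto simp: in_Hom)

lemma eps_natural:
  assumes "g \<in> carrier G" "h \<in> carrier G" "f \<in> Arr C" "Dom C f = X" "Cod C f = Y"
  shows "\<epsilon> g h Y \<bullet> Fa g (Fa h f) = Fa (g \<otimes>\<^bsub>G\<^esub> h) f \<bullet> \<epsilon> g h X"
  using natural_iso.naturality[OF act.action_iso[OF assms(1,2)], of f X Y] assms by (simp add: in_Hom)

lemma G_simps [simp]: "\<lbrakk>g \<in> carrier G; h \<in> carrier G\<rbrakk> \<Longrightarrow> g \<otimes>\<^bsub>G\<^esub> h \<in> carrier G"
  "\<one>\<^bsub>G\<^esub> \<in> carrier G" "g \<in> carrier G \<Longrightarrow> inv\<^bsub>G\<^esub> g \<in> carrier G"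
  by auto

lemma Fa_mono: "\<lbrakk>g \<in> carrier G; mono_arr C m\<rbrakk> \<Longrightarrow> mono_arr C (Fa g m)"
  by (rule equivalence_functor.pres_mono[OF F_equivalence])

lemma Fa_epi: "\<lbrakk>g \<in> carrier G; epi_arr C m\<rbrakk> \<Longrightarrow> epi_arr C (Fa g m)"
  by (rule equivalence_functor.pres_epi[OF F_equivalence])

lemma Fa_zero: "\<lbrakk>g \<in> carrier G; zero_arr C m\<rbrakk> \<Longrightarrow> zero_arr C (Fa g m)"
  by (rule equivalence_functor.pres_zero[OF F_equivalence])

lemma Fa_zero_obj: "\<lbrakk>g \<in> carrier G; zero_obj C Z\<rbrakk> \<Longrightarrow> zero_obj C (Fo g Z)"
  by (rule equivalence_functor.pres_zero_obj[OF F_equivalence])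

lemma Fa_kernel: "\<lbrakk>g \<in> carrier G; is_kernel C k f\<rbrakk> \<Longrightarrow> is_kernel C (Fa g k) (Fa g f)"
  using equivalence_functor.pres_kernel[OF F_equivalence] zero_object by metis

lemma Fa_cokernel: "\<lbrakk>g \<in> carrier G; is_cokernel C k f\<rbrakk> \<Longrightarrow> is_cokernel C (Fa g k) (Fa g f)"
  using equivalence_functor.pres_cokernel[OF F_equivalence] zero_object by metis

lemma Fa_reflect_zero: "\<lbrakk>g \<in> carrier G; f \<in> Arr C; zero_arr C (Fa g f)\<rbrakk> \<Longrightarrow> zero_arr C f"
  using equivalence_functor.reflect_zero[OF F_equivalence] zero_object by metis

lemma F_serre: "g \<in> carrier G \<Longrightarrow> serre_endofunctor C N (F g)"
proof (intro serre_endofunctor.intro serre_endofunctor_axioms.intro serre_subcategory_axioms F_functor)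
  assume g: "g \<in> carrier G"
  show "mono_arr C (Fa g m)" if "mono_arr C m" for m using Fa_mono g that .
  show "epi_arr C (Fa g m)" if "epi_arr C m" for m using Fa_epi g that .
  show "Nker C N (Fa g f)" if "Nker C N f" for f
  proof -
    obtain k where k: "is_kernel C k f" "Dom C k \<in> N" using \<open>Nker C N f\<close> by (auto simp: Nker_def)
    then show ?thesis using Fa_kernel[OF g k(1)] invariant[OF g k(2)] kernelD[OF k(1)] g
      unfolding Nker_def by auto
  qed
  show "Ncok C N (Fa g f)" if "Ncok C N f" for f
  proof -
    obtain k where k: "is_cokernel C k f" "Cod C k \<in> N" using \<open>Ncok C N f\<close> by (auto simp: Ncok_def)
    then show ?thesis using Fa_cokernel[OF g k(1)] invariant[OF g k(2)] cokernelD[OF k(1)] g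
      unfolding Ncok_def by auto
  qed
qed

text \<open>\<open>F\<^sub>1\<close> is fully faithful, so \<open>\<epsilon>\<^sub>1\<^sub>,\<^sub>1\<close> at \<open>X\<close> is \<open>F\<^sub>1 s\<close> for an isomorphism \<open>s : F\<^sub>1 X \<rightarrow> X\<close>, and the cocycle
  condition makes \<open>s \<circ> \<alpha>\<^sub>1\<close> idempotent.\<close>

lemma cocycle_one_iso:
  assumes X: "X \<in> Obj C" and a: "a \<in> Hom C X (Fo \<one>\<^bsub>G\<^esub> X)"
    and co: "a = \<epsilon> \<one>\<^bsub>G\<^esub> \<one>\<^bsub>G\<^esub> X \<bullet> (Fa \<one>\<^bsub>G\<^esub> a \<bullet> a)"
    and me: "mono_arr C a \<or> epi_arr C a"
  shows "is_iso C a"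
proof -
  let ?e = "\<one>\<^bsub>G\<^esub>"
  interpret F1: equivalence_functor C C "F ?e" by (rule F_equivalence) simp
  note [simp] = X
  have [simp]: "a \<in> Arr C" "Dom C a = X" "Cod C a = Fo ?e X" using a by (auto simp: in_Hom)
  obtain s where s: "s \<in> Hom C (Fo ?e X) X" "Fa ?e s = \<epsilon> ?e ?e X"
    using F1.full[of "Fo ?e X" X "\<epsilon> ?e ?e X"] act.grp.r_one[of ?e] by (auto simp: in_Hom)
  have [simp]: "s \<in> Arr C" "Dom C s = Fo ?e X" "Cod C s = X" using s by (auto simp: in_Hom)
  have si: "is_iso C s" by (rule F1.iso_reflect[OF _ s(1)]) (simp add: s(2))
  have nat: "s \<bullet> Fa ?e f = f \<bullet> s" if f: "f \<in> Hom C X X" for f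
  proof (rule F1.faithful[of _ "Fo ?e X" X])
    have "f \<in> Arr C" "Dom C f = X" "Cod C f = X" using f by (auto simp: in_Hom)
    then show "Fa ?e (s \<bullet> Fa ?e f) = Fa ?e (f \<bullet> s)" using eps_natural[of ?e ?e f X X] by (simp add: s(2))
  qed (use f in \<open>auto simp: in_Hom\<close>)
  let ?p = "s \<bullet> a"
  have "a = Fa ?e ?p \<bullet> a" using co by (simp flip: s(2))
  then have "?p = s \<bullet> (Fa ?e ?p \<bullet> a)" by simp
  also have "\<dots> = (s \<bullet> Fa ?e ?p) \<bullet> a" by simp
  also have "\<dots> = (?p \<bullet> s) \<bullet> a" by (subst nat) (simp_all add: in_Hom)
  finally have pp: "?p \<bullet> ?p = ?p" by simp
  have pH: "?p \<in> Hom C X X" by (simp add: in_Hom)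
  have "?p = Idn C X"
    using me
  proof
    assume "mono_arr C a"
    then have "mono_arr C ?p" using mono_comp iso_mono[OF si] by simp
    then show ?thesis by (rule monoD[where W=X]) (use pH pp in \<open>simp_all add: in_Hom\<close>)
  next
    assume "epi_arr C a"
    then have "epi_arr C ?p" using epi_comp iso_epi[OF si] by simp
    then show ?thesis by (rule epiD[where W=X]) (use pH pp in \<open>simp_all add: in_Hom\<close>)
  qed
  moreover obtain j where j: "j \<in> Hom C X (Fo ?e X)" "j \<bullet> s = Idn C (Fo ?e X)" "is_iso C j"
    using isoE[OF si s(1)] by metis
  ultimately have "a = j" using j pre[OF j(2), of a] by (simp add: in_Hom)
  then show ?thesis using j by simp
qed

lemma cocycle_iso:
  assumes X: "X \<in> Obj C" and a: "\<And>g. g \<in> carrier G \<Longrightarrow> a g \<in> Hom C X (Fo g X)"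
    and co: "\<And>g h. \<lbrakk>g \<in> carrier G; h \<in> carrier G\<rbrakk> \<Longrightarrow> a (g \<otimes>\<^bsub>G\<^esub> h) = \<epsilon> g h X \<bullet> (Fa g (a h) \<bullet> a g)"
    and me: "mono_arr C (a \<one>\<^bsub>G\<^esub>) \<or> epi_arr C (a \<one>\<^bsub>G\<^esub>)" and g: "g \<in> carrier G"
  shows "is_iso C (a g)"
proof -
  have [simp]: "a h \<in> Arr C" "Dom C (a h) = X" "Cod C (a h) = Fo h X" if "h \<in> carrier G" for h
    using a[OF that] by (auto simp: in_Hom)
  note [simp] = X
  have a1: "is_iso C (a \<one>\<^bsub>G\<^esub>)"
    by (rule cocycle_one_iso[OF X a]) (use co[of "\<one>\<^bsub>G\<^esub>" "\<one>\<^bsub>G\<^esub>"] me in simp_all)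
  have mono: "mono_arr C (a h)" if h: "h \<in> carrier G" for h
  proof -
    have "\<epsilon> (inv\<^bsub>G\<^esub> (inv\<^bsub>G\<^esub> h)) (inv\<^bsub>G\<^esub> h) X \<bullet> (Fa (inv\<^bsub>G\<^esub> (inv\<^bsub>G\<^esub> h)) (a (inv\<^bsub>G\<^esub> h)) \<bullet> a (inv\<^bsub>G\<^esub> (inv\<^bsub>G\<^esub> h))) = a \<one>\<^bsub>G\<^esub>"
      using co[of "inv\<^bsub>G\<^esub> (inv\<^bsub>G\<^esub> h)" "inv\<^bsub>G\<^esub> h"] act.grp.l_inv[of "inv\<^bsub>G\<^esub> h"] h by simp
    then have "(\<epsilon> h (inv\<^bsub>G\<^esub> h) X \<bullet> Fa h (a (inv\<^bsub>G\<^esub> h))) \<bullet> a h = a \<one>\<^bsub>G\<^esub>" using h by simp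
    moreover have "mono_arr C (a \<one>\<^bsub>G\<^esub>)" by (rule iso_mono[OF a1])
    ultimately have "mono_arr C ((\<epsilon> h (inv\<^bsub>G\<^esub> h) X \<bullet> Fa h (a (inv\<^bsub>G\<^esub> h))) \<bullet> a h)" by metis
    then show ?thesis by (rule mono_cancel) (use h in simp_all)
  qed
  let ?h = "inv\<^bsub>G\<^esub> g"
  have eq: "\<epsilon> ?h g X \<bullet> (Fa ?h (a g) \<bullet> a ?h) = a \<one>\<^bsub>G\<^esub>"
    using co[of ?h g] act.grp.l_inv[of g] g by simp
  have e: "epi_arr C (\<epsilon> ?h g X \<bullet> (Fa ?h (a g) \<bullet> a ?h))" using eq iso_epi[OF a1] by metis
  obtain j where j: "j \<in> Hom C (Fo (?h \<otimes>\<^bsub>G\<^esub> g) X) (Fo ?h (Fo g X))"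
    "j \<bullet> \<epsilon> ?h g X = Idn C (Fo ?h (Fo g X))" "is_iso C j"
    using isoE[of "\<epsilon> ?h g X" "Fo ?h (Fo g X)" "Fo (?h \<otimes>\<^bsub>G\<^esub> g) X"] g by (auto simp: in_Hom)
  have "epi_arr C (j \<bullet> (\<epsilon> ?h g X \<bullet> (Fa ?h (a g) \<bullet> a ?h)))"
    by (rule epi_comp[OF iso_epi[OF j(3)] e]) (use g j(1) in \<open>auto simp: in_Hom\<close>)
  also have "j \<bullet> (\<epsilon> ?h g X \<bullet> (Fa ?h (a g) \<bullet> a ?h)) = Fa ?h (a g) \<bullet> a ?h"
    using g j by (simp add: in_Hom pre[OF j(2)])
  finally have "epi_arr C (Fa ?h (a g))" by (rule epi_cancel) (use g in simp_all)
  then have "is_iso C (Fa ?h (a g))" using mono_epi_iso Fa_mono[OF _ mono[OF g]] g by simp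
  then show ?thesis
    by (rule equivalence_functor.iso_reflect[OF F_equivalence[OF act.grp.inv_closed[OF g]] _ a[OF g]])
qed

lemma E_ObjI:
  assumes "X \<in> Obj C" "\<And>g. g \<in> carrier G \<Longrightarrow> a g \<in> Hom C X (Fo g X)"
    "\<And>g h. \<lbrakk>g \<in> carrier G; h \<in> carrier G\<rbrakk> \<Longrightarrow> a (g \<otimes>\<^bsub>G\<^esub> h) = \<epsilon> g h X \<bullet> (Fa g (a h) \<bullet> a g)"
    "mono_arr C (a \<one>\<^bsub>G\<^esub>) \<or> epi_arr C (a \<one>\<^bsub>G\<^esub>)"
  shows "(X, restrict a (carrier G)) \<in> Obj E"
proof -
  have "a g \<in> Arr C" "Dom C (a g) = X" "Cod C (a g) = Fo g X" if "g \<in> carrier G" for g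
    using assms(2)[OF that] by (auto simp: in_Hom)
  then show ?thesis
    unfolding E_Obj using assms(1-3) cocycle_iso[OF assms] by (simp add: in_Hom)
qed

lemma E_zero_object:
  obtains O' where "zero_obj E O'" "zero_obj C (fst O')"
proof -
  obtain Z where Z: "zero_obj C Z" using zero_object .
  have ZO [simp]: "Z \<in> Obj C" using zero_obj_Obj[OF Z] .
  have "\<forall>g \<in> carrier G. \<exists>z. z \<in> Hom C Z (Fo g Z)" using zero_obj_from[OF Z] by simp
  then obtain z where z: "\<And>g. g \<in> carrier G \<Longrightarrow> z g \<in> Hom C Z (Fo g Z)" by metis
  have [simp]: "z g \<in> Arr C" "Dom C (z g) = Z" "Cod C (z g) = Fo g Z" if "g \<in> carrier G" for g
    using z[OF that] by (auto simp: in_Hom)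
  define O' where "O' = (Z, restrict z (carrier G))"
  have Ob: "O' \<in> Obj E"
    unfolding O'_def
  proof (rule E_ObjI[OF ZO z])
    show "z (g \<otimes>\<^bsub>G\<^esub> h) = \<epsilon> g h Z \<bullet> (Fa g (z h) \<bullet> z g)" if "g \<in> carrier G" "h \<in> carrier G" for g h
      by (rule zero_unique_from[OF Z]) (use that in \<open>auto simp: in_Hom\<close>)
    have "mono_arr C (z \<one>\<^bsub>G\<^esub>)"
      by (rule monoI) (use zero_unique_to[OF Z] in \<open>auto simp: in_Hom\<close>)
    then show "mono_arr C (z \<one>\<^bsub>G\<^esub>) \<or> epi_arr C (z \<one>\<^bsub>G\<^esub>)" ..
  qed
  have to: "\<exists>!a. a \<in> Hom E P O'" if P: "P \<in> Obj E" for P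
  proof -
    obtain f where f: "f \<in> Hom C (fst P) Z" using zero_obj_to[OF Z E_objD(1)[OF P]] by blast
    have "snd O' g \<bullet> f = Fa g f \<bullet> snd P g" if g: "g \<in> carrier G" for g
      by (rule zero_unique_to[OF Fa_zero_obj[OF g Z]])
        (use g f E_objD[OF P] in \<open>auto simp: in_Hom O'_def\<close>)
    then have "(P, f, O') \<in> Hom E P O'" using f P Ob by (auto simp: E_Hom_iff equi_def O'_def)
    moreover have "a = b" if "a \<in> Hom E P O'" "b \<in> Hom E P O'" for a b
      using that zero_unique_to[OF Z] by (auto simp: E_Hom_iff equi_def O'_def)
    ultimately show ?thesis by blast
  qed
  have fro: "\<exists>!a. a \<in> Hom E O' P" if P: "P \<in> Obj E" for P
  proof -
    obtain f where f: "f \<in> Hom C Z (fst P)" using zero_obj_from[OF Z E_objD(1)[OF P]] by blast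
    have "snd P g \<bullet> f = Fa g f \<bullet> snd O' g" if g: "g \<in> carrier G" for g
      by (rule zero_unique_from[OF Z])
        (use g f E_objD[OF P] in \<open>auto simp: in_Hom O'_def\<close>)
    then have "(O', f, P) \<in> Hom E O' P" using f P Ob by (auto simp: E_Hom_iff equi_def O'_def)
    moreover have "a = b" if "a \<in> Hom E O' P" "b \<in> Hom E O' P" for a b
      using that zero_unique_from[OF Z] by (auto simp: E_Hom_iff equi_def O'_def)
    ultimately show ?thesis by blast
  qed
  have "zero_obj E O'" unfolding zero_obj_def using Ob to fro by blast
  then show ?thesis using that Z by (simp add: O'_def)
qed

lemma E_zero_arr:
  assumes a: "(P, \<theta>, R) \<in> Arr E"
  shows "zero_arr E (P, \<theta>, R) \<longleftrightarrow> zero_arr C \<theta>"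
proof -
  have P: "P \<in> Obj E" and R: "R \<in> Obj E" and \<theta>: "equi P \<theta> R" using a by (auto simp: E_Arr_iff)
  obtain O' where O': "zero_obj E O'" "zero_obj C (fst O')" using E_zero_object .
  obtain u where "u \<in> Hom E P O'" using E.zero_obj_to[OF O'(1) P] by blast
  then obtain u' where u: "(P, u', O') \<in> Hom E P O'" "equi P u' O'" by (auto simp: E_Hom_iff)
  obtain v where "v \<in> Hom E O' R" using E.zero_obj_from[OF O'(1) R] by blast
  then obtain v' where v: "(O', v', R) \<in> Hom E O' R" "equi O' v' R" by (auto simp: E_Hom_iff)
  have zE: "zero_arr E (P, v' \<bullet> u', R)" using E.zero_arrI[OF O'(1) u(1) v(1)] by (simp add: E_sel)
  have zC: "zero_arr C (v' \<bullet> u')" using zero_arrI[OF O'(2)] u(2) v(2) by (auto simp: equi_def)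
  show ?thesis
  proof
    assume "zero_arr E (P, \<theta>, R)"
    then have "(P, \<theta>, R) = (P, v' \<bullet> u', R)" using E.zero_unique[OF _ zE] by (simp add: E_sel)
    then show "zero_arr C \<theta>" using zC by simp
  next
    assume "zero_arr C \<theta>"
    then have "\<theta> = v' \<bullet> u'"
      by (rule zero_unique[OF _ zC]) (use equiD[OF \<theta>] equiD[OF u(2)] equiD[OF v(2)] in auto)
    then show "zero_arr E (P, \<theta>, R)" using zE by simp
  qed
qed

lemma E_ArrD:
  assumes "(P, \<theta>, R) \<in> Arr E"
  shows "P \<in> Obj E" "R \<in> Obj E" "equi P \<theta> R"
  using assms by (auto simp: E_Arr_iff)

lemma E_ArrI: "\<lbrakk>P \<in> Obj E; R \<in> Obj E; equi P \<theta> R\<rbrakk> \<Longrightarrow> (P, \<theta>, R) \<in> Arr E"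
  by (auto simp: E_Arr_iff)

lemma E_kernel_lift:
  assumes a: "(P, \<theta>, R) \<in> Arr E" and k: "(S, k, P) \<in> Arr E" and ker: "is_kernel C k \<theta>"
  shows "is_kernel E (S, k, P) (P, \<theta>, R)"
proof (rule E.kernelI)
  note D = E_ArrD[OF a] and K = E_ArrD[OF k]
  note m = kernel_mono[OF ker]
  show "mono_arr E (S, k, P)" by (rule E_mono_lift[OF k m])
  show "(P, \<theta>, R) \<in> Arr E" by fact
  show "Cod E (S, k, P) = Dom E (P, \<theta>, R)" by (simp add: E_sel)
  show "zero_arr E ((P, \<theta>, R) \<bullet>\<^bsub>E\<^esub> (S, k, P))"
    using E_zero_arr[OF E_ArrI[OF K(1) D(2) equi_comp[OF K(1,2) D(2) K(3) D(3)]]] kernelD(4)[OF ker]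
    by (simp add: E_sel)
  fix W h assume h: "h \<in> Hom E W (Dom E (P, \<theta>, R))" and z: "zero_arr E ((P, \<theta>, R) \<bullet>\<^bsub>E\<^esub> h)"
  then obtain h' where h': "h = (W, h', P)" "equi W h' P" and W: "W \<in> Obj E" by (auto simp: E_Hom_iff E_sel)
  have "zero_arr C (\<theta> \<bullet> h')"
    using z E_zero_arr[OF E_ArrI[OF W D(2) equi_comp[OF W D(1,2) h'(2) D(3)]]] by (simp add: h'(1) E_sel)
  then obtain u where u: "u \<in> Hom C (fst W) (fst S)" "k \<bullet> u = h'"
    using kernel_factor[OF ker, of h' "fst W"] equiD[OF h'(2)] equiD[OF D(3)] equiD[OF K(3)] by (auto simp: in_Hom)
  note [simp] = E_objD(1-4)[OF W] E_objD(1-4)[OF K(1)] E_objD(1-4)[OF D(1)] equiD(1-3)[OF K(3)]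
  have [simp]: "u \<in> Arr C" "Dom C u = fst W" "Cod C u = fst S" using u by (auto simp: in_Hom)
  have "snd S g \<bullet> u = Fa g u \<bullet> snd W g" if g: "g \<in> carrier G" for g
  proof (rule monoD[OF Fa_mono[OF g m], where W="fst W"])
    have "Fa g k \<bullet> (snd S g \<bullet> u) = snd P g \<bullet> h'"
      using g by (simp add: u(2)[symmetric] pre[OF equiD(4)[OF K(3) g]])
    also have "\<dots> = Fa g k \<bullet> (Fa g u \<bullet> snd W g)"
      unfolding equiD(4)[OF h'(2) g] using g by (simp add: u(2)[symmetric])
    finally show "Fa g k \<bullet> (snd S g \<bullet> u) = Fa g k \<bullet> (Fa g u \<bullet> snd W g)" .
  qed (use g in \<open>auto simp: in_Hom\<close>)
  then have "(W, u, S) \<in> Hom E W S" using W K(1) u(1) by (auto simp: E_Hom_iff equi_def)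
  then show "\<exists>u \<in> Hom E W (Dom E (S, k, P)). (S, k, P) \<bullet>\<^bsub>E\<^esub> u = h"
    using u(2) h'(1) by (intro bexI[of _ "(W, u, S)"]) (auto simp: E_sel)
qed

lemma E_cokernel_lift:
  assumes a: "(P, \<theta>, R) \<in> Arr E" and k: "(R, k, S) \<in> Arr E" and ker: "is_cokernel C k \<theta>"
  shows "is_cokernel E (R, k, S) (P, \<theta>, R)"
proof (rule E.cokernelI)
  note D = E_ArrD[OF a] and K = E_ArrD[OF k]
  note m = cokernel_epi[OF ker]
  show "epi_arr E (R, k, S)" by (rule E_epi_lift[OF k m])
  show "(P, \<theta>, R) \<in> Arr E" by fact
  show "Dom E (R, k, S) = Cod E (P, \<theta>, R)" by (simp add: E_sel)
  show "zero_arr E ((R, k, S) \<bullet>\<^bsub>E\<^esub> (P, \<theta>, R))"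
    using E_zero_arr[OF E_ArrI[OF D(1) K(2) equi_comp[OF D(1,2) K(2) D(3) K(3)]]] cokernelD(4)[OF ker]
    by (simp add: E_sel)
  fix W h assume h: "h \<in> Hom E (Cod E (P, \<theta>, R)) W" and z: "zero_arr E (h \<bullet>\<^bsub>E\<^esub> (P, \<theta>, R))"
  then obtain h' where h': "h = (R, h', W)" "equi R h' W" and W: "W \<in> Obj E" by (auto simp: E_Hom_iff E_sel)
  have "zero_arr C (h' \<bullet> \<theta>)"
    using z E_zero_arr[OF E_ArrI[OF D(1) W equi_comp[OF D(1,2) W D(3) h'(2)]]] by (simp add: h'(1) E_sel)
  then obtain u where u: "u \<in> Hom C (fst S) (fst W)" "u \<bullet> k = h'"
    using cokernel_factor[OF ker, of h' "fst W"] equiD[OF h'(2)] equiD[OF D(3)] equiD[OF K(3)] by (auto simp: in_Hom)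
  note [simp] = E_objD(1-4)[OF W] E_objD(1-4)[OF K(1)] E_objD(1-4)[OF K(2)] equiD(1-3)[OF K(3)]
  have [simp]: "u \<in> Arr C" "Dom C u = fst S" "Cod C u = fst W" using u by (auto simp: in_Hom)
  have "snd W g \<bullet> u = Fa g u \<bullet> snd S g" if g: "g \<in> carrier G" for g
  proof (rule epiD[OF m, where W="Fo g (fst W)"])
    have "(snd W g \<bullet> u) \<bullet> k = snd W g \<bullet> h'" using g by (simp add: u(2)[symmetric])
    also have "\<dots> = (Fa g u \<bullet> snd S g) \<bullet> k"
      unfolding equiD(4)[OF h'(2) g] using g by (simp add: u(2)[symmetric] equiD(4)[OF K(3) g])
    finally show "(snd W g \<bullet> u) \<bullet> k = (Fa g u \<bullet> snd S g) \<bullet> k" .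
  qed (use g in \<open>auto simp: in_Hom\<close>)
  then have "(S, u, W) \<in> Hom E S W" using W K(2) u(1) by (auto simp: E_Hom_iff equi_def)
  then show "\<exists>u \<in> Hom E (Cod E (R, k, S)) W. u \<bullet>\<^bsub>E\<^esub> (R, k, S) = h"
    using u(2) h'(1) by (intro bexI[of _ "(S, u, W)"]) (auto simp: E_sel)
qed

lemma E_kernel_exists:
  assumes a: "(P, \<theta>, R) \<in> Arr E" and k: "is_kernel C k \<theta>"
  shows "\<exists>\<kappa>. ((Dom C k, \<kappa>), k, P) \<in> Arr E"
proof -
  note D = E_ArrD[OF a]
  note [simp] = E_objD(1-4)[OF D(1)] E_objD(1-4)[OF D(2)] equiD(1-3)[OF D(3)]
  let ?K = "Dom C k"
  have [simp]: "k \<in> Arr C" "Cod C k = fst P" using kernelD[OF k] by auto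
  note m = kernel_mono[OF k]
  have "\<exists>x \<in> Hom C ?K (Fo g ?K). Fa g k \<bullet> x = snd P g \<bullet> k" if g: "g \<in> carrier G" for g
  proof -
    have "Fa g \<theta> \<bullet> (snd P g \<bullet> k) = snd R g \<bullet> (\<theta> \<bullet> k)" using g by (simp add: pre[OF equiD(4)[OF D(3) g]])
    moreover have "zero_arr C (snd R g \<bullet> (\<theta> \<bullet> k))"
      by (rule zero_comp_left[OF kernelD(4)[OF k]]) (use g in auto)
    ultimately have "zero_arr C (Fa g \<theta> \<bullet> (snd P g \<bullet> k))" by simp
    moreover have "snd P g \<bullet> k \<in> Hom C ?K (Dom C (Fa g \<theta>))" using g by (simp add: in_Hom)
    ultimately obtain x where "x \<in> Hom C ?K (Dom C (Fa g k))" "Fa g k \<bullet> x = snd P g \<bullet> k"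
      by (rule kernel_factor[OF Fa_kernel[OF g k]])
    then show ?thesis using g by auto
  qed
  then obtain x where x: "\<And>g. g \<in> carrier G \<Longrightarrow> x g \<in> Hom C ?K (Fo g ?K)"
    and xe: "\<And>g. g \<in> carrier G \<Longrightarrow> Fa g k \<bullet> x g = snd P g \<bullet> k" by metis
  have [simp]: "x g \<in> Arr C" "Dom C (x g) = ?K" "Cod C (x g) = Fo g ?K" if "g \<in> carrier G" for g
    using x[OF that] by (auto simp: in_Hom)
  have "(?K, restrict x (carrier G)) \<in> Obj E"
  proof (rule E_ObjI[OF _ x])
    fix g h assume g: "g \<in> carrier G" and h: "h \<in> carrier G"
    let ?gh = "g \<otimes>\<^bsub>G\<^esub> h"
    show "x ?gh = \<epsilon> g h ?K \<bullet> (Fa g (x h) \<bullet> x g)"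
    proof (rule monoD[OF Fa_mono[OF _ m, of ?gh], where W="?K"])
      have nat: "Fa ?gh k \<bullet> \<epsilon> g h ?K = \<epsilon> g h (fst P) \<bullet> Fa g (Fa h k)"
        using eps_natural[OF g h, of k ?K "fst P"] by simp
      have xeh: "Fa g (Fa h k) \<bullet> Fa g (x h) = Fa g (snd P h) \<bullet> Fa g k"
        using arg_cong[OF xe[OF h], of "Fa g"] g h by simp
      have "Fa ?gh k \<bullet> (\<epsilon> g h ?K \<bullet> (Fa g (x h) \<bullet> x g)) = \<epsilon> g h (fst P) \<bullet> (Fa g (snd P h) \<bullet> (snd P g \<bullet> k))"
        using g h by (simp add: pre[OF nat] pre[OF xeh] xe[OF g])
      also have "\<dots> = Fa ?gh k \<bullet> x ?gh" using g h by (simp add: xe E_objD(6)[OF D(1)])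
      finally show "Fa ?gh k \<bullet> x ?gh = Fa ?gh k \<bullet> (\<epsilon> g h ?K \<bullet> (Fa g (x h) \<bullet> x g))" ..
    qed (use g h in \<open>auto simp: in_Hom\<close>)
  next
    have "mono_arr C (snd P \<one>\<^bsub>G\<^esub> \<bullet> k)" using mono_comp[OF m iso_mono[OF E_objD(5)[OF D(1)]]] by simp
    then have "mono_arr C (Fa \<one>\<^bsub>G\<^esub> k \<bullet> x \<one>\<^bsub>G\<^esub>)" using xe by simp
    then have "mono_arr C (x \<one>\<^bsub>G\<^esub>)" by (rule mono_cancel) auto
    then show "mono_arr C (x \<one>\<^bsub>G\<^esub>) \<or> epi_arr C (x \<one>\<^bsub>G\<^esub>)" ..
  qed simp
  then have "((?K, restrict x (carrier G)), k, P) \<in> Arr E"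
    using D(1) xe by (intro E_ArrI) (auto simp: equi_def in_Hom)
  then show ?thesis by blast
qed

lemma E_cokernel_exists:
  assumes a: "(P, \<theta>, R) \<in> Arr E" and k: "is_cokernel C k \<theta>"
  shows "\<exists>\<kappa>. (R, k, (Cod C k, \<kappa>)) \<in> Arr E"
proof -
  note D = E_ArrD[OF a]
  note [simp] = E_objD(1-4)[OF D(1)] E_objD(1-4)[OF D(2)] equiD(1-3)[OF D(3)]
  let ?K = "Cod C k"
  have [simp]: "k \<in> Arr C" "Dom C k = fst R" using cokernelD[OF k] by auto
  note m = cokernel_epi[OF k]
  have "\<exists>x \<in> Hom C ?K (Fo g ?K). x \<bullet> k = Fa g k \<bullet> snd R g" if g: "g \<in> carrier G" for g
  proof -
    have "(Fa g k \<bullet> snd R g) \<bullet> \<theta> = Fa g (k \<bullet> \<theta>) \<bullet> snd P g" using g by (simp add: equiD(4)[OF D(3) g])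
    moreover have "zero_arr C (Fa g (k \<bullet> \<theta>) \<bullet> snd P g)"
      by (rule zero_comp_right[OF Fa_zero[OF g cokernelD(4)[OF k]]]) (use g in auto)
    ultimately have "zero_arr C ((Fa g k \<bullet> snd R g) \<bullet> \<theta>)" by metis
    moreover have "Fa g k \<bullet> snd R g \<in> Hom C (Cod C \<theta>) (Fo g ?K)" using g by (simp add: in_Hom)
    ultimately obtain x where "x \<in> Hom C ?K (Fo g ?K)" "x \<bullet> k = Fa g k \<bullet> snd R g"
      by (rule cokernel_factor[OF k])
    then show ?thesis by blast
  qed
  then obtain x where x: "\<And>g. g \<in> carrier G \<Longrightarrow> x g \<in> Hom C ?K (Fo g ?K)"
    and xe: "\<And>g. g \<in> carrier G \<Longrightarrow> x g \<bullet> k = Fa g k \<bullet> snd R g" by metis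
  have [simp]: "x g \<in> Arr C" "Dom C (x g) = ?K" "Cod C (x g) = Fo g ?K" if "g \<in> carrier G" for g
    using x[OF that] by (auto simp: in_Hom)
  have "(?K, restrict x (carrier G)) \<in> Obj E"
  proof (rule E_ObjI[OF _ x])
    fix g h assume g: "g \<in> carrier G" and h: "h \<in> carrier G"
    let ?gh = "g \<otimes>\<^bsub>G\<^esub> h"
    show "x ?gh = \<epsilon> g h ?K \<bullet> (Fa g (x h) \<bullet> x g)"
    proof (rule epiD[OF m, where W="Fo ?gh ?K"])
      have nat: "\<epsilon> g h ?K \<bullet> Fa g (Fa h k) = Fa ?gh k \<bullet> \<epsilon> g h (fst R)"
        using eps_natural[OF g h, of k "fst R" ?K] by simp
      have xeh: "Fa g (x h) \<bullet> Fa g k = Fa g (Fa h k) \<bullet> Fa g (snd R h)"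
        using arg_cong[OF xe[OF h], of "Fa g"] g h by simp
      have "(\<epsilon> g h ?K \<bullet> (Fa g (x h) \<bullet> x g)) \<bullet> k
        = Fa ?gh k \<bullet> (\<epsilon> g h (fst R) \<bullet> (Fa g (snd R h) \<bullet> snd R g))"
        using g h by (simp add: xe[OF g] pre[OF xeh] pre[OF nat])
      also have "\<dots> = x ?gh \<bullet> k" using g h by (simp add: xe E_objD(6)[OF D(2)])
      finally show "x ?gh \<bullet> k = (\<epsilon> g h ?K \<bullet> (Fa g (x h) \<bullet> x g)) \<bullet> k" ..
    qed (use g h in \<open>auto simp: in_Hom\<close>)
  next
    have "epi_arr C (Fa \<one>\<^bsub>G\<^esub> k \<bullet> snd R \<one>\<^bsub>G\<^esub>)"
      by (rule epi_comp[OF Fa_epi[OF _ m] iso_epi[OF E_objD(5)[OF D(2)]]]) auto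
    then have "epi_arr C (x \<one>\<^bsub>G\<^esub> \<bullet> k)" using xe by simp
    then have "epi_arr C (x \<one>\<^bsub>G\<^esub>)" by (rule epi_cancel) auto
    then show "mono_arr C (x \<one>\<^bsub>G\<^esub>) \<or> epi_arr C (x \<one>\<^bsub>G\<^esub>)" ..
  qed simp
  then have "(R, k, (?K, restrict x (carrier G))) \<in> Arr E"
    using D(2) xe by (intro E_ArrI) (auto simp: equi_def in_Hom)
  then show ?thesis by blast
qed

lemma E_mono_iff:
  assumes a: "(P, \<theta>, R) \<in> Arr E"
  shows "mono_arr E (P, \<theta>, R) \<longleftrightarrow> mono_arr C \<theta>"
proof
  note D = E_ArrD[OF a]
  note [simp] = E_objD(1)[OF D(1)] equiD(1-3)[OF D(3)]
  assume m: "mono_arr E (P, \<theta>, R)"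
  obtain k where k: "is_kernel C k \<theta>" using kernel_exists[of \<theta>] by auto
  obtain \<kappa> where K: "((Dom C k, \<kappa>), k, P) \<in> Arr E" using E_kernel_exists[OF a k] ..
  let ?S = "(Dom C k, \<kappa>)"
  note KD = E_ArrD[OF K]
  obtain O' where O': "zero_obj E O'" "zero_obj C (fst O')" using E_zero_object .
  obtain z where z: "z \<in> Hom E ?S P" "zero_arr E z" using E.zero_arr_exists[OF O'(1) KD(1) D(1)] by blast
  have "(P, \<theta>, R) \<bullet>\<^bsub>E\<^esub> (?S, k, P) = (P, \<theta>, R) \<bullet>\<^bsub>E\<^esub> z"
  proof (rule E.zero_unique)
    show "zero_arr E ((P, \<theta>, R) \<bullet>\<^bsub>E\<^esub> (?S, k, P))" using E.kernelD(4)[OF E_kernel_lift[OF a K k]] .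
    show "zero_arr E ((P, \<theta>, R) \<bullet>\<^bsub>E\<^esub> z)"
      by (rule E.zero_comp_left[OF z(2) a]) (use z(1) in \<open>auto simp: in_Hom E_sel\<close>)
  qed (use z(1) in \<open>auto simp: E_Hom_iff E_sel\<close>)
  then have "(?S, k, P) = z"
    by (rule E.monoD[OF m, where W="?S"]) (use z(1) K in \<open>auto simp: in_Hom E_sel\<close>)
  then have "zero_arr C k" using z(2) E_zero_arr[OF K] by simp
  show "mono_arr C \<theta>"
  proof (rule mono_by_zero)
    fix W u assume u: "u \<in> Hom C W (Dom C \<theta>)" "zero_arr C (\<theta> \<bullet> u)"
    obtain y where y: "y \<in> Hom C W (Dom C k)" "k \<bullet> y = u"
      using kernel_factor[OF k u(2,1)] by metis
    then show "zero_arr C u" using zero_comp_right[OF \<open>zero_arr C k\<close>, of y] by (auto simp: in_Hom)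
  qed simp
qed (rule E_mono_lift[OF a])

lemma E_epi_iff:
  assumes a: "(P, \<theta>, R) \<in> Arr E"
  shows "epi_arr E (P, \<theta>, R) \<longleftrightarrow> epi_arr C \<theta>"
proof
  note D = E_ArrD[OF a]
  note [simp] = E_objD(1)[OF D(2)] equiD(1-3)[OF D(3)]
  assume m: "epi_arr E (P, \<theta>, R)"
  obtain k where k: "is_cokernel C k \<theta>" using cokernel_exists[of \<theta>] by auto
  obtain \<kappa> where K: "(R, k, (Cod C k, \<kappa>)) \<in> Arr E" using E_cokernel_exists[OF a k] ..
  let ?S = "(Cod C k, \<kappa>)"
  note KD = E_ArrD[OF K]
  obtain O' where O': "zero_obj E O'" "zero_obj C (fst O')" using E_zero_object .
  obtain z where z: "z \<in> Hom E R ?S" "zero_arr E z" using E.zero_arr_exists[OF O'(1) D(2) KD(2)] by blast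
  have "(R, k, ?S) \<bullet>\<^bsub>E\<^esub> (P, \<theta>, R) = z \<bullet>\<^bsub>E\<^esub> (P, \<theta>, R)"
  proof (rule E.zero_unique)
    show "zero_arr E ((R, k, ?S) \<bullet>\<^bsub>E\<^esub> (P, \<theta>, R))" using E.cokernelD(4)[OF E_cokernel_lift[OF a K k]] .
    show "zero_arr E (z \<bullet>\<^bsub>E\<^esub> (P, \<theta>, R))"
      by (rule E.zero_comp_right[OF z(2) a]) (use z(1) in \<open>auto simp: in_Hom E_sel\<close>)
  qed (use z(1) in \<open>auto simp: E_Hom_iff E_sel\<close>)
  then have "(R, k, ?S) = z"
    by (rule E.epiD[OF m, where W="?S"]) (use z(1) K in \<open>auto simp: in_Hom E_sel\<close>)
  then have "zero_arr C k" using z(2) E_zero_arr[OF K] by simp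
  show "epi_arr C \<theta>"
  proof (rule epi_by_zero)
    fix W u assume u: "u \<in> Hom C (Cod C \<theta>) W" "zero_arr C (u \<bullet> \<theta>)"
    obtain y where y: "y \<in> Hom C (Cod C k) W" "y \<bullet> k = u"
      using cokernel_factor[OF k u(2,1)] by metis
    then show "zero_arr C u" using zero_comp_left[OF \<open>zero_arr C k\<close>, of y] by (auto simp: in_Hom)
  qed simp
qed (rule E_epi_lift[OF a])

lemma E_additive:
  assumes "additive_category C add"
  shows "additive_category E (\<lambda>a b. (fst a, add (fst (snd a)) (fst (snd b)), snd (snd a)))"
    (is "additive_category E ?add")
proof -
  interpret A: additive_category C add by fact
  have Fadd: "Fa g (add f f') = add (Fa g f) (Fa g f')"
    if "g \<in> carrier G" "f \<in> Hom C X Y" "f' \<in> Hom C X Y" for g f f' X Y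
    using A.equivalence_additive[OF F_equivalence] that by blast
  show ?thesis
  proof
    fix P R assume P: "P \<in> Obj E" and R: "R \<in> Obj E"
    let ?X = "fst P" and ?Y = "fst R"
    have XY: "?X \<in> Obj C" "?Y \<in> Obj C" using E_objD(1) P R by auto
    have PH: "snd P g \<in> Hom C ?X (Fo g ?X)" and RH: "snd R g \<in> Hom C ?Y (Fo g ?Y)" if "g \<in> carrier G" for g
      using E_objD(2-4)[OF P that] E_objD(2-4)[OF R that] by (auto simp: in_Hom)
    let ?H = "\<lambda>z. \<lparr>carrier = Hom C ?X ?Y, monoid.mult = add, one = z\<rparr>"
    obtain z where z: "comm_group (?H z)" "z \<in> Hom C ?X ?Y" "zero_arr C z"
      using A.Hom_group[OF XY] by metis
    interpret gr: comm_group "?H z" by (rule z(1))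
    have sums: "snd R g \<bullet> add a b = add (snd R g \<bullet> a) (snd R g \<bullet> b)"
      "Fa g (add a b) \<bullet> snd P g = add (Fa g a \<bullet> snd P g) (Fa g b \<bullet> snd P g)"
      if g: "g \<in> carrier G" and ab: "a \<in> Hom C ?X ?Y" "b \<in> Hom C ?X ?Y" for g a b
      using A.Cmp_add_right[OF ab RH[OF g]] A.Cmp_add_left[OF PH[OF g] Fa_Hom[OF g ab(1)] Fa_Hom[OF g ab(2)]]
        Fadd[OF g ab] by auto
    have zs: "zero_arr C (snd R g \<bullet> z)" "zero_arr C (Fa g z \<bullet> snd P g)" if g: "g \<in> carrier G" for g
      using zero_comp_left[OF z(3), of "snd R g"] zero_comp_right[OF Fa_zero[OF g z(3)], of "snd P g"]
        z(2) RH[OF g] PH[OF g] g by (auto simp: in_Hom)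
    have equi_z: "equi P z R"
      unfolding equi_def
    proof (intro conjI ballI z(2))
      show "snd R g \<bullet> z = Fa g z \<bullet> snd P g" if g: "g \<in> carrier G" for g
        by (rule zero_unique[OF zs[OF g]]) (use z(2) RH[OF g] PH[OF g] g in \<open>auto simp: in_Hom\<close>)
    qed
    have equi_add: "equi P (add a b) R" if a: "equi P a R" and b: "equi P b R" for a b
      using a b sums A.add_Hom[of a ?X ?Y b] by (auto simp: equi_def)
    have equi_neg: "\<exists>b. equi P b R \<and> add b a = z" if a: "equi P a R" for a
    proof -
      have aH: "a \<in> Hom C ?X ?Y" using a by (simp add: equi_def)
      obtain b where b: "b \<in> Hom C ?X ?Y" "add a b = z" "add b a = z"
        using that[of "inv\<^bsub>?H z\<^esub> a"] gr.inv_closed[of a] gr.r_inv[of a] gr.l_inv[of a] aH by simp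
      have "snd R g \<bullet> b = Fa g b \<bullet> snd P g" if g: "g \<in> carrier G" for g
      proof -
        have Fob: "Fo g ?Y \<in> Obj C" using XY g by simp
        obtain w where w: "comm_group \<lparr>carrier = Hom C ?X (Fo g ?Y), monoid.mult = add, one = w\<rparr>"
          using A.Hom_group[OF XY(1) Fob] by metis
        interpret w: comm_group "\<lparr>carrier = Hom C ?X (Fo g ?Y), monoid.mult = add, one = w\<rparr>" by (rule w)
        have H: "snd R g \<bullet> a \<in> Hom C ?X (Fo g ?Y)" "snd R g \<bullet> b \<in> Hom C ?X (Fo g ?Y)"
          "Fa g b \<bullet> snd P g \<in> Hom C ?X (Fo g ?Y)"
          using Cmp_Hom[OF aH RH[OF g]] Cmp_Hom[OF b(1) RH[OF g]] Cmp_Hom[OF PH[OF g] Fa_Hom[OF g b(1)]] .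
        have "add (snd R g \<bullet> a) (snd R g \<bullet> b) = snd R g \<bullet> z" using sums(1)[OF g aH b(1)] b(2) by simp
        also have "\<dots> = Fa g z \<bullet> snd P g" using equiD(4)[OF equi_z g] .
        also have "\<dots> = add (Fa g a \<bullet> snd P g) (Fa g b \<bullet> snd P g)" using sums(2)[OF g aH b(1)] b(2) by simp
        also have "Fa g a \<bullet> snd P g = snd R g \<bullet> a" using equiD(4)[OF a g] by simp
        finally show ?thesis using w.Units_l_cancel[of "snd R g \<bullet> a" "snd R g \<bullet> b" "Fa g b \<bullet> snd P g"] H by simp
      qed
      then show ?thesis using b by (auto simp: equi_def)
    qed
    have H: "a \<in> Hom E P R \<longleftrightarrow> (\<exists>\<theta>. a = (P, \<theta>, R) \<and> equi P \<theta> R)" for a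
      using P R by (simp add: E_Hom_iff)
    have eqH: "equi P \<theta> R \<Longrightarrow> \<theta> \<in> Hom C ?X ?Y" for \<theta> by (simp add: equi_def)
    have "comm_group \<lparr>carrier = Hom E P R, monoid.mult = ?add, one = (P, z, R)\<rparr>"
    proof (rule comm_groupI, simp_all only: partial_object.simps monoid.simps)
      show "?add a b \<in> Hom E P R" if "a \<in> Hom E P R" "b \<in> Hom E P R" for a b
        using that equi_add by (auto simp: H)
      show "(P, z, R) \<in> Hom E P R" using equi_z by (simp add: H)
      show "?add (?add a b) c = ?add a (?add b c)"
        if "a \<in> Hom E P R" "b \<in> Hom E P R" "c \<in> Hom E P R" for a b c
        using that gr.m_assoc eqH by (auto simp: H)
      show "?add a b = ?add b a" if "a \<in> Hom E P R" "b \<in> Hom E P R" for a b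
        using that gr.m_comm eqH by (auto simp: H)
      show "?add (P, z, R) a = a" if "a \<in> Hom E P R" for a
        using that gr.l_one eqH by (auto simp: H)
      show "\<exists>b \<in> Hom E P R. ?add b a = (P, z, R)" if aH: "a \<in> Hom E P R" for a
      proof -
        obtain \<theta> where \<theta>: "a = (P, \<theta>, R)" "equi P \<theta> R" using aH H by blast
        obtain b where "equi P b R" "add b \<theta> = z" using equi_neg[OF \<theta>(2)] by blast
        then show ?thesis using \<theta>(1) by (intro bexI[of _ "(P, b, R)"]) (auto simp: H)
      qed
    qed
    then show "\<exists>z. comm_group \<lparr>carrier = Hom E P R, monoid.mult = ?add, one = z\<rparr>" by blast
  next
    fix f P R g S g' assume "f \<in> Hom E P R" "g \<in> Hom E R S" "g' \<in> Hom E R S"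
    then show "?add g g' \<bullet>\<^bsub>E\<^esub> f = ?add (g \<bullet>\<^bsub>E\<^esub> f) (g' \<bullet>\<^bsub>E\<^esub> f)"
      using A.Cmp_add_left by (auto simp: E_Hom_iff E_sel equi_def)
  next
    fix f P R f' g S assume "f \<in> Hom E P R" "f' \<in> Hom E P R" "g \<in> Hom E R S"
    then show "g \<bullet>\<^bsub>E\<^esub> ?add f f' = ?add (g \<bullet>\<^bsub>E\<^esub> f) (g \<bullet>\<^bsub>E\<^esub> f')"
      using A.Cmp_add_right by (auto simp: E_Hom_iff E_sel equi_def)
  next
    show "\<exists>Z. zero_obj E Z" using E_zero_object by metis
  next
    fix P R assume P: "P \<in> Obj E" and R: "R \<in> Obj E"
    note [simp] = E_objD(1-4)[OF P] E_objD(1-4)[OF R]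
    obtain S i j p r where ij: "i \<in> Hom C (fst P) S" "j \<in> Hom C (fst R) S"
      and pr: "p \<in> Hom C S (fst P)" "r \<in> Hom C S (fst R)"
      and eqs: "p \<bullet> i = Idn C (fst P)" "r \<bullet> j = Idn C (fst R)" "zero_arr C (r \<bullet> i)" "zero_arr C (p \<bullet> j)"
        "add (i \<bullet> p) (j \<bullet> r) = Idn C S"
      using A.biproduct_exists[of "fst P" "fst R"] by auto
    have S: "S \<in> Obj C" using Hom_Obj(2)[OF ij(1)] .
    have [simp]: "i \<in> Arr C" "Dom C i = fst P" "Cod C i = S" "j \<in> Arr C" "Dom C j = fst R" "Cod C j = S"
      "p \<in> Arr C" "Dom C p = S" "Cod C p = fst P" "r \<in> Arr C" "Dom C r = S" "Cod C r = fst R" "S \<in> Obj C"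
      using ij pr S by (auto simp: in_Hom)
    have prod: "is_product2 C (fst P) (fst R) S p r"
      using A.biproduct_product2[OF ij pr eqs] .
    have Fprod: "is_product2 C (Fo g (fst P)) (Fo g (fst R)) (Fo g S) (Fa g p) (Fa g r)"
      if "g \<in> carrier G" for g
      using equivalence_functor.pres_product2[OF F_equivalence[OF that] prod] .
    note jm = product2_eq[OF Fprod]
    have "\<exists>x \<in> Hom C S (Fo g S). Fa g p \<bullet> x = snd P g \<bullet> p \<and> Fa g r \<bullet> x = snd R g \<bullet> r"
      if g: "g \<in> carrier G" for g
      using g by (intro product2_map[OF Fprod[OF g]]) (auto simp: in_Hom)
    then obtain x where x: "\<And>g. g \<in> carrier G \<Longrightarrow> x g \<in> Hom C S (Fo g S)"
      and xp: "\<And>g. g \<in> carrier G \<Longrightarrow> Fa g p \<bullet> x g = snd P g \<bullet> p"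
      and xr: "\<And>g. g \<in> carrier G \<Longrightarrow> Fa g r \<bullet> x g = snd R g \<bullet> r" by metis
    have [simp]: "x g \<in> Arr C" "Dom C (x g) = S" "Cod C (x g) = Fo g S" if "g \<in> carrier G" for g
      using x[OF that] by (auto simp: in_Hom)
    let ?S = "(S, restrict x (carrier G))"
    have S_obj: "?S \<in> Obj E"
    proof (rule E_ObjI[OF S x])
      fix g h assume g: "g \<in> carrier G" and h: "h \<in> carrier G"
      let ?gh = "g \<otimes>\<^bsub>G\<^esub> h"
      have nat: "Fa ?gh t \<bullet> \<epsilon> g h S = \<epsilon> g h (Cod C t) \<bullet> Fa g (Fa h t)" if "t \<in> Arr C" "Dom C t = S" for t
        using eps_natural[OF g h that] by simp
      have *: "Fa ?gh t \<bullet> x ?gh = Fa ?gh t \<bullet> (\<epsilon> g h S \<bullet> (Fa g (x h) \<bullet> x g))"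
        if T: "T \<in> Obj E" and t: "t \<in> Hom C S (fst T)"
          and xt: "\<And>g. g \<in> carrier G \<Longrightarrow> Fa g t \<bullet> x g = snd T g \<bullet> t" for T t
      proof -
        have [simp]: "t \<in> Arr C" "Dom C t = S" "Cod C t = fst T" using t by (auto simp: in_Hom)
        note [simp] = E_objD(1-4)[OF T]
        have nt: "Fa ?gh t \<bullet> \<epsilon> g h S = \<epsilon> g h (fst T) \<bullet> Fa g (Fa h t)" using nat[of t] by simp
        have xh: "Fa g (Fa h t) \<bullet> Fa g (x h) = Fa g (snd T h) \<bullet> Fa g t"
          using arg_cong[OF xt[OF h], of "Fa g"] g h by simp
        show ?thesis using g h by (simp add: pre[OF nt] pre[OF xh] xt[OF g] xt[of ?gh] E_objD(6)[OF T])
      qed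
      show "x ?gh = \<epsilon> g h S \<bullet> (Fa g (x h) \<bullet> x g)"
        by (rule jm[of ?gh _ S]) (use g h *[OF P pr(1) xp] *[OF R pr(2) xr] in \<open>auto simp: in_Hom\<close>)
    next
      have "mono_arr C (x \<one>\<^bsub>G\<^esub>)"
      proof (rule monoI)
        fix W u v assume u: "u \<in> Hom C W (Dom C (x \<one>\<^bsub>G\<^esub>))" and v: "v \<in> Hom C W (Dom C (x \<one>\<^bsub>G\<^esub>))"
          and eq: "x \<one>\<^bsub>G\<^esub> \<bullet> u = x \<one>\<^bsub>G\<^esub> \<bullet> v"
        have [simp]: "u \<in> Arr C" "Dom C u = W" "Cod C u = S" "v \<in> Arr C" "Dom C v = W" "Cod C v = S"
          using u v by (auto simp: in_Hom)
        have "snd P \<one>\<^bsub>G\<^esub> \<bullet> (p \<bullet> u) = snd P \<one>\<^bsub>G\<^esub> \<bullet> (p \<bullet> v)"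
          using pre[OF xp[of "\<one>\<^bsub>G\<^esub>"], of u] pre[OF xp[of "\<one>\<^bsub>G\<^esub>"], of v] eq by simp
        then have 1: "p \<bullet> u = p \<bullet> v"
          by (rule monoD[OF iso_mono[OF E_objD(5)[OF P]], where W=W, rotated]) (auto simp: in_Hom)
        have "snd R \<one>\<^bsub>G\<^esub> \<bullet> (r \<bullet> u) = snd R \<one>\<^bsub>G\<^esub> \<bullet> (r \<bullet> v)"
          using pre[OF xr[of "\<one>\<^bsub>G\<^esub>"], of u] pre[OF xr[of "\<one>\<^bsub>G\<^esub>"], of v] eq by simp
        then have 2: "r \<bullet> u = r \<bullet> v"
          by (rule monoD[OF iso_mono[OF E_objD(5)[OF R]], where W=W, rotated]) (auto simp: in_Hom)
        show "u = v" by (rule product2_eq[OF prod, of u W v]) (use 1 2 in \<open>auto simp: in_Hom\<close>)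
      qed simp
      then show "mono_arr C (x \<one>\<^bsub>G\<^esub>) \<or> epi_arr C (x \<one>\<^bsub>G\<^esub>)" ..
    qed
    have ep: "equi ?S p P" "equi ?S r R" using xp xr pr by (auto simp: equi_def)
    have z0: "zero_arr C (Fa g (r \<bullet> i))" "zero_arr C (Fa g (p \<bullet> j))" if "g \<in> carrier G" for g
      using Fa_zero[OF that] eqs(3,4) by auto
    have idF: "Fa g p \<bullet> Fa g i = Idn C (Fo g (fst P))" "Fa g r \<bullet> Fa g j = Idn C (Fo g (fst R))"
      if "g \<in> carrier G" for g
      using arg_cong[OF eqs(1), of "Fa g"] arg_cong[OF eqs(2), of "Fa g"] that by simp_all
    have "x g \<bullet> i = Fa g i \<bullet> snd P g" if g: "g \<in> carrier G" for g
    proof (rule jm[OF g, of _ "fst P"])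
      show "Fa g p \<bullet> (x g \<bullet> i) = Fa g p \<bullet> (Fa g i \<bullet> snd P g)"
        using g by (simp add: pre[OF xp[OF g]] eqs(1) pre[OF idF(1)[OF g]])
      have "Fa g r \<bullet> (x g \<bullet> i) = snd R g \<bullet> (r \<bullet> i)" using g by (simp add: pre[OF xr[OF g]])
      moreover have "zero_arr C (snd R g \<bullet> (r \<bullet> i))" by (rule zero_comp_left[OF eqs(3)]) (use g in auto)
      moreover have "zero_arr C (Fa g (r \<bullet> i) \<bullet> snd P g)" by (rule zero_comp_right[OF z0(1)]) (use g in auto)
      ultimately show "Fa g r \<bullet> (x g \<bullet> i) = Fa g r \<bullet> (Fa g i \<bullet> snd P g)"
        using zero_unique[of "snd R g \<bullet> (r \<bullet> i)" "Fa g (r \<bullet> i) \<bullet> snd P g"] g by simp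
    qed (use g in \<open>auto simp: in_Hom\<close>)
    then have ei: "equi P i ?S" using ij by (auto simp: equi_def)
    have "x g \<bullet> j = Fa g j \<bullet> snd R g" if g: "g \<in> carrier G" for g
    proof (rule jm[OF g, of _ "fst R"])
      show "Fa g r \<bullet> (x g \<bullet> j) = Fa g r \<bullet> (Fa g j \<bullet> snd R g)"
        using g by (simp add: pre[OF xr[OF g]] eqs(2) pre[OF idF(2)[OF g]])
      have "Fa g p \<bullet> (x g \<bullet> j) = snd P g \<bullet> (p \<bullet> j)" using g by (simp add: pre[OF xp[OF g]])
      moreover have "zero_arr C (snd P g \<bullet> (p \<bullet> j))" by (rule zero_comp_left[OF eqs(4)]) (use g in auto)
      moreover have "zero_arr C (Fa g (p \<bullet> j) \<bullet> snd R g)" by (rule zero_comp_right[OF z0(2)]) (use g in auto)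
      ultimately show "Fa g p \<bullet> (x g \<bullet> j) = Fa g p \<bullet> (Fa g j \<bullet> snd R g)"
        using zero_unique[of "snd P g \<bullet> (p \<bullet> j)" "Fa g (p \<bullet> j) \<bullet> snd R g"] g by simp
    qed (use g in \<open>auto simp: in_Hom\<close>)
    then have ej: "equi R j ?S" using ij by (auto simp: equi_def)
    show "\<exists>S. \<exists>i\<in>Hom E P S. \<exists>j\<in>Hom E R S. \<exists>p\<in>Hom E S P. \<exists>r\<in>Hom E S R.
        p \<bullet>\<^bsub>E\<^esub> i = Idn E P \<and> r \<bullet>\<^bsub>E\<^esub> j = Idn E R \<and> zero_arr E (r \<bullet>\<^bsub>E\<^esub> i) \<and> zero_arr E (p \<bullet>\<^bsub>E\<^esub> j) \<and>
        ?add (i \<bullet>\<^bsub>E\<^esub> p) (j \<bullet>\<^bsub>E\<^esub> r) = Idn E S"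
    proof (intro exI bexI conjI)
      show "(P, i, ?S) \<in> Hom E P ?S" "(R, j, ?S) \<in> Hom E R ?S" "(?S, p, P) \<in> Hom E ?S P" "(?S, r, R) \<in> Hom E ?S R"
        using P R S_obj ei ej ep by (auto simp: E_Hom_iff)
      show "(?S, p, P) \<bullet>\<^bsub>E\<^esub> (P, i, ?S) = Idn E P" "(?S, r, R) \<bullet>\<^bsub>E\<^esub> (R, j, ?S) = Idn E R"
        using eqs by (simp_all add: E_sel)
      show "zero_arr E ((?S, r, R) \<bullet>\<^bsub>E\<^esub> (P, i, ?S))" "zero_arr E ((?S, p, P) \<bullet>\<^bsub>E\<^esub> (R, j, ?S))"
        using eqs(3,4) E_zero_arr[OF E_ArrI[OF P R equi_comp[OF P S_obj R ei ep(2)]]]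
          E_zero_arr[OF E_ArrI[OF R P equi_comp[OF R S_obj P ej ep(1)]]] by (simp_all add: E_sel)
      show "?add ((P, i, ?S) \<bullet>\<^bsub>E\<^esub> (?S, p, P)) ((R, j, ?S) \<bullet>\<^bsub>E\<^esub> (?S, r, R)) = Idn E ?S"
        using eqs(5) by (simp add: E_sel)
    qed
  qed
qed

lemma E_abelian: "abelian_category E"
proof (intro abelian_category.intro abelian_category_axioms.intro E_category)
  show "\<exists>add. additive_category E add" using additive E_additive by blast
  fix f assume f: "f \<in> Arr E"
  obtain P \<theta> R where [simp]: "f = (P, \<theta>, R)" by (metis prod_cases3)
  note a = f[simplified] and D = E_ArrD[OF f[simplified]]
  have \<theta>: "\<theta> \<in> Arr C" using equiD(1)[OF D(3)] .
  obtain k where k: "is_kernel C k \<theta>" using kernel_exists[OF \<theta>] ..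
  obtain c where c: "is_cokernel C c \<theta>" using cokernel_exists[OF \<theta>] ..
  show "\<exists>k. is_kernel E k f" using E_kernel_lift[OF a _ k] E_kernel_exists[OF a k] by fastforce
  show "\<exists>c. is_cokernel E c f" using E_cokernel_lift[OF a _ c] E_cokernel_exists[OF a c] by fastforce
next
  fix m assume m: "mono_arr E m"
  obtain P \<theta> R where [simp]: "m = (P, \<theta>, R)" by (metis prod_cases3)
  note a = E.mono_Arr[OF m, simplified] and D = E_ArrD[OF E.mono_Arr[OF m, simplified]]
  have \<theta>: "\<theta> \<in> Arr C" using equiD(1)[OF D(3)] .
  obtain c where c: "is_cokernel C c \<theta>" using cokernel_exists[OF \<theta>] ..
  obtain \<kappa> where K: "(R, c, (Cod C c, \<kappa>)) \<in> Arr E" using E_cokernel_exists[OF a c] ..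
  have "is_kernel C \<theta> c" using mono_kernel_of_cokernel[OF _ c] m E_mono_iff[OF a] by simp
  then show "\<exists>f. is_kernel E m f" using E_kernel_lift[OF K a] by fastforce
next
  fix m assume m: "epi_arr E m"
  obtain P \<theta> R where [simp]: "m = (P, \<theta>, R)" by (metis prod_cases3)
  note a = E.epi_Arr[OF m, simplified] and D = E_ArrD[OF E.epi_Arr[OF m, simplified]]
  have \<theta>: "\<theta> \<in> Arr C" using equiD(1)[OF D(3)] .
  obtain k where k: "is_kernel C k \<theta>" using kernel_exists[OF \<theta>] ..
  obtain \<kappa> where K: "((Dom C k, \<kappa>), k, P) \<in> Arr E" using E_kernel_exists[OF a k] ..
  have "is_cokernel C \<theta> k" using epi_cokernel_of_kernel[OF _ k] m E_epi_iff[OF a] by simp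
  then show "\<exists>f. is_cokernel E m f" using E_cokernel_lift[OF K a] by fastforce
qed

sublocale E: abelian_category E
  by (rule E_abelian)

abbreviation "NG \<equiv> equivariant_sub G C F \<epsilon> N"

lemma NG_iff: "P \<in> NG \<longleftrightarrow> P \<in> Obj E \<and> fst P \<in> N"
  by (auto simp: equivariant_sub_def equivariant_cat_def)

lemma E_serre: "serre_subcategory E NG"
proof (intro serre_subcategory.intro serre_subcategory_axioms.intro E_abelian)
  show "NG \<subseteq> Obj E" by (auto simp: NG_iff)
  obtain O' where O': "zero_obj E O'" "zero_obj C (fst O')" using E_zero_object .
  then show "NG \<noteq> {}" using N_zero E.zero_obj_Obj NG_iff by blast
  show sub: "Dom E m \<in> NG" if m: "mono_arr E m" "Cod E m \<in> NG" for m
  proof -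
    obtain P \<theta> R where [simp]: "m = (P, \<theta>, R)" by (metis prod_cases3)
    note a = E.mono_Arr[OF m(1), simplified] and D = E_ArrD[OF E.mono_Arr[OF m(1), simplified]]
    have "mono_arr C \<theta>" using E_mono_iff[OF a] m by simp
    then show ?thesis using serre_sub[of \<theta>] equiD[OF D(3)] m(2) D(1) by (auto simp: NG_iff E_sel)
  qed
  show "Cod E m \<in> NG" if m: "epi_arr E m" "Dom E m \<in> NG" for m
  proof -
    obtain P \<theta> R where [simp]: "m = (P, \<theta>, R)" by (metis prod_cases3)
    note a = E.epi_Arr[OF m(1), simplified] and D = E_ArrD[OF E.epi_Arr[OF m(1), simplified]]
    have "epi_arr C \<theta>" using E_epi_iff[OF a] m by simp
    then show ?thesis using serre_quot[of \<theta>] equiD[OF D(3)] m(2) D(2) by (auto simp: NG_iff E_sel)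
  qed
  fix k e assume se: "short_exact E k e" and kN: "Dom E k \<in> NG" and eN: "Cod E e \<in> NG"
  have ke: "is_kernel E k e" and ek: "is_cokernel E e k" using se by (auto simp: short_exact_def)
  obtain P \<theta> R where [simp]: "e = (P, \<theta>, R)" by (metis prod_cases3)
  have ee: "epi_arr E e" using E.cokernel_epi[OF ek] .
  note a = E.epi_Arr[OF ee, simplified] and D = E_ArrD[OF E.epi_Arr[OF ee, simplified]]
  have e: "epi_arr C \<theta>" using E_epi_iff[OF a] ee by simp
  obtain l where l: "is_kernel C l \<theta>" using kernel_exists equiD(1)[OF D(3)] by blast
  obtain \<kappa> where K: "((Dom C l, \<kappa>), l, P) \<in> Arr E" using E_kernel_exists[OF a l] ..
  let ?L = "(Dom C l, \<kappa>)"
  have lH: "(?L, l, P) \<in> Hom E ?L (Dom E e)" using K by (simp add: in_Hom E_sel)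
  have lE: "is_kernel E (?L, l, P) e" using E_kernel_lift[OF a K l] by simp
  obtain u where u: "u \<in> Hom E ?L (Dom E k)" "k \<bullet>\<^bsub>E\<^esub> u = (?L, l, P)"
    using E.kernel_factor[OF ke E.kernelD(4)[OF lE] lH] by metis
  have "mono_arr E u"
    by (rule E.mono_cancel[of k u]) (use u E.kernelD(1)[OF ke] E.kernel_mono[OF lE] in \<open>auto simp: in_Hom\<close>)
  then have "?L \<in> NG" using sub[of u] u(1) kN by (auto simp: in_Hom)
  then have "Dom C l \<in> N" by (simp add: NG_iff)
  moreover have "short_exact C l \<theta>" using l epi_cokernel_of_kernel[OF e l] by (simp add: short_exact_def)
  moreover have "Cod C \<theta> \<in> N" using eN equiD[OF D(3)] by (simp add: NG_iff E_sel)
  ultimately have "Dom C \<theta> \<in> N" using serre_ext by blast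
  then show "Dom E e \<in> NG" using equiD[OF D(3)] D(1) by (simp add: NG_iff E_sel)
qed

sublocale E: serre_subcategory E NG
  by (rule E_serre)

lemma E_Niso_iff:
  assumes a: "(P, \<theta>, R) \<in> Arr E"
  shows "Niso E NG (P, \<theta>, R) \<longleftrightarrow> Niso C N \<theta>"
proof -
  note D = E_ArrD[OF a]
  have \<theta>: "\<theta> \<in> Arr C" using equiD(1)[OF D(3)] .
  obtain k where k: "is_kernel C k \<theta>" using kernel_exists[OF \<theta>] ..
  obtain \<kappa> where K: "((Dom C k, \<kappa>), k, P) \<in> Arr E" using E_kernel_exists[OF a k] ..
  have "Nker E NG (P, \<theta>, R) \<longleftrightarrow> (Dom C k, \<kappa>) \<in> NG"
  proof
    assume "Nker E NG (P, \<theta>, R)"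
    then show "(Dom C k, \<kappa>) \<in> NG"
      using E.Nker_kernel[OF _ E_kernel_lift[OF a K k]] by (simp add: E_sel)
  next
    assume "(Dom C k, \<kappa>) \<in> NG"
    then show "Nker E NG (P, \<theta>, R)" unfolding Nker_def
      by (intro exI[of _ "((Dom C k, \<kappa>), k, P)"] conjI E_kernel_lift[OF a K k]) (simp add: E_sel)
  qed
  also have "\<dots> \<longleftrightarrow> Nker C N \<theta>"
    using Nker_kernel[OF _ k] k E_ArrD(1)[OF K] by (auto simp: NG_iff Nker_def)
  finally have 1: "Nker E NG (P, \<theta>, R) \<longleftrightarrow> Nker C N \<theta>" .
  obtain c where c: "is_cokernel C c \<theta>" using cokernel_exists[OF \<theta>] ..
  obtain \<mu> where L: "(R, c, (Cod C c, \<mu>)) \<in> Arr E" using E_cokernel_exists[OF a c] ..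
  have "Ncok E NG (P, \<theta>, R) \<longleftrightarrow> (Cod C c, \<mu>) \<in> NG"
  proof
    assume "Ncok E NG (P, \<theta>, R)"
    then show "(Cod C c, \<mu>) \<in> NG"
      using E.Ncok_cokernel[OF _ E_cokernel_lift[OF a L c]] by (simp add: E_sel)
  next
    assume "(Cod C c, \<mu>) \<in> NG"
    then show "Ncok E NG (P, \<theta>, R)" unfolding Ncok_def
      by (intro exI[of _ "(R, c, (Cod C c, \<mu>))"] conjI E_cokernel_lift[OF a L c]) (simp add: E_sel)
  qed
  also have "\<dots> \<longleftrightarrow> Ncok C N \<theta>"
    using Ncok_cokernel[OF _ c] c E_ArrD(2)[OF L] by (auto simp: NG_iff Ncok_def)
  finally show ?thesis using 1 by (simp add: Niso_def)
qed

end

section \<open>The comparison functor\<close>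

context serre_subcategory
begin

lemma common_equalizer:
  assumes "finite I" "U \<in> Obj C"
    and "\<And>h. h \<in> I \<Longrightarrow> a h \<in> Hom C U (Z h) \<and> b h \<in> Hom C U (Z h) \<and> q (a h) = q (b h)"
  shows "\<exists>W. \<exists>t \<in> Hom C W U. Niso C N t \<and> (\<forall>h \<in> I. a h \<bullet> t = b h \<bullet> t)"
  using assms(1,3)
proof (induction I)
  case empty
  show ?case using Idn_Hom[OF assms(2)] Niso_Idn[OF assms(2)] by blast
next
  case (insert i I)
  obtain W t where t: "t \<in> Hom C W U" "Niso C N t" "\<And>h. h \<in> I \<Longrightarrow> a h \<bullet> t = b h \<bullet> t"
    using insert.IH insert.prems by (metis insertI2)
  have i: "a i \<in> Hom C U (Z i)" "b i \<in> Hom C U (Z i)" "q (a i) = q (b i)" using insert.prems by auto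
  obtain W' t' where t': "t' \<in> Hom C W' U" "Niso C N t'" "a i \<bullet> t' = b i \<bullet> t'"
    using q_eq_iff[OF i(1,2)] i(3) by blast
  obtain V x y where xy: "x \<in> Hom C V W" "y \<in> Hom C V W'" "t \<bullet> x = t' \<bullet> y" "Niso C N (t \<bullet> x)"
    using Ore_common[OF t(1,2) t'(1,2)] by metis
  have [simp]: "t \<in> Arr C" "Dom C t = W" "Cod C t = U" "t' \<in> Arr C" "Dom C t' = W'" "Cod C t' = U"
    "x \<in> Arr C" "Cod C x = W" "y \<in> Arr C" "Cod C y = W'" "Dom C x = V"
    using t(1) t'(1) xy(1,2) by (auto simp: in_Hom)
  have "a h \<bullet> (t \<bullet> x) = b h \<bullet> (t \<bullet> x)" if h: "h \<in> insert i I" for h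
  proof -
    have [simp]: "a h \<in> Arr C" "Dom C (a h) = U" "b h \<in> Arr C" "Dom C (b h) = U"
      using insert.prems[OF h] by (auto simp: in_Hom)
    show ?thesis
    proof (cases "h \<in> I")
      case True
      show ?thesis by (simp add: pre[OF t(3)[OF True]])
    next
      case False
      then have [simp]: "h = i" using h by simp
      have [simp]: "a i \<in> Arr C" "Dom C (a i) = U" "b i \<in> Arr C" "Dom C (b i) = U"
        using i by (auto simp: in_Hom)
      show ?thesis unfolding xy(3) by (simp add: pre[OF t'(3)])
    qed
  qed
  moreover have "t \<bullet> x \<in> Hom C V U" by (simp add: in_Hom)
  ultimately show ?case using xy(4) by blast
qed

lemma q_product:
  assumes p: "is_product C I Z S \<pi>" and I: "finite I"
  shows "is_product Q I Z S (\<lambda>h. q (\<pi> h))"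
  unfolding is_product_def
proof (intro conjI ballI allI impI)
  note P = productD[OF p]
  show "S \<in> Obj Q" using P(1) by simp
  show "q (\<pi> h) \<in> Hom Q S (Z h)" if "h \<in> I" for h using q_Hom[OF P(2)[OF that]] .
  fix W u assume W: "W \<in> Obj Q" and u: "\<forall>h \<in> I. u h \<in> Hom Q W (Z h)"
  obtain V s where s: "s \<in> Hom C V W" "Niso C N s" "\<forall>h \<in> I. \<exists>f \<in> Hom C V (Z h). u h \<bullet>\<^bsub>Q\<^esub> q s = q f"
    using quot_common_roof[of I u W Z] I u W by auto
  then obtain f where f: "\<And>h. h \<in> I \<Longrightarrow> f h \<in> Hom C V (Z h)" "\<And>h. h \<in> I \<Longrightarrow> u h \<bullet>\<^bsub>Q\<^esub> q s = q (f h)"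
    by metis
  obtain x where x: "x \<in> Hom C V S" "\<forall>h \<in> I. \<pi> h \<bullet> x = f h"
    using product_map[OF p Hom_Obj(1)[OF s(1)], of f] f(1) by blast
  obtain k where k: "k \<in> Hom Q W V" "q s \<bullet>\<^bsub>Q\<^esub> k = Idn Q W"
    using Q.isoE[OF q_iso[OF s(2)] q_Hom[OF s(1)]] by metis
  have [simp]: "s \<in> Arr C" "Dom C s = V" "Cod C s = W" "x \<in> Arr C" "Dom C x = V" "Cod C x = S"
    "k \<in> Arr Q" "Dom Q k = W" "Cod Q k = V" using s x k by (auto simp: in_Hom)
  have ex: "q x \<bullet>\<^bsub>Q\<^esub> k \<in> Hom Q W S \<and> (\<forall>h \<in> I. q (\<pi> h) \<bullet>\<^bsub>Q\<^esub> (q x \<bullet>\<^bsub>Q\<^esub> k) = u h)"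
  proof (intro conjI ballI)
    show "q x \<bullet>\<^bsub>Q\<^esub> k \<in> Hom Q W S" by (simp add: in_Hom)
    fix h assume h: "h \<in> I"
    have [simp]: "\<pi> h \<in> Arr C" "Dom C (\<pi> h) = S" "u h \<in> Arr Q" "Dom Q (u h) = W"
      using P(2)[OF h] u h by (auto simp: in_Hom)
    have "q (\<pi> h) \<bullet>\<^bsub>Q\<^esub> (q x \<bullet>\<^bsub>Q\<^esub> k) = (u h \<bullet>\<^bsub>Q\<^esub> q s) \<bullet>\<^bsub>Q\<^esub> k"
      using arg_cong[OF x(2)[rule_format, OF h], of q] f(2)[OF h] by (simp flip: Q.assoc)
    then show "q (\<pi> h) \<bullet>\<^bsub>Q\<^esub> (q x \<bullet>\<^bsub>Q\<^esub> k) = u h" by (simp add: k(2))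
  qed
  moreover have "y = y'"
    if y: "y \<in> Hom Q W S" "\<forall>h \<in> I. q (\<pi> h) \<bullet>\<^bsub>Q\<^esub> y = u h"
      and y': "y' \<in> Hom Q W S" "\<forall>h \<in> I. q (\<pi> h) \<bullet>\<^bsub>Q\<^esub> y' = u h" for y y'
  proof -
    obtain U r a b where r: "r \<in> Hom C U W" "a \<in> Hom C U S" "b \<in> Hom C U S" "Niso C N r"
      "y \<bullet>\<^bsub>Q\<^esub> q r = q a" "y' \<bullet>\<^bsub>Q\<^esub> q r = q b"
      using quot_common_roof2[OF y(1) y'(1)] by metis
    have [simp]: "r \<in> Arr C" "Dom C r = U" "Cod C r = W" "a \<in> Arr C" "Dom C a = U" "Cod C a = S"
      "b \<in> Arr C" "Dom C b = U" "Cod C b = S" "y \<in> Arr Q" "Dom Q y = W" "Cod Q y = S"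
      "y' \<in> Arr Q" "Dom Q y' = W" "Cod Q y' = S"
      using r(1-3) y(1) y'(1) by (auto simp: in_Hom)
    have "\<pi> h \<bullet> a \<in> Hom C U (Z h) \<and> \<pi> h \<bullet> b \<in> Hom C U (Z h) \<and> q (\<pi> h \<bullet> a) = q (\<pi> h \<bullet> b)"
      if h: "h \<in> I" for h
    proof -
      have [simp]: "\<pi> h \<in> Arr C" "Dom C (\<pi> h) = S" "Cod C (\<pi> h) = Z h" using P(2)[OF h] by (auto simp: in_Hom)
      have "q (\<pi> h \<bullet> a) = (q (\<pi> h) \<bullet>\<^bsub>Q\<^esub> y) \<bullet>\<^bsub>Q\<^esub> q r" by (simp add: r(5))
      also have "\<dots> = (q (\<pi> h) \<bullet>\<^bsub>Q\<^esub> y') \<bullet>\<^bsub>Q\<^esub> q r" using y(2) y'(2) h by metis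
      also have "\<dots> = q (\<pi> h \<bullet> b)" by (simp add: r(6))
      finally show ?thesis by (simp add: in_Hom)
    qed
    then obtain V' t where t: "t \<in> Hom C V' U" "Niso C N t" "\<forall>h \<in> I. (\<pi> h \<bullet> a) \<bullet> t = (\<pi> h \<bullet> b) \<bullet> t"
      using common_equalizer[OF I Hom_Obj(1)[OF r(1)], of "\<lambda>h. \<pi> h \<bullet> a" Z "\<lambda>h. \<pi> h \<bullet> b"] by blast
    have [simp]: "t \<in> Arr C" "Dom C t = V'" "Cod C t = U" using t by (auto simp: in_Hom)
    have "a \<bullet> t = b \<bullet> t"
    proof (rule product_eq[OF p])
      show "\<pi> h \<bullet> (a \<bullet> t) = \<pi> h \<bullet> (b \<bullet> t)" if h: "h \<in> I" for h
        using t(3)[rule_format, OF h] P(2)[OF h] by (simp add: in_Hom)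
    qed (simp_all add: in_Hom)
    then have "q a = q b" using q_eq_iff[OF r(2,3)] t by blast
    then have "y \<bullet>\<^bsub>Q\<^esub> q r = y' \<bullet>\<^bsub>Q\<^esub> q r" using r by simp
    then show "y = y'"
      by (rule Q.epiD[OF Q.iso_epi[OF q_iso[OF r(4)]], where W=S]) (simp_all add: in_Hom)
  qed
  ultimately show "\<exists>!x. x \<in> Hom Q W S \<and> (\<forall>h \<in> I. q (\<pi> h) \<bullet>\<^bsub>Q\<^esub> x = u h)" by metis
qed

lemma q_product2:
  assumes "is_product2 C X Y S p r"
  shows "is_product2 Q X Y S (q p) (q r)"
  using q_product[OF assms] by (simp add: if_distrib[of q])

lemma q_zero_comp:
  assumes z: "zero_arr C z" "z \<in> Hom C X Y" and \<phi>: "\<phi> \<in> Hom Q W X" and z': "zero_arr C z'" "z' \<in> Hom C W Y"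
  shows "q z \<bullet>\<^bsub>Q\<^esub> \<phi> = q z'"
proof -
  obtain V s f where sf: "s \<in> Hom C V W" "f \<in> Hom C V X" "Niso C N s" "\<phi> \<bullet>\<^bsub>Q\<^esub> q s = q f"
    using quot_roof[OF \<phi>] by metis
  have [simp]: "s \<in> Arr C" "Dom C s = V" "Cod C s = W" "f \<in> Arr C" "Dom C f = V" "Cod C f = X"
    "z \<in> Arr C" "Dom C z = X" "Cod C z = Y" "z' \<in> Arr C" "Dom C z' = W" "Cod C z' = Y"
    "\<phi> \<in> Arr Q" "Dom Q \<phi> = W" "Cod Q \<phi> = X"
    using sf z z' \<phi> by (auto simp: in_Hom)
  have "z \<bullet> f = z' \<bullet> s"
    by (rule zero_unique) (use zero_comp_right[OF z(1), of f] zero_comp_right[OF z'(1), of s] in simp_all)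
  then have "q (z \<bullet> f) = q (z' \<bullet> s)" by simp
  then have "(q z \<bullet>\<^bsub>Q\<^esub> \<phi>) \<bullet>\<^bsub>Q\<^esub> q s = q z' \<bullet>\<^bsub>Q\<^esub> q s" by (simp add: sf(4))
  then show ?thesis
    by (rule Q.epiD[OF Q.iso_epi[OF q_iso[OF sf(3)]], where W=Y]) (simp_all add: in_Hom)
qed

end

context invariant_serre
begin

abbreviation "Fb g \<equiv> induced_functor C N (F g)"

lemma Fb_Obj [simp]: "FObj (Fb g) X = Fo g X"
  by (simp add: induced_functor_def)

lemma Fb_q [simp]: "\<lbrakk>g \<in> carrier G; f \<in> Arr C\<rbrakk> \<Longrightarrow> FArr (Fb g) (q f) = q (Fa g f)"
  using serre_endofunctor.Fbar_q[OF F_serre, of g f "Dom C f" "Cod C f"] by (simp add: in_Hom)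

sublocale D: functor_family G Q Fb "induced_iso C N \<epsilon>"
  by (intro functor_family.intro functor_family_axioms.intro quot_category
      serre_endofunctor.Fbar_functor[OF F_serre])

lemma eps_q [simp]: "induced_iso C N \<epsilon> g h X = q (\<epsilon> g h X)"
  by (simp add: induced_iso_def quotient_functor_def)

abbreviation "\<Psi> \<equiv> Psi G C N"
abbreviation "\<Psi>o \<equiv> Psi_obj G C N"

lemma Psi_sel:
  "FObj \<Psi> = \<Psi>o" "FArr \<Psi> (P, \<theta>, R) = (\<Psi>o P, q \<theta>, \<Psi>o R)" "fst (\<Psi>o P) = fst P"
  "g \<in> carrier G \<Longrightarrow> snd (\<Psi>o P) g = q (snd P g)"
  by (simp_all add: Psi_def Psi_obj_def quotient_functor_def case_prod_unfold)

lemma Psi_Obj: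
  assumes P: "P \<in> Obj E"
  shows "\<Psi>o P \<in> Obj D.E"
proof -
  note [simp] = E_objD(1-4)[OF P] Psi_sel
  have "snd (\<Psi>o P) \<in> extensional (carrier G)" by (simp add: Psi_obj_def case_prod_unfold)
  moreover have "is_iso Q (q (snd P g))" if "g \<in> carrier G" for g
    using q_iso[OF iso_Niso[OF E_objD(5)[OF P that]]] .
  moreover have "q (snd P (g \<otimes>\<^bsub>G\<^esub> h)) = (q (\<epsilon> g h (fst P)) \<bullet>\<^bsub>Q\<^esub> q (Fa g (snd P h))) \<bullet>\<^bsub>Q\<^esub> q (snd P g)"
    if "g \<in> carrier G" "h \<in> carrier G" for g h
    using that by (simp add: E_objD(6)[OF P])
  ultimately show ?thesis unfolding D.E_Obj by (simp add: in_Hom)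
qed

lemma Psi_equi:
  assumes P: "P \<in> Obj E" and R: "R \<in> Obj E" and \<theta>: "equi P \<theta> R"
  shows "D.equi (\<Psi>o P) (q \<theta>) (\<Psi>o R)"
  unfolding D.equi_def
proof (intro conjI ballI)
  note [simp] = E_objD(1-4)[OF P] E_objD(1-4)[OF R] equiD(1-3)[OF \<theta>] Psi_sel
  show "q \<theta> \<in> Hom Q (fst (\<Psi>o P)) (fst (\<Psi>o R))" by (simp add: in_Hom)
  fix g assume g: "g \<in> carrier G"
  have "q (snd R g \<bullet> \<theta>) = q (Fa g \<theta> \<bullet> snd P g)" using equiD(4)[OF \<theta> g] by simp
  then show "snd (\<Psi>o R) g \<bullet>\<^bsub>Q\<^esub> q \<theta> = FArr (Fb g) (q \<theta>) \<bullet>\<^bsub>Q\<^esub> snd (\<Psi>o P) g" using g by simp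
qed

lemma Psi_Hom:
  assumes "a \<in> Hom E P R"
  shows "FArr \<Psi> a \<in> Hom D.E (\<Psi>o P) (\<Psi>o R)"
proof -
  obtain \<theta> where "a = (P, \<theta>, R)" "equi P \<theta> R" and "P \<in> Obj E" "R \<in> Obj E"
    using assms unfolding E_Hom_iff by blast
  then show ?thesis unfolding D.E_Hom_iff using Psi_Obj Psi_equi Psi_sel(2) by blast
qed

lemma Psi_functor: "is_functor E D.E \<Psi>"
proof (intro is_functor.intro is_functor_axioms.intro E_category D.E_category)
  show "FObj \<Psi> P \<in> Obj D.E" if "P \<in> Obj E" for P using Psi_Obj[OF that] by (simp add: Psi_sel)
  show "FArr \<Psi> a \<in> Hom D.E (FObj \<Psi> P) (FObj \<Psi> R)" if "a \<in> Hom E P R" for a P R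
    using Psi_Hom[OF that] by (simp add: Psi_sel)
  show "FArr \<Psi> (Idn E P) = Idn D.E (FObj \<Psi> P)" if "P \<in> Obj E" for P
    by (simp add: E_sel D.E_sel Psi_sel)
  fix a P R b S assume a: "a \<in> Hom E P R" and b: "b \<in> Hom E R S"
  obtain \<theta> \<phi> where *: "a = (P, \<theta>, R)" "equi P \<theta> R" "b = (R, \<phi>, S)" "equi R \<phi> S"
    using a b unfolding E_Hom_iff by blast
  then show "FArr \<Psi> (b \<bullet>\<^bsub>E\<^esub> a) = FArr \<Psi> b \<bullet>\<^bsub>D.E\<^esub> FArr \<Psi> a"
    using equiD(1-3)[OF *(2)] equiD(1-3)[OF *(4)] by (simp add: E_sel D.E_sel Psi_sel)
qed

lemma Psi_iso:
  assumes "Niso E NG a"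
  shows "is_iso D.E (FArr \<Psi> a)"
proof -
  obtain P \<theta> R where [simp]: "a = (P, \<theta>, R)" by (metis prod_cases3)
  have a: "(P, \<theta>, R) \<in> Arr E" using E.Niso_Arr[OF assms] by simp
  note D = E_ArrD[OF a]
  have "(\<Psi>o P, q \<theta>, \<Psi>o R) \<in> Arr D.E"
    using Psi_Obj[OF D(1)] Psi_Obj[OF D(2)] Psi_equi[OF D] by (auto simp: D.E_Arr_iff)
  then show ?thesis using D.E_iso_lift[of "\<Psi>o P" "q \<theta>" "\<Psi>o R"] q_iso E_Niso_iff[OF a] assms
    by (simp add: Psi_sel)
qed

text \<open>The right adjoint of the forgetful functor: \<open>\<Prod>\<^sub>h F\<^sub>h X\<close>, with \<open>G\<close> permuting the factors.\<close>

lemma coinduced_exists: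
  assumes X: "X \<in> Obj C"
  shows "\<exists>R \<pi>. R \<in> Obj E \<and> is_product C (carrier G) (\<lambda>h. Fo h X) (fst R) \<pi> \<and>
    (\<forall>g \<in> carrier G. \<forall>h \<in> carrier G. \<epsilon> g h X \<bullet> (Fa g (\<pi> h) \<bullet> snd R g) = \<pi> (g \<otimes>\<^bsub>G\<^esub> h))"
proof -
  obtain S \<pi> where p: "is_product C (carrier G) (\<lambda>h. Fo h X) S \<pi>"
    using finite_product_exists[OF finite_G, of "\<lambda>h. Fo h X"] X by auto
  note P = productD[OF p]
  have [simp]: "\<pi> h \<in> Arr C" "Dom C (\<pi> h) = S" "Cod C (\<pi> h) = Fo h X" if "h \<in> carrier G" for h
    using P(2)[OF that] by (auto simp: in_Hom)
  note [simp] = X P(1)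
  have Fp: "is_product C (carrier G) (\<lambda>h. Fo g (Fo h X)) (Fo g S) (\<lambda>h. Fa g (\<pi> h))" if "g \<in> carrier G" for g
    using equivalence_functor.pres_product[OF F_equivalence[OF that] p] .
  have "\<exists>x \<in> Hom C S (Fo g S). \<forall>h \<in> carrier G. \<epsilon> g h X \<bullet> (Fa g (\<pi> h) \<bullet> x) = \<pi> (g \<otimes>\<^bsub>G\<^esub> h)"
    if g: "g \<in> carrier G" for g
  proof -
    have "\<exists>u. u \<in> Hom C S (Fo g (Fo h X)) \<and> \<epsilon> g h X \<bullet> u = \<pi> (g \<otimes>\<^bsub>G\<^esub> h)" if h: "h \<in> carrier G" for h
    proof -
      have eH: "\<epsilon> g h X \<in> Hom C (Fo g (Fo h X)) (Fo (g \<otimes>\<^bsub>G\<^esub> h) X)" using g h by (simp add: in_Hom)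
      obtain k where k: "k \<in> Hom C (Fo (g \<otimes>\<^bsub>G\<^esub> h) X) (Fo g (Fo h X))" "\<epsilon> g h X \<bullet> k = Idn C (Fo (g \<otimes>\<^bsub>G\<^esub> h) X)"
        using isoE[OF eps_simps(4)[OF g h X] eH] by metis
      then show ?thesis using g h by (intro exI[of _ "k \<bullet> \<pi> (g \<otimes>\<^bsub>G\<^esub> h)"]) (simp add: in_Hom pre[OF k(2)])
    qed
    then obtain u where u: "\<And>h. h \<in> carrier G \<Longrightarrow> u h \<in> Hom C S (Fo g (Fo h X))"
      "\<And>h. h \<in> carrier G \<Longrightarrow> \<epsilon> g h X \<bullet> u h = \<pi> (g \<otimes>\<^bsub>G\<^esub> h)" by metis
    obtain x where "x \<in> Hom C S (Fo g S)" "\<forall>h \<in> carrier G. Fa g (\<pi> h) \<bullet> x = u h"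
      using product_map[OF Fp[OF g] P(1), of u] u(1) by blast
    then show ?thesis using u(2) by (intro bexI[of _ x]) auto
  qed
  then obtain x where x: "\<And>g. g \<in> carrier G \<Longrightarrow> x g \<in> Hom C S (Fo g S)"
    and xe: "\<And>g h. \<lbrakk>g \<in> carrier G; h \<in> carrier G\<rbrakk> \<Longrightarrow> \<epsilon> g h X \<bullet> (Fa g (\<pi> h) \<bullet> x g) = \<pi> (g \<otimes>\<^bsub>G\<^esub> h)"
    by metis
  have [simp]: "x g \<in> Arr C" "Dom C (x g) = S" "Cod C (x g) = Fo g S" if "g \<in> carrier G" for g
    using x[OF that] by (auto simp: in_Hom)
  have "(S, restrict x (carrier G)) \<in> Obj E"
  proof (rule E_ObjI[OF P(1) x])
    fix g h assume g: "g \<in> carrier G" and h: "h \<in> carrier G"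
    let ?gh = "g \<otimes>\<^bsub>G\<^esub> h" and ?y = "\<epsilon> g h S \<bullet> (Fa g (x h) \<bullet> x g)"
    show "x ?gh = ?y"
    proof (rule product_eq[OF Fp[of ?gh]])
      fix k assume k: "k \<in> carrier G"
      let ?hk = "h \<otimes>\<^bsub>G\<^esub> k"
      have nat: "Fa ?gh (\<pi> k) \<bullet> \<epsilon> g h S = \<epsilon> g h (Fo k X) \<bullet> Fa g (Fa h (\<pi> k))"
        using eps_natural[OF g h, of "\<pi> k" S "Fo k X"] k by simp
      have co: "\<epsilon> ?gh k X \<bullet> \<epsilon> g h (Fo k X) = \<epsilon> g ?hk X \<bullet> Fa g (\<epsilon> h k X)"
        using act.action_cocycle[OF g h k X] .
      have xh: "Fa g (\<epsilon> h k X) \<bullet> (Fa g (Fa h (\<pi> k)) \<bullet> Fa g (x h)) = Fa g (\<pi> ?hk)"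
        using arg_cong[OF xe[OF h k], of "Fa g"] g h k by simp
      have xh': "Fa g (\<epsilon> h k X) \<bullet> (Fa g (Fa h (\<pi> k)) \<bullet> (Fa g (x h) \<bullet> x g)) = Fa g (\<pi> ?hk) \<bullet> x g"
        using g h k by (simp flip: xh)
      have "\<epsilon> ?gh k X \<bullet> (Fa ?gh (\<pi> k) \<bullet> ?y) = \<epsilon> g ?hk X \<bullet> (Fa g (\<pi> ?hk) \<bullet> x g)"
        using g h k act.grp.m_assoc[OF g h k] by (simp add: pre[OF nat] pre[OF co] xh')
      also have "\<dots> = \<epsilon> ?gh k X \<bullet> (Fa ?gh (\<pi> k) \<bullet> x ?gh)"
        using g h k by (simp add: xe act.grp.m_assoc)
      finally have "\<epsilon> ?gh k X \<bullet> (Fa ?gh (\<pi> k) \<bullet> x ?gh) = \<epsilon> ?gh k X \<bullet> (Fa ?gh (\<pi> k) \<bullet> ?y)" ..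
      then show "Fa ?gh (\<pi> k) \<bullet> x ?gh = Fa ?gh (\<pi> k) \<bullet> ?y"
        by (rule monoD[OF iso_mono[OF eps_simps(4)], where W=S, rotated 3]) (use g h k in \<open>auto simp: in_Hom\<close>)
    qed (use g h in \<open>auto simp: in_Hom\<close>)
  next
    have "mono_arr C (x \<one>\<^bsub>G\<^esub>)"
    proof (rule monoI)
      fix W u v assume "u \<in> Hom C W (Dom C (x \<one>\<^bsub>G\<^esub>))" "v \<in> Hom C W (Dom C (x \<one>\<^bsub>G\<^esub>))"
        and eq: "x \<one>\<^bsub>G\<^esub> \<bullet> u = x \<one>\<^bsub>G\<^esub> \<bullet> v"
      then have uv: "u \<in> Hom C W S" "v \<in> Hom C W S" by auto
      have [simp]: "u \<in> Arr C" "Cod C u = S" "v \<in> Arr C" "Cod C v = S" using uv by (auto simp: in_Hom)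
      show "u = v"
      proof (rule product_eq[OF p uv])
        fix h assume h: "h \<in> carrier G"
        have x1: "\<epsilon> \<one>\<^bsub>G\<^esub> h X \<bullet> (Fa \<one>\<^bsub>G\<^esub> (\<pi> h) \<bullet> x \<one>\<^bsub>G\<^esub>) = \<pi> h" using xe[of "\<one>\<^bsub>G\<^esub>" h] h by simp
        have *: "\<pi> h \<bullet> w = \<epsilon> \<one>\<^bsub>G\<^esub> h X \<bullet> (Fa \<one>\<^bsub>G\<^esub> (\<pi> h) \<bullet> (x \<one>\<^bsub>G\<^esub> \<bullet> w))"
          if "w \<in> Arr C" "Cod C w = S" for w
          using arg_cong[OF x1, of "\<lambda>a. a \<bullet> w"] h that by simp
        show "\<pi> h \<bullet> u = \<pi> h \<bullet> v" using *[of u] *[of v] eq by simp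
      qed
    qed simp
    then show "mono_arr C (x \<one>\<^bsub>G\<^esub>) \<or> epi_arr C (x \<one>\<^bsub>G\<^esub>)" ..
  qed
  then show ?thesis using p xe by (intro exI[of _ "(S, restrict x (carrier G))"] exI[of _ \<pi>]) simp
qed

lemma coinduced_map:
  assumes P: "P \<in> Obj E" and z: "z \<in> Hom C (fst P) X" and R: "R \<in> Obj E"
    and p: "is_product C (carrier G) (\<lambda>h. Fo h X) (fst R) \<pi>"
    and xe: "\<And>g h. \<lbrakk>g \<in> carrier G; h \<in> carrier G\<rbrakk>
      \<Longrightarrow> \<epsilon> g h X \<bullet> (Fa g (\<pi> h) \<bullet> snd R g) = \<pi> (g \<otimes>\<^bsub>G\<^esub> h)"
  shows "\<exists>y. equi P y R \<and> (\<forall>h \<in> carrier G. \<pi> h \<bullet> y = Fa h z \<bullet> snd P h)"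
proof -
  have X: "X \<in> Obj C" using Hom_Obj(2)[OF z] .
  have [simp]: "\<pi> h \<in> Arr C" "Dom C (\<pi> h) = fst R" "Cod C (\<pi> h) = Fo h X" if "h \<in> carrier G" for h
    using productD(2)[OF p that] by (auto simp: in_Hom)
  have [simp]: "z \<in> Arr C" "Dom C z = fst P" "Cod C z = X" using z by (auto simp: in_Hom)
  note [simp] = X E_objD(1-4)[OF P] E_objD(1-4)[OF R]
  obtain y where y: "y \<in> Hom C (fst P) (fst R)"
    and py: "\<And>h. h \<in> carrier G \<Longrightarrow> \<pi> h \<bullet> y = Fa h z \<bullet> snd P h"
    using product_map[OF p E_objD(1)[OF P], of "\<lambda>h. Fa h z \<bullet> snd P h"] by (auto simp: in_Hom)
  have [simp]: "y \<in> Arr C" "Dom C y = fst P" "Cod C y = fst R" using y by (auto simp: in_Hom)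
  have "snd R g \<bullet> y = Fa g y \<bullet> snd P g" if g: "g \<in> carrier G" for g
  proof (rule product_eq[OF equivalence_functor.pres_product[OF F_equivalence[OF g] p]])
    fix h assume h: "h \<in> carrier G"
    let ?gh = "g \<otimes>\<^bsub>G\<^esub> h"
    have nat: "\<epsilon> g h X \<bullet> Fa g (Fa h z) = Fa ?gh z \<bullet> \<epsilon> g h (fst P)"
      using eps_natural[OF g h, of z "fst P" X] by simp
    have Fpy: "Fa g (\<pi> h) \<bullet> Fa g y = Fa g (Fa h z) \<bullet> Fa g (snd P h)"
      using arg_cong[OF py[OF h], of "Fa g"] g h by simp
    have "\<epsilon> g h X \<bullet> (Fa g (\<pi> h) \<bullet> (snd R g \<bullet> y)) = (\<epsilon> g h X \<bullet> (Fa g (\<pi> h) \<bullet> snd R g)) \<bullet> y"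
      using g h by simp
    also have "\<dots> = Fa ?gh z \<bullet> snd P ?gh" unfolding xe[OF g h] using g h py by simp
    also have "\<dots> = \<epsilon> g h X \<bullet> (Fa g (\<pi> h) \<bullet> (Fa g y \<bullet> snd P g))"
      using g h by (simp add: pre[OF Fpy] pre[OF nat] E_objD(6)[OF P])
    finally show "Fa g (\<pi> h) \<bullet> (snd R g \<bullet> y) = Fa g (\<pi> h) \<bullet> (Fa g y \<bullet> snd P g)"
      by (rule monoD[OF iso_mono[OF eps_simps(4)], where W="fst P", rotated 3]) (use g h in \<open>auto simp: in_Hom\<close>)
  qed (use g in \<open>auto simp: in_Hom\<close>)
  then have "equi P y R" using y by (simp add: equi_def)
  then show ?thesis using py by blast
qed

text \<open>Apply \<open>F\<^sub>1\<close> and use that \<open>\<epsilon>\<^sub>1\<^sub>,\<^sub>1 \<circ> F\<^sub>1 \<beta>\<^sub>1\<close> is the identity.\<close>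

lemma zero_by_unit:
  assumes P: "P \<in> Obj E" and z: "z \<in> Hom C (fst P) X" and w: "w \<in> Hom C W (fst P)"
    and zero: "zero_arr C (Fa \<one>\<^bsub>G\<^esub> z \<bullet> (snd P \<one>\<^bsub>G\<^esub> \<bullet> w))"
  shows "zero_arr C (z \<bullet> w)"
proof (rule Fa_reflect_zero[of "\<one>\<^bsub>G\<^esub>"])
  let ?e = "\<one>\<^bsub>G\<^esub>" and ?b = "snd P \<one>\<^bsub>G\<^esub>"
  note [simp] = E_objD(1-4)[OF P] Hom_Obj(2)[OF z]
  have [simp]: "z \<in> Arr C" "Dom C z = fst P" "Cod C z = X" "w \<in> Arr C" "Dom C w = W" "Cod C w = fst P"
    using z w by (auto simp: in_Hom)
  show "z \<bullet> w \<in> Arr C" by simp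
  have "(\<epsilon> ?e ?e (fst P) \<bullet> Fa ?e ?b) \<bullet> ?b = Idn C (Fo ?e (fst P)) \<bullet> ?b"
    using E_objD(6)[OF P, of ?e ?e] by simp
  then have unit: "\<epsilon> ?e ?e (fst P) \<bullet> Fa ?e ?b = Idn C (Fo ?e (fst P))"
    by (rule epiD[OF iso_epi[OF E_objD(5)[OF P]], where W="Fo ?e (fst P)", rotated]) (auto simp: in_Hom)
  have nat: "Fa ?e z \<bullet> \<epsilon> ?e ?e (fst P) = \<epsilon> ?e ?e X \<bullet> Fa ?e (Fa ?e z)"
    using eps_natural[of ?e ?e z "fst P" X] by simp
  have "Fa ?e (z \<bullet> w) = Fa ?e z \<bullet> ((\<epsilon> ?e ?e (fst P) \<bullet> Fa ?e ?b) \<bullet> Fa ?e w)" unfolding unit by simp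
  also have "\<dots> = \<epsilon> ?e ?e X \<bullet> Fa ?e (Fa ?e z \<bullet> (?b \<bullet> w))" by (simp add: pre[OF nat])
  finally have "Fa ?e (z \<bullet> w) = \<epsilon> ?e ?e X \<bullet> Fa ?e (Fa ?e z \<bullet> (?b \<bullet> w))" .
  moreover have "zero_arr C (\<epsilon> ?e ?e X \<bullet> Fa ?e (Fa ?e z \<bullet> (?b \<bullet> w)))"
    by (rule zero_comp_left[OF Fa_zero[OF _ zero]]) auto
  ultimately show "zero_arr C (Fa ?e (z \<bullet> w))" by simp
qed simp

text \<open>A subobject of \<open>q P\<close> that is invariant in the quotient comes from an equivariant subobject of \<open>P\<close>:
  represent it by an arrow \<open>f\<close> with cokernel \<open>z\<close> and take the intersection of the kernels of all \<open>F\<^sub>h z \<circ> \<beta>\<^sub>h\<close>.\<close>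

lemma invariant_subobject:
  assumes P: "P \<in> Obj E" and \<phi>: "\<phi> \<in> Hom Q V (fst P)" "mono_arr Q \<phi>"
    and inv: "\<And>g. g \<in> carrier G \<Longrightarrow>
      \<exists>x \<in> Hom Q V (Fo g V). q (snd P g) \<bullet>\<^bsub>Q\<^esub> \<phi> = FArr (Fb g) \<phi> \<bullet>\<^bsub>Q\<^esub> x"
  shows "\<exists>I m \<xi>. (I, m, P) \<in> Arr E \<and> \<xi> \<in> Hom Q (fst I) V \<and> is_iso Q \<xi> \<and> \<phi> \<bullet>\<^bsub>Q\<^esub> \<xi> = q m"
proof -
  let ?W = "fst P"
  note [simp] = E_objD(1-4)[OF P]
  obtain U s f where sf: "s \<in> Hom C U V" "f \<in> Hom C U ?W" "Niso C N s" "\<phi> \<bullet>\<^bsub>Q\<^esub> q s = q f"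
    using quot_roof[OF \<phi>(1)] by metis
  have [simp]: "\<phi> \<in> Arr Q" "Dom Q \<phi> = V" "Cod Q \<phi> = ?W" "s \<in> Arr C" "Dom C s = U" "Cod C s = V"
    "f \<in> Arr C" "Dom C f = U" "Cod C f = ?W"
    using \<phi> sf by (auto simp: in_Hom)
  have UV [simp]: "U \<in> Obj C" "V \<in> Obj C" using Hom_Obj[OF sf(1)] by auto
  obtain z where z: "is_cokernel C z f" using cokernel_exists[of f] by auto
  let ?X = "Cod C z"
  have [simp]: "z \<in> Arr C" "Dom C z = ?W" using cokernelD[OF z] by auto
  have zH: "z \<in> Hom C ?W ?X" by (simp add: in_Hom)
  obtain R \<pi> where R: "R \<in> Obj E" and p: "is_product C (carrier G) (\<lambda>h. Fo h ?X) (fst R) \<pi>"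
    and xe: "\<And>g h. \<lbrakk>g \<in> carrier G; h \<in> carrier G\<rbrakk> \<Longrightarrow> \<epsilon> g h ?X \<bullet> (Fa g (\<pi> h) \<bullet> snd R g) = \<pi> (g \<otimes>\<^bsub>G\<^esub> h)"
    using coinduced_exists[of ?X] by auto
  obtain y where y: "equi P y R" and py: "\<And>h. h \<in> carrier G \<Longrightarrow> \<pi> h \<bullet> y = Fa h z \<bullet> snd P h"
    using coinduced_map[OF P zH R p xe] by auto
  note [simp] = equiD(1-3)[OF y] E_objD(1)[OF R]
  have [simp]: "\<pi> h \<in> Arr C" "Dom C (\<pi> h) = fst R" "Cod C (\<pi> h) = Fo h ?X" if "h \<in> carrier G" for h
    using productD(2)[OF p that] by (auto simp: in_Hom)
  obtain l where l: "is_kernel C l y" using kernel_exists[of y] by auto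
  obtain \<kappa> where L: "((Dom C l, \<kappa>), l, P) \<in> Arr E" using E_kernel_exists[OF E_ArrI[OF P R y] l] ..
  note [simp] = kernelD(1,3)[OF l, simplified]
  have zl: "zero_arr C (z \<bullet> l)"
  proof (rule zero_by_unit[OF P zH])
    show "l \<in> Hom C (Dom C l) ?W" by (simp add: in_Hom)
    have "Fa \<one>\<^bsub>G\<^esub> z \<bullet> (snd P \<one>\<^bsub>G\<^esub> \<bullet> l) = \<pi> \<one>\<^bsub>G\<^esub> \<bullet> (y \<bullet> l)" by (simp add: pre[OF py[of "\<one>\<^bsub>G\<^esub>"]])
    then show "zero_arr C (Fa \<one>\<^bsub>G\<^esub> z \<bullet> (snd P \<one>\<^bsub>G\<^esub> \<bullet> l))"
      using zero_comp_left[OF kernelD(4)[OF l], of "\<pi> \<one>\<^bsub>G\<^esub>"] by simp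
  qed
  obtain I m e where me: "mono_arr C m" "epi_arr C e" "e \<in> Hom C U I" "m \<in> Hom C I ?W" "f = m \<bullet> e"
    using factorization[OF sf(2)] by metis
  have [simp]: "m \<in> Arr C" "Dom C m = I" "Cod C m = ?W" "e \<in> Arr C" "Dom C e = U" "Cod C e = I"
    using me by (auto simp: in_Hom)
  have "is_cokernel C z m" using z cokernel_epi_comp[OF me(2), of m z] me(5) by simp
  then have mk: "is_kernel C m z" by (rule mono_kernel_of_cokernel[OF me(1)])
  obtain j where j: "j \<in> Hom C (Dom C l) I" "m \<bullet> j = l"
    using kernel_factor[OF mk zl, of "Dom C l"] by (auto simp: in_Hom)
  have [simp]: "j \<in> Arr C" "Dom C j = Dom C l" "Cod C j = I" using j by (auto simp: in_Hom)
  have qf: "q f = q m \<bullet>\<^bsub>Q\<^esub> q e" using me(5) by simp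
  have "mono_arr Q (q f)"
    using Q.mono_comp[OF Q.iso_mono[OF q_iso[OF sf(3)]] \<phi>(2)] sf(4) by simp
  then have "mono_arr Q (q e)" unfolding qf by (rule Q.mono_cancel) simp_all
  then have eN: "Niso C N e" using q_mono_Nker[of e] epi_Ncok[OF me(2)] by (simp add: Niso_def)
  obtain o' where o': "o' \<in> Hom C U (fst R)" "zero_arr C o'" using zero_Hom[of U "fst R"] by auto
  have [simp]: "o' \<in> Arr C" "Dom C o' = U" "Cod C o' = fst R" using o' by (auto simp: in_Hom)
  have "q (y \<bullet> f) = q o'"
  proof (rule Q.product_eq[OF q_product[OF p finite_G], of _ U])
    fix h assume h: "h \<in> carrier G"
    obtain x where x: "x \<in> Hom Q V (Fo h V)" "q (snd P h) \<bullet>\<^bsub>Q\<^esub> \<phi> = FArr (Fb h) \<phi> \<bullet>\<^bsub>Q\<^esub> x"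
      using inv[OF h] by blast
    have [simp]: "x \<in> Arr Q" "Dom Q x = V" "Cod Q x = Fo h V" using x by (auto simp: in_Hom)
    have sh: "q (Fa h s) \<in> Hom Q (Fo h U) (Fo h V)" using h by (simp add: in_Hom)
    have "Niso C N (Fa h s)" using serre_endofunctor.pres_Niso[OF F_serre[OF h] sf(3)] .
    then obtain k where k: "k \<in> Hom Q (Fo h V) (Fo h U)" "q (Fa h s) \<bullet>\<^bsub>Q\<^esub> k = Idn Q (Fo h V)"
      using Q.isoE[OF q_iso sh] by metis
    have [simp]: "k \<in> Arr Q" "Dom Q k = Fo h V" "Cod Q k = Fo h U" using k by (auto simp: in_Hom)
    let ?x = "k \<bullet>\<^bsub>Q\<^esub> (x \<bullet>\<^bsub>Q\<^esub> q s)"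
    have xH: "?x \<in> Hom Q U (Fo h U)" by (simp add: in_Hom)
    have Fs: "FArr (Fb h) \<phi> \<bullet>\<^bsub>Q\<^esub> q (Fa h s) = q (Fa h f)"
      using arg_cong[OF sf(4), of "FArr (Fb h)"] h by simp
    have "q (snd P h) \<bullet>\<^bsub>Q\<^esub> q f = (q (snd P h) \<bullet>\<^bsub>Q\<^esub> \<phi>) \<bullet>\<^bsub>Q\<^esub> q s" using h by (simp add: sf(4))
    also have "\<dots> = FArr (Fb h) \<phi> \<bullet>\<^bsub>Q\<^esub> (q (Fa h s) \<bullet>\<^bsub>Q\<^esub> ?x)" unfolding x(2) using h by (simp add: Q.pre[OF k(2)])
    also have "\<dots> = q (Fa h f) \<bullet>\<^bsub>Q\<^esub> ?x" using h by (simp add: Q.pre[OF Fs])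
    finally have 1: "q (snd P h) \<bullet>\<^bsub>Q\<^esub> q f = q (Fa h f) \<bullet>\<^bsub>Q\<^esub> ?x" .
    have "q (\<pi> h) \<bullet>\<^bsub>Q\<^esub> q (y \<bullet> f) = q (Fa h z \<bullet> snd P h) \<bullet>\<^bsub>Q\<^esub> q f" using h by (simp flip: py[OF h])
    also have "\<dots> = q (Fa h (z \<bullet> f)) \<bullet>\<^bsub>Q\<^esub> ?x" using h 1 by simp
    also have "\<dots> = q (\<pi> h \<bullet> o')"
    proof (rule q_zero_comp[OF Fa_zero[OF h cokernelD(4)[OF z]] _ xH])
      show "zero_arr C (\<pi> h \<bullet> o')" by (rule zero_comp_left[OF o'(2)]) (use h in auto)
    qed (use h in \<open>auto simp: in_Hom\<close>)
    finally show "q (\<pi> h) \<bullet>\<^bsub>Q\<^esub> q (y \<bullet> f) = q (\<pi> h) \<bullet>\<^bsub>Q\<^esub> q o'" using h by simp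
  qed (auto simp: in_Hom)
  then obtain T t where t: "t \<in> Hom C T U" "Niso C N t" "zero_arr C ((y \<bullet> f) \<bullet> t)"
    using q_zero[OF _ o'(2) _ o'(1), of "y \<bullet> f"] by (auto simp: in_Hom)
  have [simp]: "t \<in> Arr C" "Dom C t = T" "Cod C t = U" using t by (auto simp: in_Hom)
  obtain v where v: "v \<in> Hom C T (Dom C l)" "l \<bullet> v = f \<bullet> t"
    using kernel_factor[OF l, of "f \<bullet> t" T] t(3) by (auto simp: in_Hom)
  have [simp]: "v \<in> Arr C" "Dom C v = T" "Cod C v = Dom C l" using v by (auto simp: in_Hom)
  have "m \<bullet> (j \<bullet> v) = m \<bullet> (e \<bullet> t)" using v(2) me(5) by (simp add: pre[OF j(2)])
  then have "j \<bullet> v = e \<bullet> t" by (rule monoD[OF me(1), where W=T]) (auto simp: in_Hom)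
  moreover have "Ncok C N (e \<bullet> t)" using Niso_comp[OF t(2) eN] by (simp add: Niso_def)
  ultimately have "Ncok C N j" using Ncok_cancel[of j v] by simp
  moreover have "mono_arr C j" by (rule mono_cancel[of m]) (use j(2) kernel_mono[OF l] in auto)
  ultimately have jN: "Niso C N j" using mono_Nker by (simp add: Niso_def)
  have eH: "q e \<in> Hom Q U I" by (simp add: in_Hom)
  obtain k where k: "k \<in> Hom Q I U" "q e \<bullet>\<^bsub>Q\<^esub> k = Idn Q I" "is_iso Q k"
    using Q.isoE[OF q_iso[OF eN] eH] by metis
  have [simp]: "k \<in> Arr Q" "Dom Q k = I" "Cod Q k = U" using k by (auto simp: in_Hom)
  let ?\<xi> = "q s \<bullet>\<^bsub>Q\<^esub> (k \<bullet>\<^bsub>Q\<^esub> q j)"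
  have "\<phi> \<bullet>\<^bsub>Q\<^esub> ?\<xi> = q m \<bullet>\<^bsub>Q\<^esub> (q e \<bullet>\<^bsub>Q\<^esub> (k \<bullet>\<^bsub>Q\<^esub> q j))" by (simp add: Q.pre[OF sf(4)] qf)
  also have "\<dots> = q l" using arg_cong[OF j(2), of q] by (simp add: Q.pre[OF k(2)])
  finally have "\<phi> \<bullet>\<^bsub>Q\<^esub> ?\<xi> = q l" .
  moreover have "is_iso Q ?\<xi>"
    by (intro Q.iso_comp q_iso sf(3) jN k(3)) auto
  moreover have "?\<xi> \<in> Hom Q (fst (Dom C l, \<kappa>)) V" by (simp add: in_Hom)
  ultimately show ?thesis using L by blast
qed

text \<open>The point is that the equalizer of two equivariant arrows is equivariant.\<close>

lemma E_q_eq: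
  assumes a: "(P, f, R) \<in> Arr E" and b: "(P, g, R) \<in> Arr E" and eq: "q f = q g"
  shows "E.q (P, f, R) = E.q (P, g, R)"
proof -
  obtain add where "additive_category C add" using additive by blast
  then interpret A: additive_category C add .
  let ?add = "\<lambda>a b. (fst a, add (fst (snd a)) (fst (snd b)), snd (snd a))"
  interpret AE: additive_category E ?add by (rule E_additive[OF A.additive_category_axioms])
  note D = E_ArrD[OF a] and D' = E_ArrD[OF b]
  have fE: "(P, f, R) \<in> Hom E P R" and gE: "(P, g, R) \<in> Hom E P R" using D D' by (auto simp: E_Hom_iff)
  have f: "f \<in> Hom C (fst P) (fst R)" and g: "g \<in> Hom C (fst P) (fst R)"
    using D(3) D'(3) by (auto simp: equi_def)
  obtain n' where n': "n' \<in> Hom E P R" "zero_arr E (?add (P, g, R) n')" using AE.negative_exists[OF gE] by blast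
  obtain n where n: "n' = (P, n, R)" "equi P n R" using n'(1) unfolding E_Hom_iff by blast
  have nH: "n \<in> Hom C (fst P) (fst R)" using n(2) by (simp add: equi_def)
  have "(P, add g n, R) \<in> Arr E" using AE.add_Hom[OF gE n'(1)] n(1) by (simp add: in_Hom)
  then have n0: "zero_arr C (add g n)" using n'(2) n(1) E_zero_arr by simp
  have d: "(P, add f n, R) \<in> Arr E" using AE.add_Hom[OF fE n'(1)] n(1) by (simp add: in_Hom)
  note dd = A.difference_add[OF f g nH n0]
  have dH: "add f n \<in> Hom C (fst P) (fst R)" using A.add_Hom[OF f nH] .
  have d0: "zero_arr C (add f n \<bullet> u) \<longleftrightarrow> f \<bullet> u = g \<bullet> u" if u: "u \<in> Hom C W (fst P)" for u W
    using dd[OF u Idn_Hom[OF Hom_Obj(2)[OF f]]] u dH f g by (simp add: in_Hom)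
  obtain k where k: "is_kernel C k (add f n)" using kernel_exists[of "add f n"] dH by (auto simp: in_Hom)
  obtain \<kappa> where K: "((Dom C k, \<kappa>), k, P) \<in> Arr E" using E_kernel_exists[OF d k] ..
  let ?K = "(Dom C k, \<kappa>)"
  have kH: "k \<in> Hom C (Dom C k) (fst P)" using kernelD[OF k] dH by (auto simp: in_Hom)
  obtain W t where t: "t \<in> Hom C W (fst P)" "Niso C N t" "f \<bullet> t = g \<bullet> t"
    using q_eq_iff[OF f g] eq by blast
  have tH: "t \<in> Hom C W (Dom C (add f n))" using t(1) dH by (simp add: in_Hom)
  obtain y where y: "y \<in> Hom C W (Dom C k)" "k \<bullet> y = t"
    using kernel_factor[OF k _ tH] d0[OF t(1)] t(3) by metis
  have "Ncok C N k" using Ncok_cancel[of k y] t(2) y kH by (auto simp: Niso_def in_Hom)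
  then have "Niso C N k" using mono_Nker[OF kernel_mono[OF k]] by (simp add: Niso_def)
  then have "Niso E NG (?K, k, P)" using E_Niso_iff[OF K] by simp
  moreover have "f \<bullet> k = g \<bullet> k" using d0[OF kH] kernelD(4)[OF k] by simp
  then have "(P, f, R) \<bullet>\<^bsub>E\<^esub> (?K, k, P) = (P, g, R) \<bullet>\<^bsub>E\<^esub> (?K, k, P)" by (simp add: E_sel)
  moreover have "(?K, k, P) \<in> Hom E ?K P" using K by (simp add: in_Hom E_sel)
  ultimately show ?thesis using E.q_eq_iff[OF fE gE] by blast
qed

lemma E_product:
  assumes P: "P \<in> Obj E" and R: "R \<in> Obj E"
  shows "\<exists>S p r. S \<in> Obj E \<and> equi S p P \<and> equi S r R \<and> is_product2 C (fst P) (fst R) (fst S) p r"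
proof -
  obtain add where "additive_category C add" using additive by blast
  then interpret A: additive_category C add .
  let ?add = "\<lambda>a b. (fst a, add (fst (snd a)) (fst (snd b)), snd (snd a))"
  interpret AE: additive_category E ?add by (rule E_additive[OF A.additive_category_axioms])
  obtain S i j p r where ijpr: "i \<in> Hom E P S" "j \<in> Hom E R S" "p \<in> Hom E S P" "r \<in> Hom E S R"
    and eqs: "p \<bullet>\<^bsub>E\<^esub> i = Idn E P" "r \<bullet>\<^bsub>E\<^esub> j = Idn E R" "zero_arr E (r \<bullet>\<^bsub>E\<^esub> i)" "zero_arr E (p \<bullet>\<^bsub>E\<^esub> j)"
      "?add (i \<bullet>\<^bsub>E\<^esub> p) (j \<bullet>\<^bsub>E\<^esub> r) = Idn E S"
    using AE.biproduct_exists[OF P R] by blast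
  obtain i' j' p' r' where *: "i = (P, i', S)" "equi P i' S" "j = (R, j', S)" "equi R j' S"
    "p = (S, p', P)" "equi S p' P" "r = (S, r', R)" "equi S r' R" and S: "S \<in> Obj E"
    using ijpr unfolding E_Hom_iff by blast
  have "is_product2 C (fst P) (fst R) (fst S) p' r'"
  proof (rule A.biproduct_product2[of i' _ _ j'])
    show "zero_arr C (r' \<bullet> i')" "zero_arr C (p' \<bullet> j')"
      using eqs(3,4) E_zero_arr[OF E_ArrI[OF P R equi_comp[OF P S R *(2,8)]]]
        E_zero_arr[OF E_ArrI[OF R P equi_comp[OF R S P *(4,6)]]] by (simp_all add: * E_sel)
  qed (use * eqs in \<open>simp_all add: equi_def E_sel\<close>)
  then show ?thesis using S * by blast
qed

lemma Psi_bar_equivalence: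
  assumes K: "is_functor E.Q D.E K"
    and eq: "functor_eq_on E (comp_functor K (quotient_functor E NG)) \<Psi>"
  shows "equivalence_functor E.Q D.E K"
proof -
  interpret K: is_functor E.Q D.E K by (rule K)
  have Ko [simp]: "FObj K P = \<Psi>o P" if "P \<in> Obj E" for P
    using eq that by (auto simp: functor_eq_on_def quotient_functor_def Psi_sel)
  have Ka [simp]: "FArr K (E.q a) = FArr \<Psi> a" if "a \<in> Arr E" for a
    using eq that by (auto simp: functor_eq_on_def quotient_functor_def)
  show ?thesis
  proof (intro equivalence_functor.intro equivalence_functor_axioms.intro K)
    fix \<phi> \<psi> P R assume \<phi>: "\<phi> \<in> Hom E.Q P R" and \<psi>: "\<psi> \<in> Hom E.Q P R" and KK: "FArr K \<phi> = FArr K \<psi>"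
    obtain V s f g where s: "s \<in> Hom E V P" "f \<in> Hom E V R" "g \<in> Hom E V R" "Niso E NG s"
      "\<phi> \<bullet>\<^bsub>E.Q\<^esub> E.q s = E.q f" "\<psi> \<bullet>\<^bsub>E.Q\<^esub> E.q s = E.q g"
      using E.quot_common_roof2[OF \<phi> \<psi>] by metis
    obtain f' g' where fg: "f = (V, f', R)" "g = (V, g', R)" using s(2,3) unfolding E_Hom_iff by blast
    have Arr: "f \<in> Arr E" "g \<in> Arr E" using s(2,3) by (auto simp: in_Hom)
    have "FArr K (E.q f) = FArr K (E.q g)"
      using K.FArr_Cmp[OF E.q_Hom[OF s(1)] \<phi>] K.FArr_Cmp[OF E.q_Hom[OF s(1)] \<psi>] KK s(5,6) by simp
    then have "q f' = q g'" using Arr fg by (simp add: Psi_sel)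
    then have "E.q f = E.q g" unfolding fg by (rule E_q_eq[OF Arr[unfolded fg]])
    then have "\<phi> \<bullet>\<^bsub>E.Q\<^esub> E.q s = \<psi> \<bullet>\<^bsub>E.Q\<^esub> E.q s" using s(5,6) by simp
    then show "\<phi> = \<psi>"
      by (rule E.Q.epiD[OF E.Q.iso_epi[OF E.q_iso[OF s(4)]], where W=R])
        (use \<phi> \<psi> s(1) in \<open>auto simp: in_Hom\<close>)
  next
    fix P R \<kappa> assume "P \<in> Obj E.Q" "R \<in> Obj E.Q" and \<kappa>0: "\<kappa> \<in> Hom D.E (FObj K P) (FObj K R)"
    then have P: "P \<in> Obj E" and R: "R \<in> Obj E" by auto
    have \<kappa>1: "\<kappa> \<in> Hom D.E (\<Psi>o P) (\<Psi>o R)" using \<kappa>0 P R by simp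
    then obtain \<phi> where \<kappa>: "\<kappa> = (\<Psi>o P, \<phi>, \<Psi>o R)" and e: "D.equi (\<Psi>o P) \<phi> (\<Psi>o R)"
      unfolding D.E_Hom_iff by blast
    let ?X = "fst P" and ?Y = "fst R"
    have \<phi>: "\<phi> \<in> Hom Q ?X ?Y" using e by (simp add: D.equi_def Psi_sel)
    have \<phi>e: "q (snd R g) \<bullet>\<^bsub>Q\<^esub> \<phi> = FArr (Fb g) \<phi> \<bullet>\<^bsub>Q\<^esub> q (snd P g)" if "g \<in> carrier G" for g
      using e that by (simp add: D.equi_def Psi_sel)
    obtain S p r where S: "S \<in> Obj E" and p: "equi S p P" and r: "equi S r R"
      and prod: "is_product2 C ?X ?Y (fst S) p r"
      using E_product[OF P R] by blast
    note [simp] = E_objD(1-4)[OF P] E_objD(1-4)[OF R] E_objD(1-4)[OF S] equiD(1-3)[OF p] equiD(1-3)[OF r]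
    have [simp]: "\<phi> \<in> Arr Q" "Dom Q \<phi> = ?X" "Cod Q \<phi> = ?Y" using \<phi> by (auto simp: in_Hom)
    have idX: "Idn Q ?X \<in> Hom Q ?X ?X" using Q.Idn_Hom[of ?X] by simp
    obtain \<gamma> where \<gamma>: "\<gamma> \<in> Hom Q ?X (fst S)" "q p \<bullet>\<^bsub>Q\<^esub> \<gamma> = Idn Q ?X" "q r \<bullet>\<^bsub>Q\<^esub> \<gamma> = \<phi>"
      using Q.product2_map[OF q_product2[OF prod] idX \<phi>] by blast
    have [simp]: "\<gamma> \<in> Arr Q" "Dom Q \<gamma> = ?X" "Cod Q \<gamma> = fst S" using \<gamma> by (auto simp: in_Hom)
    have \<gamma>m: "mono_arr Q \<gamma>" by (rule Q.split_mono[of "q p"]) (use \<gamma> in simp_all)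
    have inv: "\<exists>x \<in> Hom Q ?X (Fo g ?X). q (snd S g) \<bullet>\<^bsub>Q\<^esub> \<gamma> = FArr (Fb g) \<gamma> \<bullet>\<^bsub>Q\<^esub> x" if g: "g \<in> carrier G" for g
    proof (intro bexI)
      show "q (snd P g) \<in> Hom Q ?X (Fo g ?X)" using g by (simp add: in_Hom)
      note Fprod = equivalence_functor.pres_product2[OF F_equivalence[OF g] prod]
      have Fp: "q (Fa g p) \<bullet>\<^bsub>Q\<^esub> FArr (Fb g) \<gamma> = Idn Q (Fo g ?X)" "q (Fa g r) \<bullet>\<^bsub>Q\<^esub> FArr (Fb g) \<gamma> = FArr (Fb g) \<phi>"
        using arg_cong[OF \<gamma>(2), of "FArr (Fb g)"] arg_cong[OF \<gamma>(3), of "FArr (Fb g)"] g by simp_all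
      have eqp: "q (Fa g p) \<bullet>\<^bsub>Q\<^esub> q (snd S g) = q (snd P g) \<bullet>\<^bsub>Q\<^esub> q p"
        "q (Fa g r) \<bullet>\<^bsub>Q\<^esub> q (snd S g) = q (snd R g) \<bullet>\<^bsub>Q\<^esub> q r"
        using arg_cong[OF equiD(4)[OF p g], of q] arg_cong[OF equiD(4)[OF r g], of q] g by simp_all
      show "q (snd S g) \<bullet>\<^bsub>Q\<^esub> \<gamma> = FArr (Fb g) \<gamma> \<bullet>\<^bsub>Q\<^esub> q (snd P g)"
      proof (rule Q.product2_eq[OF q_product2[OF Fprod]])
        show "q (Fa g p) \<bullet>\<^bsub>Q\<^esub> (q (snd S g) \<bullet>\<^bsub>Q\<^esub> \<gamma>) = q (Fa g p) \<bullet>\<^bsub>Q\<^esub> (FArr (Fb g) \<gamma> \<bullet>\<^bsub>Q\<^esub> q (snd P g))"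
          using g by (simp add: Q.pre[OF eqp(1)] \<gamma>(2) Q.pre[OF Fp(1)])
        show "q (Fa g r) \<bullet>\<^bsub>Q\<^esub> (q (snd S g) \<bullet>\<^bsub>Q\<^esub> \<gamma>) = q (Fa g r) \<bullet>\<^bsub>Q\<^esub> (FArr (Fb g) \<gamma> \<bullet>\<^bsub>Q\<^esub> q (snd P g))"
          using g by (simp add: Q.pre[OF eqp(2)] \<gamma>(3) Q.pre[OF Fp(2)] \<phi>e)
      qed (use g in \<open>auto simp: in_Hom\<close>)
    qed
    obtain I m \<xi> where m: "(I, m, S) \<in> Arr E" and \<xi>: "\<xi> \<in> Hom Q (fst I) ?X" "is_iso Q \<xi>" "\<gamma> \<bullet>\<^bsub>Q\<^esub> \<xi> = q m"
      using invariant_subobject[OF S \<gamma>(1) \<gamma>m inv] by blast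
    note M = E_ArrD[OF m]
    note [simp] = E_objD(1-4)[OF M(1)] equiD(1-3)[OF M(3)]
    have [simp]: "\<xi> \<in> Arr Q" "Dom Q \<xi> = fst I" "Cod Q \<xi> = ?X" using \<xi> by (auto simp: in_Hom)
    have ps: "equi I (p \<bullet> m) P" and rs: "equi I (r \<bullet> m) R"
      using equi_comp[OF M(1) S P M(3) p] equi_comp[OF M(1) S R M(3) r] .
    have pm: "q (p \<bullet> m) = \<xi>" using Q.pre[OF \<gamma>(2), of \<xi>] \<xi>(3) by simp
    have rm: "q (r \<bullet> m) = \<phi> \<bullet>\<^bsub>Q\<^esub> \<xi>" using Q.pre[OF \<gamma>(3), of \<xi>] \<xi>(3) by simp
    let ?s = "(I, p \<bullet> m, P)" and ?f = "(I, r \<bullet> m, R)"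
    have sE: "?s \<in> Hom E I P" and fE: "?f \<in> Hom E I R" using M(1) P R ps rs by (auto simp: E_Hom_iff)
    have sA: "?s \<in> Arr E" and fA: "?f \<in> Arr E" using sE fE by (auto simp: in_Hom)
    have "is_iso Q (q (p \<bullet> m))" using pm \<xi>(2) by simp
    then have "Niso C N (p \<bullet> m)" using q_iso_iff[of "p \<bullet> m"] by simp
    then have sN: "Niso E NG ?s" using E_Niso_iff[OF sA] by simp
    obtain k where k: "k \<in> Hom E.Q P I" "k \<bullet>\<^bsub>E.Q\<^esub> E.q ?s = Idn E.Q I" "E.q ?s \<bullet>\<^bsub>E.Q\<^esub> k = Idn E.Q P"
      using E.Q.isoE[OF E.q_iso[OF sN] E.q_Hom[OF sE]] by metis
    let ?\<omega> = "E.q ?f \<bullet>\<^bsub>E.Q\<^esub> k"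
    have \<omega>: "?\<omega> \<in> Hom E.Q P R" using E.Q.Cmp_Hom[OF k(1) E.q_Hom[OF fE]] .
    have "?\<omega> \<bullet>\<^bsub>E.Q\<^esub> E.q ?s = E.q ?f"
      using E.Q.Cmp_assoc[OF E.q_Hom[OF sE] k(1) E.q_Hom[OF fE]] E.Q.Cmp_Idn_right[OF E.q_Hom[OF fE]] k(2) by simp
    then have "FArr K ?\<omega> \<bullet>\<^bsub>D.E\<^esub> FArr \<Psi> ?s = FArr \<Psi> ?f"
      using K.FArr_Cmp[OF E.q_Hom[OF sE] \<omega>] Ka[OF sA] Ka[OF fA] by simp
    also have "FArr \<Psi> ?f = \<kappa> \<bullet>\<^bsub>D.E\<^esub> FArr \<Psi> ?s" using pm rm by (simp only: Psi_sel \<kappa> D.E_sel)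
    finally have "FArr K ?\<omega> \<bullet>\<^bsub>D.E\<^esub> FArr \<Psi> ?s = \<kappa> \<bullet>\<^bsub>D.E\<^esub> FArr \<Psi> ?s" .
    moreover have "FArr \<Psi> ?s \<in> Hom D.E (\<Psi>o I) (\<Psi>o P)" using Psi_Hom[OF sE] .
    moreover have "FArr K ?\<omega> \<in> Hom D.E (\<Psi>o P) (\<Psi>o R)" using K.FArr_Hom[OF \<omega>] P R by simp
    ultimately have "FArr K ?\<omega> = \<kappa>"
      using D.E.epiD[OF D.E.iso_epi[OF Psi_iso[OF sN]], of "FArr K ?\<omega>" \<kappa> "\<Psi>o R"] \<kappa>1 by (simp add: in_Hom)
    then show "\<exists>\<omega> \<in> Hom E.Q P R. FArr K \<omega> = \<kappa>" using \<omega> by blast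
  next
    fix Y assume Y: "Y \<in> Obj D.E"
    let ?X = "fst Y"
    have X [simp]: "?X \<in> Obj C" using D.E_objD(1)[OF Y] by simp
    note [simp] = D.E_objD(2)[OF Y] D.E_objD(3)[OF Y]
    have [simp]: "Cod Q (snd Y g) = Fo g ?X" if "g \<in> carrier G" for g using D.E_objD(4)[OF Y that] by simp
    have co: "snd Y (g \<otimes>\<^bsub>G\<^esub> h) = (q (\<epsilon> g h ?X) \<bullet>\<^bsub>Q\<^esub> FArr (Fb g) (snd Y h)) \<bullet>\<^bsub>Q\<^esub> snd Y g"
      if "g \<in> carrier G" "h \<in> carrier G" for g h using D.E_objD(6)[OF Y that] by simp
    obtain R \<pi> where R: "R \<in> Obj E" and p: "is_product C (carrier G) (\<lambda>h. Fo h ?X) (fst R) \<pi>"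
      and xe: "\<And>g h. \<lbrakk>g \<in> carrier G; h \<in> carrier G\<rbrakk> \<Longrightarrow> \<epsilon> g h ?X \<bullet> (Fa g (\<pi> h) \<bullet> snd R g) = \<pi> (g \<otimes>\<^bsub>G\<^esub> h)"
      using coinduced_exists[OF X] by metis
    have [simp]: "\<pi> h \<in> Arr C" "Dom C (\<pi> h) = fst R" "Cod C (\<pi> h) = Fo h ?X" if "h \<in> carrier G" for h
      using productD(2)[OF p that] by (auto simp: in_Hom)
    note [simp] = E_objD(1-4)[OF R]
    have "snd Y h \<in> Hom Q ?X (Fo h ?X)" if "h \<in> carrier G" for h using that by (simp add: in_Hom)
    then obtain \<gamma> where \<gamma>: "\<gamma> \<in> Hom Q ?X (fst R)" "\<forall>h \<in> carrier G. q (\<pi> h) \<bullet>\<^bsub>Q\<^esub> \<gamma> = snd Y h"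
      using Q.product_map[OF q_product[OF p finite_G], of ?X "snd Y"] by auto
    have [simp]: "\<gamma> \<in> Arr Q" "Dom Q \<gamma> = ?X" "Cod Q \<gamma> = fst R" using \<gamma> by (auto simp: in_Hom)
    have F\<gamma>: "q (Fa g (\<pi> h)) \<bullet>\<^bsub>Q\<^esub> FArr (Fb g) \<gamma> = FArr (Fb g) (snd Y h)"
      if "g \<in> carrier G" "h \<in> carrier G" for g h
      using arg_cong[OF \<gamma>(2)[rule_format, OF that(2)], of "FArr (Fb g)"] that by simp
    have mono1: "mono_arr Q (FArr (Fb g) \<gamma>)" if g: "g \<in> carrier G" for g
    proof (rule Q.mono_cancel[of "q (Fa g (\<pi> \<one>\<^bsub>G\<^esub>))"])
      have "is_iso Q (FArr (Fb g) (snd Y \<one>\<^bsub>G\<^esub>))"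
        using is_functor.FArr_iso[OF D.F_functor[OF g] D.E_objD(5)[OF Y]] by simp
      then show "mono_arr Q (q (Fa g (\<pi> \<one>\<^bsub>G\<^esub>)) \<bullet>\<^bsub>Q\<^esub> FArr (Fb g) \<gamma>)" using F\<gamma>[OF g, of "\<one>\<^bsub>G\<^esub>"] Q.iso_mono by simp
    qed (use g in simp_all)
    have \<gamma>m: "mono_arr Q \<gamma>"
      by (rule Q.mono_cancel[of "q (\<pi> \<one>\<^bsub>G\<^esub>)"]) (use \<gamma>(2) Q.iso_mono[OF D.E_objD(5)[OF Y]] in simp_all)
    have eqv: "q (snd R g) \<bullet>\<^bsub>Q\<^esub> \<gamma> = FArr (Fb g) \<gamma> \<bullet>\<^bsub>Q\<^esub> snd Y g" if g: "g \<in> carrier G" for g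
    proof (rule Q.product_eq[OF q_product[OF equivalence_functor.pres_product[OF F_equivalence[OF g] p] finite_G]])
      fix h assume h: "h \<in> carrier G"
      have "q (\<epsilon> g h ?X) \<bullet>\<^bsub>Q\<^esub> (q (Fa g (\<pi> h)) \<bullet>\<^bsub>Q\<^esub> (q (snd R g) \<bullet>\<^bsub>Q\<^esub> \<gamma>))
        = q (\<epsilon> g h ?X \<bullet> (Fa g (\<pi> h) \<bullet> snd R g)) \<bullet>\<^bsub>Q\<^esub> \<gamma>"
        using g h by simp
      also have "\<dots> = snd Y (g \<otimes>\<^bsub>G\<^esub> h)" unfolding xe[OF g h] using \<gamma>(2) g h by simp
      also have "\<dots> = q (\<epsilon> g h ?X) \<bullet>\<^bsub>Q\<^esub> (q (Fa g (\<pi> h)) \<bullet>\<^bsub>Q\<^esub> (FArr (Fb g) \<gamma> \<bullet>\<^bsub>Q\<^esub> snd Y g))"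
        unfolding co[OF g h] using g h by (simp add: Q.pre[OF F\<gamma>[OF g h]])
      finally show "q (Fa g (\<pi> h)) \<bullet>\<^bsub>Q\<^esub> (q (snd R g) \<bullet>\<^bsub>Q\<^esub> \<gamma>) = q (Fa g (\<pi> h)) \<bullet>\<^bsub>Q\<^esub> (FArr (Fb g) \<gamma> \<bullet>\<^bsub>Q\<^esub> snd Y g)"
        by (rule Q.monoD[OF Q.iso_mono[OF q_iso[OF iso_Niso[OF eps_simps(4)]]], where W="?X", rotated 3])
          (use g h in \<open>auto simp: in_Hom\<close>)
    qed (use g in \<open>auto simp: in_Hom\<close>)
    have inv: "\<exists>x \<in> Hom Q ?X (Fo g ?X). q (snd R g) \<bullet>\<^bsub>Q\<^esub> \<gamma> = FArr (Fb g) \<gamma> \<bullet>\<^bsub>Q\<^esub> x" if g: "g \<in> carrier G" for g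
      using eqv[OF g] g by (intro bexI[of _ "snd Y g"]) (auto simp: in_Hom)
    obtain I m \<xi> where m: "(I, m, R) \<in> Arr E" and \<xi>: "\<xi> \<in> Hom Q (fst I) ?X" "is_iso Q \<xi>" "\<gamma> \<bullet>\<^bsub>Q\<^esub> \<xi> = q m"
      using invariant_subobject[OF R \<gamma>(1) \<gamma>m inv] by blast
    note M = E_ArrD[OF m]
    note [simp] = E_objD(1-4)[OF M(1)] equiD(1-3)[OF M(3)]
    have [simp]: "\<xi> \<in> Arr Q" "Dom Q \<xi> = fst I" "Cod Q \<xi> = ?X" using \<xi> by (auto simp: in_Hom)
    have "snd Y g \<bullet>\<^bsub>Q\<^esub> \<xi> = FArr (Fb g) \<xi> \<bullet>\<^bsub>Q\<^esub> q (snd I g)" if g: "g \<in> carrier G" for g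
    proof (rule Q.monoD[OF mono1[OF g], where W="fst I"])
      have Fm: "FArr (Fb g) \<gamma> \<bullet>\<^bsub>Q\<^esub> FArr (Fb g) \<xi> = q (Fa g m)"
        using arg_cong[OF \<xi>(3), of "FArr (Fb g)"] g by simp
      have "FArr (Fb g) \<gamma> \<bullet>\<^bsub>Q\<^esub> (snd Y g \<bullet>\<^bsub>Q\<^esub> \<xi>) = q (snd R g) \<bullet>\<^bsub>Q\<^esub> (\<gamma> \<bullet>\<^bsub>Q\<^esub> \<xi>)"
        using g by (simp add: Q.pre[OF eqv[OF g]])
      also have "\<dots> = q (snd R g \<bullet> m)" using g by (simp add: \<xi>(3))
      also have "\<dots> = FArr (Fb g) \<gamma> \<bullet>\<^bsub>Q\<^esub> (FArr (Fb g) \<xi> \<bullet>\<^bsub>Q\<^esub> q (snd I g))"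
        unfolding equiD(4)[OF M(3) g] using g by (simp add: Q.pre[OF Fm])
      finally show "FArr (Fb g) \<gamma> \<bullet>\<^bsub>Q\<^esub> (snd Y g \<bullet>\<^bsub>Q\<^esub> \<xi>) = FArr (Fb g) \<gamma> \<bullet>\<^bsub>Q\<^esub> (FArr (Fb g) \<xi> \<bullet>\<^bsub>Q\<^esub> q (snd I g))" .
    qed (use g in \<open>auto simp: in_Hom\<close>)
    then have "D.equi (\<Psi>o I) \<xi> Y" using \<xi>(1) by (simp add: D.equi_def Psi_sel)
    then have a: "(\<Psi>o I, \<xi>, Y) \<in> Hom D.E (\<Psi>o I) Y" using Psi_Obj[OF M(1)] Y by (auto simp: D.E_Hom_iff)
    then have "is_iso D.E (\<Psi>o I, \<xi>, Y)" using D.E_iso_lift[OF _ \<xi>(2)] by (simp add: in_Hom)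
    then show "\<exists>P \<in> Obj E.Q. \<exists>i \<in> Hom D.E (FObj K P) Y. is_iso D.E i"
      using a M(1) by (intro bexI[of _ I] bexI[of _ "(\<Psi>o I, \<xi>, Y)"]) auto
  qed
qed

end

theorem corollary4p4:
  fixes G :: "('g, 'x) monoid_scheme"
    and A :: "('o, 'm) cat"
    and F :: "'g \<Rightarrow> ('o, 'm, 'o, 'm) cfunctor"
    and \<epsilon> :: "'g \<Rightarrow> 'g \<Rightarrow> 'o \<Rightarrow> 'm"
    and N :: "'o set"
  assumes "group G" and "finite (carrier G)"
    and "abelian_category A"
    and "cat_action G A F \<epsilon>"
    and "serre_subcategory A N"
    and "\<And>g X. \<lbrakk>g \<in> carrier G; X \<in> N\<rbrakk> \<Longrightarrow> FObj (F g) X \<in> N"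
  shows "\<exists>\<Psi>bar.
    is_induced_by (equivariant_cat G A F \<epsilon>) (equivariant_sub G A F \<epsilon> N)
      (equivariant_quotient G A F \<epsilon> N) (Psi G A N) \<Psi>bar \<and>
    is_equivalence
      (quotient_cat (equivariant_cat G A F \<epsilon>) (equivariant_sub G A F \<epsilon> N))
      (equivariant_quotient G A F \<epsilon> N) \<Psi>bar"
proof -
  interpret invariant_serre G A F \<epsilon> N
    by (intro invariant_serre.intro invariant_serre_axioms.intro assms(2,4,5,6))
  obtain K where K: "is_induced_by E NG D.E \<Psi> K"
    using E.induced_exists[OF Psi_functor Psi_iso] by blast
  then have "equivalence_functor E.Q D.E K"
    by (intro Psi_bar_equivalence) (auto simp: is_induced_by_def)
  then have "is_equivalence E.Q D.E K" by (rule equivalence_functor.is_equivalence)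
  with K show ?thesis unfolding equivariant_quotient_def by blast
qed

end
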